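(* Let $\mathcal H=(\mathcal H_L,\mathcal H_R,S)$ be a Hopf algebroid and $B\#_\sigma\mathcal H_L$ a crossed product of an $\mathcal H_L$-measured $L$-ring $B$. If the cocycle $\sigma$ is invertible, then the extension $B\subseteq B\#_\sigma\mathcal H_L$ is $\mathcal H$-cleft.
   Context: $k$ is a commutative unital ring; algebras are associative unital $k$-algebras; for an algebra $R$, an $R$-ring is an algebra $A$ with an algebra map $R\to A$ (the unit map). Summations are suppressed in Sweedler notation. Left bialgebroid $\mathcal H_L=(H,L,s_L,t_L,\gamma_L,\pi_L)$: algebras $H,L$; algebra maps $s_L:L\to H$, $t_L:L^{op}\to H$ with commuting images; $H$ is an $L$-bimodule via $l h l'=s_L(l)t_L(l')h$; $L$-bimodule maps $\gamma_L:H\to H\otimes_L H$, $h\mapsto h_{(1)}\otimes_L h_{(2)}$, and $\pi_L:H\to L$ form a coassociative counital $L$-coring; $h_{(1)}t_L(l)\otimes_L h_{(2)}=h_{(1)}\otimes_L h_{(2)}s_L(l)$; $\gamma_L(1)=1\otimes_L 1$; $\gamma_L(hh')=\gamma_L(h)\gamma_L(h')$; $\pi_L(1)=1$; $\pi_L(hs_L(\pi_L(h')))=\pi_L(hh')=\pi_L(ht_L(\pi_L(h')))$. Right bialgebroid $\mathcal H_R=(H,R,s_R,t_R,\gamma_R,\pi_R)$: algebra maps $s_R:R\to H$, $t_R:R^{op}\to H$ with commuting images; $R$-bimodule $rhr'=h s_R(r')t_R(r)$; $R$-coring $\gamma_R:H\to H\otimes_RH$, $h\mapsto h^{(1)}\otimes_R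 h^{(2)}$, $\pi_R:H\to R$; $s_R(r)h^{(1)}\otimes_R h^{(2)}=h^{(1)}\otimes_R t_R(r)h^{(2)}$; $\gamma_R$ unital and multiplicative; $\pi_R(1)=1$; $\pi_R(s_R(\pi_R(h))h')=\pi_R(hh')=\pi_R(t_R(\pi_R(h))h')$. Hopf algebroid $\mathcal H=(\mathcal H_L,\mathcal H_R,S)$: a left bialgebroid $\mathcal H_L=(H,L,s_L,t_L,\gamma_L,\pi_L)$ and a right bialgebroid $\mathcal H_R=(H,R,s_R,t_R,\gamma_R,\pi_R)$ on the same algebra $H$ with $s_L\pi_Lt_R=t_R$, $t_L\pi_Ls_R=s_R$, $s_R\pi_Rt_L=t_L$, $t_R\pi_Rs_L=s_L$; $(\gamma_L\otimes_R H)\gamma_R=(H\otimes_L\gamma_R)\gamma_L$, $(\gamma_R\otimes_L H)\gamma_L=(H\otimes_R\gamma_L)\gamma_R$; and a $k$-linear antipode $S:H\to H$ with $S(t_L(l)ht_R(r))=s_R(r)S(h)s_L(l)$, $S(t_R(r)ht_L(l))=s_L(l)S(h)s_R(r)$, $S(h_{(1)})h_{(2)}=s_R(\pi_R(h))$, $h^{(1)}S(h^{(2)})=s_L(\pi_L(h))$. A right $\mathcal H_R$-comodule is a right comodule $m\mapsto m^{[0]}\otimes_R m^{[1]}$ of the $R$-coring $H$; it is an $R$-bimodule with left action $rm=m^{[0]}\pi_R(s_R(r)m^{[1]})$. A right $\mathcal H_L$-comodule is a right comodule $m\mapsto m_{[0]}\otimes_Lm_{[1]}$ of the $L$-coring $H$.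 A right $\mathcal H$-comodule is a right $R$- and right $L$-module $M$ with an $\mathcal H_R$-coaction $\varrho_R$ and an $\mathcal H_L$-coaction $\varrho_L$ such that $\varrho_R$ is right $L$-linear, $\varrho_L$ is right $R$-linear, $(M\otimes_R\gamma_L)\varrho_R=(\varrho_R\otimes_LH)\varrho_L$ and $(M\otimes_L\gamma_R)\varrho_L=(\varrho_L\otimes_RH)\varrho_R$ (here $(m\otimes_R h)l=m\otimes_R t_L(l)h$, $(m\otimes_L h)r=m\otimes_L hs_R(r)$). Morphisms are maps colinear for both coactions. $H$ itself is a right $\mathcal H$-comodule via $\gamma_R,\gamma_L$. A right $\mathcal H$-comodule algebra is an $R$-ring $A$ with unit map $\eta_R:R\to A$ that is a right $\mathcal H$-comodule, the $R$-bimodule structure being given by multiplication with $\eta_R$ (and the right $L$-action then being $al=\eta_R(\pi_R(t_L(l)))a$), such that both coactions are unital and multiplicative. A right $\mathcal H$-extension $B\subseteq A$ is a right $\mathcal H$-comodule algebra $A$ with $B=\{b\in A: b^{[0]}\otimes_R b^{[1]}=b\otimes_R 1_H\}$. The extension is $\mathcal H$-cleft if (a) $A$ is an $L$-ring with unit map $\eta_L:L\to A$, and $B$ is an $L$-subring (so $\eta_L(L)\subseteq B$); and (b) there is a left $L$-linear ($j(s_L(l)h)=\eta_L(l)j(h)$) right $\mathcal H$-comodule map $j:H\to A$ (a cleaving map) that is convolution invertible: there is a $k$-linear $j^{c}:H\to A$ with $j^{c}(t_L(l)ht_R(r))=\eta_R(r)j^{c}(h)\eta_L(l)$, $j(h^{(1)})j^{c}(h^{(2)})=\eta_L(\pi_L(h))$,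 $j^{c}(h_{(1)})j(h_{(2)})=\eta_R(\pi_R(h))$. Crossed products. Let $\iota:L\to B$ be an $L$-ring. $\mathcal H_L$ measures $B$ if there is a $k$-linear map $H\otimes_kB\to B$, $h\otimes b\mapsto h\cdot b$, with $h\cdot1_B=\iota(\pi_L(h))$; $(t_L(l)h)\cdot b=(h\cdot b)\iota(l)$, $(s_L(l)h)\cdot b=\iota(l)(h\cdot b)$; $h\cdot(bb')=(h_{(1)}\cdot b)(h_{(2)}\cdot b')$. A 2-cocycle is a $k$-linear map $\sigma:H\otimes_{L^{op}}H\to B$ (so $\sigma(ht_L(l),k)=\sigma(h,t_L(l)k)$) with (a) $\sigma(s_L(l)h,k)=\iota(l)\sigma(h,k)$, $\sigma(t_L(l)h,k)=\sigma(h,k)\iota(l)$; (b) $(h_{(1)}\cdot\iota(l))\sigma(h_{(2)},k)=\sigma(h,s_L(l)k)$; (c) $\sigma(1,h)=\iota(\pi_L(h))=\sigma(h,1)$; (d) $[h_{(1)}\cdot\sigma(k_{(1)},m_{(1)})]\sigma(h_{(2)},k_{(2)}m_{(2)})=\sigma(h_{(1)},k_{(1)})\sigma(h_{(2)}k_{(2)},m)$. $B$ is $\sigma$-twisted if moreover $1_H\cdot b=b$ and $[h_{(1)}\cdot(k_{(1)}\cdot b)]\sigma(h_{(2)},k_{(2)})=\sigma(h_{(1)},k_{(1)})(h_{(2)}k_{(2)}\cdot b)$. Given a measuring and a 2-cocycle $\sigma$ with $B$ $\sigma$-twisted, the crossed product $B\#_\sigma\mathcal H_L$ is $B\otimes_LH$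 (left $L$-action on $H$ by left multiplication by $s_L(l)$; elements written $b\# h$) with unit $1_B\#1_H$ and product $(b\#h)(b'\#h')=b(h_{(1)}\cdot b')\sigma(h_{(2)},h'_{(1)})\#h_{(3)}h'_{(2)}$. It is an $R$-ring via $r\mapsto1_B\#s_R(r)$, an $L$-ring via $l\mapsto1_B\#s_L(l)=\iota(l)\#1_H$, and a right $\mathcal H$-comodule algebra with coactions $B\otimes_L\gamma_R$, $B\otimes_L\gamma_L$; its $\mathcal H_R$-coinvariants are the elements $b\#1_H$, which identify with $B$; this gives the right $\mathcal H$-extension $B\subseteq B\#_\sigma\mathcal H_L$. $\sigma$ is invertible if there is a $k$-linear map $\tilde\sigma:H\otimes_LH\to B$ (so $\tilde\sigma(hs_L(l),k)=\tilde\sigma(h,s_L(l)k)$) with (a) $\tilde\sigma(s_L(l)h,k)=\iota(l)\tilde\sigma(h,k)$, $\tilde\sigma(t_L(l)h,k)=\tilde\sigma(h,k)\iota(l)$; (b) $\tilde\sigma(h_{(1)},k)(h_{(2)}\cdot\iota(l))=\tilde\sigma(h,t_L(l)k)$; (c) $\sigma(h_{(1)},k_{(1)})\tilde\sigma(h_{(2)},k_{(2)})=h\cdot(k\cdot1_B)$ and $\tilde\sigma(h_{(1)},k_{(1)})\sigma(h_{(2)},k_{(2)})=hk\cdot1_B$. *)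

theory Defs
  imports "HOL-Algebra.Module"
begin

section \<open>Algebras and modules over noncommutative algebras\<close>

text \<open>The library locale \<^locale>\<open>algebra\<close> only covers commutative algebras.\<close>

locale k_algebra = module K A + ring A
  for K :: "('k, 'y) ring_scheme" and A :: "('k, 'a, 'x) module_scheme" +
  assumes smult_mult_left:
      "\<lbrakk>c \<in> carrier K; x \<in> carrier A; y \<in> carrier A\<rbrakk>
        \<Longrightarrow> (c \<odot>\<^bsub>A\<^esub> x) \<otimes>\<^bsub>A\<^esub> y = c \<odot>\<^bsub>A\<^esub> (x \<otimes>\<^bsub>A\<^esub> y)"
    and smult_mult_right:
      "\<lbrakk>c \<in> carrier K; x \<in> carrier A; y \<in> carrier A\<rbrakk>
        \<Longrightarrow> x \<otimes>\<^bsub>A\<^esub> (c \<odot>\<^bsub>A\<^esub> y) = c \<odot>\<^bsub>A\<^esub> (x \<otimes>\<^bsub>A\<^esub> y)"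

definition k_linear ::
    "('k, 'y) ring_scheme \<Rightarrow> ('k, 'm, 'x) module_scheme \<Rightarrow> ('k, 'n, 'z) module_scheme
      \<Rightarrow> ('m \<Rightarrow> 'n) \<Rightarrow> bool" where
  "k_linear K M N f \<longleftrightarrow>
     (\<forall>x\<in>carrier M. f x \<in> carrier N) \<and>
     (\<forall>x\<in>carrier M. \<forall>y\<in>carrier M. f (x \<oplus>\<^bsub>M\<^esub> y) = f x \<oplus>\<^bsub>N\<^esub> f y) \<and>
     (\<forall>c\<in>carrier K. \<forall>x\<in>carrier M. f (c \<odot>\<^bsub>M\<^esub> x) = c \<odot>\<^bsub>N\<^esub> f x)"

text \<open>Linear maps out of a tensor product over \<open>k\<close> are represented by bilinear maps.\<close>

definition k_bilinear ::
    "('k, 'y) ring_scheme \<Rightarrow> ('k, 'm, 'x) module_scheme \<Rightarrow> ('k, 'n, 'z) module_scheme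
      \<Rightarrow> ('k, 'p, 'w) module_scheme \<Rightarrow> ('m \<Rightarrow> 'n \<Rightarrow> 'p) \<Rightarrow> bool" where
  "k_bilinear K M N P f \<longleftrightarrow>
     (\<forall>x\<in>carrier M. k_linear K N P (f x)) \<and>
     (\<forall>y\<in>carrier N. k_linear K M P (\<lambda>x. f x y))"

definition alg_hom ::
    "('k, 'y) ring_scheme \<Rightarrow> ('k, 'a, 'x) module_scheme \<Rightarrow> ('k, 'b, 'z) module_scheme
      \<Rightarrow> ('a \<Rightarrow> 'b) set" where
  "alg_hom K A B = {f \<in> ring_hom A B. k_linear K A B f}"

definition opposite :: "('k, 'a, 'x) module_scheme \<Rightarrow> ('k, 'a, 'x) module_scheme" where
  "opposite A = A\<lparr>mult := (\<lambda>x y. y \<otimes>\<^bsub>A\<^esub> x)\<rparr>"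

definition right_module ::
    "('k, 'y) ring_scheme \<Rightarrow> ('k, 'r, 'z) module_scheme \<Rightarrow> ('k, 'm, 'x) module_scheme
      \<Rightarrow> ('m \<Rightarrow> 'r \<Rightarrow> 'm) \<Rightarrow> bool" where
  "right_module K R M act \<longleftrightarrow>
     module K M \<and> k_bilinear K M R M act \<and>
     (\<forall>m\<in>carrier M. \<forall>r\<in>carrier R. \<forall>r'\<in>carrier R. act (act m r) r' = act m (r \<otimes>\<^bsub>R\<^esub> r')) \<and>
     (\<forall>m\<in>carrier M. act m \<one>\<^bsub>R\<^esub> = m)"

definition left_module ::
    "('k, 'y) ring_scheme \<Rightarrow> ('k, 'r, 'z) module_scheme \<Rightarrow> ('k, 'm, 'x) module_scheme
      \<Rightarrow> ('r \<Rightarrow> 'm \<Rightarrow> 'm) \<Rightarrow> bool" where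
  "left_module K R M act \<longleftrightarrow>
     module K M \<and> k_bilinear K R M M act \<and>
     (\<forall>m\<in>carrier M. \<forall>r\<in>carrier R. \<forall>r'\<in>carrier R. act r (act r' m) = act (r \<otimes>\<^bsub>R\<^esub> r') m) \<and>
     (\<forall>m\<in>carrier M. act \<one>\<^bsub>R\<^esub> m = m)"

definition bimodule ::
    "('k, 'y) ring_scheme \<Rightarrow> ('k, 'r, 'z) module_scheme \<Rightarrow> ('k, 'm, 'x) module_scheme
      \<Rightarrow> ('r \<Rightarrow> 'm \<Rightarrow> 'm) \<Rightarrow> ('m \<Rightarrow> 'r \<Rightarrow> 'm) \<Rightarrow> bool" where
  "bimodule K R M la ra \<longleftrightarrow>
     left_module K R M la \<and> right_module K R M ra \<and>
     (\<forall>m\<in>carrier M. \<forall>r\<in>carrier R. \<forall>r'\<in>carrier R. ra (la r m) r' = la r (ra m r'))"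


section \<open>Tensor products over noncommutative algebras\<close>

text \<open>
  A formal sum of elementary tensors is a list of pairs.  \<open>tensor_eq M N X ra la\<close> is the least
  congruence on formal sums making \<open>(m, n)\<close> biadditive and balanced:
  \<open>(m r, n) ~ (m, r n)\<close> for \<open>r \<in> X\<close>.  Negatives exist in the quotient because
  \<open>(m, n) + (- m, n) ~ (0, n) ~ 0\<close>, so the quotient is the usual tensor product of a right and a
  left module.
\<close>

inductive tensor_eq ::
    "('m, 'x) ring_scheme \<Rightarrow> ('n, 'z) ring_scheme \<Rightarrow> 'r set \<Rightarrow> ('m \<Rightarrow> 'r \<Rightarrow> 'm) \<Rightarrow> ('r \<Rightarrow> 'n \<Rightarrow> 'n)
      \<Rightarrow> ('m \<times> 'n) list \<Rightarrow> ('m \<times> 'n) list \<Rightarrow> bool"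
  for M :: "('m, 'x) ring_scheme" and N :: "('n, 'z) ring_scheme" and X :: "'r set"
    and ra :: "'m \<Rightarrow> 'r \<Rightarrow> 'm" and la :: "'r \<Rightarrow> 'n \<Rightarrow> 'n"
where
  refl: "set xs \<subseteq> carrier M \<times> carrier N \<Longrightarrow> tensor_eq M N X ra la xs xs"
| sym: "tensor_eq M N X ra la xs ys \<Longrightarrow> tensor_eq M N X ra la ys xs"
| trans: "\<lbrakk>tensor_eq M N X ra la xs ys; tensor_eq M N X ra la ys zs\<rbrakk>
    \<Longrightarrow> tensor_eq M N X ra la xs zs"
| append: "\<lbrakk>tensor_eq M N X ra la xs xs'; tensor_eq M N X ra la ys ys'\<rbrakk>
    \<Longrightarrow> tensor_eq M N X ra la (xs @ ys) (xs' @ ys')"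
| comm: "\<lbrakk>set xs \<subseteq> carrier M \<times> carrier N; set ys \<subseteq> carrier M \<times> carrier N\<rbrakk>
    \<Longrightarrow> tensor_eq M N X ra la (xs @ ys) (ys @ xs)"
| zero: "n \<in> carrier N \<Longrightarrow> tensor_eq M N X ra la [(\<zero>\<^bsub>M\<^esub>, n)] []"
| add_left: "\<lbrakk>m \<in> carrier M; m' \<in> carrier M; n \<in> carrier N\<rbrakk>
    \<Longrightarrow> tensor_eq M N X ra la [(m \<oplus>\<^bsub>M\<^esub> m', n)] [(m, n), (m', n)]"
| add_right: "\<lbrakk>m \<in> carrier M; n \<in> carrier N; n' \<in> carrier N\<rbrakk>
    \<Longrightarrow> tensor_eq M N X ra la [(m, n \<oplus>\<^bsub>N\<^esub> n')] [(m, n), (m, n')]"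
| balanced: "\<lbrakk>m \<in> carrier M; r \<in> X; n \<in> carrier N\<rbrakk>
    \<Longrightarrow> tensor_eq M N X ra la [(ra m r, n)] [(m, la r n)]"

text \<open>
  Tensor products are \<open>k\<close>-modules whose elements are the classes of formal sums; the field
  \<open>tens\<close> yields the elementary tensors.  The ring fields \<open>mult\<close> and \<open>one\<close> are left
  unspecified and are only filled in for crossed products below.
\<close>

record ('k, 'm, 'n) tensor = "('k, ('m \<times> 'n) list set) module" +
  tens :: "'m \<Rightarrow> 'n \<Rightarrow> ('m \<times> 'n) list set" (infixl \<open>\<boxtimes>\<index>\<close> 68)

definition some_rep :: "('m \<times> 'n) list set \<Rightarrow> ('m \<times> 'n) list" where
  "some_rep T = (SOME xs. xs \<in> T)"

definition tensor_product ::
    "('k, 'm, 'x) module_scheme \<Rightarrow> ('n, 'z) ring_scheme \<Rightarrow> 'r set \<Rightarrow> ('m \<Rightarrow> 'r \<Rightarrow> 'm)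
      \<Rightarrow> ('r \<Rightarrow> 'n \<Rightarrow> 'n) \<Rightarrow> ('k, 'm, 'n) tensor" where
  "tensor_product M N X ra la =
    (let cls = (\<lambda>xs. {ys. tensor_eq M N X ra la xs ys}) in
     \<lparr>carrier = cls ` {xs. set xs \<subseteq> carrier M \<times> carrier N},
      mult = undefined,
      one = undefined,
      zero = cls [],
      add = (\<lambda>T U. cls (some_rep T @ some_rep U)),
      smult = (\<lambda>c T. cls (map (\<lambda>(m, n). (c \<odot>\<^bsub>M\<^esub> m, n)) (some_rep T))),
      tens = (\<lambda>m n. cls [(m, n)])\<rparr>)"

text \<open>
  Sweedler notation: \<open>sweedler G T f\<close> is the sum in \<open>G\<close> of \<open>f a b\<close> over an expression
  \<open>T = \<Sum> a \<otimes> b\<close>.  It is independent of the chosen expression whenever \<open>f\<close> is biadditive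
  and balanced.  As a sum over a fixed representative, it may be nested in any order, so that
  formulas with several Sweedler indices make sense whenever their total sum is well defined.
\<close>

definition sweedler ::
    "('g, 'x) ring_scheme \<Rightarrow> ('m \<times> 'n) list set \<Rightarrow> ('m \<Rightarrow> 'n \<Rightarrow> 'g) \<Rightarrow> 'g" where
  "sweedler G T f = foldr (\<lambda>(a, b) s. f a b \<oplus>\<^bsub>G\<^esub> s) (some_rep T) \<zero>\<^bsub>G\<^esub>"

text \<open>Left action on a tensor product through its first factor.\<close>

definition tensor_lact ::
    "('k, 'm, 'n, 'x) tensor_scheme \<Rightarrow> ('r \<Rightarrow> 'm \<Rightarrow> 'm) \<Rightarrow> 'r \<Rightarrow> ('m \<times> 'n) list set
      \<Rightarrow> ('m \<times> 'n) list set" where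
  "tensor_lact G la r T = sweedler G T (\<lambda>m n. la r m \<boxtimes>\<^bsub>G\<^esub> n)"


section \<open>Corings and comodules\<close>

text \<open>Iterated tensor products are bracketed to the right.\<close>

locale coring_data =
  fixes K :: "('k, 'y) ring_scheme"
    and R :: "('k, 'r, 'z) module_scheme"
    and C :: "('k, 'c, 'x) module_scheme"
    and la :: "'r \<Rightarrow> 'c \<Rightarrow> 'c"
    and ra :: "'c \<Rightarrow> 'r \<Rightarrow> 'c"
    and \<Delta> :: "'c \<Rightarrow> ('c \<times> 'c) list set"
    and \<epsilon> :: "'c \<Rightarrow> 'r"
begin

abbreviation CC where
  "CC \<equiv> tensor_product C C (carrier R) ra la"

abbreviation CCC where
  "CCC \<equiv> tensor_product C CC (carrier R) ra (tensor_lact CC la)"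

end

locale coring = coring_data +
  assumes base_algebra: "k_algebra K R"
    and bimodule: "bimodule K R C la ra"
    and comult_linear: "k_linear K C CC \<Delta>"
    and comult_bilinear:
      "\<lbrakk>r \<in> carrier R; r' \<in> carrier R; c \<in> carrier C\<rbrakk>
        \<Longrightarrow> \<Delta> (ra (la r c) r') = sweedler CC (\<Delta> c) (\<lambda>a b. la r a \<boxtimes>\<^bsub>CC\<^esub> ra b r')"
    and counit_linear: "k_linear K C R \<epsilon>"
    and counit_bilinear:
      "\<lbrakk>r \<in> carrier R; r' \<in> carrier R; c \<in> carrier C\<rbrakk>
        \<Longrightarrow> \<epsilon> (ra (la r c) r') = r \<otimes>\<^bsub>R\<^esub> \<epsilon> c \<otimes>\<^bsub>R\<^esub> r'"
    and coassoc:
      "c \<in> carrier C \<Longrightarrow>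
        sweedler CCC (\<Delta> c) (\<lambda>a b. sweedler CCC (\<Delta> a) (\<lambda>a1 a2. a1 \<boxtimes>\<^bsub>CCC\<^esub> (a2 \<boxtimes>\<^bsub>CC\<^esub> b)))
        = sweedler CCC (\<Delta> c) (\<lambda>a b. a \<boxtimes>\<^bsub>CCC\<^esub> \<Delta> b)"
    and counit_left: "c \<in> carrier C \<Longrightarrow> sweedler C (\<Delta> c) (\<lambda>a b. la (\<epsilon> a) b) = c"
    and counit_right: "c \<in> carrier C \<Longrightarrow> sweedler C (\<Delta> c) (\<lambda>a b. ra a (\<epsilon> b)) = c"

locale right_comodule = coring K R C la ra \<Delta> \<epsilon>
  for K :: "('k, 'y) ring_scheme"
    and R :: "('k, 'r, 'z) module_scheme"
    and C :: "('k, 'c, 'x) module_scheme" and la ra \<Delta> \<epsilon> +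
  fixes M :: "('k, 'm, 'v) module_scheme"
    and act :: "'m \<Rightarrow> 'r \<Rightarrow> 'm"
    and \<rho> :: "'m \<Rightarrow> ('m \<times> 'c) list set"
  assumes comodule_module: "right_module K R M act"
    and coaction_linear:
      "k_linear K M (tensor_product M C (carrier R) act la) \<rho>"
    and coaction_base_linear:
      "\<lbrakk>m \<in> carrier M; r \<in> carrier R\<rbrakk> \<Longrightarrow>
        (let MC = tensor_product M C (carrier R) act la in
          \<rho> (act m r) = sweedler MC (\<rho> m) (\<lambda>x c. x \<boxtimes>\<^bsub>MC\<^esub> ra c r))"
    and coaction_coassoc:
      "m \<in> carrier M \<Longrightarrow>
        (let MCC = tensor_product M CC (carrier R) act (tensor_lact CC la) in
          sweedler MCC (\<rho> m) (\<lambda>x c. sweedler MCC (\<rho> x) (\<lambda>y d. y \<boxtimes>\<^bsub>MCC\<^esub> (d \<boxtimes>\<^bsub>CC\<^esub> c)))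
          = sweedler MCC (\<rho> m) (\<lambda>x c. x \<boxtimes>\<^bsub>MCC\<^esub> \<Delta> c))"
    and coaction_counit: "m \<in> carrier M \<Longrightarrow> sweedler M (\<rho> m) (\<lambda>x c. act x (\<epsilon> c)) = m"


section \<open>Bialgebroids and Hopf algebroids\<close>

locale left_bialgebroid_data =
  fixes K :: "('k, 'y) ring_scheme"
    and H :: "('k, 'h) module"
    and L :: "('k, 'l) module"
    and sL tL :: "'l \<Rightarrow> 'h"
    and \<gamma>L :: "'h \<Rightarrow> ('h \<times> 'h) list set"
    and \<pi>L :: "'h \<Rightarrow> 'l"
begin

text \<open>The \<open>L\<close>-bimodule structure is \<open>l h l' = s_L(l) t_L(l') h\<close>.\<close>

abbreviation lactL :: "'l \<Rightarrow> 'h \<Rightarrow> 'h" where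
  "lactL l h \<equiv> sL l \<otimes>\<^bsub>H\<^esub> h"

abbreviation ractL :: "'h \<Rightarrow> 'l \<Rightarrow> 'h" where
  "ractL h l \<equiv> tL l \<otimes>\<^bsub>H\<^esub> h"

abbreviation HLH where
  "HLH \<equiv> tensor_product H H (carrier L) ractL lactL"

end

locale left_bialgebroid = left_bialgebroid_data +
  assumes H_algebra: "k_algebra K H"
    and L_algebra: "k_algebra K L"
    and sL_hom: "sL \<in> alg_hom K L H"
    and tL_hom: "tL \<in> alg_hom K (opposite L) H"
    and sL_tL_commute:
      "\<lbrakk>l \<in> carrier L; l' \<in> carrier L\<rbrakk> \<Longrightarrow> sL l \<otimes>\<^bsub>H\<^esub> tL l' = tL l' \<otimes>\<^bsub>H\<^esub> sL l"
    and coringL: "coring K L H lactL ractL \<gamma>L \<pi>L"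
    and takeuchiL:
      "\<lbrakk>h \<in> carrier H; l \<in> carrier L\<rbrakk> \<Longrightarrow>
        sweedler HLH (\<gamma>L h) (\<lambda>a b. (a \<otimes>\<^bsub>H\<^esub> tL l) \<boxtimes>\<^bsub>HLH\<^esub> b)
        = sweedler HLH (\<gamma>L h) (\<lambda>a b. a \<boxtimes>\<^bsub>HLH\<^esub> (b \<otimes>\<^bsub>H\<^esub> sL l))"
    and \<gamma>L_one: "\<gamma>L \<one>\<^bsub>H\<^esub> = \<one>\<^bsub>H\<^esub> \<boxtimes>\<^bsub>HLH\<^esub> \<one>\<^bsub>H\<^esub>"
    and \<gamma>L_mult:
      "\<lbrakk>h \<in> carrier H; h' \<in> carrier H\<rbrakk> \<Longrightarrow>
        \<gamma>L (h \<otimes>\<^bsub>H\<^esub> h') =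
          sweedler HLH (\<gamma>L h') (\<lambda>a' b'. sweedler HLH (\<gamma>L h) (\<lambda>a b.
            (a \<otimes>\<^bsub>H\<^esub> a') \<boxtimes>\<^bsub>HLH\<^esub> (b \<otimes>\<^bsub>H\<^esub> b')))"
    and \<pi>L_one: "\<pi>L \<one>\<^bsub>H\<^esub> = \<one>\<^bsub>L\<^esub>"
    and \<pi>L_sL:
      "\<lbrakk>h \<in> carrier H; h' \<in> carrier H\<rbrakk> \<Longrightarrow> \<pi>L (h \<otimes>\<^bsub>H\<^esub> sL (\<pi>L h')) = \<pi>L (h \<otimes>\<^bsub>H\<^esub> h')"
    and \<pi>L_tL:
      "\<lbrakk>h \<in> carrier H; h' \<in> carrier H\<rbrakk> \<Longrightarrow> \<pi>L (h \<otimes>\<^bsub>H\<^esub> tL (\<pi>L h')) = \<pi>L (h \<otimes>\<^bsub>H\<^esub> h')"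

locale right_bialgebroid_data =
  fixes K :: "('k, 'y) ring_scheme"
    and H :: "('k, 'h) module"
    and R :: "('k, 'r) module"
    and sR tR :: "'r \<Rightarrow> 'h"
    and \<gamma>R :: "'h \<Rightarrow> ('h \<times> 'h) list set"
    and \<pi>R :: "'h \<Rightarrow> 'r"
begin

text \<open>The \<open>R\<close>-bimodule structure is \<open>r h r' = h s_R(r') t_R(r)\<close>.\<close>

abbreviation lactR :: "'r \<Rightarrow> 'h \<Rightarrow> 'h" where
  "lactR r h \<equiv> h \<otimes>\<^bsub>H\<^esub> tR r"

abbreviation ractR :: "'h \<Rightarrow> 'r \<Rightarrow> 'h" where
  "ractR h r \<equiv> h \<otimes>\<^bsub>H\<^esub> sR r"

abbreviation HRH where
  "HRH \<equiv> tensor_product H H (carrier R) ractR lactR"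

end

locale right_bialgebroid = right_bialgebroid_data +
  assumes H_algebra: "k_algebra K H"
    and R_algebra: "k_algebra K R"
    and sR_hom: "sR \<in> alg_hom K R H"
    and tR_hom: "tR \<in> alg_hom K (opposite R) H"
    and sR_tR_commute:
      "\<lbrakk>r \<in> carrier R; r' \<in> carrier R\<rbrakk> \<Longrightarrow> sR r \<otimes>\<^bsub>H\<^esub> tR r' = tR r' \<otimes>\<^bsub>H\<^esub> sR r"
    and coringR: "coring K R H lactR ractR \<gamma>R \<pi>R"
    and takeuchiR:
      "\<lbrakk>h \<in> carrier H; r \<in> carrier R\<rbrakk> \<Longrightarrow>
        sweedler HRH (\<gamma>R h) (\<lambda>a b. (sR r \<otimes>\<^bsub>H\<^esub> a) \<boxtimes>\<^bsub>HRH\<^esub> b)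
        = sweedler HRH (\<gamma>R h) (\<lambda>a b. a \<boxtimes>\<^bsub>HRH\<^esub> (tR r \<otimes>\<^bsub>H\<^esub> b))"
    and \<gamma>R_one: "\<gamma>R \<one>\<^bsub>H\<^esub> = \<one>\<^bsub>H\<^esub> \<boxtimes>\<^bsub>HRH\<^esub> \<one>\<^bsub>H\<^esub>"
    and \<gamma>R_mult:
      "\<lbrakk>h \<in> carrier H; h' \<in> carrier H\<rbrakk> \<Longrightarrow>
        \<gamma>R (h \<otimes>\<^bsub>H\<^esub> h') =
          sweedler HRH (\<gamma>R h) (\<lambda>a b. sweedler HRH (\<gamma>R h') (\<lambda>a' b'.
            (a \<otimes>\<^bsub>H\<^esub> a') \<boxtimes>\<^bsub>HRH\<^esub> (b \<otimes>\<^bsub>H\<^esub> b')))"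
    and \<pi>R_one: "\<pi>R \<one>\<^bsub>H\<^esub> = \<one>\<^bsub>R\<^esub>"
    and \<pi>R_sR:
      "\<lbrakk>h \<in> carrier H; h' \<in> carrier H\<rbrakk> \<Longrightarrow> \<pi>R (sR (\<pi>R h) \<otimes>\<^bsub>H\<^esub> h') = \<pi>R (h \<otimes>\<^bsub>H\<^esub> h')"
    and \<pi>R_tR:
      "\<lbrakk>h \<in> carrier H; h' \<in> carrier H\<rbrakk> \<Longrightarrow> \<pi>R (tR (\<pi>R h) \<otimes>\<^bsub>H\<^esub> h') = \<pi>R (h \<otimes>\<^bsub>H\<^esub> h')"

locale hopf_algebroid =
  left: left_bialgebroid K H L sL tL \<gamma>L \<pi>L +
  right: right_bialgebroid K H R sR tR \<gamma>R \<pi>R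
  for K :: "('k, 'y) ring_scheme"
    and H :: "('k, 'h) module"
    and L :: "('k, 'l) module" and sL tL \<gamma>L \<pi>L
    and R :: "('k, 'r) module" and sR tR \<gamma>R \<pi>R +
  fixes S :: "'h \<Rightarrow> 'h"
  assumes sL_\<pi>L_tR: "r \<in> carrier R \<Longrightarrow> sL (\<pi>L (tR r)) = tR r"
    and tL_\<pi>L_sR: "r \<in> carrier R \<Longrightarrow> tL (\<pi>L (sR r)) = sR r"
    and sR_\<pi>R_tL: "l \<in> carrier L \<Longrightarrow> sR (\<pi>R (tL l)) = tL l"
    and tR_\<pi>R_sL: "l \<in> carrier L \<Longrightarrow> tR (\<pi>R (sL l)) = sL l"
    and \<gamma>L_\<gamma>R_coassoc:
      "h \<in> carrier H \<Longrightarrow>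
        (let G = tensor_product H right.HRH (carrier L) left.ractL
                   (tensor_lact right.HRH left.lactL) in
          sweedler G (\<gamma>R h) (\<lambda>a b. sweedler G (\<gamma>L a) (\<lambda>a1 a2. a1 \<boxtimes>\<^bsub>G\<^esub> (a2 \<boxtimes>\<^bsub>right.HRH\<^esub> b)))
          = sweedler G (\<gamma>L h) (\<lambda>a b. a \<boxtimes>\<^bsub>G\<^esub> \<gamma>R b))"
    and \<gamma>R_\<gamma>L_coassoc:
      "h \<in> carrier H \<Longrightarrow>
        (let G = tensor_product H left.HLH (carrier R) right.ractR
                   (tensor_lact left.HLH right.lactR) in
          sweedler G (\<gamma>L h) (\<lambda>a b. sweedler G (\<gamma>R a) (\<lambda>a1 a2. a1 \<boxtimes>\<^bsub>G\<^esub> (a2 \<boxtimes>\<^bsub>left.HLH\<^esub> b)))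
          = sweedler G (\<gamma>R h) (\<lambda>a b. a \<boxtimes>\<^bsub>G\<^esub> \<gamma>L b))"
    and S_linear: "k_linear K H H S"
    and S_tL_tR:
      "\<lbrakk>h \<in> carrier H; l \<in> carrier L; r \<in> carrier R\<rbrakk> \<Longrightarrow>
        S (tL l \<otimes>\<^bsub>H\<^esub> h \<otimes>\<^bsub>H\<^esub> tR r) = sR r \<otimes>\<^bsub>H\<^esub> S h \<otimes>\<^bsub>H\<^esub> sL l"
    and S_tR_tL:
      "\<lbrakk>h \<in> carrier H; l \<in> carrier L; r \<in> carrier R\<rbrakk> \<Longrightarrow>
        S (tR r \<otimes>\<^bsub>H\<^esub> h \<otimes>\<^bsub>H\<^esub> tL l) = sL l \<otimes>\<^bsub>H\<^esub> S h \<otimes>\<^bsub>H\<^esub> sR r"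
    and S_left: "h \<in> carrier H \<Longrightarrow> sweedler H (\<gamma>L h) (\<lambda>a b. S a \<otimes>\<^bsub>H\<^esub> b) = sR (\<pi>R h)"
    and S_right: "h \<in> carrier H \<Longrightarrow> sweedler H (\<gamma>R h) (\<lambda>a b. a \<otimes>\<^bsub>H\<^esub> S b) = sL (\<pi>L h)"


section \<open>Comodules and comodule algebras of a Hopf algebroid\<close>

locale right_hopf_comodule =
  hopf_algebroid K H L sL tL \<gamma>L \<pi>L R sR tR \<gamma>R \<pi>R S
  for K :: "('k, 'y) ring_scheme"
    and H :: "('k, 'h) module"
    and L :: "('k, 'l) module" and sL tL \<gamma>L \<pi>L
    and R :: "('k, 'r) module" and sR tR \<gamma>R \<pi>R and S +
  fixes M :: "('k, 'm, 'v) module_scheme"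
    and actR :: "'m \<Rightarrow> 'r \<Rightarrow> 'm"
    and actL :: "'m \<Rightarrow> 'l \<Rightarrow> 'm"
    and \<rho>R \<rho>L :: "'m \<Rightarrow> ('m \<times> 'h) list set"
  assumes comoduleR:
      "right_comodule K R H right.lactR right.ractR \<gamma>R \<pi>R M actR \<rho>R"
    and comoduleL:
      "right_comodule K L H left.lactL left.ractL \<gamma>L \<pi>L M actL \<rho>L"
    and \<rho>R_L_linear:
      "\<lbrakk>m \<in> carrier M; l \<in> carrier L\<rbrakk> \<Longrightarrow>
        (let MRH = tensor_product M H (carrier R) actR right.lactR in
          \<rho>R (actL m l) = sweedler MRH (\<rho>R m) (\<lambda>x h. x \<boxtimes>\<^bsub>MRH\<^esub> (tL l \<otimes>\<^bsub>H\<^esub> h)))"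
    and \<rho>L_R_linear:
      "\<lbrakk>m \<in> carrier M; r \<in> carrier R\<rbrakk> \<Longrightarrow>
        (let MLH = tensor_product M H (carrier L) actL left.lactL in
          \<rho>L (actR m r) = sweedler MLH (\<rho>L m) (\<lambda>x h. x \<boxtimes>\<^bsub>MLH\<^esub> (h \<otimes>\<^bsub>H\<^esub> sR r)))"
    and \<rho>R_\<gamma>L:
      "m \<in> carrier M \<Longrightarrow>
        (let G = tensor_product M left.HLH (carrier R) actR (tensor_lact left.HLH right.lactR) in
          sweedler G (\<rho>R m) (\<lambda>x h. x \<boxtimes>\<^bsub>G\<^esub> \<gamma>L h)
          = sweedler G (\<rho>L m) (\<lambda>x h. sweedler G (\<rho>R x) (\<lambda>y g. y \<boxtimes>\<^bsub>G\<^esub> (g \<boxtimes>\<^bsub>left.HLH\<^esub> h))))"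
    and \<rho>L_\<gamma>R:
      "m \<in> carrier M \<Longrightarrow>
        (let G = tensor_product M right.HRH (carrier L) actL (tensor_lact right.HRH left.lactL) in
          sweedler G (\<rho>L m) (\<lambda>x h. x \<boxtimes>\<^bsub>G\<^esub> \<gamma>R h)
          = sweedler G (\<rho>R m) (\<lambda>x h. sweedler G (\<rho>L x) (\<lambda>y g. y \<boxtimes>\<^bsub>G\<^esub> (g \<boxtimes>\<^bsub>right.HRH\<^esub> h))))"

locale comodule_algebra_data =
  hopf_algebroid K H L sL tL \<gamma>L \<pi>L R sR tR \<gamma>R \<pi>R S
  for K :: "('k, 'y) ring_scheme"
    and H :: "('k, 'h) module"
    and L :: "('k, 'l) module" and sL tL \<gamma>L \<pi>L
    and R :: "('k, 'r) module" and sR tR \<gamma>R \<pi>R and S +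
  fixes A :: "('k, 'a, 'v) module_scheme"
    and \<eta>R :: "'r \<Rightarrow> 'a"
    and \<rho>R \<rho>L :: "'a \<Rightarrow> ('a \<times> 'h) list set"
begin

abbreviation ractRA :: "'a \<Rightarrow> 'r \<Rightarrow> 'a" where
  "ractRA a r \<equiv> a \<otimes>\<^bsub>A\<^esub> \<eta>R r"

abbreviation ractLA :: "'a \<Rightarrow> 'l \<Rightarrow> 'a" where
  "ractLA a l \<equiv> \<eta>R (\<pi>R (tL l)) \<otimes>\<^bsub>A\<^esub> a"

abbreviation ARH where
  "ARH \<equiv> tensor_product A H (carrier R) ractRA right.lactR"

abbreviation ALH where
  "ALH \<equiv> tensor_product A H (carrier L) ractLA left.lactL"

end

text \<open>
  In \<open>left_action\<close>, the left-hand side is the canonical left \<open>R\<close>-action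
  \<open>r a = a^[0] \<pi>_R(s_R(r) a^[1])\<close> of an \<open>H_R\<close>-comodule.
\<close>

locale comodule_algebra = comodule_algebra_data +
  assumes A_algebra: "k_algebra K A"
    and \<eta>R_hom: "\<eta>R \<in> alg_hom K R A"
    and hopf_comodule:
      "right_hopf_comodule K H L sL tL \<gamma>L \<pi>L R sR tR \<gamma>R \<pi>R S A ractRA ractLA \<rho>R \<rho>L"
    and left_action:
      "\<lbrakk>a \<in> carrier A; r \<in> carrier R\<rbrakk> \<Longrightarrow>
        sweedler A (\<rho>R a) (\<lambda>x h. ractRA x (\<pi>R (sR r \<otimes>\<^bsub>H\<^esub> h))) = \<eta>R r \<otimes>\<^bsub>A\<^esub> a"
    and \<rho>R_one: "\<rho>R \<one>\<^bsub>A\<^esub> = \<one>\<^bsub>A\<^esub> \<boxtimes>\<^bsub>ARH\<^esub> \<one>\<^bsub>H\<^esub>"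
    and \<rho>R_mult:
      "\<lbrakk>a \<in> carrier A; a' \<in> carrier A\<rbrakk> \<Longrightarrow>
        \<rho>R (a \<otimes>\<^bsub>A\<^esub> a') =
          sweedler ARH (\<rho>R a) (\<lambda>x h. sweedler ARH (\<rho>R a') (\<lambda>x' h'.
            (x \<otimes>\<^bsub>A\<^esub> x') \<boxtimes>\<^bsub>ARH\<^esub> (h \<otimes>\<^bsub>H\<^esub> h')))"
    and \<rho>L_one: "\<rho>L \<one>\<^bsub>A\<^esub> = \<one>\<^bsub>A\<^esub> \<boxtimes>\<^bsub>ALH\<^esub> \<one>\<^bsub>H\<^esub>"
    and \<rho>L_mult:
      "\<lbrakk>a \<in> carrier A; a' \<in> carrier A\<rbrakk> \<Longrightarrow>
        \<rho>L (a \<otimes>\<^bsub>A\<^esub> a') =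
          sweedler ALH (\<rho>L a') (\<lambda>x' h'. sweedler ALH (\<rho>L a) (\<lambda>x h.
            (x \<otimes>\<^bsub>A\<^esub> x') \<boxtimes>\<^bsub>ALH\<^esub> (h \<otimes>\<^bsub>H\<^esub> h')))"

text \<open>
  The inclusion \<open>B \<subseteq> A\<close> is given as an injective algebra map \<open>i : B \<rightarrow> A\<close>.
\<close>

locale hopf_extension =
  comodule_algebra K H L sL tL \<gamma>L \<pi>L R sR tR \<gamma>R \<pi>R S A \<eta>R \<rho>R \<rho>L
  for K :: "('k, 'y) ring_scheme"
    and H :: "('k, 'h) module"
    and L :: "('k, 'l) module" and sL tL \<gamma>L \<pi>L
    and R :: "('k, 'r) module" and sR tR \<gamma>R \<pi>R and S
    and A :: "('k, 'a, 'v) module_scheme" and \<eta>R \<rho>R \<rho>L +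
  fixes B :: "('k, 'b, 'u) module_scheme"
    and i :: "'b \<Rightarrow> 'a"
  assumes B_algebra: "k_algebra K B"
    and i_hom: "i \<in> alg_hom K B A"
    and i_inj: "inj_on i (carrier B)"
    and coinvariants: "i ` carrier B = {b \<in> carrier A. \<rho>R b = b \<boxtimes>\<^bsub>ARH\<^esub> \<one>\<^bsub>H\<^esub>}"
begin

definition comodule_map :: "('h \<Rightarrow> 'a) \<Rightarrow> bool" where
  "comodule_map j \<longleftrightarrow>
     k_linear K H A j \<and>
     (\<forall>h\<in>carrier H. \<forall>r\<in>carrier R. j (right.ractR h r) = ractRA (j h) r) \<and>
     (\<forall>h\<in>carrier H. \<forall>l\<in>carrier L. j (left.ractL h l) = ractLA (j h) l) \<and>
     (\<forall>h\<in>carrier H. \<rho>R (j h) = sweedler ARH (\<gamma>R h) (\<lambda>a b. j a \<boxtimes>\<^bsub>ARH\<^esub> b)) \<and>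
     (\<forall>h\<in>carrier H. \<rho>L (j h) = sweedler ALH (\<gamma>L h) (\<lambda>a b. j a \<boxtimes>\<^bsub>ALH\<^esub> b))"

definition convolution_inverse :: "('l \<Rightarrow> 'a) \<Rightarrow> ('h \<Rightarrow> 'a) \<Rightarrow> ('h \<Rightarrow> 'a) \<Rightarrow> bool" where
  "convolution_inverse \<eta>L j jc \<longleftrightarrow>
     k_linear K H A jc \<and>
     (\<forall>h\<in>carrier H. \<forall>l\<in>carrier L. \<forall>r\<in>carrier R.
        jc (tL l \<otimes>\<^bsub>H\<^esub> h \<otimes>\<^bsub>H\<^esub> tR r) = \<eta>R r \<otimes>\<^bsub>A\<^esub> jc h \<otimes>\<^bsub>A\<^esub> \<eta>L l) \<and>
     (\<forall>h\<in>carrier H. sweedler A (\<gamma>R h) (\<lambda>a b. j a \<otimes>\<^bsub>A\<^esub> jc b) = \<eta>L (\<pi>L h)) \<and>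
     (\<forall>h\<in>carrier H. sweedler A (\<gamma>L h) (\<lambda>a b. jc a \<otimes>\<^bsub>A\<^esub> j b) = \<eta>R (\<pi>R h))"

definition cleaving_map :: "('l \<Rightarrow> 'a) \<Rightarrow> ('h \<Rightarrow> 'a) \<Rightarrow> bool" where
  "cleaving_map \<eta>L j \<longleftrightarrow>
     comodule_map j \<and>
     (\<forall>h\<in>carrier H. \<forall>l\<in>carrier L. j (sL l \<otimes>\<^bsub>H\<^esub> h) = \<eta>L l \<otimes>\<^bsub>A\<^esub> j h) \<and>
     (\<exists>jc. convolution_inverse \<eta>L j jc)"

end

locale cleft_extension =
  hopf_extension K H L sL tL \<gamma>L \<pi>L R sR tR \<gamma>R \<pi>R S A \<eta>R \<rho>R \<rho>L B i
  for K :: "('k, 'y) ring_scheme"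
    and H :: "('k, 'h) module"
    and L :: "('k, 'l) module" and sL tL \<gamma>L \<pi>L
    and R :: "('k, 'r) module" and sR tR \<gamma>R \<pi>R and S
    and A :: "('k, 'a, 'v) module_scheme" and \<eta>R \<rho>R \<rho>L
    and B :: "('k, 'b, 'u) module_scheme" and i +
  fixes \<eta>L :: "'l \<Rightarrow> 'a"
  assumes \<eta>L_hom: "\<eta>L \<in> alg_hom K L A"
    and \<eta>L_subring: "\<eta>L ` carrier L \<subseteq> i ` carrier B"
    and cleaving: "\<exists>j. cleaving_map \<eta>L j"


section \<open>Crossed products\<close>

locale measured_ring =
  left_bialgebroid K H L sL tL \<gamma>L \<pi>L
  for K :: "('k, 'y) ring_scheme"
    and H :: "('k, 'h) module"
    and L :: "('k, 'l) module" and sL tL \<gamma>L \<pi>L +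
  fixes B :: "('k, 'b) module"
    and \<iota> :: "'l \<Rightarrow> 'b"
    and meas :: "'h \<Rightarrow> 'b \<Rightarrow> 'b"  (infixr \<open>\<cdot>\<close> 75)
  assumes B_algebra: "k_algebra K B"
    and \<iota>_hom: "\<iota> \<in> alg_hom K L B"
    and meas_bilinear: "k_bilinear K H B B (\<cdot>)"
    and meas_one: "h \<in> carrier H \<Longrightarrow> h \<cdot> \<one>\<^bsub>B\<^esub> = \<iota> (\<pi>L h)"
    and meas_tL:
      "\<lbrakk>h \<in> carrier H; b \<in> carrier B; l \<in> carrier L\<rbrakk> \<Longrightarrow>
        (tL l \<otimes>\<^bsub>H\<^esub> h) \<cdot> b = (h \<cdot> b) \<otimes>\<^bsub>B\<^esub> \<iota> l"
    and meas_sL: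
      "\<lbrakk>h \<in> carrier H; b \<in> carrier B; l \<in> carrier L\<rbrakk> \<Longrightarrow>
        (sL l \<otimes>\<^bsub>H\<^esub> h) \<cdot> b = \<iota> l \<otimes>\<^bsub>B\<^esub> (h \<cdot> b)"
    and meas_mult:
      "\<lbrakk>h \<in> carrier H; b \<in> carrier B; b' \<in> carrier B\<rbrakk> \<Longrightarrow>
        h \<cdot> (b \<otimes>\<^bsub>B\<^esub> b') = sweedler B (\<gamma>L h) (\<lambda>h1 h2. (h1 \<cdot> b) \<otimes>\<^bsub>B\<^esub> (h2 \<cdot> b'))"

text \<open>
  A \<open>k\<close>-linear map on \<open>H \<otimes> H\<close> over \<open>L^op\<close> (for \<open>\<sigma>\<close>) or over \<open>L\<close> (for its inverse) is
  represented by a balanced \<open>k\<close>-bilinear map of two arguments.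
\<close>

locale two_cocycle =
  measured_ring K H L sL tL \<gamma>L \<pi>L B \<iota> meas
  for K :: "('k, 'y) ring_scheme"
    and H :: "('k, 'h) module"
    and L :: "('k, 'l) module" and sL tL \<gamma>L \<pi>L
    and B :: "('k, 'b) module" and \<iota>
    and meas :: "'h \<Rightarrow> 'b \<Rightarrow> 'b"  (infixr \<open>\<cdot>\<close> 75) +
  fixes \<sigma> :: "'h \<Rightarrow> 'h \<Rightarrow> 'b"
  assumes \<sigma>_bilinear: "k_bilinear K H H B \<sigma>"
    and \<sigma>_balanced:
      "\<lbrakk>h \<in> carrier H; k \<in> carrier H; l \<in> carrier L\<rbrakk> \<Longrightarrow>
        \<sigma> (h \<otimes>\<^bsub>H\<^esub> tL l) k = \<sigma> h (tL l \<otimes>\<^bsub>H\<^esub> k)"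
    and \<sigma>_sL:
      "\<lbrakk>h \<in> carrier H; k \<in> carrier H; l \<in> carrier L\<rbrakk> \<Longrightarrow>
        \<sigma> (sL l \<otimes>\<^bsub>H\<^esub> h) k = \<iota> l \<otimes>\<^bsub>B\<^esub> \<sigma> h k"
    and \<sigma>_tL:
      "\<lbrakk>h \<in> carrier H; k \<in> carrier H; l \<in> carrier L\<rbrakk> \<Longrightarrow>
        \<sigma> (tL l \<otimes>\<^bsub>H\<^esub> h) k = \<sigma> h k \<otimes>\<^bsub>B\<^esub> \<iota> l"
    and \<sigma>_\<iota>:
      "\<lbrakk>h \<in> carrier H; k \<in> carrier H; l \<in> carrier L\<rbrakk> \<Longrightarrow>
        sweedler B (\<gamma>L h) (\<lambda>h1 h2. (h1 \<cdot> \<iota> l) \<otimes>\<^bsub>B\<^esub> \<sigma> h2 k) = \<sigma> h (sL l \<otimes>\<^bsub>H\<^esub> k)"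
    and \<sigma>_one_left: "h \<in> carrier H \<Longrightarrow> \<sigma> \<one>\<^bsub>H\<^esub> h = \<iota> (\<pi>L h)"
    and \<sigma>_one_right: "h \<in> carrier H \<Longrightarrow> \<sigma> h \<one>\<^bsub>H\<^esub> = \<iota> (\<pi>L h)"
    and \<sigma>_cocycle:
      "\<lbrakk>h \<in> carrier H; k \<in> carrier H; m \<in> carrier H\<rbrakk> \<Longrightarrow>
        sweedler B (\<gamma>L m) (\<lambda>m1 m2. sweedler B (\<gamma>L k) (\<lambda>k1 k2. sweedler B (\<gamma>L h) (\<lambda>h1 h2.
          (h1 \<cdot> \<sigma> k1 m1) \<otimes>\<^bsub>B\<^esub> \<sigma> h2 (k2 \<otimes>\<^bsub>H\<^esub> m2))))
        = sweedler B (\<gamma>L k) (\<lambda>k1 k2. sweedler B (\<gamma>L h) (\<lambda>h1 h2.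
            \<sigma> h1 k1 \<otimes>\<^bsub>B\<^esub> \<sigma> (h2 \<otimes>\<^bsub>H\<^esub> k2) m))"

locale twisted_ring = two_cocycle +
  assumes meas_unit: "b \<in> carrier B \<Longrightarrow> \<one>\<^bsub>H\<^esub> \<cdot> b = b"
    and meas_twisted:
      "\<lbrakk>h \<in> carrier H; k \<in> carrier H; b \<in> carrier B\<rbrakk> \<Longrightarrow>
        sweedler B (\<gamma>L k) (\<lambda>k1 k2. sweedler B (\<gamma>L h) (\<lambda>h1 h2.
          (h1 \<cdot> k1 \<cdot> b) \<otimes>\<^bsub>B\<^esub> \<sigma> h2 k2))
        = sweedler B (\<gamma>L k) (\<lambda>k1 k2. sweedler B (\<gamma>L h) (\<lambda>h1 h2.
            \<sigma> h1 k1 \<otimes>\<^bsub>B\<^esub> ((h2 \<otimes>\<^bsub>H\<^esub> k2) \<cdot> b)))"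

definition (in measured_ring) cocycle_inverse :: "('h \<Rightarrow> 'h \<Rightarrow> 'b) \<Rightarrow> ('h \<Rightarrow> 'h \<Rightarrow> 'b) \<Rightarrow> bool" where
  "cocycle_inverse \<sigma> \<tau> \<longleftrightarrow>
     k_bilinear K H H B \<tau> \<and>
     (\<forall>h\<in>carrier H. \<forall>k\<in>carrier H. \<forall>l\<in>carrier L.
        \<tau> (h \<otimes>\<^bsub>H\<^esub> sL l) k = \<tau> h (sL l \<otimes>\<^bsub>H\<^esub> k) \<and>
        \<tau> (sL l \<otimes>\<^bsub>H\<^esub> h) k = \<iota> l \<otimes>\<^bsub>B\<^esub> \<tau> h k \<and>
        \<tau> (tL l \<otimes>\<^bsub>H\<^esub> h) k = \<tau> h k \<otimes>\<^bsub>B\<^esub> \<iota> l \<and>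
        sweedler B (\<gamma>L h) (\<lambda>h1 h2. \<tau> h1 k \<otimes>\<^bsub>B\<^esub> (h2 \<cdot> \<iota> l)) = \<tau> h (tL l \<otimes>\<^bsub>H\<^esub> k)) \<and>
     (\<forall>h\<in>carrier H. \<forall>k\<in>carrier H.
        sweedler B (\<gamma>L k) (\<lambda>k1 k2. sweedler B (\<gamma>L h) (\<lambda>h1 h2. \<sigma> h1 k1 \<otimes>\<^bsub>B\<^esub> \<tau> h2 k2))
          = h \<cdot> k \<cdot> \<one>\<^bsub>B\<^esub> \<and>
        sweedler B (\<gamma>L k) (\<lambda>k1 k2. sweedler B (\<gamma>L h) (\<lambda>h1 h2. \<tau> h1 k1 \<otimes>\<^bsub>B\<^esub> \<sigma> h2 k2))
          = (h \<otimes>\<^bsub>H\<^esub> k) \<cdot> \<one>\<^bsub>B\<^esub>)"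

locale invertible_cocycle = two_cocycle +
  assumes invertible: "\<exists>\<tau>. cocycle_inverse \<sigma> \<tau>"

text \<open>
  The crossed product is \<open>B \<otimes>_L H\<close> with the product
  \<open>(b # h) (b' # h') = b (h_(1) \<cdot> b') \<sigma>(h_(2), h'_(1)) # h_(3) h'_(2)\<close>;
  its field \<open>tens\<close> is \<open>b # h\<close>.  Below, \<open>h23\<close> is split into \<open>h_(2)\<close> and \<open>h_(3)\<close>.
\<close>

definition crossed_product ::
    "('k, 'h) module \<Rightarrow> ('k, 'l) module \<Rightarrow> ('l \<Rightarrow> 'h) \<Rightarrow> ('h \<Rightarrow> ('h \<times> 'h) list set)
      \<Rightarrow> ('k, 'b) module \<Rightarrow> ('l \<Rightarrow> 'b) \<Rightarrow> ('h \<Rightarrow> 'b \<Rightarrow> 'b) \<Rightarrow> ('h \<Rightarrow> 'h \<Rightarrow> 'b)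
      \<Rightarrow> ('k, 'b, 'h) tensor" where
  "crossed_product H L sL \<gamma>L B \<iota> meas \<sigma> =
    (let T = tensor_product B H (carrier L) (\<lambda>b l. b \<otimes>\<^bsub>B\<^esub> \<iota> l) (\<lambda>l h. sL l \<otimes>\<^bsub>H\<^esub> h) in
     T\<lparr>mult := (\<lambda>u v.
          sweedler T v (\<lambda>b' h'. sweedler T u (\<lambda>b h.
            sweedler T (\<gamma>L h') (\<lambda>h'1 h'2.
              sweedler T (\<gamma>L h) (\<lambda>h1 h23. sweedler T (\<gamma>L h23) (\<lambda>h2 h3.
                (b \<otimes>\<^bsub>B\<^esub> meas h1 b' \<otimes>\<^bsub>B\<^esub> \<sigma> h2 h'1) \<boxtimes>\<^bsub>T\<^esub> (h3 \<otimes>\<^bsub>H\<^esub> h'2))))))),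
       one := \<one>\<^bsub>B\<^esub> \<boxtimes>\<^bsub>T\<^esub> \<one>\<^bsub>H\<^esub>\<rparr>)"

text \<open>
  For \<open>A = B \<otimes>_L H\<close>, a map \<open>\<gamma> : H \<rightarrow> H \<otimes> H\<close> and a target \<open>G = A \<otimes> H\<close>, this is
  \<open>B \<otimes>_L \<gamma> : b # h \<mapsto> (b # h') \<otimes> h''\<close> where \<open>\<gamma>(h) = h' \<otimes> h''\<close>.
\<close>

definition crossed_coaction ::
    "('k, 'b, 'h) tensor \<Rightarrow> ('k, ('b \<times> 'h) list set, 'h) tensor \<Rightarrow> ('h \<Rightarrow> ('h \<times> 'h) list set)
      \<Rightarrow> ('b \<times> 'h) list set \<Rightarrow> (('b \<times> 'h) list set \<times> 'h) list set" where
  "crossed_coaction A G \<gamma> u =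
    sweedler G u (\<lambda>b h. sweedler G (\<gamma> h) (\<lambda>h' h''. (b \<boxtimes>\<^bsub>A\<^esub> h') \<boxtimes>\<^bsub>G\<^esub> h''))"

end

theory Submission
  imports Defs
begin

text \<open>
  Write \<open>j(h) = 1 # h\<close>.  The cleaving map is \<open>j\<close>, and its convolution inverse is
  \<open>j\<^sup>c(h) = \<tau>(S(h_(1))_(1), h_(2)) # S(h_(1))_(2)\<close>, where \<open>\<tau>\<close> is the inverse of \<open>\<sigma>\<close>.  That
  \<open>j\<^sup>c\<close> is a left inverse is immediate from \<open>\<tau> \<sigma> = 1\<close>; that it is a right inverse needs the
  identity \<open>(h_(1) \<cdot> \<tau>(k_(1), m)) \<sigma>(h_(2), k_(2)) = \<sigma>(h_(1), k_(1) m_(1)) \<tau>(h_(2) k_(2), m_(2))\<close>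
  and \<open>S(v_(1))_(1) v_(2) \<otimes> S(v_(1))_(2) = 1 \<otimes> S(v)\<close>.

  The product of \<open>B #_\<sigma> H\<close> is \<open>(b # h) v = b \<Theta>_h(v)\<close> for operators \<open>\<Theta>_h\<close> with
  \<open>\<Theta>_h(b v) = (h_(1) \<cdot> b) \<Theta>_{h_(2)}(v)\<close> and
  \<open>\<Theta>_h \<Theta>_k = \<sigma>(h_(1), k_(1)) \<Theta>_{h_(2) k_(2)}\<close>, which reduces associativity to the cocycle and twisting
  conditions.
\<close>

section \<open>Additive maps and sums over formal tensors\<close>

text \<open>For an ordinary Hopf algebra S reverses coproducts, and the formula for
  \<open>j\<^sup>c\<close> becomes the classical \<tau>(S(h_(2)), h_(3)) # S(h_(1)). Over a Hopf
  algebroid the antipode exchanges the two coproducts, so the left coproduct of S(h_(1)) is kept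
  unexpanded. The obstacle throughout is well-definedness. \<open>sweedler\<close> sums over a
  chosen representative, so a rewriting step is legitimate only if the summand is additive in each
  argument and balanced over the base algebra. Additivity alone (\<open>add_map\<close>) is recorded
  for summands; scalars are treated separately. Balancedness is delicate: in \<sigma>(h_(1), k_(1))
  \<Theta>_{h_(2) k_(2)}(u) the summand is in general balanced in k only after summation over h. The
  variables cannot be treated independently of each other, and so associativity of convolution in
  several variables is proved once, under the condition \<open>linked\<close>. Cleftness comprises
  all axioms of a comodule algebra and the determination of its coinvariants, so these are
  established for the crossed product before the inverse is treated.\<close>

definition add_map :: "('m, 'x) ring_scheme \<Rightarrow> ('g, 'w) ring_scheme \<Rightarrow> ('m \<Rightarrow> 'g) \<Rightarrow> bool" where
  "add_map M G f \<longleftrightarrow> (\<forall>x\<in>carrier M. f x \<in> carrier G) \<and>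
     (\<forall>x\<in>carrier M. \<forall>y\<in>carrier M. f (x \<oplus>\<^bsub>M\<^esub> y) = f x \<oplus>\<^bsub>G\<^esub> f y)"

lemma add_mapI:
  assumes "\<And>x. x \<in> carrier M \<Longrightarrow> f x \<in> carrier G"
    and "\<And>x y. x \<in> carrier M \<Longrightarrow> y \<in> carrier M \<Longrightarrow> f (x \<oplus>\<^bsub>M\<^esub> y) = f x \<oplus>\<^bsub>G\<^esub> f y"
  shows "add_map M G f"
  using assms by (auto simp: add_map_def)

lemma add_map_closed: "add_map M G f \<Longrightarrow> x \<in> carrier M \<Longrightarrow> f x \<in> carrier G"
  by (auto simp: add_map_def)

lemma add_map_add:
  "add_map M G f \<Longrightarrow> x \<in> carrier M \<Longrightarrow> y \<in> carrier M \<Longrightarrow> f (x \<oplus>\<^bsub>M\<^esub> y) = f x \<oplus>\<^bsub>G\<^esub> f y"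
  by (auto simp: add_map_def)

lemma add_map_comp:
  "add_map M N f \<Longrightarrow> add_map N G g \<Longrightarrow> add_map M G (\<lambda>x. g (f x))"
  by (auto simp: add_map_def)

lemma add_map_id: "add_map M M (\<lambda>x. x)"
  by (auto simp: add_map_def)

lemma add_map_zero:
  assumes "add_map M G f" "abelian_group M" "abelian_group G"
  shows "f \<zero>\<^bsub>M\<^esub> = \<zero>\<^bsub>G\<^esub>"
proof -
  interpret M: abelian_group M by fact
  interpret G: abelian_group G by fact
  have "f \<zero>\<^bsub>M\<^esub> \<oplus>\<^bsub>G\<^esub> f \<zero>\<^bsub>M\<^esub> = f \<zero>\<^bsub>M\<^esub> \<oplus>\<^bsub>G\<^esub> \<zero>\<^bsub>G\<^esub>"
    using add_map_add[OF assms(1), of "\<zero>\<^bsub>M\<^esub>" "\<zero>\<^bsub>M\<^esub>"] add_map_closed[OF assms(1)] by simp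
  then show ?thesis
    using add_map_closed[OF assms(1)] by (metis G.minus_equality G.r_neg G.a_assoc G.l_zero G.r_zero G.a_inv_closed G.zero_closed M.zero_closed)
qed

text \<open>This is \<open>sweedler\<close> with an explicit list in place of the chosen
  representative, so that list induction and induction on \<open>tensor_eq\<close> apply.\<close>

definition lsum :: "('g, 'w) ring_scheme \<Rightarrow> ('m \<Rightarrow> 'n \<Rightarrow> 'g) \<Rightarrow> ('m \<times> 'n) list \<Rightarrow> 'g" where
  "lsum G f xs = foldr (\<lambda>(a, b) s. f a b \<oplus>\<^bsub>G\<^esub> s) xs \<zero>\<^bsub>G\<^esub>"

lemma lsum_simps [simp]:
  "lsum G f [] = \<zero>\<^bsub>G\<^esub>"
  "lsum G f ((a, b) # xs) = f a b \<oplus>\<^bsub>G\<^esub> lsum G f xs"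
  by (simp_all add: lsum_def)

lemma lsum_cong:
  "(\<And>a b. (a, b) \<in> set xs \<Longrightarrow> f a b = g a b) \<Longrightarrow> lsum G f xs = lsum G g xs"
  by (induction xs) auto

context abelian_group
begin

lemma lsum_closed:
  "(\<And>a b. (a, b) \<in> set xs \<Longrightarrow> f a b \<in> carrier G) \<Longrightarrow> lsum G f xs \<in> carrier G"
  by (induction xs) auto

lemma lsum_append:
  assumes "\<And>a b. (a, b) \<in> set xs \<Longrightarrow> f a b \<in> carrier G"
    and "\<And>a b. (a, b) \<in> set ys \<Longrightarrow> f a b \<in> carrier G"
  shows "lsum G f (xs @ ys) = lsum G f xs \<oplus> lsum G f ys"
  using assms
proof (induction xs)
  case (Cons p xs)
  obtain a b where p: "p = (a, b)" by force
  show ?case using Cons by (auto simp: p intro!: a_assoc[symmetric] lsum_closed)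
qed (auto simp: lsum_closed)

lemma lsum_add:
  assumes "\<And>a b. (a, b) \<in> set xs \<Longrightarrow> f a b \<in> carrier G \<and> g a b \<in> carrier G"
  shows "lsum G (\<lambda>a b. f a b \<oplus> g a b) xs = lsum G f xs \<oplus> lsum G g xs"
  using assms
proof (induction xs)
  case (Cons p xs)
  obtain a b where p: "p = (a, b)" by force
  have "lsum G f xs \<in> carrier G" "lsum G g xs \<in> carrier G" "f a b \<in> carrier G" "g a b \<in> carrier G"
    using Cons(2) by (auto simp: p intro!: lsum_closed)
  then show ?case using Cons by (simp add: p a_ac)
qed auto

lemma lsum_zero:
  "(\<And>a b. (a, b) \<in> set xs \<Longrightarrow> f a b = \<zero>) \<Longrightarrow> lsum G f xs = \<zero>"
  by (induction xs) auto

lemma lsum_hom: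
  assumes "add_map G G' \<phi>" "abelian_group G'"
    and "\<And>a b. (a, b) \<in> set xs \<Longrightarrow> f a b \<in> carrier G"
  shows "\<phi> (lsum G f xs) = lsum G' (\<lambda>a b. \<phi> (f a b)) xs"
  using assms(3)
proof (induction xs)
  case Nil
  show ?case using add_map_zero[OF assms(1) abelian_group_axioms assms(2)] by simp
next
  case (Cons p xs)
  obtain a b where p: "p = (a, b)" by force
  have "lsum G f xs \<in> carrier G" "f a b \<in> carrier G"
    using Cons(2) by (auto simp: p intro!: lsum_closed)
  then show ?case using Cons by (simp add: p add_map_add[OF assms(1)])
qed

lemma lsum_swap:
  assumes "\<And>a b c d. (a, b) \<in> set xs \<Longrightarrow> (c, d) \<in> set ys \<Longrightarrow> f a b c d \<in> carrier G"
  shows "lsum G (\<lambda>a b. lsum G (\<lambda>c d. f a b c d) ys) xs = lsum G (\<lambda>c d. lsum G (\<lambda>a b. f a b c d) xs) ys"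
  using assms
proof (induction xs)
  case Nil
  then show ?case by (simp add: lsum_zero)
next
  case (Cons p xs)
  obtain a b where p: "p = (a, b)" by force
  have "lsum G (\<lambda>c d. f a b c d \<oplus> lsum G (\<lambda>a b. f a b c d) xs) ys
    = lsum G (f a b) ys \<oplus> lsum G (\<lambda>c d. lsum G (\<lambda>a b. f a b c d) xs) ys"
    using Cons(2) by (intro lsum_add) (auto simp: p intro!: lsum_closed)
  then show ?case using Cons by (simp add: p)
qed

end

text \<open>
  Restricting the summation to entries in the carriers makes the congruence and interchange rules
  unconditional; on elements of tensor products nothing changes.
\<close>

definition tsum ::
    "('m, 'x) ring_scheme \<Rightarrow> ('n, 'z) ring_scheme \<Rightarrow> ('g, 'w) ring_scheme \<Rightarrow> ('m \<times> 'n) list set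
      \<Rightarrow> ('m \<Rightarrow> 'n \<Rightarrow> 'g) \<Rightarrow> 'g" where
  "tsum M N G T f = lsum G f (filter (\<lambda>(a, b). a \<in> carrier M \<and> b \<in> carrier N) (some_rep T))"

text \<open>As a congruence rule this hands the simplifier the membership of both summation
  variables in their carriers. The closure conditions inside nested Sweedler sums are then solved
  without naming the variables.\<close>

lemma tsum_cong [cong]:
  "T = T' \<Longrightarrow> (\<And>a b. a \<in> carrier M \<Longrightarrow> b \<in> carrier N \<Longrightarrow> f a b = g a b)
    \<Longrightarrow> tsum M N G T f = tsum M N G T' g"
  by (auto simp: tsum_def intro: lsum_cong)

text \<open>A sum depends on addition and zero of its target only. This transfers sums between the
  crossed product \<open>A\<close> and the underlying tensor product \<open>BH\<close>, which are
  different records with the same additive group.\<close>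

lemma tsum_target_cong:
  "add G = add G' \<Longrightarrow> zero G = zero G' \<Longrightarrow> tsum M N G T f = tsum M N G' T f"
  by (simp add: tsum_def lsum_def)

lemma tsum_closed:
  "abelian_group G \<Longrightarrow> (\<And>a b. a \<in> carrier M \<Longrightarrow> b \<in> carrier N \<Longrightarrow> f a b \<in> carrier G)
    \<Longrightarrow> tsum M N G T f \<in> carrier G"
  by (auto simp: tsum_def intro: abelian_group.lsum_closed)

lemma tsum_add:
  assumes "abelian_group G"
    and "\<And>a b. a \<in> carrier M \<Longrightarrow> b \<in> carrier N \<Longrightarrow> f a b \<in> carrier G"
    and "\<And>a b. a \<in> carrier M \<Longrightarrow> b \<in> carrier N \<Longrightarrow> g a b \<in> carrier G"
  shows "tsum M N G T (\<lambda>a b. f a b \<oplus>\<^bsub>G\<^esub> g a b) = tsum M N G T f \<oplus>\<^bsub>G\<^esub> tsum M N G T g"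
  unfolding tsum_def by (intro abelian_group.lsum_add) (use assms in auto)

lemma tsum_hom:
  assumes "add_map G G' \<phi>" "abelian_group G" "abelian_group G'"
    and "\<And>a b. a \<in> carrier M \<Longrightarrow> b \<in> carrier N \<Longrightarrow> f a b \<in> carrier G"
  shows "\<phi> (tsum M N G T f) = tsum M N G' T (\<lambda>a b. \<phi> (f a b))"
  unfolding tsum_def by (intro abelian_group.lsum_hom) (use assms in auto)

lemma tsum_swap:
  assumes "abelian_group G"
    and "\<And>a b c d. a \<in> carrier M \<Longrightarrow> b \<in> carrier N \<Longrightarrow> c \<in> carrier M' \<Longrightarrow> d \<in> carrier N'
      \<Longrightarrow> f a b c d \<in> carrier G"
  shows "tsum M N G T (\<lambda>a b. tsum M' N' G U (\<lambda>c d. f a b c d))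
    = tsum M' N' G U (\<lambda>c d. tsum M N G T (\<lambda>a b. f a b c d))"
  unfolding tsum_def by (intro abelian_group.lsum_swap) (use assms in auto)

text \<open>Additivity in a parameter of the summand does not involve balancedness, because the
  representative of T stays the same while the parameter varies.\<close>

lemma add_map_tsum:
  assumes "abelian_group G"
    and "\<And>a b. a \<in> carrier M \<Longrightarrow> b \<in> carrier N \<Longrightarrow> add_map P G (\<lambda>x. F x a b)"
  shows "add_map P G (\<lambda>x. tsum M N G T (F x))"
proof (rule add_mapI)
  fix x y assume xy: "x \<in> carrier P" "y \<in> carrier P"
  have "tsum M N G T (F (x \<oplus>\<^bsub>P\<^esub> y)) = tsum M N G T (\<lambda>a b. F x a b \<oplus>\<^bsub>G\<^esub> F y a b)"
    using xy assms(2) by (intro tsum_cong) (auto simp: add_map_def)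
  also have "\<dots> = tsum M N G T (F x) \<oplus>\<^bsub>G\<^esub> tsum M N G T (F y)"
    using xy assms by (intro tsum_add) (auto simp: add_map_def)
  finally show "tsum M N G T (F (x \<oplus>\<^bsub>P\<^esub> y)) = tsum M N G T (F x) \<oplus>\<^bsub>G\<^esub> tsum M N G T (F y)" .
qed (use assms in \<open>auto simp: add_map_def intro!: tsum_closed\<close>)

section \<open>Balanced maps and the universal property of tensor products\<close>

definition bal_map ::
    "('m, 'x) ring_scheme \<Rightarrow> ('n, 'z) ring_scheme \<Rightarrow> 'r set \<Rightarrow> ('m \<Rightarrow> 'r \<Rightarrow> 'm) \<Rightarrow> ('r \<Rightarrow> 'n \<Rightarrow> 'n)
      \<Rightarrow> ('g, 'w) ring_scheme \<Rightarrow> ('m \<Rightarrow> 'n \<Rightarrow> 'g) \<Rightarrow> bool" where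
  "bal_map M N X ra la G f \<longleftrightarrow>
     (\<forall>a\<in>carrier M. add_map N G (f a)) \<and> (\<forall>b\<in>carrier N. add_map M G (\<lambda>a. f a b)) \<and>
     (\<forall>a\<in>carrier M. \<forall>b\<in>carrier N. \<forall>r\<in>X. f (ra a r) b = f a (la r b))"

lemma bal_mapI:
  assumes "\<And>a. a \<in> carrier M \<Longrightarrow> add_map N G (f a)"
    and "\<And>b. b \<in> carrier N \<Longrightarrow> add_map M G (\<lambda>a. f a b)"
    and "\<And>a b r. a \<in> carrier M \<Longrightarrow> b \<in> carrier N \<Longrightarrow> r \<in> X \<Longrightarrow> f (ra a r) b = f a (la r b)"
  shows "bal_map M N X ra la G f"
  using assms by (auto simp: bal_map_def)

lemma bal_map_closed: "bal_map M N X ra la G f \<Longrightarrow> a \<in> carrier M \<Longrightarrow> b \<in> carrier N \<Longrightarrow> f a b \<in> carrier G"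
  by (auto simp: bal_map_def add_map_def)

lemma bal_map_balanced:
  "bal_map M N X ra la G f \<Longrightarrow> a \<in> carrier M \<Longrightarrow> b \<in> carrier N \<Longrightarrow> r \<in> X
    \<Longrightarrow> f (ra a r) b = f a (la r b)"
  by (auto simp: bal_map_def)

lemma bal_map_add1:
  "bal_map M N X ra la G f \<Longrightarrow> b \<in> carrier N \<Longrightarrow> add_map P M g \<Longrightarrow> add_map P G (\<lambda>x. f (g x) b)"
  by (auto simp: bal_map_def add_map_def)

lemma bal_map_add2:
  "bal_map M N X ra la G f \<Longrightarrow> a \<in> carrier M \<Longrightarrow> add_map P N g \<Longrightarrow> add_map P G (\<lambda>x. f a (g x))"
  by (auto simp: bal_map_def add_map_def)

text \<open>Of the two actions only closure is recorded, in a form that iterated tensor products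
  with left action \<open>tensor_lact\<close> satisfy at once.\<close>

locale tensor_pair =
  fixes M :: "('k, 'm, 'x) module_scheme" and N :: "('n, 'z) ring_scheme" and X :: "'r set"
    and ra :: "'m \<Rightarrow> 'r \<Rightarrow> 'm" and la :: "'r \<Rightarrow> 'n \<Rightarrow> 'n"
  assumes M_group: "abelian_group M" and N_group: "abelian_group N"
    and ra_closed: "\<And>m r. m \<in> carrier M \<Longrightarrow> r \<in> X \<Longrightarrow> ra m r \<in> carrier M"
    and la_closed: "\<And>n r. n \<in> carrier N \<Longrightarrow> r \<in> X \<Longrightarrow> la r n \<in> carrier N"
begin

interpretation M: abelian_group M by (rule M_group)
interpretation N: abelian_group N by (rule N_group)

abbreviation T where "T \<equiv> tensor_product M N X ra la"
abbreviation eqv where "eqv \<equiv> tensor_eq M N X ra la"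
abbreviation bal where "bal G f \<equiv> bal_map M N X ra la G f"

definition cls where "cls xs = {ys. eqv xs ys}"

lemma T_simps:
  "carrier T = cls ` {xs. set xs \<subseteq> carrier M \<times> carrier N}"
  "zero T = cls []"
  "add T = (\<lambda>U V. cls (some_rep U @ some_rep V))"
  "smult T = (\<lambda>c U. cls (map (\<lambda>(m, n). (c \<odot>\<^bsub>M\<^esub> m, n)) (some_rep U)))"
  "tens T = (\<lambda>m n. cls [(m, n)])"
  by (auto simp: tensor_product_def cls_def Let_def fun_eq_iff)

lemma eqv_valid:
  "eqv xs ys \<Longrightarrow> set xs \<subseteq> carrier M \<times> carrier N \<and> set ys \<subseteq> carrier M \<times> carrier N"
  by (induction rule: tensor_eq.induct) (auto simp: ra_closed la_closed)

lemma cls_eqI: "eqv xs ys \<Longrightarrow> cls xs = cls ys"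
  unfolding cls_def by (auto intro: tensor_eq.trans tensor_eq.sym)

lemma some_rep_cls:
  assumes "set xs \<subseteq> carrier M \<times> carrier N"
  shows "eqv xs (some_rep (cls xs))"
proof -
  have "xs \<in> cls xs" using assms by (auto simp: cls_def intro: tensor_eq.refl)
  then have "some_rep (cls xs) \<in> cls xs" unfolding some_rep_def by (rule someI)
  then show ?thesis by (simp add: cls_def)
qed

lemma some_rep_valid: "u \<in> carrier T \<Longrightarrow> set (some_rep u) \<subseteq> carrier M \<times> carrier N"
  using eqv_valid[OF some_rep_cls] unfolding T_simps by blast

lemma cls_some_rep: "u \<in> carrier T \<Longrightarrow> cls (some_rep u) = u"
  using cls_eqI[OF tensor_eq.sym[OF some_rep_cls]] unfolding T_simps by blast

lemma cls_closed: "set xs \<subseteq> carrier M \<times> carrier N \<Longrightarrow> cls xs \<in> carrier T"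
  by (auto simp: T_simps)

lemma add_cls:
  "set xs \<subseteq> carrier M \<times> carrier N \<Longrightarrow> set ys \<subseteq> carrier M \<times> carrier N
    \<Longrightarrow> cls xs \<oplus>\<^bsub>T\<^esub> cls ys = cls (xs @ ys)"
  unfolding T_simps by (intro cls_eqI tensor_eq.append tensor_eq.sym[OF some_rep_cls])

lemma T_group: "abelian_group T"
proof (rule abelian_groupI)
  fix u assume "u \<in> carrier T"
  then obtain xs where xs: "u = cls xs" "set xs \<subseteq> carrier M \<times> carrier N"
    by (auto simp: T_simps)
  \<comment> \<open>The negative of a formal sum is assembled pair by pair. The rules
    \<open>add_left\<close> and \<open>zero\<close> cancel (-a, b) against (a, b), and
    \<open>comm\<close> moves the cancelling pair in front of the negative \<open>ys\<close> found
    so far.\<close>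
  have inv: "\<exists>ys. set ys \<subseteq> carrier M \<times> carrier N \<and> eqv (ys @ xs) []"
    using xs(2)
  proof (induction xs)
    case Nil
    show ?case by (intro exI[of _ "[]"]) (auto intro: tensor_eq.refl)
  next
    case (Cons p xs)
    obtain a b where p: "p = (a, b)" by force
    have ab: "a \<in> carrier M" "b \<in> carrier N" and xs: "set xs \<subseteq> carrier M \<times> carrier N"
      using Cons(2) by (auto simp: p)
    obtain ys where ys: "set ys \<subseteq> carrier M \<times> carrier N" "eqv (ys @ xs) []"
      using Cons by auto
    have "eqv [(\<ominus>\<^bsub>M\<^esub> a \<oplus>\<^bsub>M\<^esub> a, b)] [(\<ominus>\<^bsub>M\<^esub> a, b), (a, b)]"
      using ab by (intro tensor_eq.add_left) auto
    then have 1: "eqv [(\<ominus>\<^bsub>M\<^esub> a, b), (a, b)] []"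
      using tensor_eq.trans[OF tensor_eq.sym tensor_eq.zero[OF ab(2), of M X ra la]] ab
      by (simp add: M.l_neg)
    have 2: "eqv ([(\<ominus>\<^bsub>M\<^esub> a, b), (a, b)] @ (ys @ xs)) ([] @ [])"
      using 1 ys(2) by (rule tensor_eq.append)
    have 3: "eqv (ys @ [(\<ominus>\<^bsub>M\<^esub> a, b), (a, b)]) ([(\<ominus>\<^bsub>M\<^esub> a, b), (a, b)] @ ys)"
      using ys ab by (intro tensor_eq.comm) auto
    have "eqv ((ys @ [(\<ominus>\<^bsub>M\<^esub> a, b), (a, b)]) @ xs) (([(\<ominus>\<^bsub>M\<^esub> a, b), (a, b)] @ ys) @ xs)"
      by (rule tensor_eq.append[OF 3 tensor_eq.refl[OF xs]])
    then have "eqv ((ys @ [(\<ominus>\<^bsub>M\<^esub> a, b)]) @ p # xs) []"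
      using tensor_eq.trans[OF _ 2] by (simp add: p)
    then show ?case using ys ab by (intro exI[of _ "ys @ [(\<ominus>\<^bsub>M\<^esub> a, b)]"]) auto
  qed
  then obtain ys where "set ys \<subseteq> carrier M \<times> carrier N" "eqv (ys @ xs) []" by auto
  then show "\<exists>v\<in>carrier T. v \<oplus>\<^bsub>T\<^esub> u = \<zero>\<^bsub>T\<^esub>"
    using xs by (intro bexI[of _ "cls ys"]) (auto simp: add_cls cls_closed T_simps(2) intro!: cls_eqI)
next
  fix u v assume "u \<in> carrier T" "v \<in> carrier T"
  then obtain xs ys where "u = cls xs" "set xs \<subseteq> carrier M \<times> carrier N"
      "v = cls ys" "set ys \<subseteq> carrier M \<times> carrier N"
    by (auto simp: T_simps)
  then show "u \<oplus>\<^bsub>T\<^esub> v \<in> carrier T" "u \<oplus>\<^bsub>T\<^esub> v = v \<oplus>\<^bsub>T\<^esub> u"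
    by (auto simp: add_cls cls_closed intro!: cls_eqI tensor_eq.comm)
next
  fix u v w assume "u \<in> carrier T" "v \<in> carrier T" "w \<in> carrier T"
  then obtain xs ys zs where "u = cls xs" "set xs \<subseteq> carrier M \<times> carrier N"
      "v = cls ys" "set ys \<subseteq> carrier M \<times> carrier N" "w = cls zs" "set zs \<subseteq> carrier M \<times> carrier N"
    by (auto simp: T_simps)
  then show "u \<oplus>\<^bsub>T\<^esub> v \<oplus>\<^bsub>T\<^esub> w = u \<oplus>\<^bsub>T\<^esub> (v \<oplus>\<^bsub>T\<^esub> w)"
    by (simp add: add_cls)
next
  show "\<zero>\<^bsub>T\<^esub> \<in> carrier T" by (simp add: T_simps(2) cls_closed)
next
  fix u assume "u \<in> carrier T"
  then obtain xs where "u = cls xs" "set xs \<subseteq> carrier M \<times> carrier N"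
    by (auto simp: T_simps)
  then show "\<zero>\<^bsub>T\<^esub> \<oplus>\<^bsub>T\<^esub> u = u" by (simp add: T_simps(2) add_cls)
qed

lemma tens_closed: "m \<in> carrier M \<Longrightarrow> n \<in> carrier N \<Longrightarrow> m \<boxtimes>\<^bsub>T\<^esub> n \<in> carrier T"
  by (simp add: T_simps(5) cls_closed)

lemma tens_bal: "bal T (tens T)"
proof -
  have [simp]: "cls [(m, n)] \<oplus>\<^bsub>T\<^esub> cls [(m', n')] = cls [(m, n), (m', n')]"
    if "m \<in> carrier M" "n \<in> carrier N" "m' \<in> carrier M" "n' \<in> carrier N" for m n m' n'
    using that by (subst add_cls) auto
  show ?thesis
    by (auto simp: bal_map_def add_map_def T_simps(5) intro!: cls_closed cls_eqI
        intro: tensor_eq.add_left tensor_eq.add_right tensor_eq.balanced)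
qed

text \<open>This is the universal property of the tensor product, by induction on the generating
  relations. It is the reason why Sweedler sums of balanced maps may be computed on any
  representative.\<close>

lemma lsum_eqv:
  assumes "abelian_group G" "bal G f" "eqv xs ys"
  shows "lsum G f xs = lsum G f ys"
proof -
  interpret G: abelian_group G by fact
  have cl: "f a b \<in> carrier G" if "a \<in> carrier M" "b \<in> carrier N" for a b
    using assms(2) that by (auto simp: bal_map_def add_map_def)
  have z: "f \<zero>\<^bsub>M\<^esub> b = \<zero>\<^bsub>G\<^esub>" if "b \<in> carrier N" for b
    using add_map_zero[OF _ M_group assms(1), of "\<lambda>a. f a b"] assms(2) that
    by (simp add: bal_map_def)
  have cls': "f a b \<in> carrier G" if "set xs \<subseteq> carrier M \<times> carrier N" "(a, b) \<in> set xs" for a b xs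
    using that cl by blast
  show ?thesis using assms(3)
  proof (induction rule: tensor_eq.induct)
    case (append xs xs' ys ys')
    have "lsum G f (xs @ ys) = lsum G f xs \<oplus>\<^bsub>G\<^esub> lsum G f ys"
      using cls' eqv_valid[OF append.hyps(1)] eqv_valid[OF append.hyps(2)]
      by (intro G.lsum_append) auto
    moreover have "lsum G f (xs' @ ys') = lsum G f xs' \<oplus>\<^bsub>G\<^esub> lsum G f ys'"
      using cls' eqv_valid[OF append.hyps(1)] eqv_valid[OF append.hyps(2)]
      by (intro G.lsum_append) auto
    ultimately show ?case using append.IH by simp
  next
    case (comm xs ys)
    have "lsum G f (xs @ ys) = lsum G f xs \<oplus>\<^bsub>G\<^esub> lsum G f ys"
        "lsum G f (ys @ xs) = lsum G f ys \<oplus>\<^bsub>G\<^esub> lsum G f xs"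
      using cls' comm by (auto intro!: G.lsum_append)
    moreover have "lsum G f xs \<in> carrier G" "lsum G f ys \<in> carrier G"
      using cls' comm by (auto intro!: G.lsum_closed)
    ultimately show ?case by (simp add: G.a_comm)
  next
    case (zero n)
    then show ?case by (simp add: z)
  next
    case (add_left m m' n)
    then show ?case using assms(2) by (auto simp: cl bal_map_def add_map_def)
  next
    case (add_right m n n')
    then show ?case using assms(2) by (auto simp: cl bal_map_def add_map_def)
  next
    case (balanced m r n)
    then show ?case using assms(2) by (auto simp: cl bal_map_def add_map_def)
  qed auto
qed

lemma tsum_eq_lsum: "u \<in> carrier T \<Longrightarrow> tsum M N G u f = lsum G f (some_rep u)"
proof -
  assume "u \<in> carrier T"
  then have "filter (\<lambda>(a, b). a \<in> carrier M \<and> b \<in> carrier N) (some_rep u) = some_rep u"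
    using some_rep_valid[of u] by (auto simp: filter_id_conv)
  then show ?thesis by (simp add: tsum_def)
qed

lemma sweedler_eq_tsum: "u \<in> carrier T \<Longrightarrow> sweedler G u f = tsum M N G u f"
  by (simp add: tsum_eq_lsum sweedler_def lsum_def)

lemma tsum_cls:
  assumes "abelian_group G" "bal G f" "set xs \<subseteq> carrier M \<times> carrier N"
  shows "tsum M N G (cls xs) f = lsum G f xs"
  using lsum_eqv[OF assms(1,2) some_rep_cls[OF assms(3)]] assms(3)
  by (simp add: tsum_eq_lsum cls_closed)

lemma tsum_tens:
  assumes "abelian_group G" "bal G f" "m \<in> carrier M" "n \<in> carrier N"
  shows "tsum M N G (m \<boxtimes>\<^bsub>T\<^esub> n) f = f m n"
proof -
  interpret G: abelian_group G by fact
  have "f m n \<in> carrier G" using assms by (auto simp: bal_map_def add_map_def)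
  then show ?thesis using assms by (simp add: T_simps(5) tsum_cls)
qed

lemma tsum_add_map:
  assumes "abelian_group G" "bal G f"
  shows "add_map T G (\<lambda>u. tsum M N G u f)"
proof (rule add_mapI)
  interpret G: abelian_group G by fact
  have cl: "f a b \<in> carrier G" if "a \<in> carrier M" "b \<in> carrier N" for a b
    using assms(2) that by (auto simp: bal_map_def add_map_def)
  then show "tsum M N G u f \<in> carrier G" for u by (rule tsum_closed[OF assms(1)])
  fix u v assume "u \<in> carrier T" "v \<in> carrier T"
  then obtain xs ys where xs: "u = cls xs" "set xs \<subseteq> carrier M \<times> carrier N"
      "v = cls ys" "set ys \<subseteq> carrier M \<times> carrier N"
    by (auto simp: T_simps)
  have "lsum G f (xs @ ys) = lsum G f xs \<oplus>\<^bsub>G\<^esub> lsum G f ys"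
    by (intro G.lsum_append) (use xs cl in blast)+
  then show "tsum M N G (u \<oplus>\<^bsub>T\<^esub> v) f = tsum M N G u f \<oplus>\<^bsub>G\<^esub> tsum M N G v f"
    using xs by (simp add: add_cls tsum_cls[OF assms])
qed

lemma lsum_tens: "set xs \<subseteq> carrier M \<times> carrier N \<Longrightarrow> lsum T (tens T) xs = cls xs"
proof (induction xs)
  case Nil
  show ?case by (simp add: T_simps(2))
next
  case (Cons p xs)
  obtain a b where p: "p = (a, b)" by force
  show ?case using Cons add_cls[of "[(a, b)]" xs] by (auto simp: p T_simps(5))
qed

lemma tsum_tens_self: "u \<in> carrier T \<Longrightarrow> tsum M N T u (tens T) = u"
  using cls_some_rep by (simp add: tsum_eq_lsum lsum_tens some_rep_valid)

lemma tsum_rep: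
  assumes "add_map T G \<phi>" "abelian_group G" "u \<in> carrier T"
  shows "\<phi> u = tsum M N G u (\<lambda>m n. \<phi> (m \<boxtimes>\<^bsub>T\<^esub> n))"
  using tsum_hom[OF assms(1) T_group assms(2), of M N "tens T" u] assms(3)
  by (simp add: tsum_tens_self tens_closed)

text \<open>Elementary tensors generate the tensor product as a group, so additive maps are compared
  on them. Most identities in the crossed product are reduced to elements b # h in this way.\<close>

lemma add_map_eqI:
  assumes "add_map T G \<phi>" "add_map T G \<psi>" "abelian_group G"
    and "\<And>m n. m \<in> carrier M \<Longrightarrow> n \<in> carrier N \<Longrightarrow> \<phi> (m \<boxtimes>\<^bsub>T\<^esub> n) = \<psi> (m \<boxtimes>\<^bsub>T\<^esub> n)"
    and "u \<in> carrier T"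
  shows "\<phi> u = \<psi> u"
  using assms by (simp add: tsum_rep[of G \<phi>] tsum_rep[of G \<psi>])

lemma tsum_tsum:
  assumes "abelian_group G" "bal G f"
    and "\<And>a b. a \<in> carrier P \<Longrightarrow> b \<in> carrier Q \<Longrightarrow> g a b \<in> carrier T"
  shows "tsum M N G (tsum P Q T U g) f = tsum P Q G U (\<lambda>a b. tsum M N G (g a b) f)"
  using assms by (intro tsum_hom[OF tsum_add_map]) (auto intro: T_group)

text \<open>Axioms such as multiplicativity or the Takeuchi condition equate two elements of a
  tensor product. Applying a balanced f to both sides turns them into equations between Sweedler
  sums with summand f.\<close>

lemma tsum_tsum_tens:
  assumes "abelian_group G" "bal G f"
    and "\<And>a b. a \<in> carrier P \<Longrightarrow> b \<in> carrier Q \<Longrightarrow> g a b \<in> carrier M"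
    and "\<And>a b. a \<in> carrier P \<Longrightarrow> b \<in> carrier Q \<Longrightarrow> g' a b \<in> carrier N"
  shows "tsum M N G (tsum P Q T U (\<lambda>a b. g a b \<boxtimes>\<^bsub>T\<^esub> g' a b)) f
    = tsum P Q G U (\<lambda>a b. f (g a b) (g' a b))"
  using assms by (simp add: tsum_tsum tens_closed tsum_tens)

end

text \<open>Scalars act through the first factor in \<open>tensor_product\<close>; compatibility of
  \<open>ra\<close> with scalars makes this action respect the balancing relation.\<close>

locale tensor_module = tensor_pair + module K M for K +
  assumes ra_smult: "\<And>c m r. c \<in> carrier K \<Longrightarrow> m \<in> carrier M \<Longrightarrow> r \<in> X
    \<Longrightarrow> ra (c \<odot>\<^bsub>M\<^esub> m) r = c \<odot>\<^bsub>M\<^esub> ra m r"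
begin

lemma smult_bal:
  assumes "c \<in> carrier K"
  shows "bal T (\<lambda>m n. (c \<odot>\<^bsub>M\<^esub> m) \<boxtimes>\<^bsub>T\<^esub> n)"
  using tens_bal assms
  by (auto simp: bal_map_def add_map_def smult_r_distr ra_smult[symmetric])

lemma smult_eq_tsum:
  assumes "c \<in> carrier K" "u \<in> carrier T"
  shows "c \<odot>\<^bsub>T\<^esub> u = tsum M N T u (\<lambda>m n. (c \<odot>\<^bsub>M\<^esub> m) \<boxtimes>\<^bsub>T\<^esub> n)"
proof -
  have "lsum T (tens T) (map (\<lambda>(m, n). (c \<odot>\<^bsub>M\<^esub> m, n)) xs) = lsum T (\<lambda>m n. (c \<odot>\<^bsub>M\<^esub> m) \<boxtimes>\<^bsub>T\<^esub> n) xs" for xs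
    by (induction xs) auto
  moreover have "set (map (\<lambda>(m, n). (c \<odot>\<^bsub>M\<^esub> m, n)) (some_rep u)) \<subseteq> carrier M \<times> carrier N"
    using some_rep_valid[OF assms(2)] assms(1) by auto
  ultimately show ?thesis using assms(2)
    by (metis (no_types, lifting) T_simps(4) lsum_tens tsum_eq_lsum)
qed

lemma smult_add_map: "c \<in> carrier K \<Longrightarrow> add_map T T (\<lambda>u. c \<odot>\<^bsub>T\<^esub> u)"
  using tsum_add_map[OF T_group smult_bal] unfolding add_map_def
  by (auto simp: smult_eq_tsum abelian_monoid.a_closed[OF abelian_group.axioms(1)[OF T_group]])

lemma smult_tens:
  "c \<in> carrier K \<Longrightarrow> m \<in> carrier M \<Longrightarrow> n \<in> carrier N \<Longrightarrow> c \<odot>\<^bsub>T\<^esub> (m \<boxtimes>\<^bsub>T\<^esub> n) = (c \<odot>\<^bsub>M\<^esub> m) \<boxtimes>\<^bsub>T\<^esub> n"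
  by (simp add: smult_eq_tsum tens_closed tsum_tens T_group smult_bal)

lemma T_module: "module K T"
proof -
  interpret T: abelian_group T by (rule T_group)
  note bl = tens_bal[unfolded bal_map_def add_map_def]
  show ?thesis
  proof (rule moduleI)
    show "cring K" by (rule is_cring)
    show "abelian_group T" by (rule T_group)
    show cl: "a \<odot>\<^bsub>T\<^esub> x \<in> carrier T" if "a \<in> carrier K" "x \<in> carrier T" for a x
      using smult_add_map that by (auto simp: add_map_def)
    show "a \<odot>\<^bsub>T\<^esub> (x \<oplus>\<^bsub>T\<^esub> y) = a \<odot>\<^bsub>T\<^esub> x \<oplus>\<^bsub>T\<^esub> a \<odot>\<^bsub>T\<^esub> y"
      if "a \<in> carrier K" "x \<in> carrier T" "y \<in> carrier T" for a x y
      using smult_add_map that by (auto simp: add_map_def)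
    show "(a \<oplus>\<^bsub>K\<^esub> b) \<odot>\<^bsub>T\<^esub> x = a \<odot>\<^bsub>T\<^esub> x \<oplus>\<^bsub>T\<^esub> b \<odot>\<^bsub>T\<^esub> x"
      if "a \<in> carrier K" "b \<in> carrier K" "x \<in> carrier T" for a b x
      by (rule add_map_eqI[where G = T and \<phi> = "\<lambda>x. (a \<oplus>\<^bsub>K\<^esub> b) \<odot>\<^bsub>T\<^esub> x"])
        (use that bl in \<open>auto simp: smult_tens smult_l_distr T_group smult_add_map T.a_ac cl
            add_map_add[OF smult_add_map] intro!: add_mapI\<close>)
    show "(a \<otimes>\<^bsub>K\<^esub> b) \<odot>\<^bsub>T\<^esub> x = a \<odot>\<^bsub>T\<^esub> (b \<odot>\<^bsub>T\<^esub> x)"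
      if "a \<in> carrier K" "b \<in> carrier K" "x \<in> carrier T" for a b x
      by (rule add_map_eqI[where G = T and \<phi> = "\<lambda>x. (a \<otimes>\<^bsub>K\<^esub> b) \<odot>\<^bsub>T\<^esub> x"])
        (use that add_map_comp[OF smult_add_map smult_add_map, of b a] in
          \<open>auto simp: smult_tens smult_assoc1 T_group smult_add_map\<close>)
    show "\<one>\<^bsub>K\<^esub> \<odot>\<^bsub>T\<^esub> x = x" if "x \<in> carrier T" for x
      by (rule add_map_eqI[where G = T and \<phi> = "\<lambda>x. \<one>\<^bsub>K\<^esub> \<odot>\<^bsub>T\<^esub> x"])
        (use that in \<open>auto simp: smult_tens T_group smult_add_map add_map_id\<close>)
  qed
qed

end

section \<open>Sweedler calculus in corings and bialgebroids\<close>

text \<open>These rules propagate additivity through products, sums and structure maps, so that the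
  additivity conditions on Sweedler summands are found by backward chaining.\<close>

named_theorems add_map_intros

declare add_map_id [add_map_intros] add_map_tsum [add_map_intros]

lemma (in ring) add_map_mult_left [add_map_intros]:
  "c \<in> carrier R \<Longrightarrow> add_map M R f \<Longrightarrow> add_map M R (\<lambda>x. c \<otimes> f x)"
  by (auto simp: add_map_def r_distr)

lemma (in ring) add_map_mult_right [add_map_intros]:
  "c \<in> carrier R \<Longrightarrow> add_map M R f \<Longrightarrow> add_map M R (\<lambda>x. f x \<otimes> c)"
  by (auto simp: add_map_def l_distr)

lemma k_linear_add_map: "k_linear K M N f \<Longrightarrow> add_map M N f"
  by (auto simp: k_linear_def add_map_def)

lemma k_bilinear_add_map:
  assumes "k_bilinear K M N P f"
  shows "x \<in> carrier M \<Longrightarrow> add_map N P (f x)" and "y \<in> carrier N \<Longrightarrow> add_map M P (\<lambda>x. f x y)"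
  using assms by (auto simp: k_bilinear_def intro: k_linear_add_map)

text \<open>The two tensor signs may be taken over different algebras, since mixed coassociativity
  of a Hopf algebroid lives over L in one place and over R in the other.\<close>

definition tri_map where
  "tri_map C X raX laX Y raY laY W F \<longleftrightarrow>
     (\<forall>c\<in>carrier C. bal_map C C X raX laX W (\<lambda>a b. F a b c)) \<and>
     (\<forall>a\<in>carrier C. bal_map C C Y raY laY W (F a))"

lemma tri_mapI:
  assumes "\<And>b c. b \<in> carrier C \<Longrightarrow> c \<in> carrier C \<Longrightarrow> add_map C W (\<lambda>a. F a b c)"
    and "\<And>a c. a \<in> carrier C \<Longrightarrow> c \<in> carrier C \<Longrightarrow> add_map C W (\<lambda>b. F a b c)"
    and "\<And>a b. a \<in> carrier C \<Longrightarrow> b \<in> carrier C \<Longrightarrow> add_map C W (\<lambda>c. F a b c)"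
    and "\<And>a b c r. a \<in> carrier C \<Longrightarrow> b \<in> carrier C \<Longrightarrow> c \<in> carrier C \<Longrightarrow> r \<in> X
      \<Longrightarrow> F (raX a r) b c = F a (laX r b) c"
    and "\<And>a b c r. a \<in> carrier C \<Longrightarrow> b \<in> carrier C \<Longrightarrow> c \<in> carrier C \<Longrightarrow> r \<in> Y
      \<Longrightarrow> F a (raY b r) c = F a b (laY r c)"
  shows "tri_map C X raX laX Y raY laY W F"
  using assms by (auto simp: tri_map_def intro!: bal_mapI)

text \<open>
  Every coassociativity law in the definitions has the shape of the hypothesis \<open>eq\<close>, for
  \<open>X\<close> and \<open>Y\<close> among the two base algebras.
\<close>

lemma coassoc_eval:
  fixes C :: "('k, 'c, 'x) module_scheme"
    and X :: "'r set" and Y :: "'s set" and W :: "('w, 'v) ring_scheme"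
    and raX :: "'c \<Rightarrow> 'r \<Rightarrow> 'c" and laX :: "'r \<Rightarrow> 'c \<Rightarrow> 'c"
    and raY :: "'c \<Rightarrow> 's \<Rightarrow> 'c" and laY :: "'s \<Rightarrow> 'c \<Rightarrow> 'c"
  defines "CXC \<equiv> tensor_product C C X raX laX" and "CYC \<equiv> tensor_product C C Y raY laY"
  defines "G \<equiv> tensor_product C CYC X raX (tensor_lact CYC laX)"
  assumes tX: "tensor_pair C C X raX laX" and tY: "tensor_pair C C Y raY laY"
    and u: "u \<in> carrier CYC" and v: "v \<in> carrier CXC"
    and dX: "\<And>a. a \<in> carrier C \<Longrightarrow> dX a \<in> carrier CXC"
    and dY: "\<And>a. a \<in> carrier C \<Longrightarrow> dY a \<in> carrier CYC"
    and eq: "sweedler G u (\<lambda>a b. sweedler G (dX a) (\<lambda>a1 a2. a1 \<boxtimes>\<^bsub>G\<^esub> (a2 \<boxtimes>\<^bsub>CYC\<^esub> b)))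
      = sweedler G v (\<lambda>a b. a \<boxtimes>\<^bsub>G\<^esub> dY b)"
    and W: "abelian_group W" and F: "tri_map C X raX laX Y raY laY W F"
  shows "tsum C C W u (\<lambda>a b. tsum C C W (dX a) (\<lambda>a1 a2. F a1 a2 b))
    = tsum C C W v (\<lambda>a b. tsum C C W (dY b) (\<lambda>b1 b2. F a b1 b2))"
proof -
  interpret X: tensor_pair C C X raX laX by (rule tX)
  interpret Y: tensor_pair C C Y raY laY by (rule tY)
  note la = X.la_closed
  have lact: "tensor_lact CYC laX r T = tsum C C CYC T (\<lambda>m n. laX r m \<boxtimes>\<^bsub>CYC\<^esub> n)"
    if "T \<in> carrier CYC" for r T
    using that unfolding tensor_lact_def CYC_def by (rule Y.sweedler_eq_tsum)
  interpret G: tensor_pair C CYC X raX "tensor_lact CYC laX"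
    using X.M_group Y.T_group X.ra_closed
    by (intro tensor_pair.intro)
      (auto simp: lact[unfolded CYC_def] CYC_def intro!: tsum_closed Y.tens_closed X.la_closed)
  \<comment> \<open>Summing F over the inner tensor first gives a balanced map on pairs from C and
    \<open>CYC\<close>. Evaluated on the two sides of \<open>eq\<close> it yields the two iterated
    sums.\<close>
  let ?f = "\<lambda>a T. tsum C C W T (F a)"
  have FY: "bal_map C C Y raY laY W (F a)" if "a \<in> carrier C" for a
    using F that by (auto simp: tri_map_def)
  have FX: "bal_map C C X raX laX W (\<lambda>a b. F a b c)" if "c \<in> carrier C" for c
    using F that by (auto simp: tri_map_def)
  have f: "G.bal W ?f"
  proof (rule bal_mapI)
    show "add_map CYC W (?f a)" if "a \<in> carrier C" for a
      using Y.tsum_add_map[OF W FY[OF that]] by (simp add: CYC_def)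
    show "add_map C W (\<lambda>a. ?f a T)" for T
      using F by (intro add_map_tsum W) (auto simp: tri_map_def bal_map_def)
    show "?f (raX a r) T = ?f a (tensor_lact CYC laX r T)"
      if "a \<in> carrier C" "T \<in> carrier CYC" "r \<in> X" for a T r
    proof -
      have "?f a (tensor_lact CYC laX r T) = tsum C C W T (\<lambda>m n. F a (laX r m) n)"
        unfolding lact[OF that(2)] unfolding CYC_def
        using that by (intro Y.tsum_tsum_tens W FY la) auto
      also have "\<dots> = ?f (raX a r) T"
        using that FX by (intro tsum_cong) (auto simp: bal_map_def)
      finally show ?thesis by simp
    qed
  qed
  have 1: "sweedler G u (\<lambda>a b. sweedler G (dX a) (\<lambda>a1 a2. a1 \<boxtimes>\<^bsub>G\<^esub> (a2 \<boxtimes>\<^bsub>CYC\<^esub> b)))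
    = tsum C C G u (\<lambda>a b. tsum C C G (dX a) (\<lambda>a1 a2. a1 \<boxtimes>\<^bsub>G\<^esub> (a2 \<boxtimes>\<^bsub>CYC\<^esub> b)))"
    using u dX unfolding CYC_def CXC_def by (simp add: Y.sweedler_eq_tsum X.sweedler_eq_tsum)
  have 2: "sweedler G v (\<lambda>a b. a \<boxtimes>\<^bsub>G\<^esub> dY b) = tsum C C G v (\<lambda>a b. a \<boxtimes>\<^bsub>G\<^esub> dY b)"
    using v unfolding CXC_def by (simp add: X.sweedler_eq_tsum)
  have cl: "a2 \<boxtimes>\<^bsub>CYC\<^esub> b \<in> carrier CYC" if "a2 \<in> carrier C" "b \<in> carrier C" for a2 b
    using that by (simp add: CYC_def Y.tens_closed)
  have Ggr: "abelian_group G" unfolding G_def by (rule G.T_group)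
  have "tsum C CYC W (tsum C C G v (\<lambda>a b. a \<boxtimes>\<^bsub>G\<^esub> dY b)) ?f = tsum C C W v (\<lambda>a b. ?f a (dY b))"
    unfolding G_def by (intro G.tsum_tsum_tens W f dY)
  moreover have "tsum C CYC W (tsum C C G u (\<lambda>a b. tsum C C G (dX a)
      (\<lambda>a1 a2. a1 \<boxtimes>\<^bsub>G\<^esub> (a2 \<boxtimes>\<^bsub>CYC\<^esub> b)))) ?f
    = tsum C C W u (\<lambda>a b. tsum C CYC W (tsum C C G (dX a) (\<lambda>a1 a2. a1 \<boxtimes>\<^bsub>G\<^esub> (a2 \<boxtimes>\<^bsub>CYC\<^esub> b))) ?f)"
    unfolding G_def
    by (intro G.tsum_tsum W f tsum_closed Ggr[unfolded G_def] G.tens_closed cl)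
  moreover have "tsum C CYC W (tsum C C G (dX a) (\<lambda>a1 a2. a1 \<boxtimes>\<^bsub>G\<^esub> (a2 \<boxtimes>\<^bsub>CYC\<^esub> b))) ?f
      = tsum C C W (dX a) (\<lambda>a1 a2. F a1 a2 b)" if "a \<in> carrier C" "b \<in> carrier C" for a b
  proof -
    have "tsum C CYC W (tsum C C G (dX a) (\<lambda>a1 a2. a1 \<boxtimes>\<^bsub>G\<^esub> (a2 \<boxtimes>\<^bsub>CYC\<^esub> b))) ?f
      = tsum C C W (dX a) (\<lambda>a1 a2. ?f a1 (a2 \<boxtimes>\<^bsub>CYC\<^esub> b))"
      unfolding G_def using that by (intro G.tsum_tsum_tens W f cl)
    then show ?thesis using that by (simp add: CYC_def Y.tsum_tens W FY)
  qed
  ultimately show ?thesis using eq unfolding 1 2 by simp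
qed

section \<open>Sums over the comultiplication of a coring\<close>

context coring
begin

lemma C_module: "module K C"
  using bimodule by (auto simp: bimodule_def left_module_def)

lemma ra_add_map: "r \<in> carrier R \<Longrightarrow> add_map C C (\<lambda>c. ra c r)"
  using bimodule k_bilinear_add_map(2)[of K C R C ra]
  by (auto simp: bimodule_def right_module_def)

lemma la_add_map: "r \<in> carrier R \<Longrightarrow> add_map C C (la r)"
  using bimodule k_bilinear_add_map(1)[of K R C C la]
  by (auto simp: bimodule_def left_module_def)

lemma CC_tensor: "tensor_module C C (carrier R) ra la K"
proof -
  interpret C: module K C by (rule C_module)
  show ?thesis
    using bimodule ra_add_map la_add_map C.abelian_group_axioms C_module
    by (intro tensor_module.intro tensor_pair.intro tensor_module_axioms.intro)
      (auto simp: add_map_def bimodule_def right_module_def k_bilinear_def k_linear_def)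
qed

sublocale CC: tensor_module C C "carrier R" ra la K by (rule CC_tensor)

lemma C_group: "abelian_group C" by (rule CC.M_group)

lemma comult_add_map: "add_map C CC \<Delta>"
  using comult_linear by (rule k_linear_add_map)

lemma comult_closed: "c \<in> carrier C \<Longrightarrow> \<Delta> c \<in> carrier CC"
  using comult_add_map by (rule add_map_closed)

lemma sweedler_comult: "c \<in> carrier C \<Longrightarrow> sweedler G (\<Delta> c) f = tsum C C G (\<Delta> c) f"
  by (simp add: CC.sweedler_eq_tsum comult_closed)

lemma comult_tsum_add_map:
  "abelian_group W \<Longrightarrow> CC.bal W f \<Longrightarrow> add_map C W (\<lambda>c. tsum C C W (\<Delta> c) f)"
  by (rule add_map_comp[OF comult_add_map CC.tsum_add_map])

lemma R_one_closed: "\<one>\<^bsub>R\<^esub> \<in> carrier R"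
  using base_algebra by (simp add: k_algebra_def ring.ring_simprules)

lemma la_one: "c \<in> carrier C \<Longrightarrow> la \<one>\<^bsub>R\<^esub> c = c" and ra_one: "c \<in> carrier C \<Longrightarrow> ra c \<one>\<^bsub>R\<^esub> = c"
  using bimodule by (auto simp: bimodule_def left_module_def right_module_def)

lemma comult_bilinear_tsum:
  assumes "abelian_group W" "CC.bal W f" "c \<in> carrier C" "r \<in> carrier R" "r' \<in> carrier R"
  shows "tsum C C W (\<Delta> (ra (la r c) r')) f = tsum C C W (\<Delta> c) (\<lambda>a b. f (la r a) (ra b r'))"
  unfolding comult_bilinear[OF assms(4,5,3)] sweedler_comult[OF assms(3)]
  using assms by (intro CC.tsum_tsum_tens CC.la_closed CC.ra_closed)

lemma comult_ra_tsum:
  assumes "abelian_group W" "CC.bal W f" "c \<in> carrier C" "r \<in> carrier R"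
  shows "tsum C C W (\<Delta> (ra c r)) f = tsum C C W (\<Delta> c) (\<lambda>a b. f a (ra b r))"
  using comult_bilinear_tsum[OF assms(1,2,3) R_one_closed assms(4)] assms
  by (simp add: la_one)

lemma comult_la_tsum:
  assumes "abelian_group W" "CC.bal W f" "c \<in> carrier C" "r \<in> carrier R"
  shows "tsum C C W (\<Delta> (la r c)) f = tsum C C W (\<Delta> c) (\<lambda>a b. f (la r a) b)"
  using comult_bilinear_tsum[OF assms(1,2,3,4) R_one_closed] assms
  by (simp add: ra_one CC.la_closed)

lemma counit_add_map: "add_map C R \<epsilon>"
  using counit_linear by (rule k_linear_add_map)

lemma counit_closed: "c \<in> carrier C \<Longrightarrow> \<epsilon> c \<in> carrier R"
  using counit_add_map by (rule add_map_closed)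

text \<open>The counit law is stated underneath an additive map \<phi>, since the counital
  expression occurs inside larger terms.\<close>

lemma counit_left_tsum:
  assumes "abelian_group W" "add_map C W \<phi>" "c \<in> carrier C"
  shows "tsum C C W (\<Delta> c) (\<lambda>a b. \<phi> (la (\<epsilon> a) b)) = \<phi> c"
proof -
  have "\<phi> (tsum C C C (\<Delta> c) (\<lambda>a b. la (\<epsilon> a) b)) = tsum C C W (\<Delta> c) (\<lambda>a b. \<phi> (la (\<epsilon> a) b))"
    using assms by (intro tsum_hom) (auto intro!: CC.la_closed counit_closed C_group)
  then show ?thesis using counit_left[OF assms(3)] assms by (simp add: sweedler_comult)
qed

lemma counit_right_tsum:
  assumes "abelian_group W" "add_map C W \<phi>" "c \<in> carrier C"
  shows "tsum C C W (\<Delta> c) (\<lambda>a b. \<phi> (ra a (\<epsilon> b))) = \<phi> c"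
proof -
  have "\<phi> (tsum C C C (\<Delta> c) (\<lambda>a b. ra a (\<epsilon> b))) = tsum C C W (\<Delta> c) (\<lambda>a b. \<phi> (ra a (\<epsilon> b)))"
    using assms by (intro tsum_hom) (auto intro!: CC.ra_closed counit_closed C_group)
  then show ?thesis using counit_right[OF assms(3)] assms by (simp add: sweedler_comult)
qed

lemma coassoc_tsum:
  assumes "abelian_group W" "tri_map C (carrier R) ra la (carrier R) ra la W F" "c \<in> carrier C"
  shows "tsum C C W (\<Delta> c) (\<lambda>a b. tsum C C W (\<Delta> a) (\<lambda>a1 a2. F a1 a2 b))
    = tsum C C W (\<Delta> c) (\<lambda>a b. tsum C C W (\<Delta> b) (\<lambda>b1 b2. F a b1 b2))"
  by (rule coassoc_eval[OF CC.tensor_pair_axioms CC.tensor_pair_axioms])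
    (use assms coassoc in \<open>auto intro: comult_closed\<close>)

end

section \<open>Left bialgebroids: coproducts of products and of base elements\<close>

context left_bialgebroid
begin

sublocale H: k_algebra K H by (rule H_algebra)
sublocale L: k_algebra K L by (rule L_algebra)
sublocale corL: coring K L H lactL ractL \<gamma>L \<pi>L by (rule coringL)

abbreviation "SL G h f \<equiv> tsum H H G (\<gamma>L h) f"
abbreviation "balL G f \<equiv> bal_map H H (carrier L) ractL lactL G f"

lemma sL_closed [simp]: "l \<in> carrier L \<Longrightarrow> sL l \<in> carrier H"
  and sL_mult: "l \<in> carrier L \<Longrightarrow> l' \<in> carrier L \<Longrightarrow> sL (l \<otimes>\<^bsub>L\<^esub> l') = sL l \<otimes>\<^bsub>H\<^esub> sL l'"
  and sL_one [simp]: "sL \<one>\<^bsub>L\<^esub> = \<one>\<^bsub>H\<^esub>"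
  and sL_linear: "k_linear K L H sL"
  using sL_hom by (auto simp: alg_hom_def ring_hom_def)

lemma tL_closed [simp]: "l \<in> carrier L \<Longrightarrow> tL l \<in> carrier H"
  and tL_one [simp]: "tL \<one>\<^bsub>L\<^esub> = \<one>\<^bsub>H\<^esub>"
  using tL_hom by (auto simp: alg_hom_def ring_hom_def opposite_def)

lemma piL_closed [simp]: "h \<in> carrier H \<Longrightarrow> \<pi>L h \<in> carrier L"
  by (rule corL.counit_closed)

lemma HLH_group [simp]: "abelian_group HLH" by (rule corL.CC.T_group)
lemma H_group [simp]: "abelian_group H" by (rule H.abelian_group_axioms)

lemma gammaL_closed [simp]: "h \<in> carrier H \<Longrightarrow> \<gamma>L h \<in> carrier HLH"
  by (rule corL.comult_closed)

lemma SL_tL: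
  "abelian_group W \<Longrightarrow> balL W f \<Longrightarrow> h \<in> carrier H \<Longrightarrow> l \<in> carrier L
    \<Longrightarrow> SL W (tL l \<otimes>\<^bsub>H\<^esub> h) f = SL W h (\<lambda>a b. f a (tL l \<otimes>\<^bsub>H\<^esub> b))"
  by (rule corL.comult_ra_tsum)

lemma SL_sL:
  "abelian_group W \<Longrightarrow> balL W f \<Longrightarrow> h \<in> carrier H \<Longrightarrow> l \<in> carrier L
    \<Longrightarrow> SL W (sL l \<otimes>\<^bsub>H\<^esub> h) f = SL W h (\<lambda>a b. f (sL l \<otimes>\<^bsub>H\<^esub> a) b)"
  by (rule corL.comult_la_tsum)

lemma SL_one:
  "abelian_group W \<Longrightarrow> balL W f \<Longrightarrow> SL W \<one>\<^bsub>H\<^esub> f = f \<one>\<^bsub>H\<^esub> \<one>\<^bsub>H\<^esub>"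
  unfolding \<gamma>L_one by (rule corL.CC.tsum_tens) auto

lemma SL_takeuchi:
  assumes "abelian_group W" "balL W f" "h \<in> carrier H" "l \<in> carrier L"
  shows "SL W h (\<lambda>a b. f (a \<otimes>\<^bsub>H\<^esub> tL l) b) = SL W h (\<lambda>a b. f a (b \<otimes>\<^bsub>H\<^esub> sL l))"
proof -
  have "tsum H H W (SL HLH h (\<lambda>a b. (a \<otimes>\<^bsub>H\<^esub> tL l) \<boxtimes>\<^bsub>HLH\<^esub> b)) f = SL W h (\<lambda>a b. f (a \<otimes>\<^bsub>H\<^esub> tL l) b)"
    using assms by (intro corL.CC.tsum_tsum_tens) auto
  moreover have "tsum H H W (SL HLH h (\<lambda>a b. a \<boxtimes>\<^bsub>HLH\<^esub> (b \<otimes>\<^bsub>H\<^esub> sL l))) f = SL W h (\<lambda>a b. f a (b \<otimes>\<^bsub>H\<^esub> sL l))"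
    using assms by (intro corL.CC.tsum_tsum_tens) auto
  ultimately show ?thesis
    using takeuchiL[OF assms(3,4)] assms by (simp add: corL.sweedler_comult)
qed

lemma SL_mult:
  assumes "abelian_group W" "balL W f" "h \<in> carrier H" "k \<in> carrier H"
  shows "SL W (h \<otimes>\<^bsub>H\<^esub> k) f = SL W k (\<lambda>k1 k2. SL W h (\<lambda>h1 h2. f (h1 \<otimes>\<^bsub>H\<^esub> k1) (h2 \<otimes>\<^bsub>H\<^esub> k2)))"
proof -
  have "tsum H H W (SL HLH k (\<lambda>k1 k2. SL HLH h (\<lambda>h1 h2. (h1 \<otimes>\<^bsub>H\<^esub> k1) \<boxtimes>\<^bsub>HLH\<^esub> (h2 \<otimes>\<^bsub>H\<^esub> k2)))) f
    = SL W k (\<lambda>k1 k2. tsum H H W (SL HLH h (\<lambda>h1 h2. (h1 \<otimes>\<^bsub>H\<^esub> k1) \<boxtimes>\<^bsub>HLH\<^esub> (h2 \<otimes>\<^bsub>H\<^esub> k2))) f)"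
    using assms by (intro corL.CC.tsum_tsum) (auto intro!: tsum_closed corL.CC.tens_closed)
  also have "\<dots> = SL W k (\<lambda>k1 k2. SL W h (\<lambda>h1 h2. f (h1 \<otimes>\<^bsub>H\<^esub> k1) (h2 \<otimes>\<^bsub>H\<^esub> k2)))"
    using assms by (intro tsum_cong HOL.refl corL.CC.tsum_tsum_tens) auto
  finally show ?thesis using assms by (simp add: \<gamma>L_mult corL.sweedler_comult)
qed

lemma balL_mult:
  assumes "balL W f" "x \<in> carrier H" "y \<in> carrier H"
  shows "balL W (\<lambda>a b. f (a \<otimes>\<^bsub>H\<^esub> x) (b \<otimes>\<^bsub>H\<^esub> y))"
  using assms by (auto simp: bal_map_def add_map_def H.l_distr H.m_assoc)

text \<open>For fixed h1, h2 the summand is in general not balanced in k: a factor t_L(l) in front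
  of k1 stands to the right of h1. The Takeuchi condition trades it for s_L(l) to the right of h2,
  which requires the sum over h to be the inner one.\<close>

lemma balL_SL_mult:
  assumes "abelian_group W" "balL W f" "h \<in> carrier H"
  shows "balL W (\<lambda>k1 k2. SL W h (\<lambda>h1 h2. f (h1 \<otimes>\<^bsub>H\<^esub> k1) (h2 \<otimes>\<^bsub>H\<^esub> k2)))"
proof (rule bal_mapI)
  show "SL W h (\<lambda>h1 h2. f (h1 \<otimes>\<^bsub>H\<^esub> (tL r \<otimes>\<^bsub>H\<^esub> a)) (h2 \<otimes>\<^bsub>H\<^esub> b))
    = SL W h (\<lambda>h1 h2. f (h1 \<otimes>\<^bsub>H\<^esub> a) (h2 \<otimes>\<^bsub>H\<^esub> (sL r \<otimes>\<^bsub>H\<^esub> b)))"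
    if "a \<in> carrier H" "b \<in> carrier H" "r \<in> carrier L" for a b r
    using SL_takeuchi[OF assms(1) balL_mult[OF assms(2), of a b] assms(3), of r] that
    by (simp add: H.m_assoc)
qed (use assms in \<open>auto intro!: add_map_intros bal_map_add1[OF assms(2)] bal_map_add2[OF assms(2)]\<close>)

lemma balL_cong:
  assumes "\<And>a b. a \<in> carrier H \<Longrightarrow> b \<in> carrier H \<Longrightarrow> f a b = g a b"
  shows "balL W f \<longleftrightarrow> balL W g"
proof -
  have 1: "balL W g" if "balL W f" "\<And>a b. a \<in> carrier H \<Longrightarrow> b \<in> carrier H \<Longrightarrow> g a b = f a b" for f g
    using that(1) by (simp add: that(2) bal_map_def add_map_def)
  show ?thesis using 1[of f g] 1[of g f] assms by auto
qed

lemma sL_tL_left_commute: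
  assumes "l \<in> carrier L" "l' \<in> carrier L" "h \<in> carrier H"
  shows "sL l \<otimes>\<^bsub>H\<^esub> (tL l' \<otimes>\<^bsub>H\<^esub> h) = tL l' \<otimes>\<^bsub>H\<^esub> (sL l \<otimes>\<^bsub>H\<^esub> h)"
  using assms sL_tL_commute[of l l'] by (simp flip: H.m_assoc)

lemma balL_sL:
  assumes "balL W f" "l \<in> carrier L"
  shows "balL W (\<lambda>a b. f (sL l \<otimes>\<^bsub>H\<^esub> a) b)"
  by (rule bal_mapI)
    (use assms in \<open>auto intro!: add_map_intros bal_map_add1[OF assms(1)] bal_map_add2[OF assms(1)]
      simp: sL_tL_left_commute bal_map_balanced[OF assms(1)]\<close>)

lemma balL_tL:
  assumes "balL W f" "l \<in> carrier L"
  shows "balL W (\<lambda>a b. f a (tL l \<otimes>\<^bsub>H\<^esub> b))"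
  by (rule bal_mapI)
    (use assms in \<open>auto intro!: add_map_intros bal_map_add1[OF assms(1)] bal_map_add2[OF assms(1)]
      simp: sL_tL_left_commute bal_map_balanced[OF assms(1)]\<close>)

text \<open>Here s_L(l) is read as s_L(l) 1, so bilinearity of \<gamma>L gives its coproduct s_L(l)
  \<otimes> 1, and multiplicativity does the rest.\<close>

lemma SL_mult_sL:
  assumes "abelian_group W" "balL W f" "h \<in> carrier H" "l \<in> carrier L"
  shows "SL W (h \<otimes>\<^bsub>H\<^esub> sL l) f = SL W h (\<lambda>a b. f (a \<otimes>\<^bsub>H\<^esub> sL l) b)"
  using SL_mult[OF assms(1-3), of "sL l"]
    SL_sL[OF assms(1) balL_SL_mult[OF assms(1-3)] H.one_closed assms(4)] assms
  by (simp add: SL_one[OF _ balL_sL[OF balL_SL_mult]])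

lemma SL_mult_tL:
  assumes "abelian_group W" "balL W f" "h \<in> carrier H" "l \<in> carrier L"
  shows "SL W (h \<otimes>\<^bsub>H\<^esub> tL l) f = SL W h (\<lambda>a b. f a (b \<otimes>\<^bsub>H\<^esub> tL l))"
  using SL_mult[OF assms(1-3), of "tL l"]
    SL_tL[OF assms(1) balL_SL_mult[OF assms(1-3)] H.one_closed assms(4)] assms
  by (simp add: SL_one[OF _ balL_tL[OF balL_SL_mult]])

abbreviation "triL W F \<equiv> tri_map H (carrier L) ractL lactL (carrier L) ractL lactL W F"

lemma SL_coassoc:
  "abelian_group W \<Longrightarrow> triL W F \<Longrightarrow> h \<in> carrier H \<Longrightarrow>
    SL W h (\<lambda>a b. SL W a (\<lambda>a1 a2. F a1 a2 b)) = SL W h (\<lambda>a b. SL W b (\<lambda>b1 b2. F a b1 b2))"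
  by (rule corL.coassoc_tsum)

lemma SL_counit_left:
  "abelian_group W \<Longrightarrow> add_map H W \<phi> \<Longrightarrow> h \<in> carrier H
    \<Longrightarrow> SL W h (\<lambda>a b. \<phi> (sL (\<pi>L a) \<otimes>\<^bsub>H\<^esub> b)) = \<phi> h"
  by (rule corL.counit_left_tsum)

lemma SL_counit_right:
  "abelian_group W \<Longrightarrow> add_map H W \<phi> \<Longrightarrow> h \<in> carrier H
    \<Longrightarrow> SL W h (\<lambda>a b. \<phi> (tL (\<pi>L b) \<otimes>\<^bsub>H\<^esub> a)) = \<phi> h"
  by (rule corL.counit_right_tsum)

lemma SL_add_map [add_map_intros]:
  assumes "abelian_group W" "balL W f" "add_map M H g"
  shows "add_map M W (\<lambda>x. SL W (g x) f)"
  by (rule add_map_comp[OF assms(3) corL.comult_tsum_add_map[OF assms(1,2)]])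

end

section \<open>Right bialgebroids, with left and right multiplication exchanged\<close>

context right_bialgebroid
begin

sublocale H: k_algebra K H by (rule H_algebra)
sublocale R: k_algebra K R by (rule R_algebra)
sublocale corR: coring K R H lactR ractR \<gamma>R \<pi>R by (rule coringR)

abbreviation "SR G h f \<equiv> tsum H H G (\<gamma>R h) f"
abbreviation "balR G f \<equiv> bal_map H H (carrier R) ractR lactR G f"

lemma sR_closed [simp]: "r \<in> carrier R \<Longrightarrow> sR r \<in> carrier H"
  and sR_mult: "r \<in> carrier R \<Longrightarrow> r' \<in> carrier R \<Longrightarrow> sR (r \<otimes>\<^bsub>R\<^esub> r') = sR r \<otimes>\<^bsub>H\<^esub> sR r'"
  and sR_one [simp]: "sR \<one>\<^bsub>R\<^esub> = \<one>\<^bsub>H\<^esub>"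
  and sR_linear: "k_linear K R H sR"
  using sR_hom by (auto simp: alg_hom_def ring_hom_def)

lemma tR_closed [simp]: "r \<in> carrier R \<Longrightarrow> tR r \<in> carrier H"
  and tR_one [simp]: "tR \<one>\<^bsub>R\<^esub> = \<one>\<^bsub>H\<^esub>"
  using tR_hom by (auto simp: alg_hom_def ring_hom_def opposite_def)

lemma piR_closed [simp]: "h \<in> carrier H \<Longrightarrow> \<pi>R h \<in> carrier R"
  by (rule corR.counit_closed)

lemma HRH_group [simp]: "abelian_group HRH" by (rule corR.CC.T_group)

lemma gammaR_closed [simp]: "h \<in> carrier H \<Longrightarrow> \<gamma>R h \<in> carrier HRH"
  by (rule corR.comult_closed)

lemma SR_sR:
  "abelian_group W \<Longrightarrow> balR W f \<Longrightarrow> h \<in> carrier H \<Longrightarrow> r \<in> carrier R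
    \<Longrightarrow> SR W (h \<otimes>\<^bsub>H\<^esub> sR r) f = SR W h (\<lambda>a b. f a (b \<otimes>\<^bsub>H\<^esub> sR r))"
  by (rule corR.comult_ra_tsum)

lemma SR_tR:
  "abelian_group W \<Longrightarrow> balR W f \<Longrightarrow> h \<in> carrier H \<Longrightarrow> r \<in> carrier R
    \<Longrightarrow> SR W (h \<otimes>\<^bsub>H\<^esub> tR r) f = SR W h (\<lambda>a b. f (a \<otimes>\<^bsub>H\<^esub> tR r) b)"
  by (rule corR.comult_la_tsum)

lemma SR_one:
  "abelian_group W \<Longrightarrow> balR W f \<Longrightarrow> SR W \<one>\<^bsub>H\<^esub> f = f \<one>\<^bsub>H\<^esub> \<one>\<^bsub>H\<^esub>"
  unfolding \<gamma>R_one by (rule corR.CC.tsum_tens) auto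

lemma SR_takeuchi:
  assumes "abelian_group W" "balR W f" "h \<in> carrier H" "r \<in> carrier R"
  shows "SR W h (\<lambda>a b. f (sR r \<otimes>\<^bsub>H\<^esub> a) b) = SR W h (\<lambda>a b. f a (tR r \<otimes>\<^bsub>H\<^esub> b))"
proof -
  have "tsum H H W (SR HRH h (\<lambda>a b. (sR r \<otimes>\<^bsub>H\<^esub> a) \<boxtimes>\<^bsub>HRH\<^esub> b)) f = SR W h (\<lambda>a b. f (sR r \<otimes>\<^bsub>H\<^esub> a) b)"
    using assms by (intro corR.CC.tsum_tsum_tens) auto
  moreover have "tsum H H W (SR HRH h (\<lambda>a b. a \<boxtimes>\<^bsub>HRH\<^esub> (tR r \<otimes>\<^bsub>H\<^esub> b))) f = SR W h (\<lambda>a b. f a (tR r \<otimes>\<^bsub>H\<^esub> b))"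
    using assms by (intro corR.CC.tsum_tsum_tens) auto
  ultimately show ?thesis
    using takeuchiR[OF assms(3,4)] assms by (simp add: corR.sweedler_comult)
qed

lemma SR_mult:
  assumes "abelian_group W" "balR W f" "h \<in> carrier H" "k \<in> carrier H"
  shows "SR W (h \<otimes>\<^bsub>H\<^esub> k) f = SR W h (\<lambda>h1 h2. SR W k (\<lambda>k1 k2. f (h1 \<otimes>\<^bsub>H\<^esub> k1) (h2 \<otimes>\<^bsub>H\<^esub> k2)))"
proof -
  have "tsum H H W (SR HRH h (\<lambda>h1 h2. SR HRH k (\<lambda>k1 k2. (h1 \<otimes>\<^bsub>H\<^esub> k1) \<boxtimes>\<^bsub>HRH\<^esub> (h2 \<otimes>\<^bsub>H\<^esub> k2)))) f
    = SR W h (\<lambda>h1 h2. tsum H H W (SR HRH k (\<lambda>k1 k2. (h1 \<otimes>\<^bsub>H\<^esub> k1) \<boxtimes>\<^bsub>HRH\<^esub> (h2 \<otimes>\<^bsub>H\<^esub> k2))) f)"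
    using assms by (intro corR.CC.tsum_tsum) (auto intro!: tsum_closed corR.CC.tens_closed)
  also have "\<dots> = SR W h (\<lambda>h1 h2. SR W k (\<lambda>k1 k2. f (h1 \<otimes>\<^bsub>H\<^esub> k1) (h2 \<otimes>\<^bsub>H\<^esub> k2)))"
    using assms by (intro tsum_cong HOL.refl corR.CC.tsum_tsum_tens) auto
  finally show ?thesis using assms by (simp add: \<gamma>R_mult corR.sweedler_comult)
qed

lemma balR_mult:
  assumes "balR W f" "x \<in> carrier H" "y \<in> carrier H"
  shows "balR W (\<lambda>a b. f (x \<otimes>\<^bsub>H\<^esub> a) (y \<otimes>\<^bsub>H\<^esub> b))"
  by (rule bal_mapI)
    (use assms in \<open>auto intro!: add_map_intros bal_map_add1[OF assms(1)] bal_map_add2[OF assms(1)]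
      simp: bal_map_balanced[OF assms(1)] simp flip: H.m_assoc\<close>)

text \<open>The right Takeuchi condition concerns multiplication from the left. Hence balancedness
  in h comes from the sum over k being inside, opposite to the order for left bialgebroids.\<close>

lemma balR_SR_mult:
  assumes "abelian_group W" "balR W f" "k \<in> carrier H"
  shows "balR W (\<lambda>h1 h2. SR W k (\<lambda>k1 k2. f (h1 \<otimes>\<^bsub>H\<^esub> k1) (h2 \<otimes>\<^bsub>H\<^esub> k2)))"
proof (rule bal_mapI)
  show "SR W k (\<lambda>k1 k2. f ((a \<otimes>\<^bsub>H\<^esub> sR r) \<otimes>\<^bsub>H\<^esub> k1) (b \<otimes>\<^bsub>H\<^esub> k2))
    = SR W k (\<lambda>k1 k2. f (a \<otimes>\<^bsub>H\<^esub> k1) ((b \<otimes>\<^bsub>H\<^esub> tR r) \<otimes>\<^bsub>H\<^esub> k2))"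
    if "a \<in> carrier H" "b \<in> carrier H" "r \<in> carrier R" for a b r
    using SR_takeuchi[OF assms(1) balR_mult[OF assms(2), of a b] assms(3), of r] that
    by (simp add: H.m_assoc)
qed (use assms in \<open>auto intro!: add_map_intros bal_map_add1[OF assms(2)] bal_map_add2[OF assms(2)]\<close>)

lemma sR_tR_right_commute:
  assumes "r \<in> carrier R" "r' \<in> carrier R" "h \<in> carrier H"
  shows "h \<otimes>\<^bsub>H\<^esub> sR r \<otimes>\<^bsub>H\<^esub> tR r' = h \<otimes>\<^bsub>H\<^esub> tR r' \<otimes>\<^bsub>H\<^esub> sR r"
  using assms sR_tR_commute[of r r'] by (simp add: H.m_assoc)

lemma balR_sR:
  assumes "balR W f" "r \<in> carrier R"
  shows "balR W (\<lambda>a b. f a (b \<otimes>\<^bsub>H\<^esub> sR r))"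
  by (rule bal_mapI)
    (use assms in \<open>auto intro!: add_map_intros bal_map_add1[OF assms(1)] bal_map_add2[OF assms(1)]
      simp: sR_tR_right_commute[symmetric] bal_map_balanced[OF assms(1)]\<close>)

lemma balR_tR:
  assumes "balR W f" "r \<in> carrier R"
  shows "balR W (\<lambda>a b. f (a \<otimes>\<^bsub>H\<^esub> tR r) b)"
  by (rule bal_mapI)
    (use assms in \<open>auto intro!: add_map_intros bal_map_add1[OF assms(1)] bal_map_add2[OF assms(1)]
      simp: sR_tR_right_commute bal_map_balanced[OF assms(1)]\<close>)

lemma SR_sR_mult:
  assumes "abelian_group W" "balR W f" "h \<in> carrier H" "r \<in> carrier R"
  shows "SR W (sR r \<otimes>\<^bsub>H\<^esub> h) f = SR W h (\<lambda>a b. f a (sR r \<otimes>\<^bsub>H\<^esub> b))"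
  using SR_mult[OF assms(1,2), of "sR r" h]
    SR_sR[OF assms(1) balR_SR_mult[OF assms(1-3)] H.one_closed assms(4)] assms
  by (simp add: SR_one[OF _ balR_sR[OF balR_SR_mult]])

lemma SR_tR_mult:
  assumes "abelian_group W" "balR W f" "h \<in> carrier H" "r \<in> carrier R"
  shows "SR W (tR r \<otimes>\<^bsub>H\<^esub> h) f = SR W h (\<lambda>a b. f (tR r \<otimes>\<^bsub>H\<^esub> a) b)"
  using SR_mult[OF assms(1,2), of "tR r" h]
    SR_tR[OF assms(1) balR_SR_mult[OF assms(1-3)] H.one_closed assms(4)] assms
  by (simp add: SR_one[OF _ balR_tR[OF balR_SR_mult]])

lemma SR_counit_left:
  "abelian_group W \<Longrightarrow> add_map H W \<phi> \<Longrightarrow> h \<in> carrier H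
    \<Longrightarrow> SR W h (\<lambda>a b. \<phi> (b \<otimes>\<^bsub>H\<^esub> tR (\<pi>R a))) = \<phi> h"
  by (rule corR.counit_left_tsum)

lemma SR_counit_right:
  "abelian_group W \<Longrightarrow> add_map H W \<phi> \<Longrightarrow> h \<in> carrier H
    \<Longrightarrow> SR W h (\<lambda>a b. \<phi> (a \<otimes>\<^bsub>H\<^esub> sR (\<pi>R b))) = \<phi> h"
  by (rule corR.counit_right_tsum)

lemma SR_add_map [add_map_intros]:
  assumes "abelian_group W" "balR W f" "add_map M H g"
  shows "add_map M W (\<lambda>x. SR W (g x) f)"
  by (rule add_map_comp[OF assms(3) corR.comult_tsum_add_map[OF assms(1,2)]])

end

section \<open>Hopf algebroids: mixed coassociativity and the antipode\<close>

context hopf_algebroid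
begin

abbreviation "triLR W F \<equiv> tri_map H (carrier L) left.ractL left.lactL (carrier R) right.ractR right.lactR W F"
abbreviation "triRL W F \<equiv> tri_map H (carrier R) right.ractR right.lactR (carrier L) left.ractL left.lactL W F"

lemma coassoc_LR:
  assumes "abelian_group W" "triLR W F" "h \<in> carrier H"
  shows "right.SR W h (\<lambda>a b. left.SL W a (\<lambda>a1 a2. F a1 a2 b)) = left.SL W h (\<lambda>a b. right.SR W b (\<lambda>b1 b2. F a b1 b2))"
  by (rule coassoc_eval[OF left.corL.CC.tensor_pair_axioms right.corR.CC.tensor_pair_axioms])
    (use assms \<gamma>L_\<gamma>R_coassoc in \<open>auto simp: Let_def\<close>)

lemma coassoc_RL:
  assumes "abelian_group W" "triRL W F" "h \<in> carrier H"
  shows "left.SL W h (\<lambda>a b. right.SR W a (\<lambda>a1 a2. F a1 a2 b)) = right.SR W h (\<lambda>a b. left.SL W b (\<lambda>b1 b2. F a b1 b2))"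
  by (rule coassoc_eval[OF right.corR.CC.tensor_pair_axioms left.corL.CC.tensor_pair_axioms])
    (use assms \<gamma>R_\<gamma>L_coassoc in \<open>auto simp: Let_def\<close>)

text \<open>The axioms on \<pi>L and \<pi>R identify the images of t_L and s_R, and likewise those
  of s_L and t_R. Writing t_L(l) as s_R(r) with r = \<pi>R(t_L(l)) makes the rules of one
  bialgebroid available for the base maps of the other.\<close>

lemma SR_tL:
  assumes "abelian_group W" "right.balR W f" "h \<in> carrier H" "l \<in> carrier L"
  shows "right.SR W (tL l \<otimes>\<^bsub>H\<^esub> h) f = right.SR W h (\<lambda>a b. f a (tL l \<otimes>\<^bsub>H\<^esub> b))"
  using right.SR_sR_mult[OF assms(1-3), of "\<pi>R (tL l)"] assms by (simp add: sR_\<pi>R_tL)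

lemma SR_sL:
  assumes "abelian_group W" "right.balR W f" "h \<in> carrier H" "l \<in> carrier L"
  shows "right.SR W (sL l \<otimes>\<^bsub>H\<^esub> h) f = right.SR W h (\<lambda>a b. f (sL l \<otimes>\<^bsub>H\<^esub> a) b)"
  using right.SR_tR_mult[OF assms(1-3), of "\<pi>R (sL l)"] assms by (simp add: tR_\<pi>R_sL)

lemma SL_sR:
  assumes "abelian_group W" "left.balL W f" "h \<in> carrier H" "r \<in> carrier R"
  shows "left.SL W (sR r \<otimes>\<^bsub>H\<^esub> h) f = left.SL W h (\<lambda>a b. f a (sR r \<otimes>\<^bsub>H\<^esub> b))"
  using left.SL_tL[OF assms(1-3), of "\<pi>L (sR r)"] assms by (simp add: tL_\<pi>L_sR)

lemma SL_mult_sR: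
  assumes "abelian_group W" "left.balL W f" "h \<in> carrier H" "r \<in> carrier R"
  shows "left.SL W (h \<otimes>\<^bsub>H\<^esub> sR r) f = left.SL W h (\<lambda>a b. f a (b \<otimes>\<^bsub>H\<^esub> sR r))"
  using left.SL_mult_tL[OF assms(1-3), of "\<pi>L (sR r)"] assms by (simp add: tL_\<pi>L_sR)

lemma SL_mult_tR:
  assumes "abelian_group W" "left.balL W f" "h \<in> carrier H" "r \<in> carrier R"
  shows "left.SL W (h \<otimes>\<^bsub>H\<^esub> tR r) f = left.SL W h (\<lambda>a b. f (a \<otimes>\<^bsub>H\<^esub> tR r) b)"
  using left.SL_mult_sL[OF assms(1-3), of "\<pi>L (tR r)"] assms by (simp add: sL_\<pi>L_tR)

lemma S_add_map: "add_map H H S"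
  using S_linear by (rule k_linear_add_map)

lemma S_closed [simp]: "h \<in> carrier H \<Longrightarrow> S h \<in> carrier H"
  using S_add_map by (rule add_map_closed)

lemma S_add [add_map_intros]: "add_map M H f \<Longrightarrow> add_map M H (\<lambda>x. S (f x))"
  using S_add_map by (rule add_map_comp[rotated])

lemma S_tL: "h \<in> carrier H \<Longrightarrow> l \<in> carrier L \<Longrightarrow> S (tL l \<otimes>\<^bsub>H\<^esub> h) = S h \<otimes>\<^bsub>H\<^esub> sL l"
  using S_tL_tR[of h l "\<one>\<^bsub>R\<^esub>"] by simp

lemma S_tR: "h \<in> carrier H \<Longrightarrow> r \<in> carrier R \<Longrightarrow> S (h \<otimes>\<^bsub>H\<^esub> tR r) = sR r \<otimes>\<^bsub>H\<^esub> S h"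
  using S_tL_tR[of h "\<one>\<^bsub>L\<^esub>" r] by simp

lemma S_left_tsum: "h \<in> carrier H \<Longrightarrow> left.SL H h (\<lambda>a b. S a \<otimes>\<^bsub>H\<^esub> b) = sR (\<pi>R h)"
  using S_left[of h] by (simp add: left.corL.sweedler_comult)

lemma S_right_tsum: "h \<in> carrier H \<Longrightarrow> right.SR H h (\<lambda>a b. a \<otimes>\<^bsub>H\<^esub> S b) = sL (\<pi>L h)"
  using S_right[of h] by (simp add: right.corR.sweedler_comult)

lemma S_left_hom:
  assumes "add_map H W \<phi>" "abelian_group W" "h \<in> carrier H"
  shows "left.SL W h (\<lambda>a b. \<phi> (S a \<otimes>\<^bsub>H\<^esub> b)) = \<phi> (sR (\<pi>R h))"
  using tsum_hom[OF assms(1) left.H_group assms(2), of H H "\<lambda>a b. S a \<otimes>\<^bsub>H\<^esub> b" "\<gamma>L h"] assms(3)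
  by (simp add: S_left_tsum)

lemma S_right_hom:
  assumes "add_map H W \<phi>" "abelian_group W" "h \<in> carrier H"
  shows "right.SR W h (\<lambda>a b. \<phi> (a \<otimes>\<^bsub>H\<^esub> S b)) = \<phi> (sL (\<pi>L h))"
  using tsum_hom[OF assms(1) left.H_group assms(2), of H H "\<lambda>a b. a \<otimes>\<^bsub>H\<^esub> S b" "\<gamma>R h"] assms(3)
  by (simp add: S_right_tsum)

text \<open>The antipode axiom at 1: since its summand is balanced, the sum over \<gamma>L(1) has
  the single term S(1) 1.\<close>

lemma S_one: "S \<one>\<^bsub>H\<^esub> = \<one>\<^bsub>H\<^esub>"
proof -
  have "left.balL H (\<lambda>a b. S a \<otimes>\<^bsub>H\<^esub> b)"
    by (rule bal_mapI) (auto intro!: add_map_intros left.H.add_map_mult_left left.H.add_map_mult_right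
        simp: S_tL left.H.m_assoc)
  then have "left.SL H \<one>\<^bsub>H\<^esub> (\<lambda>a b. S a \<otimes>\<^bsub>H\<^esub> b) = S \<one>\<^bsub>H\<^esub> \<otimes>\<^bsub>H\<^esub> \<one>\<^bsub>H\<^esub>"
    by (intro left.SL_one) auto
  then show ?thesis by (simp add: S_left_tsum right.\<pi>R_one)
qed

text \<open>
  This replaces anti-comultiplicativity of the antipode.  One inserts \<open>v_(3)^(1) S(v_(3)^(2)) = s_L(\<pi>_L(v_(3)))\<close> on the right, and mixed
  coassociativity turns \<open>v_(1), v_(2), v_(3)^(1)\<close> into an iterated coproduct of \<open>v^(1)\<close>.
\<close>

lemma antipode_coproduct:
  assumes W: "abelian_group W" and f: "left.balL W f" and v: "v \<in> carrier H"
  shows "left.SL W v (\<lambda>v1 v2. left.SL W (S v1) (\<lambda>x1 x2. f (x1 \<otimes>\<^bsub>H\<^esub> v2) x2)) = f \<one>\<^bsub>H\<^esub> (S v)"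
proof -
  note [simp] = W
  note f_add [add_map_intros] = bal_map_add1[OF f] bal_map_add2[OF f]
  note [add_map_intros] = left.H.add_map_mult_left left.H.add_map_mult_right
    left.SL_add_map right.SR_add_map
  note f_closed [simp] = bal_map_closed[OF f]
  \<comment> \<open>The third slot c starts as 1. It receives s_L(\<pi>L(v3)) and then v3^(1)
    S(v3^(2)); \<open>G_bal2\<close>, which is the Takeuchi condition for the coproduct of S(a),
    lets base elements move into it.\<close>
  define G where "G = (\<lambda>a b c. left.SL W (S a) (\<lambda>x1 x2. f (x1 \<otimes>\<^bsub>H\<^esub> b) (x2 \<otimes>\<^bsub>H\<^esub> c)))"
  have bal_f: "left.balL W (\<lambda>x1 x2. f (x1 \<otimes>\<^bsub>H\<^esub> b) (x2 \<otimes>\<^bsub>H\<^esub> c))"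
    if "b \<in> carrier H" "c \<in> carrier H" for b c
    by (rule left.balL_mult[OF f that])
  have bal_f1: "left.balL W (\<lambda>p q. f p (q \<otimes>\<^bsub>H\<^esub> c))" if "c \<in> carrier H" for c
    using that by (intro bal_mapI add_map_intros) (auto simp: bal_map_balanced[OF f] left.H.m_assoc)
  have G_closed [simp]: "G a b c \<in> carrier W" if "a \<in> carrier H" "b \<in> carrier H" "c \<in> carrier H" for a b c
    using that by (auto simp: G_def intro!: tsum_closed)
  have G_add1 [add_map_intros]: "add_map M W (\<lambda>x. G (g x) b c)"
    if "add_map M H g" "b \<in> carrier H" "c \<in> carrier H" for M :: "('k, 'h) module" and g b c
    unfolding G_def using that bal_f by (intro add_map_intros) auto
  have G_add2 [add_map_intros]: "add_map M W (\<lambda>x. G a (g x) c)"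
    if "add_map M H g" "a \<in> carrier H" "c \<in> carrier H" for M :: "('k, 'h) module" and g a c
    unfolding G_def using that by (intro add_map_intros) auto
  have G_add3 [add_map_intros]: "add_map M W (\<lambda>x. G a b (g x))"
    if "add_map M H g" "a \<in> carrier H" "b \<in> carrier H" for M :: "('k, 'h) module" and g a b
    unfolding G_def using that by (intro add_map_intros) auto
  have G_bal1: "G (tL l \<otimes>\<^bsub>H\<^esub> a) b c = G a (sL l \<otimes>\<^bsub>H\<^esub> b) c"
    if "a \<in> carrier H" "b \<in> carrier H" "c \<in> carrier H" "l \<in> carrier L" for a b c l
    using that left.SL_mult_sL[OF W bal_f[OF that(2,3)], of "S a" l]
    by (simp add: G_def S_tL left.H.m_assoc)
  have G_bal2: "G a (tL l \<otimes>\<^bsub>H\<^esub> b) c = G a b (sL l \<otimes>\<^bsub>H\<^esub> c)"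
    if "a \<in> carrier H" "b \<in> carrier H" "c \<in> carrier H" "l \<in> carrier L" for a b c l
    using that left.SL_takeuchi[OF W bal_f[OF that(2,3)], of "S a" l]
    by (simp add: G_def left.H.m_assoc)
  have G_bal3: "right.balR W (\<lambda>c1 c2. G a b (c1 \<otimes>\<^bsub>H\<^esub> S c2))"
    if "a \<in> carrier H" "b \<in> carrier H" for a b
    using that by (intro bal_mapI add_map_intros) (auto simp: S_tR left.H.m_assoc)
  have "left.SL W v (\<lambda>v1 v2. left.SL W (S v1) (\<lambda>x1 x2. f (x1 \<otimes>\<^bsub>H\<^esub> v2) x2))
    = left.SL W v (\<lambda>v1 v2. G v1 v2 \<one>\<^bsub>H\<^esub>)"
    by (auto simp: G_def intro!: tsum_cong)
  also have "\<dots> = left.SL W v (\<lambda>v1 v2. left.SL W v2 (\<lambda>v2 v3. G v1 (tL (\<pi>L v3) \<otimes>\<^bsub>H\<^esub> v2) \<one>\<^bsub>H\<^esub>))"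
    by (intro tsum_cong HOL.refl left.SL_counit_right[symmetric] W add_map_intros) auto
  also have "\<dots> = left.SL W v (\<lambda>v1 v2. left.SL W v2 (\<lambda>v2 v3. G v1 v2 (sL (\<pi>L v3))))"
    by (intro tsum_cong HOL.refl) (simp add: G_bal2)
  also have "\<dots> = left.SL W v (\<lambda>v1 v2. left.SL W v2 (\<lambda>v2 v3. right.SR W v3 (\<lambda>a b. G v1 v2 (a \<otimes>\<^bsub>H\<^esub> S b))))"
    by (intro tsum_cong HOL.refl S_right_hom[symmetric] add_map_intros W) auto
  also have "\<dots> = left.SL W v (\<lambda>v1 v3. left.SL W v1 (\<lambda>v1 v2. right.SR W v3 (\<lambda>a b. G v1 v2 (a \<otimes>\<^bsub>H\<^esub> S b))))"
  proof (intro left.SL_coassoc[symmetric] W v tri_mapI add_map_intros G_bal3)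
    show "right.SR W c (\<lambda>c1 c2. G a (tL l \<otimes>\<^bsub>H\<^esub> b) (c1 \<otimes>\<^bsub>H\<^esub> S c2))
      = right.SR W (sL l \<otimes>\<^bsub>H\<^esub> c) (\<lambda>c1 c2. G a b (c1 \<otimes>\<^bsub>H\<^esub> S c2))"
      if "a \<in> carrier H" "b \<in> carrier H" "c \<in> carrier H" "l \<in> carrier L" for a b c l
      using that by (simp add: SR_sL[OF W G_bal3] G_bal2 left.H.m_assoc)
  qed (auto simp: G_bal1 intro!: left.H.m_closed)
  also have "\<dots> = left.SL W v (\<lambda>v1 v3. right.SR W v3 (\<lambda>a b. left.SL W v1 (\<lambda>v1 v2. G v1 v2 (a \<otimes>\<^bsub>H\<^esub> S b))))"
    by (intro tsum_cong HOL.refl tsum_swap) auto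
  also have "\<dots> = right.SR W v (\<lambda>w b. left.SL W w (\<lambda>w a. left.SL W w (\<lambda>v1 v2. G v1 v2 (a \<otimes>\<^bsub>H\<^esub> S b))))"
  proof (intro coassoc_LR[symmetric] W v tri_mapI add_map_intros bal_mapI)
    show "left.SL W (tL l \<otimes>\<^bsub>H\<^esub> w) (\<lambda>v1 v2. G v1 v2 (a \<otimes>\<^bsub>H\<^esub> S b))
      = left.SL W w (\<lambda>v1 v2. G v1 v2 (sL l \<otimes>\<^bsub>H\<^esub> a \<otimes>\<^bsub>H\<^esub> S b))"
      if "w \<in> carrier H" "a \<in> carrier H" "b \<in> carrier H" "l \<in> carrier L" for w a b l
    proof -
      have "left.balL W (\<lambda>v1 v2. G v1 v2 (a \<otimes>\<^bsub>H\<^esub> S b))"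
        using that by (intro bal_mapI add_map_intros) (auto simp: G_bal1)
      then show ?thesis using that by (simp add: left.SL_tL G_bal2 left.H.m_assoc)
    qed
  qed (auto simp: G_bal1 S_tR left.H.m_assoc intro!: left.H.m_closed)
  also have "\<dots> = right.SR W v (\<lambda>w b. left.SL W w (\<lambda>w1 w2. left.SL W w2 (\<lambda>v2 a. G w1 v2 (a \<otimes>\<^bsub>H\<^esub> S b))))"
    by (intro tsum_cong HOL.refl left.SL_coassoc W tri_mapI add_map_intros)
      (auto simp: G_bal1 G_bal2 left.H.m_assoc)
  \<comment> \<open>Multiplicativity now recognises the coproduct of S(w1) w2, which collapses to
    s_R(\<pi>R(w)). As the image of s_R lies in that of t_L, this element acts on the second leg
    only, where it is absorbed by S and the counit of \<gamma>R.\<close>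
  also have "\<dots> = right.SR W v (\<lambda>w b. left.SL W w (\<lambda>w1 w2. left.SL W (S w1 \<otimes>\<^bsub>H\<^esub> w2) (\<lambda>p q. f p (q \<otimes>\<^bsub>H\<^esub> S b))))"
    by (simp add: left.SL_mult bal_f1 G_def left.H.m_assoc)
  also have "\<dots> = right.SR W v (\<lambda>w b. left.SL W (sR (\<pi>R w)) (\<lambda>p q. f p (q \<otimes>\<^bsub>H\<^esub> S b)))"
  proof (rule tsum_cong[OF HOL.refl])
    fix w b assume wb: "w \<in> carrier H" "b \<in> carrier H"
    have "add_map H W (\<lambda>z. left.SL W z (\<lambda>p q. f p (q \<otimes>\<^bsub>H\<^esub> S b)))"
      using wb by (intro add_map_intros bal_f1 W) auto
    from S_left_hom[OF this W wb(1)]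
    show "left.SL W w (\<lambda>w1 w2. left.SL W (S w1 \<otimes>\<^bsub>H\<^esub> w2) (\<lambda>p q. f p (q \<otimes>\<^bsub>H\<^esub> S b)))
      = left.SL W (sR (\<pi>R w)) (\<lambda>p q. f p (q \<otimes>\<^bsub>H\<^esub> S b))" .
  qed
  also have "\<dots> = right.SR W v (\<lambda>w b. f \<one>\<^bsub>H\<^esub> (S (b \<otimes>\<^bsub>H\<^esub> tR (\<pi>R w))))"
  proof (rule tsum_cong[OF HOL.refl])
    fix w b assume wb: "w \<in> carrier H" "b \<in> carrier H"
    have "left.balL W (\<lambda>p q. f p (sR (\<pi>R w) \<otimes>\<^bsub>H\<^esub> q \<otimes>\<^bsub>H\<^esub> S b))"
      using left.balL_tL[OF bal_f1, of "S b" "\<pi>L (sR (\<pi>R w))"] wb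
      by (simp add: tL_\<pi>L_sR)
    from left.SL_one[OF W this]
    show "left.SL W (sR (\<pi>R w)) (\<lambda>p q. f p (q \<otimes>\<^bsub>H\<^esub> S b)) = f \<one>\<^bsub>H\<^esub> (S (b \<otimes>\<^bsub>H\<^esub> tR (\<pi>R w)))"
      using SL_sR[OF W bal_f1 left.H.one_closed, of "S b" "\<pi>R w"] wb
      by (simp add: S_tR left.H.m_assoc)
  qed
  also have "\<dots> = f \<one>\<^bsub>H\<^esub> (S v)"
    using v by (intro right.SR_counit_left add_map_intros W) auto
  finally show ?thesis .
qed

end

section \<open>Convolution of maps of several variables\<close>

text \<open>A left B-module without its scalars. The instances \<open>B\<close> and
  \<open>BH\<close> let one convolution calculus treat maps with values in B and in the crossed
  product; a third one carries the coactions.\<close>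

locale ring_action = B: ring B
  for B :: "('b, 'x) ring_scheme" +
  fixes W :: "('w, 'v) ring_scheme" and act :: "'b \<Rightarrow> 'w \<Rightarrow> 'w"
  assumes W_group: "abelian_group W"
    and act_add_right: "b \<in> carrier B \<Longrightarrow> add_map W W (act b)"
    and act_add_left: "w \<in> carrier W \<Longrightarrow> add_map B W (\<lambda>b. act b w)"
    and act_assoc: "\<lbrakk>b \<in> carrier B; c \<in> carrier B; w \<in> carrier W\<rbrakk> \<Longrightarrow> act (b \<otimes>\<^bsub>B\<^esub> c) w = act b (act c w)"
    and act_one: "w \<in> carrier W \<Longrightarrow> act \<one>\<^bsub>B\<^esub> w = w"
begin

lemma act_closed: "b \<in> carrier B \<Longrightarrow> w \<in> carrier W \<Longrightarrow> act b w \<in> carrier W"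
  using act_add_right by (rule add_map_closed)

lemma act_add1 [add_map_intros]:
  "w \<in> carrier W \<Longrightarrow> add_map M B f \<Longrightarrow> add_map M W (\<lambda>x. act (f x) w)"
  using act_add_left by (rule add_map_comp[rotated])

lemma act_add2 [add_map_intros]:
  "b \<in> carrier B \<Longrightarrow> add_map M W f \<Longrightarrow> add_map M W (\<lambda>x. act b (f x))"
  using act_add_right by (rule add_map_comp[rotated])

lemma act_tsum:
  assumes "b \<in> carrier B" "\<And>x y. x \<in> carrier M \<Longrightarrow> y \<in> carrier N \<Longrightarrow> f x y \<in> carrier W"
  shows "act b (tsum M N W T f) = tsum M N W T (\<lambda>x y. act b (f x y))"
  using assms by (intro tsum_hom act_add_right W_group)

lemma tsum_act:
  assumes "w \<in> carrier W" "\<And>x y. x \<in> carrier M \<Longrightarrow> y \<in> carrier N \<Longrightarrow> f x y \<in> carrier B"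
  shows "act (tsum M N B T f) w = tsum M N W T (\<lambda>x y. act (f x y) w)"
  using assms by (intro tsum_hom[of B W "\<lambda>b. act b w"] act_add_left W_group B.abelian_group_axioms)

end

lemma (in ring) ring_action_self: "ring_action R R (\<otimes>)"
  by (intro ring_action.intro ring_axioms ring_action_axioms.intro abelian_group_axioms)
    (auto simp: add_map_def l_distr r_distr m_assoc)

context left_bialgebroid
begin

text \<open>
  Maps of several variables in \<open>H\<close> are maps on lists, the variable whose coproduct is summed
  outermost being the head.  Since \<open>f(h_(1), k_(1)) g(h_(2), k_(2))\<close> need only be balanced in \<open>k\<close>
  after summation over \<open>h\<close>, the balancing condition \<open>linked\<close> refers to the convolution in the
  remaining variables.
\<close>

fun conv :: "('w, 'v) ring_scheme \<Rightarrow> ('p \<Rightarrow> 'w \<Rightarrow> 'w) \<Rightarrow> ('c list \<Rightarrow> 'p) \<Rightarrow> ('c list \<Rightarrow> 'w) \<Rightarrow> 'c list \<Rightarrow> 'w"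
  where
  "conv W act f g [] = act (f []) (g [])"
| "conv W act f g (m # p) =
     SL W m (\<lambda>m1 m2. conv W act (\<lambda>p. f (m1 # p)) (\<lambda>p. g (m2 # p)) p)"

definition pts :: "nat \<Rightarrow> 'c list set" where
  "pts n = {p. length p = n \<and> set p \<subseteq> carrier H}"

lemma pts_simps [simp]:
  "p \<in> pts 0 \<longleftrightarrow> p = []" "[] \<in> pts (Suc n) \<longleftrightarrow> False"
  "(m # p) \<in> pts (Suc n) \<longleftrightarrow> m \<in> carrier H \<and> p \<in> pts n"
  by (auto simp: pts_def)

lemma pts_SucE:
  assumes "p \<in> pts (Suc n)" obtains m q where "p = m # q" "m \<in> carrier H" "q \<in> pts n"
  using assms by (cases p) auto

fun multi_add :: "nat \<Rightarrow> ('w, 'v) ring_scheme \<Rightarrow> ('c list \<Rightarrow> 'w) \<Rightarrow> bool" where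
  "multi_add 0 W f \<longleftrightarrow> f [] \<in> carrier W"
| "multi_add (Suc n) W f \<longleftrightarrow> (\<forall>m\<in>carrier H. multi_add n W (\<lambda>p. f (m # p))) \<and>
     (\<forall>p\<in>pts n. add_map H W (\<lambda>m. f (m # p)))"

fun linked :: "nat \<Rightarrow> ('w, 'v) ring_scheme \<Rightarrow> ('p \<Rightarrow> 'w \<Rightarrow> 'w) \<Rightarrow> ('c list \<Rightarrow> 'p) \<Rightarrow> ('c list \<Rightarrow> 'w) \<Rightarrow> bool"
  where
  "linked 0 W act f g \<longleftrightarrow> True"
| "linked (Suc n) W act f g \<longleftrightarrow> (\<forall>m\<in>carrier H. \<forall>m'\<in>carrier H.
     linked n W act (\<lambda>p. f (m # p)) (\<lambda>p. g (m' # p)) \<and>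
     (\<forall>l\<in>carrier L. \<forall>p\<in>pts n. conv W act (\<lambda>p. f ((tL l \<otimes>\<^bsub>H\<^esub> m) # p)) (\<lambda>p. g (m' # p)) p
        = conv W act (\<lambda>p. f (m # p)) (\<lambda>p. g ((sL l \<otimes>\<^bsub>H\<^esub> m') # p)) p))"

lemma multi_add_closed: "multi_add n W f \<Longrightarrow> p \<in> pts n \<Longrightarrow> f p \<in> carrier W"
  by (induction n arbitrary: f p) (auto elim!: pts_SucE)

lemma conv_cong:
  assumes "\<And>p. p \<in> pts n \<Longrightarrow> f p = f' p" "\<And>p. p \<in> pts n \<Longrightarrow> g p = g' p" "p \<in> pts n"
  shows "conv W act f g p = conv W act f' g' p"
  using assms
proof (induction n arbitrary: f g f' g' p)
  case (Suc n)
  from Suc.prems(3) obtain m q where p: "p = m # q" "m \<in> carrier H" "q \<in> pts n"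
    by (rule pts_SucE)
  show ?case unfolding p conv.simps
    by (intro tsum_cong HOL.refl Suc.IH) (use Suc.prems p in auto)
qed auto

lemma multi_add_tsum:
  assumes "abelian_group W"
    "\<And>a b. a \<in> carrier P \<Longrightarrow> b \<in> carrier Q \<Longrightarrow> multi_add n W (F a b)"
  shows "multi_add n W (\<lambda>p. tsum P Q W U (\<lambda>a b. F a b p))"
  using assms(2)
proof (induction n arbitrary: F)
  case 0
  then show ?case by (auto intro: tsum_closed assms(1))
next
  case (Suc n)
  show ?case unfolding multi_add.simps
    by (intro conjI ballI Suc.IH add_map_tsum assms(1)) (use Suc.prems in auto)
qed

context
  fixes B :: "('p, 'q) ring_scheme" and W :: "('w, 'v) ring_scheme" and act :: "'p \<Rightarrow> 'w \<Rightarrow> 'w"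
  assumes action: "ring_action B W act"
begin

interpretation ring_action B W act by (rule action)

lemma conv_closed:
  assumes "\<And>p. p \<in> pts n \<Longrightarrow> f p \<in> carrier B" "\<And>p. p \<in> pts n \<Longrightarrow> g p \<in> carrier W" "p \<in> pts n"
  shows "conv W act f g p \<in> carrier W"
  using assms
proof (induction n arbitrary: f g p)
  case 0
  then show ?case by (auto intro: act_closed)
next
  case (Suc n)
  from Suc.prems(3) obtain m q where p: "p = m # q" "m \<in> carrier H" "q \<in> pts n"
    by (rule pts_SucE)
  show ?case unfolding p conv.simps
    by (intro tsum_closed W_group Suc.IH) (use Suc.prems p in auto)
qed

lemma conv_add1:
  assumes "\<And>p. p \<in> pts n \<Longrightarrow> add_map M B (\<lambda>x. F x p)" "\<And>p. p \<in> pts n \<Longrightarrow> g p \<in> carrier W" "p \<in> pts n"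
  shows "add_map M W (\<lambda>x. conv W act (F x) g p)"
  using assms
proof (induction n arbitrary: F g p)
  case 0
  then show ?case by (auto intro: act_add1)
next
  case (Suc n)
  from Suc.prems(3) obtain m q where p: "p = m # q" "m \<in> carrier H" "q \<in> pts n"
    by (rule pts_SucE)
  show ?case unfolding p conv.simps
    by (intro add_map_tsum W_group Suc.IH) (use Suc.prems p in auto)
qed

lemma conv_add2:
  assumes "\<And>p. p \<in> pts n \<Longrightarrow> f p \<in> carrier B" "\<And>p. p \<in> pts n \<Longrightarrow> add_map M W (\<lambda>x. G x p)" "p \<in> pts n"
  shows "add_map M W (\<lambda>x. conv W act f (G x) p)"
  using assms
proof (induction n arbitrary: f G p)
  case 0
  then show ?case by (auto intro: act_add2)
next
  case (Suc n)
  from Suc.prems(3) obtain m q where p: "p = m # q" "m \<in> carrier H" "q \<in> pts n"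
    by (rule pts_SucE)
  show ?case unfolding p conv.simps
    by (intro add_map_tsum W_group Suc.IH) (use Suc.prems p in auto)
qed

lemma conv_tsum1:
  assumes "\<And>a b p. a \<in> carrier P \<Longrightarrow> b \<in> carrier Q \<Longrightarrow> p \<in> pts n \<Longrightarrow> F a b p \<in> carrier B"
    and "\<And>p. p \<in> pts n \<Longrightarrow> g p \<in> carrier W" "p \<in> pts n"
  shows "conv W act (\<lambda>p. tsum P Q B U (\<lambda>a b. F a b p)) g p
    = tsum P Q W U (\<lambda>a b. conv W act (F a b) g p)"
  using assms
proof (induction n arbitrary: F g p)
  case 0
  then show ?case by (simp add: tsum_act)
next
  case (Suc n)
  from Suc.prems(3) obtain m q where p: "p = m # q" "m \<in> carrier H" "q \<in> pts n"
    by (rule pts_SucE)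
  have "conv W act (\<lambda>p. tsum P Q B U (\<lambda>a b. F a b p)) g (m # q)
    = SL W m (\<lambda>m1 m2. tsum P Q W U (\<lambda>a b. conv W act (\<lambda>p. F a b (m1 # p)) (\<lambda>p. g (m2 # p)) q))"
    unfolding conv.simps by (intro tsum_cong HOL.refl Suc.IH) (use Suc.prems p in auto)
  also have "\<dots> = tsum P Q W U (\<lambda>a b. conv W act (F a b) g (m # q))"
    unfolding conv.simps by (intro tsum_swap W_group conv_closed[of n]) (use Suc.prems p in auto)
  finally show ?case unfolding p .
qed

lemma conv_tsum2:
  assumes "\<And>p. p \<in> pts n \<Longrightarrow> f p \<in> carrier B"
    and "\<And>a b p. a \<in> carrier P \<Longrightarrow> b \<in> carrier Q \<Longrightarrow> p \<in> pts n \<Longrightarrow> G a b p \<in> carrier W" "p \<in> pts n"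
  shows "conv W act f (\<lambda>p. tsum P Q W U (\<lambda>a b. G a b p)) p
    = tsum P Q W U (\<lambda>a b. conv W act f (G a b) p)"
  using assms
proof (induction n arbitrary: f G p)
  case 0
  then show ?case by (simp add: act_tsum)
next
  case (Suc n)
  from Suc.prems(3) obtain m q where p: "p = m # q" "m \<in> carrier H" "q \<in> pts n"
    by (rule pts_SucE)
  have "conv W act f (\<lambda>p. tsum P Q W U (\<lambda>a b. G a b p)) (m # q)
    = SL W m (\<lambda>m1 m2. tsum P Q W U (\<lambda>a b. conv W act (\<lambda>p. f (m1 # p)) (\<lambda>p. G a b (m2 # p)) q))"
    unfolding conv.simps by (intro tsum_cong HOL.refl Suc.IH) (use Suc.prems p in auto)
  also have "\<dots> = tsum P Q W U (\<lambda>a b. conv W act f (G a b) (m # q))"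
    unfolding conv.simps by (intro tsum_swap W_group conv_closed[of n]) (use Suc.prems p in auto)
  finally show ?case unfolding p .
qed

text \<open>The condition \<open>linked\<close> is tailored to this statement: it supplies the
  balancing in the outermost variable, while \<open>multi_add\<close> supplies additivity.\<close>

lemma conv_bal:
  assumes "multi_add (Suc n) B f" "multi_add (Suc n) W g" "linked (Suc n) W act f g" "p \<in> pts n"
  shows "balL W (\<lambda>m1 m2. conv W act (\<lambda>p. f (m1 # p)) (\<lambda>p. g (m2 # p)) p)"
  using assms
  by (intro bal_mapI conv_add1[where n = n] conv_add2[where n = n]) (auto intro: multi_add_closed)

lemma multi_add_conv:
  assumes "multi_add n B f" "multi_add n W g" "linked n W act f g"
  shows "multi_add n W (conv W act f g)"
  using assms
proof (induction n arbitrary: f g)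
  case 0
  then show ?case by (auto intro: act_closed)
next
  case (Suc n)
  show ?case unfolding multi_add.simps
  proof (intro conjI ballI)
    show "multi_add n W (\<lambda>p. conv W act f g (m # p))" if "m \<in> carrier H" for m
      unfolding conv.simps by (intro multi_add_tsum W_group Suc.IH) (use Suc.prems that in auto)
    show "add_map H W (\<lambda>m. conv W act f g (m # p))" if "p \<in> pts n" for p
      unfolding conv.simps using conv_bal[OF Suc.prems that]
      by (intro SL_add_map W_group add_map_id)
  qed
qed

end

text \<open>Induction on the number of variables, with coassociativity for the outermost one. Its
  summand F has to be balanced between the first two and between the last two copies. The condition
  on f and g is visible only when their convolution is formed first, the one on g and e only in the
  other bracketing; the induction hypothesis, as \<open>F_alt\<close>, switches between
  them.\<close>

lemma conv_assoc:
  assumes action: "ring_action B W act"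
  assumes "multi_add n B f" "multi_add n B g" "multi_add n W e"
    and "linked n B (\<otimes>\<^bsub>B\<^esub>) f g" "linked n W act g e" "p \<in> pts n"
  shows "conv W act f (conv W act g e) p = conv W act (conv B (\<otimes>\<^bsub>B\<^esub>) f g) e p"
  using assms(2-)
proof (induction n arbitrary: f g e p)
  case 0
  then show ?case by (simp add: ring_action.act_assoc[OF action])
next
  case (Suc n)
  interpret ring_action B W act by (rule action)
  have self: "ring_action B B (\<otimes>\<^bsub>B\<^esub>)" by (rule B.ring_action_self)
  from Suc.prems(6) obtain m q where p: "p = m # q" and m: "m \<in> carrier H" and q: "q \<in> pts n"
    by (rule pts_SucE)
  note f = Suc.prems(1) and g = Suc.prems(2) and e = Suc.prems(3)
    and fg = Suc.prems(4) and ge = Suc.prems(5)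
  have cl [simp]: "f (a # p) \<in> carrier B" "g (a # p) \<in> carrier B" "e (a # p) \<in> carrier W"
    if "a \<in> carrier H" "p \<in> pts n" for a p
    using that multi_add_closed[OF f] multi_add_closed[OF g] multi_add_closed[OF e] by auto
  have add: "add_map H B (\<lambda>a. f (a # p))" "add_map H B (\<lambda>a. g (a # p))" "add_map H W (\<lambda>a. e (a # p))"
    if "p \<in> pts n" for p
    using that f g e by auto
  define F where "F a b c = conv W act (\<lambda>p. f (a # p))
    (conv W act (\<lambda>p. g (b # p)) (\<lambda>p. e (c # p))) q" for a b c
  have F_alt: "F a b c = conv W act (conv B (\<otimes>\<^bsub>B\<^esub>) (\<lambda>p. f (a # p)) (\<lambda>p. g (b # p))) (\<lambda>p. e (c # p)) q"
    if "a \<in> carrier H" "b \<in> carrier H" "c \<in> carrier H" for a b c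
    unfolding F_def using f g e fg ge q that by (intro Suc.IH) auto
  have "conv W act f (conv W act g e) p
    = SL W m (\<lambda>m1 m2. SL W m2 (\<lambda>m2 m3. F m1 m2 m3))"
    unfolding p conv.simps F_def
    using q by (intro tsum_cong HOL.refl conv_tsum2[OF action, where n = n] conv_closed[OF action, where n = n]) auto
  also have "\<dots> = SL W m (\<lambda>m1 m3. SL W m1 (\<lambda>m1 m2. F m1 m2 m3))"
  proof (intro SL_coassoc[symmetric] W_group m tri_mapI)
    fix b c assume bc: "b \<in> carrier H" "c \<in> carrier H"
    show "add_map H W (\<lambda>a. F a b c)" unfolding F_def
      using q bc by (intro conv_add1[OF action, where n = n] conv_closed[OF action, where n = n] add) auto
    show "add_map H W (\<lambda>a. F b a c)" unfolding F_def
      using q bc by (intro conv_add1[OF action, where n = n] conv_add2[OF action, where n = n] add) auto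
    show "add_map H W (F b c)" unfolding F_def
      using q bc by (intro conv_add2[OF action, where n = n] add) auto
  next
    fix a b c l assume *: "a \<in> carrier H" "b \<in> carrier H" "c \<in> carrier H" "l \<in> carrier L"
    have "conv W act (conv B (\<otimes>\<^bsub>B\<^esub>) (\<lambda>p. f ((tL l \<otimes>\<^bsub>H\<^esub> a) # p)) (\<lambda>p. g (b # p))) (\<lambda>p. e (c # p)) q
      = conv W act (conv B (\<otimes>\<^bsub>B\<^esub>) (\<lambda>p. f (a # p)) (\<lambda>p. g ((sL l \<otimes>\<^bsub>H\<^esub> b) # p))) (\<lambda>p. e (c # p)) q"
      by (rule conv_cong[of n]) (use * fg q in auto)
    then show "F (tL l \<otimes>\<^bsub>H\<^esub> a) b c = F a (sL l \<otimes>\<^bsub>H\<^esub> b) c"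
      using * by (simp add: F_alt)
    show "F a (tL l \<otimes>\<^bsub>H\<^esub> b) c = F a b (sL l \<otimes>\<^bsub>H\<^esub> c)"
      unfolding F_def by (rule conv_cong[of n]) (use * ge q in auto)
  qed
  also have "\<dots> = SL W m (\<lambda>m1 m3. SL W m1 (\<lambda>m1 m2.
      conv W act (conv B (\<otimes>\<^bsub>B\<^esub>) (\<lambda>p. f (m1 # p)) (\<lambda>p. g (m2 # p))) (\<lambda>p. e (m3 # p)) q))"
    by (intro tsum_cong HOL.refl F_alt)
  also have "\<dots> = conv W act (conv B (\<otimes>\<^bsub>B\<^esub>) f g) e p"
    unfolding p conv.simps
    using q by (intro tsum_cong HOL.refl conv_tsum1[OF action, where n = n, symmetric] conv_closed[OF self, where n = n]) auto
  finally show ?case .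
qed

lemma linked_tsum1:
  assumes "ring_action B W act"
    and "\<And>a b. a \<in> carrier P \<Longrightarrow> b \<in> carrier Q \<Longrightarrow> linked n W act (F a b) g"
    and "\<And>a b. a \<in> carrier P \<Longrightarrow> b \<in> carrier Q \<Longrightarrow> multi_add n B (F a b)" "multi_add n W g"
  shows "linked n W act (\<lambda>p. tsum P Q B U (\<lambda>a b. F a b p)) g"
  using assms(2-)
proof (induction n arbitrary: F g)
  case (Suc n)
  have cl: "F a b (m # p) \<in> carrier B"
    if "a \<in> carrier P" "b \<in> carrier Q" "m \<in> carrier H" "p \<in> pts n" for a b m p
    using that multi_add_closed[OF Suc.prems(2), of a b "m # p"] by auto
  show ?case unfolding linked.simps
  proof (intro ballI conjI Suc.IH)
    fix m m' l p assume *: "m \<in> carrier H" "m' \<in> carrier H" "l \<in> carrier L" "p \<in> pts n"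
    have eq: "conv W act (\<lambda>p. tsum P Q B U (\<lambda>a b. F a b (x # p))) (\<lambda>p. g (y # p)) p
      = tsum P Q W U (\<lambda>a b. conv W act (\<lambda>p. F a b (x # p)) (\<lambda>p. g (y # p)) p)"
      if "x \<in> carrier H" "y \<in> carrier H" for x y
      using that * Suc.prems(3) by (intro conv_tsum1[OF assms(1), where n = n] cl) (auto intro: multi_add_closed)
    show "conv W act (\<lambda>p. tsum P Q B U (\<lambda>a b. F a b ((tL l \<otimes>\<^bsub>H\<^esub> m) # p))) (\<lambda>p. g (m' # p)) p
      = conv W act (\<lambda>p. tsum P Q B U (\<lambda>a b. F a b (m # p))) (\<lambda>p. g ((sL l \<otimes>\<^bsub>H\<^esub> m') # p)) p"
      using * Suc.prems(1) by (simp add: eq)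
  qed (use Suc.prems in auto)
qed auto

lemma linked_tsum2:
  assumes "ring_action B W act"
    and "\<And>a b. a \<in> carrier P \<Longrightarrow> b \<in> carrier Q \<Longrightarrow> linked n W act f (G a b)"
    and "\<And>a b. a \<in> carrier P \<Longrightarrow> b \<in> carrier Q \<Longrightarrow> multi_add n W (G a b)" "multi_add n B f"
  shows "linked n W act f (\<lambda>p. tsum P Q W U (\<lambda>a b. G a b p))"
  using assms(2-)
proof (induction n arbitrary: f G)
  case (Suc n)
  have cl: "G a b (m # p) \<in> carrier W"
    if "a \<in> carrier P" "b \<in> carrier Q" "m \<in> carrier H" "p \<in> pts n" for a b m p
    using that multi_add_closed[OF Suc.prems(2), of a b "m # p"] by auto
  show ?case unfolding linked.simps
  proof (intro ballI conjI Suc.IH)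
    fix m m' l p assume *: "m \<in> carrier H" "m' \<in> carrier H" "l \<in> carrier L" "p \<in> pts n"
    have eq: "conv W act (\<lambda>p. f (x # p)) (\<lambda>p. tsum P Q W U (\<lambda>a b. G a b (y # p))) p
      = tsum P Q W U (\<lambda>a b. conv W act (\<lambda>p. f (x # p)) (\<lambda>p. G a b (y # p)) p)"
      if "x \<in> carrier H" "y \<in> carrier H" for x y
      using that * Suc.prems(3) by (intro conv_tsum2[OF assms(1), where n = n] cl) (auto intro: multi_add_closed)
    show "conv W act (\<lambda>p. f ((tL l \<otimes>\<^bsub>H\<^esub> m) # p)) (\<lambda>p. tsum P Q W U (\<lambda>a b. G a b (m' # p))) p
      = conv W act (\<lambda>p. f (m # p)) (\<lambda>p. tsum P Q W U (\<lambda>a b. G a b ((sL l \<otimes>\<^bsub>H\<^esub> m') # p))) p"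
      using * Suc.prems(1) by (simp add: eq)
  qed (use Suc.prems in auto)
qed auto

text \<open>Together with its counterpart this extends associativity to four factors. Since
  \<gamma>L(t_L(l) m) = m1 \<otimes> t_L(l) m2, the factor t_L(l) reaches the leg that g receives,
  and from there it passes to e.\<close>

lemma linked_conv1:
  assumes action: "ring_action B W act"
  assumes "multi_add n B f" "multi_add n B g" "multi_add n W e"
    and "linked n B (\<otimes>\<^bsub>B\<^esub>) f g" "linked n W act g e"
  shows "linked n W act (conv B (\<otimes>\<^bsub>B\<^esub>) f g) e"
  using assms(2-)
proof (induction n arbitrary: f g e)
  case (Suc n)
  interpret ring_action B W act by (rule action)
  have self: "ring_action B B (\<otimes>\<^bsub>B\<^esub>)" by (rule B.ring_action_self)
  note f = Suc.prems(1) and g = Suc.prems(2) and e = Suc.prems(3)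
    and fg = Suc.prems(4) and ge = Suc.prems(5)
  show ?case unfolding linked.simps
  proof (intro ballI conjI)
    fix m m' assume *: "m \<in> carrier H" "m' \<in> carrier H"
    show "linked n W act (\<lambda>p. conv B (\<otimes>\<^bsub>B\<^esub>) f g (m # p)) (\<lambda>p. e (m' # p))"
      unfolding conv.simps
      by (intro linked_tsum1[OF action] Suc.IH multi_add_conv[OF self])
        (use f g e fg ge * in auto)
    fix l p assume l: "l \<in> carrier L" "p \<in> pts n"
    have sum: "conv W act (\<lambda>p. conv B (\<otimes>\<^bsub>B\<^esub>) f g (a # p)) (\<lambda>p. e (b # p)) p
        = SL W a (\<lambda>a1 a2. conv W act (\<lambda>p. f (a1 # p)) (conv W act (\<lambda>p. g (a2 # p)) (\<lambda>p. e (b # p))) p)"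
      if ab: "a \<in> carrier H" "b \<in> carrier H" for a b
    proof -
      have "conv W act (\<lambda>p. conv B (\<otimes>\<^bsub>B\<^esub>) f g (a # p)) (\<lambda>p. e (b # p)) p
        = SL W a (\<lambda>a1 a2. conv W act (conv B (\<otimes>\<^bsub>B\<^esub>) (\<lambda>p. f (a1 # p)) (\<lambda>p. g (a2 # p))) (\<lambda>p. e (b # p)) p)"
        unfolding conv.simps
        by (intro conv_tsum1[OF action, where n = n] conv_closed[OF self, where n = n])
          (use f g e ab l in \<open>auto intro: multi_add_closed\<close>)
      also have "\<dots> = SL W a (\<lambda>a1 a2. conv W act (\<lambda>p. f (a1 # p)) (conv W act (\<lambda>p. g (a2 # p)) (\<lambda>p. e (b # p))) p)"
        by (intro tsum_cong HOL.refl conv_assoc[OF action, where n = n, symmetric])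
          (use f g e fg ge ab l in auto)
      finally show ?thesis .
    qed
    have bal: "balL W (\<lambda>a1 a2. conv W act (\<lambda>p. f (a1 # p)) (conv W act (\<lambda>p. g (a2 # p)) (\<lambda>p. e (m' # p))) p)"
    proof (rule bal_mapI)
      fix a b l' assume ab: "a \<in> carrier H" "b \<in> carrier H" "l' \<in> carrier L"
      have assoc: "conv W act (\<lambda>p. f (x # p)) (conv W act (\<lambda>p. g (y # p)) (\<lambda>p. e (m' # p))) p
        = conv W act (conv B (\<otimes>\<^bsub>B\<^esub>) (\<lambda>p. f (x # p)) (\<lambda>p. g (y # p))) (\<lambda>p. e (m' # p)) p"
        if "x \<in> carrier H" "y \<in> carrier H" for x y
        using that f g e fg ge * l by (intro conv_assoc[OF action, where n = n]) auto
      have "conv W act (conv B (\<otimes>\<^bsub>B\<^esub>) (\<lambda>p. f ((tL l' \<otimes>\<^bsub>H\<^esub> a) # p)) (\<lambda>p. g (b # p))) (\<lambda>p. e (m' # p)) p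
        = conv W act (conv B (\<otimes>\<^bsub>B\<^esub>) (\<lambda>p. f (a # p)) (\<lambda>p. g ((sL l' \<otimes>\<^bsub>H\<^esub> b) # p))) (\<lambda>p. e (m' # p)) p"
        by (rule conv_cong[of n]) (use ab fg l in auto)
      then show "conv W act (\<lambda>p. f ((tL l' \<otimes>\<^bsub>H\<^esub> a) # p)) (conv W act (\<lambda>p. g (b # p)) (\<lambda>p. e (m' # p))) p
        = conv W act (\<lambda>p. f (a # p)) (conv W act (\<lambda>p. g ((sL l' \<otimes>\<^bsub>H\<^esub> b) # p)) (\<lambda>p. e (m' # p))) p"
        using ab by (simp add: assoc)
    qed (use f g e * l in \<open>auto intro!: conv_add1[OF action, where n = n] conv_add2[OF action, where n = n]
        conv_closed[OF action, where n = n] intro: multi_add_closed\<close>)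
    have "conv W act (\<lambda>p. conv B (\<otimes>\<^bsub>B\<^esub>) f g ((tL l \<otimes>\<^bsub>H\<^esub> m) # p)) (\<lambda>p. e (m' # p)) p
      = SL W m (\<lambda>a1 a2. conv W act (\<lambda>p. f (a1 # p))
          (conv W act (\<lambda>p. g ((tL l \<otimes>\<^bsub>H\<^esub> a2) # p)) (\<lambda>p. e (m' # p))) p)"
      using * l by (simp add: sum SL_tL[OF W_group bal] del: conv.simps)
    also have "\<dots> = SL W m (\<lambda>a1 a2. conv W act (\<lambda>p. f (a1 # p))
          (conv W act (\<lambda>p. g (a2 # p)) (\<lambda>p. e ((sL l \<otimes>\<^bsub>H\<^esub> m') # p))) p)"
      by (intro tsum_cong[OF HOL.refl], rule conv_cong[of n]) (use * l ge in auto)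
    finally show "conv W act (\<lambda>p. conv B (\<otimes>\<^bsub>B\<^esub>) f g ((tL l \<otimes>\<^bsub>H\<^esub> m) # p)) (\<lambda>p. e (m' # p)) p
      = conv W act (\<lambda>p. conv B (\<otimes>\<^bsub>B\<^esub>) f g (m # p)) (\<lambda>p. e ((sL l \<otimes>\<^bsub>H\<^esub> m') # p)) p"
      using * l by (simp add: sum del: conv.simps)
  qed
qed auto

text \<open>Here s_L(l) enters the first leg of m', the one that g receives. To bring f next to g
  the term is rebracketed by \<open>conv_assoc\<close>.\<close>

lemma linked_conv2:
  assumes action: "ring_action B W act"
  assumes "multi_add n B f" "multi_add n B g" "multi_add n W e"
    and "linked n B (\<otimes>\<^bsub>B\<^esub>) f g" "linked n W act g e"
  shows "linked n W act f (conv W act g e)"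
  using assms(2-)
proof (induction n arbitrary: f g e)
  case (Suc n)
  interpret ring_action B W act by (rule action)
  have self: "ring_action B B (\<otimes>\<^bsub>B\<^esub>)" by (rule B.ring_action_self)
  note f = Suc.prems(1) and g = Suc.prems(2) and e = Suc.prems(3)
    and fg = Suc.prems(4) and ge = Suc.prems(5)
  show ?case unfolding linked.simps
  proof (intro ballI conjI)
    fix m m' assume *: "m \<in> carrier H" "m' \<in> carrier H"
    show "linked n W act (\<lambda>p. f (m # p)) (\<lambda>p. conv W act g e (m' # p))"
      unfolding conv.simps
      by (intro linked_tsum2[OF action] Suc.IH multi_add_conv[OF action])
        (use f g e fg ge * in auto)
    fix l p assume l: "l \<in> carrier L" "p \<in> pts n"
    have sum: "conv W act (\<lambda>p. f (a # p)) (\<lambda>p. conv W act g e (b # p)) p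
        = SL W b (\<lambda>b1 b2. conv W act (\<lambda>p. f (a # p)) (conv W act (\<lambda>p. g (b1 # p)) (\<lambda>p. e (b2 # p))) p)"
      if ab: "a \<in> carrier H" "b \<in> carrier H" for a b
      unfolding conv.simps
      by (intro conv_tsum2[OF action, where n = n] conv_closed[OF action, where n = n])
        (use f g e ab l in \<open>auto intro: multi_add_closed\<close>)
    have bal: "balL W (\<lambda>b1 b2. conv W act (\<lambda>p. f (m # p)) (conv W act (\<lambda>p. g (b1 # p)) (\<lambda>p. e (b2 # p))) p)"
    proof (rule bal_mapI)
      fix a b l' assume ab: "a \<in> carrier H" "b \<in> carrier H" "l' \<in> carrier L"
      show "conv W act (\<lambda>p. f (m # p)) (conv W act (\<lambda>p. g ((tL l' \<otimes>\<^bsub>H\<^esub> a) # p)) (\<lambda>p. e (b # p))) p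
        = conv W act (\<lambda>p. f (m # p)) (conv W act (\<lambda>p. g (a # p)) (\<lambda>p. e ((sL l' \<otimes>\<^bsub>H\<^esub> b) # p))) p"
        by (rule conv_cong[of n]) (use ab ge l in auto)
    qed (use f g e * l in \<open>auto intro!: conv_add1[OF action, where n = n] conv_add2[OF action, where n = n]
        conv_closed[OF action, where n = n] intro: multi_add_closed\<close>)
    have assoc: "conv W act (\<lambda>p. f (x # p)) (conv W act (\<lambda>p. g (y # p)) (\<lambda>p. e (z # p))) p
      = conv W act (conv B (\<otimes>\<^bsub>B\<^esub>) (\<lambda>p. f (x # p)) (\<lambda>p. g (y # p))) (\<lambda>p. e (z # p)) p"
      if "x \<in> carrier H" "y \<in> carrier H" "z \<in> carrier H" for x y z
      using that f g e fg ge * l by (intro conv_assoc[OF action, where n = n]) auto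
    have move: "conv W act (conv B (\<otimes>\<^bsub>B\<^esub>) (\<lambda>p. f ((tL l \<otimes>\<^bsub>H\<^esub> m) # p)) (\<lambda>p. g (y # p))) (\<lambda>p. e (z # p)) p
      = conv W act (conv B (\<otimes>\<^bsub>B\<^esub>) (\<lambda>p. f (m # p)) (\<lambda>p. g ((sL l \<otimes>\<^bsub>H\<^esub> y) # p))) (\<lambda>p. e (z # p)) p"
      if "y \<in> carrier H" "z \<in> carrier H" for y z
      by (rule conv_cong[of n]) (use that * l fg in auto)
    show "conv W act (\<lambda>p. f ((tL l \<otimes>\<^bsub>H\<^esub> m) # p)) (\<lambda>p. conv W act g e (m' # p)) p
      = conv W act (\<lambda>p. f (m # p)) (\<lambda>p. conv W act g e ((sL l \<otimes>\<^bsub>H\<^esub> m') # p)) p"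
      using * l SL_sL[OF W_group bal, of m' l] by (simp add: sum assoc move del: conv.simps)
  qed
qed auto

text \<open>The list holds the arguments in reverse order: its head, whose coproduct is summed
  outermost, is the last argument. Thus a convolution evaluated at \<open>[k, h]\<close> sums over h
  inside the sum over k, the order forced by the left Takeuchi condition.\<close>

definition fn1 where "fn1 f p = f (p ! 0)"
definition fn2 where "fn2 f p = f (p ! 1) (p ! 0)"
definition fn3 where "fn3 f p = f (p ! 2) (p ! 1) (p ! 0)"

lemma fn_simps [simp]:
  "fn1 f [h] = f h" "fn2 f' [k, h] = f' h k" "fn3 f'' [m, k, h] = f'' h k m"
  by (simp_all add: fn1_def fn2_def fn3_def)

lemma fn_Cons [simp]:
  "(\<lambda>p. fn2 f' (k # p)) = fn1 (\<lambda>h. f' h k)" "(\<lambda>p. fn3 f'' (m # p)) = fn2 (\<lambda>h k. f'' h k m)"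
  by (auto simp: fn1_def fn2_def fn3_def)

lemma multi_add_fn1: "multi_add (Suc 0) W (fn1 f)" if "add_map H W f"
  using that by (auto simp: add_map_closed)

lemma multi_add_fn2: "multi_add (Suc (Suc 0)) W (fn2 f)"
  if "\<And>h. h \<in> carrier H \<Longrightarrow> add_map H W (f h)" "\<And>k. k \<in> carrier H \<Longrightarrow> add_map H W (\<lambda>h. f h k)"
  using that by (auto elim!: pts_SucE intro: add_map_closed[OF that(1)])

lemma multi_add_fn3: "multi_add (Suc (Suc (Suc 0))) W (fn3 f)"
  if "\<And>h k. h \<in> carrier H \<Longrightarrow> k \<in> carrier H \<Longrightarrow> add_map H W (f h k)"
    "\<And>h m. h \<in> carrier H \<Longrightarrow> m \<in> carrier H \<Longrightarrow> add_map H W (\<lambda>k. f h k m)"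
    "\<And>k m. k \<in> carrier H \<Longrightarrow> m \<in> carrier H \<Longrightarrow> add_map H W (\<lambda>h. f h k m)"
  using that by (auto elim!: pts_SucE intro: add_map_closed[OF that(1)])

lemma linked_fn1:
  assumes "\<And>h h' l. h \<in> carrier H \<Longrightarrow> h' \<in> carrier H \<Longrightarrow> l \<in> carrier L
    \<Longrightarrow> act (f (tL l \<otimes>\<^bsub>H\<^esub> h)) (g h') = act (f h) (g (sL l \<otimes>\<^bsub>H\<^esub> h'))"
  shows "linked (Suc 0) W act (fn1 f) (fn1 g)"
  using assms by simp

lemma linked_fn2:
  assumes "\<And>h h' k k' l. h \<in> carrier H \<Longrightarrow> h' \<in> carrier H \<Longrightarrow> k \<in> carrier H \<Longrightarrow> k' \<in> carrier H
      \<Longrightarrow> l \<in> carrier L \<Longrightarrow> act (f (tL l \<otimes>\<^bsub>H\<^esub> h) k) (g h' k') = act (f h k) (g (sL l \<otimes>\<^bsub>H\<^esub> h') k')"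
    and "\<And>h k k' l. h \<in> carrier H \<Longrightarrow> k \<in> carrier H \<Longrightarrow> k' \<in> carrier H \<Longrightarrow> l \<in> carrier L
      \<Longrightarrow> SL W h (\<lambda>h1 h2. act (f h1 (tL l \<otimes>\<^bsub>H\<^esub> k)) (g h2 k'))
        = SL W h (\<lambda>h1 h2. act (f h1 k) (g h2 (sL l \<otimes>\<^bsub>H\<^esub> k')))"
  shows "linked (Suc (Suc 0)) W act (fn2 f) (fn2 g)"
  using assms by (auto elim!: pts_SucE)

lemma linked_fn3:
  assumes "\<And>m m'. m \<in> carrier H \<Longrightarrow> m' \<in> carrier H
      \<Longrightarrow> linked (Suc (Suc 0)) W act (fn2 (\<lambda>h k. f h k m)) (fn2 (\<lambda>h k. g h k m'))"
    and "\<And>h k m m' l. h \<in> carrier H \<Longrightarrow> k \<in> carrier H \<Longrightarrow> m \<in> carrier H \<Longrightarrow> m' \<in> carrier H \<Longrightarrow> l \<in> carrier L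
      \<Longrightarrow> SL W k (\<lambda>k1 k2. SL W h (\<lambda>h1 h2. act (f h1 k1 (tL l \<otimes>\<^bsub>H\<^esub> m)) (g h2 k2 m')))
        = SL W k (\<lambda>k1 k2. SL W h (\<lambda>h1 h2. act (f h1 k1 m) (g h2 k2 (sL l \<otimes>\<^bsub>H\<^esub> m'))))"
  shows "linked (Suc (Suc (Suc 0))) W act (fn3 f) (fn3 g)"
  using assms by (subst linked.simps) (auto simp del: linked.simps elim!: pts_SucE)

text \<open>A factor in front of m is transferred to the right of k, where the Takeuchi condition
  applies. That condition asks for a summand balanced in k, and this is \<open>conv_bal\<close> for
  the first two variables.\<close>

lemma linked_fn3_diag:
  assumes "ring_action B W act"
    and lk: "\<And>m m'. m \<in> carrier H \<Longrightarrow> m' \<in> carrier H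
      \<Longrightarrow> linked (Suc (Suc 0)) W act (fn2 (\<lambda>h k. f h k m)) (fn2 (\<lambda>h k. g h k m'))"
    and f: "multi_add (Suc (Suc (Suc 0))) B (fn3 f)" and g: "multi_add (Suc (Suc (Suc 0))) W (fn3 g)"
    and "\<And>h k m l. h \<in> carrier H \<Longrightarrow> k \<in> carrier H \<Longrightarrow> m \<in> carrier H \<Longrightarrow> l \<in> carrier L
      \<Longrightarrow> f h k (tL l \<otimes>\<^bsub>H\<^esub> m) = f h (k \<otimes>\<^bsub>H\<^esub> tL l) m"
    and "\<And>h k m l. h \<in> carrier H \<Longrightarrow> k \<in> carrier H \<Longrightarrow> m \<in> carrier H \<Longrightarrow> l \<in> carrier L
      \<Longrightarrow> g h k (sL l \<otimes>\<^bsub>H\<^esub> m) = g h (k \<otimes>\<^bsub>H\<^esub> sL l) m"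
  shows "linked (Suc (Suc (Suc 0))) W act (fn3 f) (fn3 g)"
proof (rule linked_fn3[OF lk])
  interpret ring_action B W act by fact
  fix h k m m' l
  assume *: "h \<in> carrier H" "k \<in> carrier H" "m \<in> carrier H" "m' \<in> carrier H" "l \<in> carrier L"
  have "balL W (\<lambda>k1 k2. conv W act (\<lambda>p. fn2 (\<lambda>h k. f h k m) (k1 # p)) (\<lambda>p. fn2 (\<lambda>h k. g h k m') (k2 # p)) [h])"
    using f g * lk[of m m'] by (intro conv_bal[OF assms(1)]) auto
  then have "balL W (\<lambda>k1 k2. SL W h (\<lambda>h1 h2. act (f h1 k1 m) (g h2 k2 m')))"
    by simp
  from SL_takeuchi[OF W_group this *(2,5)]
  show "SL W k (\<lambda>k1 k2. SL W h (\<lambda>h1 h2. act (f h1 k1 (tL l \<otimes>\<^bsub>H\<^esub> m)) (g h2 k2 m')))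
    = SL W k (\<lambda>k1 k2. SL W h (\<lambda>h1 h2. act (f h1 k1 m) (g h2 k2 (sL l \<otimes>\<^bsub>H\<^esub> m'))))"
    using * assms(5,6) by simp
qed

end

section \<open>Measured rings and the left B-module structure of the tensor product of B and H over
  L\<close>

context measured_ring
begin

sublocale B: k_algebra K B by (rule B_algebra)

lemma B_group [simp]: "abelian_group B" by (rule B.abelian_group_axioms)

lemma iota_closed [simp]: "l \<in> carrier L \<Longrightarrow> \<iota> l \<in> carrier B"
  and iota_one [simp]: "\<iota> \<one>\<^bsub>L\<^esub> = \<one>\<^bsub>B\<^esub>"
  and iota_linear: "k_linear K L B \<iota>"
  and iota_mult: "l \<in> carrier L \<Longrightarrow> l' \<in> carrier L \<Longrightarrow> \<iota> (l \<otimes>\<^bsub>L\<^esub> l') = \<iota> l \<otimes>\<^bsub>B\<^esub> \<iota> l'"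
  using \<iota>_hom by (auto simp: alg_hom_def ring_hom_def)

lemma iota_add [add_map_intros]: "add_map M L f \<Longrightarrow> add_map M B (\<lambda>x. \<iota> (f x))"
  using k_linear_add_map[OF iota_linear] by (rule add_map_comp[rotated])

lemma piL_add [add_map_intros]: "add_map M H f \<Longrightarrow> add_map M L (\<lambda>x. \<pi>L (f x))"
  using corL.counit_add_map by (rule add_map_comp[rotated])

lemma meas_add1 [add_map_intros]: "b \<in> carrier B \<Longrightarrow> add_map M H f \<Longrightarrow> add_map M B (\<lambda>x. f x \<cdot> b)"
  using k_bilinear_add_map(2)[OF meas_bilinear] by (rule add_map_comp[rotated])

lemma meas_add2 [add_map_intros]: "h \<in> carrier H \<Longrightarrow> add_map M B f \<Longrightarrow> add_map M B (\<lambda>x. h \<cdot> f x)"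
  using k_bilinear_add_map(1)[OF meas_bilinear] by (rule add_map_comp[rotated])

lemma meas_closed [simp]: "h \<in> carrier H \<Longrightarrow> b \<in> carrier B \<Longrightarrow> h \<cdot> b \<in> carrier B"
  using k_bilinear_add_map(1)[OF meas_bilinear] by (rule add_map_closed)

lemmas [add_map_intros] = B.add_map_mult_left B.add_map_mult_right H.add_map_mult_left H.add_map_mult_right

lemma meas_mult_tsum:
  "h \<in> carrier H \<Longrightarrow> b \<in> carrier B \<Longrightarrow> b' \<in> carrier B
    \<Longrightarrow> h \<cdot> (b \<otimes>\<^bsub>B\<^esub> b') = SL B h (\<lambda>h1 h2. (h1 \<cdot> b) \<otimes>\<^bsub>B\<^esub> (h2 \<cdot> b'))"
  by (simp add: meas_mult corL.sweedler_comult)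

lemma meas_tsum:
  assumes "h \<in> carrier H" "\<And>x y. x \<in> carrier M \<Longrightarrow> y \<in> carrier N \<Longrightarrow> f x y \<in> carrier B"
  shows "h \<cdot> tsum M N B T f = tsum M N B T (\<lambda>x y. h \<cdot> f x y)"
  using assms by (intro tsum_hom k_bilinear_add_map(1)[OF meas_bilinear] B_group)

abbreviation BH where
  "BH \<equiv> tensor_product B H (carrier L) (\<lambda>b l. b \<otimes>\<^bsub>B\<^esub> \<iota> l) (\<lambda>l h. sL l \<otimes>\<^bsub>H\<^esub> h)"

sublocale BH: tensor_module B H "carrier L" "\<lambda>b l. b \<otimes>\<^bsub>B\<^esub> \<iota> l" "\<lambda>l h. sL l \<otimes>\<^bsub>H\<^esub> h" K
  by (intro tensor_module.intro tensor_pair.intro tensor_module_axioms.intro B.module_axioms)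
    (auto simp: B.smult_mult_left)

lemma BH_group [simp]: "abelian_group BH" by (rule BH.T_group)

lemmas BH_closed [simp] = BH.tens_closed
lemmas BH_add1 [add_map_intros] = bal_map_add1[OF BH.tens_bal]
lemmas BH_add2 [add_map_intros] = bal_map_add2[OF BH.tens_bal]

lemma BH_balanced:
  "b \<in> carrier B \<Longrightarrow> h \<in> carrier H \<Longrightarrow> l \<in> carrier L
    \<Longrightarrow> (b \<otimes>\<^bsub>B\<^esub> \<iota> l) \<boxtimes>\<^bsub>BH\<^esub> h = b \<boxtimes>\<^bsub>BH\<^esub> (sL l \<otimes>\<^bsub>H\<^esub> h)"
  by (rule bal_map_balanced[OF BH.tens_bal])

lemma iota_tens: "h \<in> carrier H \<Longrightarrow> l \<in> carrier L \<Longrightarrow> \<iota> l \<boxtimes>\<^bsub>BH\<^esub> h = \<one>\<^bsub>B\<^esub> \<boxtimes>\<^bsub>BH\<^esub> (sL l \<otimes>\<^bsub>H\<^esub> h)"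
  using BH_balanced[of "\<one>\<^bsub>B\<^esub>" h l] by simp

text \<open>Scalars of the tensor product act on B. They reach the factor H because c h = s_L(c 1)
  h, and balancing turns s_L(c 1) into \<iota>(c 1) = c 1.\<close>

lemma BH_smult_right:
  assumes "c \<in> carrier K" "b \<in> carrier B" "h \<in> carrier H"
  shows "b \<boxtimes>\<^bsub>BH\<^esub> (c \<odot>\<^bsub>H\<^esub> h) = c \<odot>\<^bsub>BH\<^esub> (b \<boxtimes>\<^bsub>BH\<^esub> h)"
proof -
  have "c \<odot>\<^bsub>H\<^esub> h = sL (c \<odot>\<^bsub>L\<^esub> \<one>\<^bsub>L\<^esub>) \<otimes>\<^bsub>H\<^esub> h"
    using sL_linear assms by (simp add: k_linear_def H.smult_mult_left)
  moreover have "\<iota> (c \<odot>\<^bsub>L\<^esub> \<one>\<^bsub>L\<^esub>) = c \<odot>\<^bsub>B\<^esub> \<one>\<^bsub>B\<^esub>"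
    using iota_linear assms by (simp add: k_linear_def)
  ultimately show ?thesis
    using assms BH_balanced[of b h "c \<odot>\<^bsub>L\<^esub> \<one>\<^bsub>L\<^esub>"]
    by (simp add: BH.smult_tens B.smult_mult_right)
qed

definition bact (infixr \<open>\<triangleright>\<close> 72) where
  "b \<triangleright> u = tsum B H BH u (\<lambda>c h. (b \<otimes>\<^bsub>B\<^esub> c) \<boxtimes>\<^bsub>BH\<^esub> h)"

lemma bact_bal:
  assumes "b \<in> carrier B"
  shows "BH.bal BH (\<lambda>c h. (b \<otimes>\<^bsub>B\<^esub> c) \<boxtimes>\<^bsub>BH\<^esub> h)"
  by (rule bal_mapI) (use assms in \<open>auto intro!: add_map_intros simp: BH_balanced simp flip: B.m_assoc\<close>)

lemma bact_tens [simp]: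
  "b \<in> carrier B \<Longrightarrow> c \<in> carrier B \<Longrightarrow> h \<in> carrier H \<Longrightarrow> b \<triangleright> (c \<boxtimes>\<^bsub>BH\<^esub> h) = (b \<otimes>\<^bsub>B\<^esub> c) \<boxtimes>\<^bsub>BH\<^esub> h"
  unfolding bact_def by (intro BH.tsum_tens bact_bal BH_group)

lemma bact_add_map: "b \<in> carrier B \<Longrightarrow> add_map BH BH ((\<triangleright>) b)"
  using BH.tsum_add_map[OF BH_group bact_bal] by (simp add: bact_def[abs_def])

sublocale act: ring_action B BH bact
proof (intro ring_action.intro ring_action_axioms.intro B.ring_axioms BH_group bact_add_map)
  show "add_map B BH (\<lambda>b. b \<triangleright> u)" for u
    unfolding bact_def by (auto intro!: add_map_intros)
  show "(b \<otimes>\<^bsub>B\<^esub> c) \<triangleright> u = b \<triangleright> c \<triangleright> u" if "b \<in> carrier B" "c \<in> carrier B" "u \<in> carrier BH" for b c u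
    by (rule BH.add_map_eqI[OF bact_add_map add_map_comp[OF bact_add_map bact_add_map]])
      (use that in \<open>auto simp: B.m_assoc\<close>)
  show "\<one>\<^bsub>B\<^esub> \<triangleright> u = u" if "u \<in> carrier BH" for u
    by (rule BH.add_map_eqI[OF bact_add_map add_map_id]) (use that in auto)
qed

lemmas actB = B.ring_action_self
lemmas actT = act.ring_action_axioms
lemmas bact_closed [simp] = act.act_closed

lemma smult_bact:
  assumes "c \<in> carrier K" "b \<in> carrier B" "u \<in> carrier BH"
  shows "(c \<odot>\<^bsub>B\<^esub> b) \<triangleright> u = c \<odot>\<^bsub>BH\<^esub> (b \<triangleright> u)" and "b \<triangleright> (c \<odot>\<^bsub>BH\<^esub> u) = c \<odot>\<^bsub>BH\<^esub> (b \<triangleright> u)"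
proof -
  have cb: "add_map BH BH (\<lambda>u. c \<odot>\<^bsub>BH\<^esub> (b \<triangleright> u))"
    by (rule add_map_comp[OF bact_add_map BH.smult_add_map]) (use assms in auto)
  have bc: "add_map BH BH (\<lambda>u. b \<triangleright> (c \<odot>\<^bsub>BH\<^esub> u))"
    by (rule add_map_comp[OF BH.smult_add_map bact_add_map]) (use assms in auto)
  show "(c \<odot>\<^bsub>B\<^esub> b) \<triangleright> u = c \<odot>\<^bsub>BH\<^esub> (b \<triangleright> u)"
    by (rule BH.add_map_eqI[OF bact_add_map cb])
      (use assms in \<open>auto simp: BH.smult_tens B.smult_mult_left\<close>)
  show "b \<triangleright> (c \<odot>\<^bsub>BH\<^esub> u) = c \<odot>\<^bsub>BH\<^esub> (b \<triangleright> u)"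
    by (rule BH.add_map_eqI[OF bc cb])
      (use assms in \<open>auto simp: BH.smult_tens B.smult_mult_right\<close>)
qed

text \<open>
  Balancedness in the second variable comes from the Takeuchi condition in \<open>linked_diag\<close>, and from
  inserting a factor \<open>h \<cdot> \<iota>(l)\<close> between \<open>f\<close> and \<open>g\<close> in \<open>linked_meas\<close>.
\<close>

lemma linked_diag:
  assumes "ring_action B W act"
    and "\<And>h. h \<in> carrier H \<Longrightarrow> add_map H B (f h)" "\<And>k. k \<in> carrier H \<Longrightarrow> add_map H B (\<lambda>h. f h k)"
    and "\<And>h. h \<in> carrier H \<Longrightarrow> add_map H W (g h)" "\<And>k. k \<in> carrier H \<Longrightarrow> add_map H W (\<lambda>h. g h k)"
    and "\<And>h k l. h \<in> carrier H \<Longrightarrow> k \<in> carrier H \<Longrightarrow> l \<in> carrier L \<Longrightarrow> f (tL l \<otimes>\<^bsub>H\<^esub> h) k = f h k \<otimes>\<^bsub>B\<^esub> \<iota> l"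
    and "\<And>h k l. h \<in> carrier H \<Longrightarrow> k \<in> carrier H \<Longrightarrow> l \<in> carrier L \<Longrightarrow> g (sL l \<otimes>\<^bsub>H\<^esub> h) k = act (\<iota> l) (g h k)"
    and "\<And>h k l. h \<in> carrier H \<Longrightarrow> k \<in> carrier H \<Longrightarrow> l \<in> carrier L \<Longrightarrow> f h (tL l \<otimes>\<^bsub>H\<^esub> k) = f (h \<otimes>\<^bsub>H\<^esub> tL l) k"
    and "\<And>h k l. h \<in> carrier H \<Longrightarrow> k \<in> carrier H \<Longrightarrow> l \<in> carrier L \<Longrightarrow> g h (sL l \<otimes>\<^bsub>H\<^esub> k) = g (h \<otimes>\<^bsub>H\<^esub> sL l) k"
  shows "linked (Suc (Suc 0)) W act (fn2 f) (fn2 g)"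
proof (rule linked_fn2)
  interpret ring_action B W act by fact
  note cl = add_map_closed[OF assms(2)] add_map_closed[OF assms(4)]
  show 1: "act (f (tL l \<otimes>\<^bsub>H\<^esub> h) k) (g h' k') = act (f h k) (g (sL l \<otimes>\<^bsub>H\<^esub> h') k')"
    if "h \<in> carrier H" "h' \<in> carrier H" "k \<in> carrier H" "k' \<in> carrier H" "l \<in> carrier L" for h h' k k' l
    using that by (simp add: assms(6,7) act_assoc cl)
  fix h k k' l assume *: "h \<in> carrier H" "k \<in> carrier H" "k' \<in> carrier H" "l \<in> carrier L"
  have "balL W (\<lambda>h1 h2. act (f h1 k) (g h2 k'))"
    by (intro bal_mapI add_map_intros 1) (use * assms(3,5) cl in auto)
  from SL_takeuchi[OF W_group this *(1,4)]
  show "SL W h (\<lambda>h1 h2. act (f h1 (tL l \<otimes>\<^bsub>H\<^esub> k)) (g h2 k'))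
    = SL W h (\<lambda>h1 h2. act (f h1 k) (g h2 (sL l \<otimes>\<^bsub>H\<^esub> k')))"
    using * by (simp add: assms(8,9))
qed

lemma linked_meas:
  assumes "ring_action B W act"
    and "\<And>h. h \<in> carrier H \<Longrightarrow> add_map H B (f h)" "\<And>k. k \<in> carrier H \<Longrightarrow> add_map H B (\<lambda>h. f h k)"
    and "\<And>h. h \<in> carrier H \<Longrightarrow> add_map H W (g h)" "\<And>k. k \<in> carrier H \<Longrightarrow> add_map H W (\<lambda>h. g h k)"
    and "\<And>h k l. h \<in> carrier H \<Longrightarrow> k \<in> carrier H \<Longrightarrow> l \<in> carrier L \<Longrightarrow> f (tL l \<otimes>\<^bsub>H\<^esub> h) k = f h k \<otimes>\<^bsub>B\<^esub> \<iota> l"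
    and "\<And>h k l. h \<in> carrier H \<Longrightarrow> k \<in> carrier H \<Longrightarrow> l \<in> carrier L \<Longrightarrow> g (sL l \<otimes>\<^bsub>H\<^esub> h) k = act (\<iota> l) (g h k)"
    and "\<And>h k l. h \<in> carrier H \<Longrightarrow> k \<in> carrier H \<Longrightarrow> l \<in> carrier L
      \<Longrightarrow> f h (tL l \<otimes>\<^bsub>H\<^esub> k) = SL B h (\<lambda>h1 h2. f h1 k \<otimes>\<^bsub>B\<^esub> (h2 \<cdot> \<iota> l))"
    and "\<And>h k l. h \<in> carrier H \<Longrightarrow> k \<in> carrier H \<Longrightarrow> l \<in> carrier L
      \<Longrightarrow> g h (sL l \<otimes>\<^bsub>H\<^esub> k) = SL W h (\<lambda>h1 h2. act (h1 \<cdot> \<iota> l) (g h2 k))"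
  shows "linked (Suc (Suc 0)) W act (fn2 f) (fn2 g)"
proof (rule linked_fn2)
  interpret ring_action B W act by fact
  note cl = add_map_closed[OF assms(2)] add_map_closed[OF assms(4)]
  show "act (f (tL l \<otimes>\<^bsub>H\<^esub> h) k) (g h' k') = act (f h k) (g (sL l \<otimes>\<^bsub>H\<^esub> h') k')"
    if "h \<in> carrier H" "h' \<in> carrier H" "k \<in> carrier H" "k' \<in> carrier H" "l \<in> carrier L" for h h' k k' l
    using that by (simp add: assms(6,7) act_assoc cl)
  fix h k k' l assume *: "h \<in> carrier H" "k \<in> carrier H" "k' \<in> carrier H" "l \<in> carrier L"
  have "conv W act (fn1 (\<lambda>h. f h k)) (conv W act (fn1 (\<lambda>h. h \<cdot> \<iota> l)) (fn1 (\<lambda>h. g h k'))) [h]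
    = conv W act (conv B (\<otimes>\<^bsub>B\<^esub>) (fn1 (\<lambda>h. f h k)) (fn1 (\<lambda>h. h \<cdot> \<iota> l))) (fn1 (\<lambda>h. g h k')) [h]"
    using * assms(3,5)
    by (intro conv_assoc[OF assms(1), where n = "Suc 0"] multi_add_fn1 linked_fn1)
      (auto simp: assms(6,7) meas_tL meas_sL act_assoc cl B.m_assoc intro!: add_map_intros)
  then show "SL W h (\<lambda>h1 h2. act (f h1 (tL l \<otimes>\<^bsub>H\<^esub> k)) (g h2 k'))
    = SL W h (\<lambda>h1 h2. act (f h1 k) (g h2 (sL l \<otimes>\<^bsub>H\<^esub> k')))"
    using * by (simp add: assms(8,9))
qed

text \<open>Supplies the condition of \<open>linked_meas\<close> on the left factor when that factor
  is a measured term h \<cdot> \<phi>(k).\<close>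

lemma meas_right_linked:
  assumes "\<And>k l. k \<in> carrier H \<Longrightarrow> l \<in> carrier L \<Longrightarrow> \<phi> (tL l \<otimes>\<^bsub>H\<^esub> k) = \<phi> k \<otimes>\<^bsub>B\<^esub> \<iota> l"
    and "\<And>k. k \<in> carrier H \<Longrightarrow> \<phi> k \<in> carrier B"
    and "h \<in> carrier H" "k \<in> carrier H" "l \<in> carrier L"
  shows "h \<cdot> \<phi> (tL l \<otimes>\<^bsub>H\<^esub> k) = SL B h (\<lambda>h1 h2. (h1 \<cdot> \<phi> k) \<otimes>\<^bsub>B\<^esub> (h2 \<cdot> \<iota> l))"
  using assms by (simp add: meas_mult_tsum)

end

section \<open>The crossed product algebra\<close>

context two_cocycle
begin

lemma sigma_add1 [add_map_intros]: "k \<in> carrier H \<Longrightarrow> add_map M H f \<Longrightarrow> add_map M B (\<lambda>x. \<sigma> (f x) k)"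
  using k_bilinear_add_map(2)[OF \<sigma>_bilinear] by (rule add_map_comp[rotated])

lemma sigma_add2 [add_map_intros]: "h \<in> carrier H \<Longrightarrow> add_map M H f \<Longrightarrow> add_map M B (\<lambda>x. \<sigma> h (f x))"
  using k_bilinear_add_map(1)[OF \<sigma>_bilinear] by (rule add_map_comp[rotated])

lemma sigma_closed [simp]: "h \<in> carrier H \<Longrightarrow> k \<in> carrier H \<Longrightarrow> \<sigma> h k \<in> carrier B"
  using k_bilinear_add_map(1)[OF \<sigma>_bilinear] by (rule add_map_closed)

lemma sigma_iota_tsum:
  "h \<in> carrier H \<Longrightarrow> k \<in> carrier H \<Longrightarrow> l \<in> carrier L
    \<Longrightarrow> \<sigma> h (sL l \<otimes>\<^bsub>H\<^esub> k) = SL B h (\<lambda>h1 h2. (h1 \<cdot> \<iota> l) \<otimes>\<^bsub>B\<^esub> \<sigma> h2 k)"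
  using \<sigma>_\<iota>[of h k l] by (simp add: corL.sweedler_comult)

text \<open>The second variable is balanced diagonally: t_L(l) passes from k to h because \<sigma>
  is balanced over L^op, and s_L(l) does so in the product h k by associativity.\<close>

lemma linked_sigma_mult:
  assumes "ring_action B W act" "add_map H W \<phi>"
    and "\<And>h l. h \<in> carrier H \<Longrightarrow> l \<in> carrier L \<Longrightarrow> \<phi> (sL l \<otimes>\<^bsub>H\<^esub> h) = act (\<iota> l) (\<phi> h)"
  shows "linked (Suc (Suc 0)) W act (fn2 \<sigma>) (fn2 (\<lambda>h k. \<phi> (h \<otimes>\<^bsub>H\<^esub> k)))"
  by (rule linked_diag[OF assms(1)])
    (auto simp: \<sigma>_tL \<sigma>_balanced assms(3) H.m_assoc intro!: add_map_intros add_map_comp[OF _ assms(2)])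

lemma linked_mult_mult:
  assumes "ring_action B W act" "add_map H B \<phi>" "add_map H W \<psi>"
    and "\<And>h l. h \<in> carrier H \<Longrightarrow> l \<in> carrier L \<Longrightarrow> \<phi> (tL l \<otimes>\<^bsub>H\<^esub> h) = \<phi> h \<otimes>\<^bsub>B\<^esub> \<iota> l"
    and "\<And>h l. h \<in> carrier H \<Longrightarrow> l \<in> carrier L \<Longrightarrow> \<psi> (sL l \<otimes>\<^bsub>H\<^esub> h) = act (\<iota> l) (\<psi> h)"
  shows "linked (Suc (Suc 0)) W act (fn2 (\<lambda>h k. \<phi> (h \<otimes>\<^bsub>H\<^esub> k))) (fn2 (\<lambda>h k. \<psi> (h \<otimes>\<^bsub>H\<^esub> k)))"
  by (rule linked_diag[OF assms(1)])
    (auto simp: assms(4,5) H.m_assoc intro!: add_map_intros add_map_comp[OF _ assms(2)]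
      add_map_comp[OF _ assms(3)])

lemma linked_meas_sigma:
  assumes "add_map H B \<phi>"
    and "\<And>k l. k \<in> carrier H \<Longrightarrow> l \<in> carrier L \<Longrightarrow> \<phi> (tL l \<otimes>\<^bsub>H\<^esub> k) = \<phi> k \<otimes>\<^bsub>B\<^esub> \<iota> l"
  shows "linked (Suc (Suc 0)) B (\<otimes>\<^bsub>B\<^esub>) (fn2 (\<lambda>h k. h \<cdot> \<phi> k)) (fn2 \<sigma>)"
  using add_map_closed[OF assms(1)]
  by (intro linked_meas actB)
    (auto simp: \<sigma>_sL sigma_iota_tsum meas_tL meas_right_linked[of \<phi>, OF assms(2)]
      intro!: add_map_intros assms(1))

lemma multi_add_sigma: "multi_add (Suc (Suc 0)) B (fn2 \<sigma>)"
  by (intro multi_add_fn2 add_map_intros)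

lemma multi_add_mult: "add_map H W \<phi> \<Longrightarrow> multi_add (Suc (Suc 0)) W (fn2 (\<lambda>h k. \<phi> (h \<otimes>\<^bsub>H\<^esub> k)))"
  by (intro multi_add_fn2; rule add_map_comp[of H H]) (auto intro!: add_map_intros)

text \<open>The product (1 # h)(1 # k) written out, ahead of any multiplication on
  \<open>BH\<close>.\<close>

definition P where
  "P h k = SL BH k (\<lambda>k1 k2. SL BH h (\<lambda>h1 h2. \<sigma> h1 k1 \<boxtimes>\<^bsub>BH\<^esub> (h2 \<otimes>\<^bsub>H\<^esub> k2)))"

abbreviation j where "j h \<equiv> \<one>\<^bsub>B\<^esub> \<boxtimes>\<^bsub>BH\<^esub> h"

lemma j_sL: "h \<in> carrier H \<Longrightarrow> l \<in> carrier L \<Longrightarrow> j (sL l \<otimes>\<^bsub>H\<^esub> h) = \<iota> l \<triangleright> j h"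
  by (simp add: iota_tens)

lemma j_add: "add_map H BH j"
  by (intro add_map_intros) auto

lemma linked_P: "linked (Suc (Suc 0)) BH bact (fn2 \<sigma>) (fn2 (\<lambda>h k. j (h \<otimes>\<^bsub>H\<^esub> k)))"
  by (intro linked_sigma_mult actT j_add j_sL)

lemma P_eq_conv:
  assumes "h \<in> carrier H" "k \<in> carrier H"
  shows "P h k = conv BH bact (fn2 \<sigma>) (fn2 (\<lambda>h k. j (h \<otimes>\<^bsub>H\<^esub> k))) [k, h]"
  by (simp add: P_def)

lemma P_bal:
  assumes "h \<in> carrier H"
  shows "balL BH (\<lambda>k1 k2. SL BH h (\<lambda>h1 h2. \<sigma> h1 k1 \<boxtimes>\<^bsub>BH\<^esub> (h2 \<otimes>\<^bsub>H\<^esub> k2)))"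
  using conv_bal[OF actT multi_add_sigma multi_add_mult[OF j_add] linked_P, of "[h]"] assms
  by (subst balL_cong) (auto intro!: tsum_cong)

lemma P_bal1:
  assumes "x \<in> carrier H" "y \<in> carrier H"
  shows "balL BH (\<lambda>h1 h2. \<sigma> h1 x \<boxtimes>\<^bsub>BH\<^esub> (h2 \<otimes>\<^bsub>H\<^esub> y))"
  using assms by (intro bal_mapI add_map_intros) (auto simp: \<sigma>_tL BH_balanced H.m_assoc)

lemma P_closed [simp]: "h \<in> carrier H \<Longrightarrow> k \<in> carrier H \<Longrightarrow> P h k \<in> carrier BH"
  unfolding P_def by (intro tsum_closed BH_group) auto

lemma P_add1 [add_map_intros]: "k \<in> carrier H \<Longrightarrow> add_map M H f \<Longrightarrow> add_map M BH (\<lambda>x. P (f x) k)"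
  unfolding P_def by (intro add_map_tsum SL_add_map P_bal1 BH_group)

lemma P_add2 [add_map_intros]: "h \<in> carrier H \<Longrightarrow> add_map M H f \<Longrightarrow> add_map M BH (\<lambda>x. P h (f x))"
  unfolding P_def by (intro SL_add_map P_bal BH_group)

lemma P_sL_left:
  assumes "h \<in> carrier H" "k \<in> carrier H" "l \<in> carrier L"
  shows "P (sL l \<otimes>\<^bsub>H\<^esub> h) k = \<iota> l \<triangleright> P h k"
  using assms
  by (simp add: P_def SL_sL P_bal1 act.act_tsum tsum_closed \<sigma>_sL)

lemma P_tL_right:
  assumes "h \<in> carrier H" "k \<in> carrier H" "l \<in> carrier L"
  shows "P h (tL l \<otimes>\<^bsub>H\<^esub> k) = P (h \<otimes>\<^bsub>H\<^esub> tL l) k"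
  using assms
  by (simp add: P_def SL_tL P_bal SL_mult_tL P_bal1 H.m_assoc)

text \<open>Condition (b) of a cocycle, followed by coassociativity in h. It is the reason why b
  \<iota>(l) # k and b # s_L(l) k have the same image under \<Theta>, which is thereby well
  defined.\<close>

lemma P_sL_right:
  assumes "h \<in> carrier H" "k \<in> carrier H" "l \<in> carrier L"
  shows "P h (sL l \<otimes>\<^bsub>H\<^esub> k) = SL BH h (\<lambda>h1 h2. (h1 \<cdot> \<iota> l) \<triangleright> P h2 k)"
proof -
  have "P h (sL l \<otimes>\<^bsub>H\<^esub> k)
    = SL BH k (\<lambda>k1 k2. conv BH bact (conv B (\<otimes>\<^bsub>B\<^esub>) (fn1 (\<lambda>h. h \<cdot> \<iota> l)) (fn1 (\<lambda>h. \<sigma> h k1)))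
        (fn1 (\<lambda>h. j (h \<otimes>\<^bsub>H\<^esub> k2))) [h])"
    using assms by (simp add: P_def SL_sL P_bal sigma_iota_tsum tsum_closed)
  also have "\<dots> = SL BH k (\<lambda>k1 k2. conv BH bact (fn1 (\<lambda>h. h \<cdot> \<iota> l))
      (conv BH bact (fn1 (\<lambda>h. \<sigma> h k1)) (fn1 (\<lambda>h. j (h \<otimes>\<^bsub>H\<^esub> k2)))) [h])"
    using assms
    by (intro tsum_cong HOL.refl conv_assoc[OF actT, where n = "Suc 0", symmetric] multi_add_fn1 linked_fn1)
      (auto simp: \<sigma>_sL \<sigma>_tL meas_tL B.m_assoc H.m_assoc BH_balanced intro!: add_map_intros)
  also have "\<dots> = SL BH h (\<lambda>h1 h2. SL BH k (\<lambda>k1 k2. (h1 \<cdot> \<iota> l) \<triangleright> SL BH h2 (\<lambda>h1 h2. \<sigma> h1 k1 \<boxtimes>\<^bsub>BH\<^esub> (h2 \<otimes>\<^bsub>H\<^esub> k2))))"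
    using assms by (simp, intro tsum_swap) (auto intro!: bact_closed tsum_closed)
  also have "\<dots> = SL BH h (\<lambda>h1 h2. (h1 \<cdot> \<iota> l) \<triangleright> P h2 k)"
    using assms by (simp add: P_def act.act_tsum tsum_closed)
  finally show ?thesis .
qed

lemma P_one_left: "k \<in> carrier H \<Longrightarrow> P \<one>\<^bsub>H\<^esub> k = j k"
  using SL_counit_left[OF BH_group j_add, of k]
  by (simp add: P_def SL_one P_bal1 \<sigma>_one_left iota_tens)

lemma P_one_right: "h \<in> carrier H \<Longrightarrow> P h \<one>\<^bsub>H\<^esub> = j h"
  using SL_counit_left[OF BH_group j_add, of h]
  by (simp add: P_def SL_one P_bal \<sigma>_one_right iota_tens)

definition \<Theta> where
  "\<Theta> h u = tsum B H BH u (\<lambda>b k. SL BH h (\<lambda>h1 h2. (h1 \<cdot> b) \<triangleright> P h2 k))"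

lemma meas_act_bal:
  assumes "b \<in> carrier B" "add_map H BH \<phi>"
    and "\<And>h l. h \<in> carrier H \<Longrightarrow> l \<in> carrier L \<Longrightarrow> \<phi> (sL l \<otimes>\<^bsub>H\<^esub> h) = \<iota> l \<triangleright> \<phi> h"
  shows "balL BH (\<lambda>h1 h2. (h1 \<cdot> b) \<triangleright> \<phi> h2)"
  using assms add_map_closed[OF assms(2)]
  by (intro bal_mapI add_map_intros) (auto simp: meas_tL act.act_assoc)

text \<open>One-variable associativity of convolution, applied to the splitting h \<cdot> (b c) =
  (h1 \<cdot> b)(h2 \<cdot> c).\<close>

lemma meas_act_assoc:
  assumes "h \<in> carrier H" "b \<in> carrier B" "c \<in> carrier B" "add_map H BH \<phi>"
    and "\<And>h l. h \<in> carrier H \<Longrightarrow> l \<in> carrier L \<Longrightarrow> \<phi> (sL l \<otimes>\<^bsub>H\<^esub> h) = \<iota> l \<triangleright> \<phi> h"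
  shows "SL BH h (\<lambda>h1 h2. (h1 \<cdot> (b \<otimes>\<^bsub>B\<^esub> c)) \<triangleright> \<phi> h2)
    = SL BH h (\<lambda>h1 h2. (h1 \<cdot> b) \<triangleright> SL BH h2 (\<lambda>h2 h3. (h2 \<cdot> c) \<triangleright> \<phi> h3))"
proof -
  have "conv BH bact (fn1 (\<lambda>h. h \<cdot> b)) (conv BH bact (fn1 (\<lambda>h. h \<cdot> c)) (fn1 \<phi>)) [h]
    = conv BH bact (conv B (\<otimes>\<^bsub>B\<^esub>) (fn1 (\<lambda>h. h \<cdot> b)) (fn1 (\<lambda>h. h \<cdot> c))) (fn1 \<phi>) [h]"
    using assms add_map_closed[OF assms(4)]
    by (intro conv_assoc[OF actT, where n = "Suc 0"] multi_add_fn1 linked_fn1)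
      (auto simp: meas_tL meas_sL B.m_assoc act.act_assoc intro!: add_map_intros)
  then show ?thesis using assms by (simp add: meas_mult_tsum)
qed

lemma Theta_bal:
  assumes "h \<in> carrier H"
  shows "BH.bal BH (\<lambda>b k. SL BH h (\<lambda>h1 h2. (h1 \<cdot> b) \<triangleright> P h2 k))"
proof (intro bal_mapI add_map_intros)
  show "SL BH h (\<lambda>h1 h2. (h1 \<cdot> (b \<otimes>\<^bsub>B\<^esub> \<iota> l)) \<triangleright> P h2 k) = SL BH h (\<lambda>h1 h2. (h1 \<cdot> b) \<triangleright> P h2 (sL l \<otimes>\<^bsub>H\<^esub> k))"
    if "b \<in> carrier B" "k \<in> carrier H" "l \<in> carrier L" for b k l
    using that assms meas_act_assoc[of h b "\<iota> l" "\<lambda>h. P h k"]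
    by (simp add: P_sL_right P_add1 add_map_id P_sL_left)
qed auto

lemma Theta_tens [simp]:
  "h \<in> carrier H \<Longrightarrow> b \<in> carrier B \<Longrightarrow> k \<in> carrier H
    \<Longrightarrow> \<Theta> h (b \<boxtimes>\<^bsub>BH\<^esub> k) = SL BH h (\<lambda>h1 h2. (h1 \<cdot> b) \<triangleright> P h2 k)"
  unfolding \<Theta>_def by (intro BH.tsum_tens Theta_bal BH_group)

lemma Theta_add_map: "h \<in> carrier H \<Longrightarrow> add_map BH BH (\<Theta> h)"
  using BH.tsum_add_map[OF BH_group Theta_bal] by (simp add: \<Theta>_def[abs_def])

lemma Theta_add2 [add_map_intros]: "h \<in> carrier H \<Longrightarrow> add_map M BH f \<Longrightarrow> add_map M BH (\<lambda>x. \<Theta> h (f x))"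
  using Theta_add_map by (rule add_map_comp[rotated])

lemma Theta_closed [simp]: "h \<in> carrier H \<Longrightarrow> u \<in> carrier BH \<Longrightarrow> \<Theta> h u \<in> carrier BH"
  using Theta_add_map by (rule add_map_closed)

lemma Theta_add1 [add_map_intros]: "add_map M H f \<Longrightarrow> add_map M BH (\<lambda>x. \<Theta> (f x) u)"
  unfolding \<Theta>_def
  by (intro add_map_tsum SL_add_map meas_act_bal P_add1 add_map_id BH_group P_sL_left)

lemma Theta_tsum:
  assumes "h \<in> carrier H" "\<And>x y. x \<in> carrier M \<Longrightarrow> y \<in> carrier N \<Longrightarrow> f x y \<in> carrier BH"
  shows "\<Theta> h (tsum M N BH T f) = tsum M N BH T (\<lambda>x y. \<Theta> h (f x y))"
  using assms by (intro tsum_hom Theta_add_map BH_group)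

lemma Theta_j: "h \<in> carrier H \<Longrightarrow> k \<in> carrier H \<Longrightarrow> \<Theta> h (j k) = P h k"
  using SL_counit_left[OF BH_group, of "\<lambda>h. P h k" h]
  by (simp add: meas_one P_sL_left P_add1 add_map_id)

lemma Theta_sL:
  assumes "h \<in> carrier H" "l \<in> carrier L" "u \<in> carrier BH"
  shows "\<Theta> (sL l \<otimes>\<^bsub>H\<^esub> h) u = \<iota> l \<triangleright> \<Theta> h u"
  using assms
  by (simp add: \<Theta>_def SL_sL meas_act_bal P_add1 add_map_id P_sL_left meas_sL act.act_tsum
      tsum_closed act.act_assoc)

lemma Theta_bact:
  assumes "h \<in> carrier H" "b \<in> carrier B" "u \<in> carrier BH"
  shows "\<Theta> h (b \<triangleright> u) = SL BH h (\<lambda>h1 h2. (h1 \<cdot> b) \<triangleright> \<Theta> h2 u)"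
proof (rule BH.add_map_eqI[OF _ _ BH_group _ assms(3)])
  show "add_map BH BH (\<lambda>u. \<Theta> h (b \<triangleright> u))"
    using assms by (intro add_map_intros) auto
  show "add_map BH BH (\<lambda>u. SL BH h (\<lambda>h1 h2. (h1 \<cdot> b) \<triangleright> \<Theta> h2 u))"
    using assms by (intro add_map_intros) auto
  show "\<Theta> h (b \<triangleright> (c \<boxtimes>\<^bsub>BH\<^esub> k)) = SL BH h (\<lambda>h1 h2. (h1 \<cdot> b) \<triangleright> \<Theta> h2 (c \<boxtimes>\<^bsub>BH\<^esub> k))"
    if "c \<in> carrier B" "k \<in> carrier H" for c k
    using that assms meas_act_assoc[of h b c "\<lambda>h. P h k"]
    by (simp add: P_add1 add_map_id P_sL_left)
qed

lemma cocycle_conv: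
  assumes "h \<in> carrier H" "k \<in> carrier H" "m \<in> carrier H"
  shows "conv B (\<otimes>\<^bsub>B\<^esub>) (fn3 (\<lambda>h k m. h \<cdot> \<sigma> k m)) (fn3 (\<lambda>h k m. \<sigma> h (k \<otimes>\<^bsub>H\<^esub> m))) [m, k, h]
    = conv B (\<otimes>\<^bsub>B\<^esub>) (fn2 \<sigma>) (fn2 (\<lambda>h k. \<sigma> (h \<otimes>\<^bsub>H\<^esub> k) m)) [k, h]"
  using \<sigma>_cocycle[OF assms] assms by (simp add: corL.sweedler_comult)

lemma multi_add_cocycle:
  "multi_add (Suc (Suc (Suc 0))) B (fn3 (\<lambda>h k m. h \<cdot> \<sigma> k m))"
  "multi_add (Suc (Suc (Suc 0))) B (fn3 (\<lambda>h k m. \<sigma> h (k \<otimes>\<^bsub>H\<^esub> m)))"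
  by (intro multi_add_fn3 add_map_intros; auto)+

lemma multi_add_j_mult: "multi_add (Suc (Suc (Suc 0))) BH (fn3 (\<lambda>h k m. j (h \<otimes>\<^bsub>H\<^esub> (k \<otimes>\<^bsub>H\<^esub> m))))"
  by (intro multi_add_fn3 add_map_intros) auto

lemma linked_cocycle:
  "linked (Suc (Suc (Suc 0))) B (\<otimes>\<^bsub>B\<^esub>) (fn3 (\<lambda>h k m. h \<cdot> \<sigma> k m)) (fn3 (\<lambda>h k m. \<sigma> h (k \<otimes>\<^bsub>H\<^esub> m)))"
proof (rule linked_fn3_diag[OF actB _ multi_add_cocycle])
  fix m m' assume m: "m \<in> carrier H" "m' \<in> carrier H"
  show "linked (Suc (Suc 0)) B (\<otimes>\<^bsub>B\<^esub>) (fn2 (\<lambda>h k. h \<cdot> \<sigma> k m)) (fn2 (\<lambda>h k. \<sigma> h (k \<otimes>\<^bsub>H\<^esub> m')))"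
    using m
    by (intro linked_meas actB)
      (auto simp: \<sigma>_sL \<sigma>_tL sigma_iota_tsum meas_tL meas_mult_tsum H.m_assoc intro!: add_map_intros)
qed (auto simp: \<sigma>_balanced H.m_assoc)

lemma P_mult:
  assumes "h \<in> carrier H" "k \<in> carrier H" "m \<in> carrier H"
  shows "P h (k \<otimes>\<^bsub>H\<^esub> m) = conv BH bact (fn3 (\<lambda>h k m. \<sigma> h (k \<otimes>\<^bsub>H\<^esub> m)))
    (fn3 (\<lambda>h k m. j (h \<otimes>\<^bsub>H\<^esub> (k \<otimes>\<^bsub>H\<^esub> m)))) [m, k, h]"
  using assms by (simp add: P_def SL_mult P_bal)

lemma P_mult_left:
  assumes "h \<in> carrier H" "k \<in> carrier H" "m \<in> carrier H"
  shows "P (h \<otimes>\<^bsub>H\<^esub> k) m = SL BH m (\<lambda>m1 m2. conv BH bact (fn2 (\<lambda>h k. \<sigma> (h \<otimes>\<^bsub>H\<^esub> k) m1))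
    (fn2 (\<lambda>h k. j (h \<otimes>\<^bsub>H\<^esub> k \<otimes>\<^bsub>H\<^esub> m2))) [k, h])"
  using assms by (simp add: P_def SL_mult P_bal1)

lemma linked_sigma_P:
  "linked (Suc (Suc (Suc 0))) BH bact (fn3 (\<lambda>h k m. \<sigma> h (k \<otimes>\<^bsub>H\<^esub> m)))
    (fn3 (\<lambda>h k m. j (h \<otimes>\<^bsub>H\<^esub> (k \<otimes>\<^bsub>H\<^esub> m))))"
proof (rule linked_fn3_diag[OF actT _ multi_add_cocycle(2) multi_add_j_mult])
  fix m m' assume m: "m \<in> carrier H" "m' \<in> carrier H"
  show "linked (Suc (Suc 0)) BH bact (fn2 (\<lambda>h k. \<sigma> h (k \<otimes>\<^bsub>H\<^esub> m))) (fn2 (\<lambda>h k. j (h \<otimes>\<^bsub>H\<^esub> (k \<otimes>\<^bsub>H\<^esub> m'))))"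
    using m
    by (intro linked_diag actT)
      (auto simp: \<sigma>_sL \<sigma>_tL \<sigma>_balanced iota_tens H.m_assoc intro!: add_map_intros)
qed (auto simp: H.m_assoc)

text \<open>The composition law of the operators at u = 1 # m, and the place where the cocycle
  condition enters. In the triple convolution of h \<cdot> \<sigma>(k, m), \<sigma>(h, k m) and 1 #
  h k m the first two factors are replaced by \<sigma>(h, k) and \<sigma>(h k, m), and the last two
  are then regrouped into P(h k, m).\<close>

lemma Theta_P:
  assumes hk: "h \<in> carrier H" "k \<in> carrier H" "m \<in> carrier H"
  shows "\<Theta> h (P k m) = SL BH k (\<lambda>k1 k2. SL BH h (\<lambda>h1 h2. \<sigma> h1 k1 \<triangleright> P (h2 \<otimes>\<^bsub>H\<^esub> k2) m))"
proof -
  let ?a = "fn3 (\<lambda>h k m. h \<cdot> \<sigma> k m)" and ?c = "fn3 (\<lambda>h k m. \<sigma> h (k \<otimes>\<^bsub>H\<^esub> m))"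
    and ?e = "fn3 (\<lambda>h k m. j (h \<otimes>\<^bsub>H\<^esub> (k \<otimes>\<^bsub>H\<^esub> m)))"
  have "\<Theta> h (P k m) = conv BH bact ?a (fn3 (\<lambda>h k m. P h (k \<otimes>\<^bsub>H\<^esub> m))) [m, k, h]"
    using hk by (simp add: P_def[of k] Theta_tsum tsum_closed)
  also have "\<dots> = conv BH bact ?a (conv BH bact ?c ?e) [m, k, h]"
    using hk by (intro conv_cong[of "Suc (Suc (Suc 0))"]) (auto simp: P_mult simp del: conv.simps elim!: pts_SucE)
  also have "\<dots> = conv BH bact (conv B (\<otimes>\<^bsub>B\<^esub>) ?a ?c) ?e [m, k, h]"
    using hk by (intro conv_assoc[OF actT, where n = "Suc (Suc (Suc 0))"] multi_add_cocycle multi_add_j_mult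
        linked_cocycle linked_sigma_P) auto
  also have "\<dots> = SL BH m (\<lambda>m1 m2. conv BH bact (\<lambda>p. conv B (\<otimes>\<^bsub>B\<^esub>) ?a ?c (m1 # p)) (\<lambda>p. ?e (m2 # p)) [k, h])"
    by (rule conv.simps)
  \<comment> \<open>After the cocycle condition the B-valued part contains m1 undivided, so for
    fixed legs of m only the variables h and k are convolved.\<close>
  also have "\<dots> = SL BH m (\<lambda>m1 m2. conv BH bact
      (conv B (\<otimes>\<^bsub>B\<^esub>) (fn2 \<sigma>) (fn2 (\<lambda>h k. \<sigma> (h \<otimes>\<^bsub>H\<^esub> k) m1)))
      (fn2 (\<lambda>h k. j (h \<otimes>\<^bsub>H\<^esub> k \<otimes>\<^bsub>H\<^esub> m2))) [k, h])"
    by (intro tsum_cong HOL.refl, rule conv_cong[of "Suc (Suc 0)"])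
      (use hk in \<open>auto simp: cocycle_conv H.m_assoc simp del: conv.simps elim!: pts_SucE\<close>)
  also have "\<dots> = SL BH m (\<lambda>m1 m2. conv BH bact (fn2 \<sigma>)
      (conv BH bact (fn2 (\<lambda>h k. \<sigma> (h \<otimes>\<^bsub>H\<^esub> k) m1)) (fn2 (\<lambda>h k. j (h \<otimes>\<^bsub>H\<^esub> k \<otimes>\<^bsub>H\<^esub> m2)))) [k, h])"
  proof (intro tsum_cong HOL.refl conv_assoc[OF actT, where n = "Suc (Suc 0)", symmetric] multi_add_sigma)
    fix m1 m2 assume m: "m1 \<in> carrier H" "m2 \<in> carrier H"
    show "linked (Suc (Suc 0)) B (\<otimes>\<^bsub>B\<^esub>) (fn2 \<sigma>) (fn2 (\<lambda>h k. \<sigma> (h \<otimes>\<^bsub>H\<^esub> k) m1))"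
      using m by (intro linked_sigma_mult[where \<phi> = "\<lambda>x. \<sigma> x m1"] actB add_map_intros) (auto simp: \<sigma>_sL)
    show "linked (Suc (Suc 0)) BH bact (fn2 (\<lambda>h k. \<sigma> (h \<otimes>\<^bsub>H\<^esub> k) m1)) (fn2 (\<lambda>h k. j (h \<otimes>\<^bsub>H\<^esub> k \<otimes>\<^bsub>H\<^esub> m2)))"
      using m by (intro linked_mult_mult[where \<phi> = "\<lambda>x. \<sigma> x m1" and \<psi> = "\<lambda>x. j (x \<otimes>\<^bsub>H\<^esub> m2)"] actT add_map_intros)
        (auto simp: \<sigma>_tL iota_tens H.m_assoc)
    show "multi_add (Suc (Suc 0)) B (fn2 (\<lambda>h k. \<sigma> (h \<otimes>\<^bsub>H\<^esub> k) m1))"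
      "multi_add (Suc (Suc 0)) BH (fn2 (\<lambda>h k. j (h \<otimes>\<^bsub>H\<^esub> k \<otimes>\<^bsub>H\<^esub> m2)))"
      using m by (intro multi_add_fn2 add_map_intros; simp)+
  qed (use hk in auto)
  also have "\<dots> = conv BH bact (fn2 \<sigma>) (\<lambda>p. SL BH m (\<lambda>m1 m2.
      conv BH bact (fn2 (\<lambda>h k. \<sigma> (h \<otimes>\<^bsub>H\<^esub> k) m1)) (fn2 (\<lambda>h k. j (h \<otimes>\<^bsub>H\<^esub> k \<otimes>\<^bsub>H\<^esub> m2))) p)) [k, h]"
    by (intro conv_tsum2[OF actT, where n = "Suc (Suc 0)", symmetric] conv_closed[OF actT, where n = "Suc (Suc 0)"])
      (use hk in \<open>auto elim!: pts_SucE\<close>)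
  also have "\<dots> = conv BH bact (fn2 \<sigma>) (fn2 (\<lambda>h k. P (h \<otimes>\<^bsub>H\<^esub> k) m)) [k, h]"
    by (rule conv_cong[of "Suc (Suc 0)"])
      (use hk in \<open>auto simp: P_mult_left simp del: conv.simps elim!: pts_SucE\<close>)
  finally show ?thesis by simp
qed

end

section \<open>Composition of the operators, and the crossed product as an algebra\<close>

context twisted_ring
begin

lemma meas_twisted_conv:
  assumes "h \<in> carrier H" "k \<in> carrier H" "b \<in> carrier B"
  shows "conv B (\<otimes>\<^bsub>B\<^esub>) (fn2 (\<lambda>h k. h \<cdot> k \<cdot> b)) (fn2 \<sigma>) [k, h]
    = conv B (\<otimes>\<^bsub>B\<^esub>) (fn2 \<sigma>) (fn2 (\<lambda>h k. (h \<otimes>\<^bsub>H\<^esub> k) \<cdot> b)) [k, h]"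
  using meas_twisted[OF assms] assms by (simp add: corL.sweedler_comult)

text \<open>On u = b # m, additivity and \<open>Theta_P\<close> leave the convolution of h \<cdot> k
  \<cdot> b, \<sigma> and P(h k, m). The twisting condition replaces the first two factors by
  \<sigma> and (h k) \<cdot> b, and multiplicativity of \<gamma>L reassembles \<Theta>.\<close>

lemma Theta_Theta:
  assumes hk: "h \<in> carrier H" "k \<in> carrier H" "u \<in> carrier BH"
  shows "\<Theta> h (\<Theta> k u) = SL BH k (\<lambda>k1 k2. SL BH h (\<lambda>h1 h2. \<sigma> h1 k1 \<triangleright> \<Theta> (h2 \<otimes>\<^bsub>H\<^esub> k2) u))"
proof (rule BH.add_map_eqI[OF _ _ BH_group _ assms(3)])
  show "add_map BH BH (\<lambda>u. \<Theta> h (\<Theta> k u))"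
    using hk by (intro add_map_intros)
  show "add_map BH BH (\<lambda>u. SL BH k (\<lambda>k1 k2. SL BH h (\<lambda>h1 h2. \<sigma> h1 k1 \<triangleright> \<Theta> (h2 \<otimes>\<^bsub>H\<^esub> k2) u)))"
    by (intro add_map_intros) auto
  fix b m assume bm: "b \<in> carrier B" "m \<in> carrier H"
  let ?a = "fn2 (\<lambda>h k. h \<cdot> k \<cdot> b)" and ?p = "fn2 (\<lambda>h k. P (h \<otimes>\<^bsub>H\<^esub> k) m)"
    and ?c = "fn2 (\<lambda>h k. (h \<otimes>\<^bsub>H\<^esub> k) \<cdot> b)"
  have madd: "multi_add (Suc (Suc 0)) B ?a" "multi_add (Suc (Suc 0)) B ?c" "multi_add (Suc (Suc 0)) BH ?p"
    using bm by (intro multi_add_fn2 add_map_intros; simp)+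
  have lk_as: "linked (Suc (Suc 0)) B (\<otimes>\<^bsub>B\<^esub>) ?a (fn2 \<sigma>)"
    using bm by (intro linked_meas_sigma add_map_intros) (auto simp: meas_tL)
  have lk_sp: "linked (Suc (Suc 0)) BH bact (fn2 \<sigma>) ?p"
    using bm by (intro linked_sigma_mult[where \<phi> = "\<lambda>x. P x m"] actT add_map_intros) (auto simp: P_sL_left)
  have lk_sc: "linked (Suc (Suc 0)) B (\<otimes>\<^bsub>B\<^esub>) (fn2 \<sigma>) ?c"
    using bm by (intro linked_sigma_mult[where \<phi> = "\<lambda>x. x \<cdot> b"] actB add_map_intros) (auto simp: meas_sL)
  have lk_cp: "linked (Suc (Suc 0)) BH bact ?c ?p"
    using bm by (intro linked_mult_mult[where \<phi> = "\<lambda>x. x \<cdot> b" and \<psi> = "\<lambda>x. P x m"] actT add_map_intros)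
      (auto simp: P_sL_left meas_tL)
  have "\<Theta> h (\<Theta> k (b \<boxtimes>\<^bsub>BH\<^esub> m)) = conv BH bact ?a (conv BH bact (fn2 \<sigma>) ?p) [k, h]"
    using hk bm by (simp add: Theta_tsum Theta_bact Theta_P)
  also have "\<dots> = conv BH bact (conv B (\<otimes>\<^bsub>B\<^esub>) ?a (fn2 \<sigma>)) ?p [k, h]"
    using hk by (intro conv_assoc[OF actT, where n = "Suc (Suc 0)"] madd multi_add_sigma lk_as lk_sp) auto
  also have "\<dots> = conv BH bact (conv B (\<otimes>\<^bsub>B\<^esub>) (fn2 \<sigma>) ?c) ?p [k, h]"
    by (rule conv_cong[of "Suc (Suc 0)"])
      (use hk bm in \<open>auto simp: meas_twisted_conv simp del: conv.simps elim!: pts_SucE\<close>)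
  also have "\<dots> = conv BH bact (fn2 \<sigma>) (conv BH bact ?c ?p) [k, h]"
    using hk by (intro conv_assoc[OF actT, where n = "Suc (Suc 0)", symmetric] madd multi_add_sigma lk_sc lk_cp) auto
  also have "\<dots> = conv BH bact (fn2 \<sigma>) (fn2 (\<lambda>h k. \<Theta> (h \<otimes>\<^bsub>H\<^esub> k) (b \<boxtimes>\<^bsub>BH\<^esub> m))) [k, h]"
    by (rule conv_cong[of "Suc (Suc 0)"])
      (use hk bm in \<open>auto simp: SL_mult meas_act_bal P_add1 add_map_id P_sL_left elim!: pts_SucE\<close>)
  finally show "\<Theta> h (\<Theta> k (b \<boxtimes>\<^bsub>BH\<^esub> m))
    = SL BH k (\<lambda>k1 k2. SL BH h (\<lambda>h1 h2. \<sigma> h1 k1 \<triangleright> \<Theta> (h2 \<otimes>\<^bsub>H\<^esub> k2) (b \<boxtimes>\<^bsub>BH\<^esub> m)))"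
    by simp
qed

definition cmult (infixl \<open>\<star>\<close> 70) where
  "u \<star> v = tsum B H BH u (\<lambda>b h. b \<triangleright> \<Theta> h v)"

lemma cmult_bal: "v \<in> carrier BH \<Longrightarrow> BH.bal BH (\<lambda>b h. b \<triangleright> \<Theta> h v)"
  by (intro bal_mapI add_map_intros) (auto simp: Theta_sL act.act_assoc)

lemma cmult_tens [simp]:
  "b \<in> carrier B \<Longrightarrow> h \<in> carrier H \<Longrightarrow> v \<in> carrier BH \<Longrightarrow> (b \<boxtimes>\<^bsub>BH\<^esub> h) \<star> v = b \<triangleright> \<Theta> h v"
  unfolding cmult_def by (intro BH.tsum_tens cmult_bal BH_group)

lemma cmult_add1 [add_map_intros]:
  "v \<in> carrier BH \<Longrightarrow> add_map M BH f \<Longrightarrow> add_map M BH (\<lambda>x. f x \<star> v)"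
  using BH.tsum_add_map[OF BH_group cmult_bal] unfolding cmult_def[symmetric]
  by (rule add_map_comp[rotated])

lemma cmult_add2 [add_map_intros]: "add_map M BH f \<Longrightarrow> add_map M BH (\<lambda>x. u \<star> f x)"
  unfolding cmult_def by (intro add_map_intros BH_group)

lemma cmult_closed [simp]: "v \<in> carrier BH \<Longrightarrow> u \<star> v \<in> carrier BH"
  using cmult_add2[OF add_map_id] by (rule add_map_closed)

lemma tsum_cmult:
  assumes "w \<in> carrier BH" "\<And>x y. x \<in> carrier M \<Longrightarrow> y \<in> carrier N \<Longrightarrow> f x y \<in> carrier BH"
  shows "tsum M N BH T f \<star> w = tsum M N BH T (\<lambda>x y. f x y \<star> w)"
  using assms by (intro tsum_hom[of BH BH "\<lambda>u. u \<star> w"] add_map_intros BH_group)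

lemma cmult_tsum:
  assumes "\<And>x y. x \<in> carrier M \<Longrightarrow> y \<in> carrier N \<Longrightarrow> f x y \<in> carrier BH"
  shows "w \<star> tsum M N BH T f = tsum M N BH T (\<lambda>x y. w \<star> f x y)"
  using assms by (intro tsum_hom add_map_intros BH_group)

lemma bact_cmult:
  assumes "b \<in> carrier B" "u \<in> carrier BH" "v \<in> carrier BH"
  shows "(b \<triangleright> u) \<star> v = b \<triangleright> (u \<star> v)"
  by (rule BH.add_map_eqI[where G = BH and \<phi> = "\<lambda>u. (b \<triangleright> u) \<star> v"])
    (use assms in \<open>auto intro!: add_map_intros simp: act.act_assoc\<close>)

text \<open>Associativity when the first factor is 1 # h. For the middle factor c # k it comes down
  to P(x, k) w = \<Theta>_x(\<Theta>_k(w)), which is \<open>Theta_Theta\<close>.\<close>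

lemma Theta_cmult:
  assumes "h \<in> carrier H" "v \<in> carrier BH" "w \<in> carrier BH"
  shows "\<Theta> h v \<star> w = \<Theta> h (v \<star> w)"
proof (rule BH.add_map_eqI[OF _ _ BH_group _ assms(2)])
  show "add_map BH BH (\<lambda>v. \<Theta> h v \<star> w)" "add_map BH BH (\<lambda>v. \<Theta> h (v \<star> w))"
    using assms by (intro add_map_intros; simp)+
  fix c k assume ck: "c \<in> carrier B" "k \<in> carrier H"
  have P: "P x k \<star> w = \<Theta> x (\<Theta> k w)" if "x \<in> carrier H" for x
    using that ck assms by (simp add: P_def tsum_cmult tsum_closed Theta_Theta)
  show "\<Theta> h (c \<boxtimes>\<^bsub>BH\<^esub> k) \<star> w = \<Theta> h ((c \<boxtimes>\<^bsub>BH\<^esub> k) \<star> w)"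
    using ck assms by (simp add: tsum_cmult bact_cmult P Theta_bact)
qed

lemma cmult_assoc:
  assumes "u \<in> carrier BH" "v \<in> carrier BH" "w \<in> carrier BH"
  shows "(u \<star> v) \<star> w = u \<star> (v \<star> w)"
  by (rule BH.add_map_eqI[where G = BH and \<phi> = "\<lambda>u. (u \<star> v) \<star> w" and \<psi> = "\<lambda>u. u \<star> (v \<star> w)"])
    (use assms in \<open>auto intro!: add_map_intros simp: bact_cmult Theta_cmult\<close>)

lemma Theta_one:
  assumes "v \<in> carrier BH"
  shows "\<Theta> \<one>\<^bsub>H\<^esub> v = v"
  by (rule BH.add_map_eqI[where G = BH and \<phi> = "\<Theta> \<one>\<^bsub>H\<^esub>" and \<psi> = "\<lambda>u. u"])
    (use assms in \<open>auto intro!: add_map_intros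
      simp: SL_one meas_act_bal P_add1 add_map_id P_sL_left P_one_left meas_unit\<close>)

lemma cmult_one_left: "v \<in> carrier BH \<Longrightarrow> j \<one>\<^bsub>H\<^esub> \<star> v = v"
  by (simp add: Theta_one act.act_one)

lemma cmult_one_right:
  assumes "u \<in> carrier BH"
  shows "u \<star> j \<one>\<^bsub>H\<^esub> = u"
  by (rule BH.add_map_eqI[where G = BH and \<phi> = "\<lambda>u. u \<star> j \<one>\<^bsub>H\<^esub>" and \<psi> = "\<lambda>u. u"])
    (use assms in \<open>auto intro!: add_map_intros simp: Theta_j P_one_right simp del: Theta_tens\<close>)

lemma smult_Theta:
  assumes "c \<in> carrier K" "h \<in> carrier H" "u \<in> carrier BH"
  shows "\<Theta> h (c \<odot>\<^bsub>BH\<^esub> u) = c \<odot>\<^bsub>BH\<^esub> \<Theta> h u"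
proof -
  have lin: "x \<cdot> (c \<odot>\<^bsub>B\<^esub> b) = c \<odot>\<^bsub>B\<^esub> (x \<cdot> b)" if "x \<in> carrier H" "b \<in> carrier B" for x b
    using meas_bilinear that assms by (auto simp: k_bilinear_def k_linear_def)
  have sum: "c \<odot>\<^bsub>BH\<^esub> tsum H H BH T f = tsum H H BH T (\<lambda>x y. c \<odot>\<^bsub>BH\<^esub> f x y)"
    if "\<And>x y. x \<in> carrier H \<Longrightarrow> y \<in> carrier H \<Longrightarrow> f x y \<in> carrier BH" for T f
    using that assms by (intro tsum_hom BH.smult_add_map BH_group)
  show ?thesis
    by (rule BH.add_map_eqI[where G = BH, OF add_map_comp[OF BH.smult_add_map Theta_add_map]
          add_map_comp[OF Theta_add_map BH.smult_add_map]])
      (use assms in \<open>auto simp: BH.smult_tens lin sum smult_bact\<close>)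
qed

lemma smult_cmult:
  assumes "c \<in> carrier K" "u \<in> carrier BH" "v \<in> carrier BH"
  shows "(c \<odot>\<^bsub>BH\<^esub> u) \<star> v = c \<odot>\<^bsub>BH\<^esub> (u \<star> v)"
    and "u \<star> (c \<odot>\<^bsub>BH\<^esub> v) = c \<odot>\<^bsub>BH\<^esub> (u \<star> v)"
proof -
  interpret BHm: module K BH by (rule BH.T_module)
  show "(c \<odot>\<^bsub>BH\<^esub> u) \<star> v = c \<odot>\<^bsub>BH\<^esub> (u \<star> v)"
    by (rule BH.add_map_eqI[where G = BH and \<phi> = "\<lambda>u. (c \<odot>\<^bsub>BH\<^esub> u) \<star> v" and \<psi> = "\<lambda>u. c \<odot>\<^bsub>BH\<^esub> (u \<star> v)"])
      (use assms in \<open>auto intro!: add_map_comp[OF _ BH.smult_add_map[OF assms(1)]] cmult_add1 add_map_id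
        simp: BH.smult_tens smult_bact\<close>)
  show "u \<star> (c \<odot>\<^bsub>BH\<^esub> v) = c \<odot>\<^bsub>BH\<^esub> (u \<star> v)"
    by (rule BH.add_map_eqI[where G = BH and \<phi> = "\<lambda>u. u \<star> (c \<odot>\<^bsub>BH\<^esub> v)" and \<psi> = "\<lambda>u. c \<odot>\<^bsub>BH\<^esub> (u \<star> v)"])
      (use assms in \<open>auto intro!: add_map_comp[OF _ BH.smult_add_map[OF assms(1)]] cmult_add1 add_map_id
        simp: BH.smult_tens smult_bact smult_Theta\<close>)
qed

text \<open>As a record it differs from \<open>BH\<close> in multiplication and unit only. Elements
  are therefore handled in \<open>BH\<close>, and \<open>A_simps\<close> and \<open>A_mult\<close>
  translate.\<close>

definition A where "A = crossed_product H L sL \<gamma>L B \<iota> meas \<sigma>"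

lemma A_simps [simp]:
  "carrier A = carrier BH" "zero A = zero BH" "add A = add BH" "smult A = smult BH"
  "tens A = tens BH" "one A = j \<one>\<^bsub>H\<^esub>"
  by (simp_all add: A_def crossed_product_def Let_def)

lemma A_mult [simp]:
  assumes "u \<in> carrier BH" "v \<in> carrier BH"
  shows "u \<otimes>\<^bsub>A\<^esub> v = u \<star> v"
proof -
  have "u \<otimes>\<^bsub>A\<^esub> v = tsum B H BH v (\<lambda>b' h'. tsum B H BH u (\<lambda>b h. SL BH h' (\<lambda>h'1 h'2.
      SL BH h (\<lambda>h1 h23. SL BH h23 (\<lambda>h2 h3.
        (b \<otimes>\<^bsub>B\<^esub> (h1 \<cdot> b') \<otimes>\<^bsub>B\<^esub> \<sigma> h2 h'1) \<boxtimes>\<^bsub>BH\<^esub> (h3 \<otimes>\<^bsub>H\<^esub> h'2))))))"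
    using assms by (simp add: A_def crossed_product_def Let_def BH.sweedler_eq_tsum corL.sweedler_comult)
  \<comment> \<open>The definition of the product sums over the right factor outermost,
    \<open>\<star>\<close> over the left one. The representatives are fixed, so the sums may be
    exchanged.\<close>
  also have "\<dots> = tsum B H BH u (\<lambda>b h. tsum B H BH v (\<lambda>b' h'. SL BH h (\<lambda>h1 h23. SL BH h' (\<lambda>h'1 h'2.
      SL BH h23 (\<lambda>h2 h3.
        (b \<otimes>\<^bsub>B\<^esub> (h1 \<cdot> b') \<otimes>\<^bsub>B\<^esub> \<sigma> h2 h'1) \<boxtimes>\<^bsub>BH\<^esub> (h3 \<otimes>\<^bsub>H\<^esub> h'2))))))"
    by (subst tsum_swap, simp, simp add: tsum_closed, intro tsum_cong HOL.refl tsum_swap)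
      (auto intro!: tsum_closed)
  also have "\<dots> = u \<star> v"
    by (simp add: cmult_def \<Theta>_def P_def act.act_tsum tsum_closed B.m_assoc)
  finally show ?thesis .
qed

lemma A_group [simp]: "abelian_group A"
proof -
  interpret BH': abelian_group BH by (rule BH_group)
  show ?thesis
    by (rule abelian_groupI) (auto simp: BH'.a_ac intro: BH'.l_neg)
qed

lemma A_algebra: "k_algebra K A"
proof (intro k_algebra.intro k_algebra_axioms.intro)
  interpret BH': module K BH by (rule BH.T_module)
  show "module K A"
    by (rule moduleI) (auto simp: BH'.smult_l_distr BH'.smult_r_distr BH'.smult_assoc1
        intro: module.axioms(1)[OF BH.T_module])
  show "ring A"
  proof (rule ringI[OF A_group])
    show "monoid A"
      by (rule monoidI) (auto simp: cmult_assoc cmult_one_right Theta_one act.act_one)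
  qed (auto simp: add_map_add[OF cmult_add1[OF _ add_map_id]] add_map_add[OF cmult_add2[OF add_map_id]])
qed (auto simp: smult_cmult add_map_closed[OF BH.smult_add_map])

end

section \<open>Coactions on the crossed product\<close>

locale crossed_hopf =
  twisted_ring K H L sL tL \<gamma>L \<pi>L B \<iota> meas \<sigma> +
  hopf_algebroid K H L sL tL \<gamma>L \<pi>L R sR tR \<gamma>R \<pi>R S
  for K :: "('k, 'y) ring_scheme"
    and H :: "('k, 'h) module"
    and L :: "('k, 'l) module" and sL tL \<gamma>L \<pi>L
    and B :: "('k, 'b) module" and \<iota>
    and meas :: "'h \<Rightarrow> 'b \<Rightarrow> 'b"  (infixr \<open>\<cdot>\<close> 75)
    and \<sigma> :: "'h \<Rightarrow> 'h \<Rightarrow> 'b"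
    and R :: "('k, 'r) module" and sR tR \<gamma>R \<pi>R S

text \<open>
  Both coactions of the crossed product are instances of the following, with \<open>X\<close> one of the two
  base algebras.
\<close>

locale crossed_coact =
  crossed_hopf K H L sL tL \<gamma>L \<pi>L B \<iota> meas \<sigma> R sR tR \<gamma>R \<pi>R S +
  X: coring K X H laX raX \<gamma>X \<epsilon>X
  for K :: "('k, 'y) ring_scheme"
    and H :: "('k, 'h) module"
    and L :: "('k, 'l) module" and sL tL \<gamma>L \<pi>L
    and B :: "('k, 'b) module" and \<iota>
    and meas :: "'h \<Rightarrow> 'b \<Rightarrow> 'b"  (infixr \<open>\<cdot>\<close> 75)
    and \<sigma> :: "'h \<Rightarrow> 'h \<Rightarrow> 'b"
    and R :: "('k, 'r) module" and sR tR \<gamma>R \<pi>R S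
    and X :: "('k, 's) module" and laX raX \<gamma>X \<epsilon>X +
  fixes raA :: "('b \<times> 'h) list set \<Rightarrow> 's \<Rightarrow> ('b \<times> 'h) list set"
  assumes raX_sL: "\<lbrakk>l \<in> carrier L; h \<in> carrier H; x \<in> carrier X\<rbrakk> \<Longrightarrow> raX (sL l \<otimes>\<^bsub>H\<^esub> h) x = sL l \<otimes>\<^bsub>H\<^esub> raX h x"
    and gammaX_sL: "\<lbrakk>l \<in> carrier L; h \<in> carrier H\<rbrakk> \<Longrightarrow>
      \<gamma>X (sL l \<otimes>\<^bsub>H\<^esub> h) = tsum H H X.CC (\<gamma>X h) (\<lambda>a b. (sL l \<otimes>\<^bsub>H\<^esub> a) \<boxtimes>\<^bsub>X.CC\<^esub> b)"
    and raA_add: "x \<in> carrier X \<Longrightarrow> add_map BH BH (\<lambda>u. raA u x)"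
    and raA_tens: "\<lbrakk>b \<in> carrier B; h \<in> carrier H; x \<in> carrier X\<rbrakk> \<Longrightarrow>
      raA (b \<boxtimes>\<^bsub>BH\<^esub> h) x = b \<boxtimes>\<^bsub>BH\<^esub> raX h x"
begin

lemma raA_closed [simp]: "u \<in> carrier BH \<Longrightarrow> x \<in> carrier X \<Longrightarrow> raA u x \<in> carrier BH"
  using raA_add by (rule add_map_closed)

lemma raX_closed [simp]: "h \<in> carrier H \<Longrightarrow> x \<in> carrier X \<Longrightarrow> raX h x \<in> carrier H"
  and laX_closed [simp]: "h \<in> carrier H \<Longrightarrow> x \<in> carrier X \<Longrightarrow> laX x h \<in> carrier H"
  using X.CC.ra_closed X.CC.la_closed by auto

lemma epsX_closed [simp]: "h \<in> carrier H \<Longrightarrow> \<epsilon>X h \<in> carrier X"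
  by (rule X.counit_closed)

lemma A_module: "module K A"
  using A_algebra by (simp add: k_algebra_def)

lemma raA_smult:
  assumes "c \<in> carrier K" "u \<in> carrier BH" "x \<in> carrier X"
  shows "raA (c \<odot>\<^bsub>BH\<^esub> u) x = c \<odot>\<^bsub>BH\<^esub> raA u x"
  by (rule BH.add_map_eqI[where G = BH, OF add_map_comp[OF BH.smult_add_map raA_add]
        add_map_comp[OF raA_add BH.smult_add_map]])
    (use assms in \<open>auto simp: BH.smult_tens raA_tens\<close>)

sublocale AX: tensor_module A H "carrier X" raA laX K
  by (intro tensor_module.intro tensor_pair.intro tensor_module_axioms.intro A_module)
    (auto simp: raA_smult)

abbreviation AXH where "AXH \<equiv> tensor_product A H (carrier X) raA laX"
abbreviation "SX G h f \<equiv> tsum H H G (\<gamma>X h) f"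

lemma AXH_group [simp]: "abelian_group AXH" by (rule AX.T_group)

lemma AXH_closed [simp]: "u \<in> carrier BH \<Longrightarrow> h \<in> carrier H \<Longrightarrow> u \<boxtimes>\<^bsub>AXH\<^esub> h \<in> carrier AXH"
  using AX.tens_closed[of u h] by simp

lemma AXH_add1 [add_map_intros]: "h \<in> carrier H \<Longrightarrow> add_map M BH f \<Longrightarrow> add_map M AXH (\<lambda>y. f y \<boxtimes>\<^bsub>AXH\<^esub> h)"
  using bal_map_add1[OF AX.tens_bal, of h M f] by (simp add: add_map_def)

lemma AXH_add2 [add_map_intros]: "u \<in> carrier BH \<Longrightarrow> add_map M H f \<Longrightarrow> add_map M AXH (\<lambda>y. u \<boxtimes>\<^bsub>AXH\<^esub> f y)"
  using bal_map_add2[OF AX.tens_bal, of u M f] by simp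

lemma AXH_balanced:
  "u \<in> carrier BH \<Longrightarrow> h \<in> carrier H \<Longrightarrow> x \<in> carrier X \<Longrightarrow> raA u x \<boxtimes>\<^bsub>AXH\<^esub> h = u \<boxtimes>\<^bsub>AXH\<^esub> laX x h"
  using bal_map_balanced[OF AX.tens_bal, of u h x] by simp

lemma AX_balI:
  assumes "\<And>a. a \<in> carrier BH \<Longrightarrow> add_map H G (f a)"
    and "\<And>b. b \<in> carrier H \<Longrightarrow> add_map BH G (\<lambda>a. f a b)"
    and "\<And>a b r. a \<in> carrier BH \<Longrightarrow> b \<in> carrier H \<Longrightarrow> r \<in> carrier X \<Longrightarrow> f (raA a r) b = f a (laX r b)"
  shows "AX.bal G f"
  using assms by (intro bal_mapI) (auto simp: add_map_def)

definition xact where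
  "xact b w = tsum A H AXH w (\<lambda>u h. (b \<triangleright> u) \<boxtimes>\<^bsub>AXH\<^esub> h)"

lemma raA_bact:
  assumes "b \<in> carrier B" "u \<in> carrier BH" "x \<in> carrier X"
  shows "raA (b \<triangleright> u) x = b \<triangleright> raA u x"
  by (rule BH.add_map_eqI[where G = BH, OF add_map_comp[OF bact_add_map raA_add]
        add_map_comp[OF raA_add bact_add_map]])
    (use assms in \<open>auto simp: raA_tens\<close>)

lemma xact_bal: "b \<in> carrier B \<Longrightarrow> AX.bal AXH (\<lambda>u h. (b \<triangleright> u) \<boxtimes>\<^bsub>AXH\<^esub> h)"
  by (intro AX_balI add_map_intros) (auto simp: AXH_balanced simp flip: raA_bact)

lemma xact_tens [simp]:
  "b \<in> carrier B \<Longrightarrow> u \<in> carrier BH \<Longrightarrow> h \<in> carrier H \<Longrightarrow> xact b (u \<boxtimes>\<^bsub>AXH\<^esub> h) = (b \<triangleright> u) \<boxtimes>\<^bsub>AXH\<^esub> h"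
  unfolding xact_def by (intro AX.tsum_tens xact_bal AXH_group) auto

lemma xact_add_map: "b \<in> carrier B \<Longrightarrow> add_map AXH AXH (xact b)"
  using AX.tsum_add_map[OF AXH_group xact_bal] by (simp add: xact_def[abs_def])

sublocale xact: ring_action B AXH xact
proof (intro ring_action.intro ring_action_axioms.intro B.ring_axioms AXH_group xact_add_map)
  show "add_map B AXH (\<lambda>b. xact b w)" for w
    unfolding xact_def by (intro add_map_tsum AXH_group add_map_intros) auto
  show "xact (b \<otimes>\<^bsub>B\<^esub> c) w = xact b (xact c w)" if "b \<in> carrier B" "c \<in> carrier B" "w \<in> carrier AXH" for b c w
    by (rule AX.add_map_eqI[OF xact_add_map add_map_comp[OF xact_add_map xact_add_map]])
      (use that in \<open>auto simp: act.act_assoc\<close>)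
  show "xact \<one>\<^bsub>B\<^esub> w = w" if "w \<in> carrier AXH" for w
    by (rule AX.add_map_eqI[OF xact_add_map add_map_id]) (use that in \<open>auto simp: act.act_one\<close>)
qed

definition \<rho> where "\<rho> = crossed_coaction A AXH \<gamma>X"

lemma SX_add_map [add_map_intros]:
  assumes "abelian_group W" "X.CC.bal W f" "add_map M H g"
  shows "add_map M W (\<lambda>x. SX W (g x) f)"
  by (rule add_map_comp[OF assms(3) X.comult_tsum_add_map[OF assms(1,2)]])

lemma SX_sL:
  assumes "abelian_group W" "X.CC.bal W f" "h \<in> carrier H" "l \<in> carrier L"
  shows "SX W (sL l \<otimes>\<^bsub>H\<^esub> h) f = SX W h (\<lambda>a b. f (sL l \<otimes>\<^bsub>H\<^esub> a) b)"
  using assms by (simp add: gammaX_sL X.CC.tsum_tsum_tens)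

lemma rho_bal1:
  assumes "b \<in> carrier B"
  shows "X.CC.bal AXH (\<lambda>h1 h2. (b \<boxtimes>\<^bsub>BH\<^esub> h1) \<boxtimes>\<^bsub>AXH\<^esub> h2)"
  using assms by (intro bal_mapI add_map_intros) (auto simp: AXH_balanced simp flip: raA_tens)

lemma rho_bal: "BH.bal AXH (\<lambda>b h. SX AXH h (\<lambda>h1 h2. (b \<boxtimes>\<^bsub>BH\<^esub> h1) \<boxtimes>\<^bsub>AXH\<^esub> h2))"
  by (intro bal_mapI add_map_intros rho_bal1) (auto simp: SX_sL rho_bal1 BH_balanced)

lemma rho_eq: "u \<in> carrier BH \<Longrightarrow> \<rho> u = tsum B H AXH u (\<lambda>b h. SX AXH h (\<lambda>h1 h2. (b \<boxtimes>\<^bsub>BH\<^esub> h1) \<boxtimes>\<^bsub>AXH\<^esub> h2))"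
  by (simp add: \<rho>_def crossed_coaction_def BH.sweedler_eq_tsum X.sweedler_comult)

lemma rho_tens [simp]:
  "b \<in> carrier B \<Longrightarrow> h \<in> carrier H \<Longrightarrow> \<rho> (b \<boxtimes>\<^bsub>BH\<^esub> h) = SX AXH h (\<lambda>h1 h2. (b \<boxtimes>\<^bsub>BH\<^esub> h1) \<boxtimes>\<^bsub>AXH\<^esub> h2)"
  by (simp add: rho_eq BH.tsum_tens rho_bal)

lemma rho_add_map: "add_map BH AXH \<rho>"
  using BH.tsum_add_map[OF AXH_group rho_bal] rho_eq
  by (auto simp: add_map_def abelian_monoid.a_closed abelian_group.axioms(1))

lemma rho_closed [simp]: "u \<in> carrier BH \<Longrightarrow> \<rho> u \<in> carrier AXH"
  using rho_add_map by (rule add_map_closed)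

lemma rho_add [add_map_intros]: "add_map M BH f \<Longrightarrow> add_map M AXH (\<lambda>x. \<rho> (f x))"
  using rho_add_map by (rule add_map_comp[rotated])

text \<open>B-linearity of the coaction. In the proof of multiplicativity it reduces everything to
  the coaction on P(h, k).\<close>

lemma rho_bact:
  assumes "b \<in> carrier B" "u \<in> carrier BH"
  shows "\<rho> (b \<triangleright> u) = xact b (\<rho> u)"
  by (rule BH.add_map_eqI[where G = AXH, OF add_map_comp[OF bact_add_map rho_add_map]
        add_map_comp[OF rho_add_map xact_add_map]])
    (use assms in \<open>auto simp: xact.act_tsum\<close>)

lemma rho_tsum:
  assumes "\<And>x y. x \<in> carrier M \<Longrightarrow> y \<in> carrier N \<Longrightarrow> f x y \<in> carrier BH"
  shows "\<rho> (tsum M N BH T f) = tsum M N AXH T (\<lambda>x y. \<rho> (f x y))"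
  using assms by (intro tsum_hom rho_add_map BH_group AXH_group)

lemma sweedler_rho: "u \<in> carrier BH \<Longrightarrow> sweedler G (\<rho> u) f = tsum A H G (\<rho> u) f"
  by (rule AX.sweedler_eq_tsum) simp

lemma tsum_rho_tens:
  assumes "abelian_group G" "AX.bal G f" "b \<in> carrier B" "h \<in> carrier H"
  shows "tsum A H G (\<rho> (b \<boxtimes>\<^bsub>BH\<^esub> h)) f = SX G h (\<lambda>h1 h2. f (b \<boxtimes>\<^bsub>BH\<^esub> h1) h2)"
  using assms by (simp add: AX.tsum_tsum_tens)

lemma tsum_rho_add_map: "abelian_group G \<Longrightarrow> AX.bal G f \<Longrightarrow> add_map BH G (\<lambda>u. tsum A H G (\<rho> u) f)"
  by (rule add_map_comp[OF rho_add_map AX.tsum_add_map])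

lemma rho_linear: "k_linear K A AXH \<rho>"
proof -
  have sum: "c \<odot>\<^bsub>AXH\<^esub> tsum H H AXH T f = tsum H H AXH T (\<lambda>x y. c \<odot>\<^bsub>AXH\<^esub> f x y)"
    if "c \<in> carrier K" "\<And>x y. x \<in> carrier H \<Longrightarrow> y \<in> carrier H \<Longrightarrow> f x y \<in> carrier AXH" for c T f
    using that by (intro tsum_hom AX.smult_add_map AXH_group)
  have "\<rho> (c \<odot>\<^bsub>BH\<^esub> u) = c \<odot>\<^bsub>AXH\<^esub> \<rho> u" if "c \<in> carrier K" "u \<in> carrier BH" for c u
    by (rule BH.add_map_eqI[where G = AXH, OF add_map_comp[OF BH.smult_add_map rho_add_map]
          add_map_comp[OF rho_add_map AX.smult_add_map]])
      (use that AX.smult_tens in \<open>auto simp: BH.smult_tens sum\<close>)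
  then show ?thesis using rho_add_map by (auto simp: k_linear_def add_map_def)
qed

text \<open>Both linearity properties of a coaction have this origin: an operation on the factor H
  that \<gamma>X carries to its second leg. It is used with the right action of X and with that of
  the second base algebra in a pair.\<close>

lemma rho_transport:
  assumes \<phi>: "add_map H H \<phi>" and \<Phi>: "add_map BH BH \<Phi>"
    and "\<And>b h. b \<in> carrier B \<Longrightarrow> h \<in> carrier H \<Longrightarrow> \<Phi> (b \<boxtimes>\<^bsub>BH\<^esub> h) = b \<boxtimes>\<^bsub>BH\<^esub> \<phi> h"
    and "\<And>h. h \<in> carrier H \<Longrightarrow> \<gamma>X (\<phi> h) = tsum H H X.CC (\<gamma>X h) (\<lambda>a b. a \<boxtimes>\<^bsub>X.CC\<^esub> \<phi> b)"
    and "\<And>h x. h \<in> carrier H \<Longrightarrow> x \<in> carrier X \<Longrightarrow> \<phi> (laX x h) = laX x (\<phi> h)"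
    and u: "u \<in> carrier BH"
  shows "\<rho> (\<Phi> u) = tsum A H AXH (\<rho> u) (\<lambda>v h. v \<boxtimes>\<^bsub>AXH\<^esub> \<phi> h)"
proof -
  note [simp] = add_map_closed[OF \<phi>]
  have bal: "AX.bal AXH (\<lambda>v h. v \<boxtimes>\<^bsub>AXH\<^esub> \<phi> h)"
    by (intro AX_balI add_map_intros \<phi>) (auto simp: AXH_balanced assms(5))
  show ?thesis
  proof (rule BH.add_map_eqI[where G = AXH, OF add_map_comp[OF \<Phi> rho_add_map]
        tsum_rho_add_map[OF AXH_group bal] AXH_group _ u])
    fix b h assume bh: "b \<in> carrier B" "h \<in> carrier H"
    then show "\<rho> (\<Phi> (b \<boxtimes>\<^bsub>BH\<^esub> h)) = tsum A H AXH (\<rho> (b \<boxtimes>\<^bsub>BH\<^esub> h)) (\<lambda>v h. v \<boxtimes>\<^bsub>AXH\<^esub> \<phi> h)"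
      unfolding tsum_rho_tens[OF AXH_group bal bh]
      by (simp add: assms(3,4) X.CC.tsum_tsum_tens rho_bal1)
  qed
qed

lemma raX_add: "h \<in> carrier H \<Longrightarrow> add_map X H (raX h)"
  using X.bimodule k_bilinear_add_map(1)[of K H X H raX]
  by (auto simp: bimodule_def right_module_def)

lemma raX_assoc:
  "h \<in> carrier H \<Longrightarrow> x \<in> carrier X \<Longrightarrow> y \<in> carrier X \<Longrightarrow> raX (raX h x) y = raX h (x \<otimes>\<^bsub>X\<^esub> y)"
  using X.bimodule by (auto simp: bimodule_def right_module_def)

lemma laX_raX:
  "h \<in> carrier H \<Longrightarrow> x \<in> carrier X \<Longrightarrow> y \<in> carrier X \<Longrightarrow> raX (laX x h) y = laX x (raX h y)"
  using X.bimodule by (auto simp: bimodule_def)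

lemma raA_assoc:
  assumes "u \<in> carrier BH" "x \<in> carrier X" "y \<in> carrier X" "x \<otimes>\<^bsub>X\<^esub> y \<in> carrier X"
  shows "raA (raA u x) y = raA u (x \<otimes>\<^bsub>X\<^esub> y)"
  by (rule BH.add_map_eqI[where G = BH, OF add_map_comp[OF raA_add raA_add] raA_add])
    (use assms in \<open>auto simp: raA_tens raX_assoc\<close>)

lemma raA_add2:
  assumes "u \<in> carrier BH"
  shows "add_map X BH (raA u)"
proof (rule add_mapI)
  interpret X': k_algebra K X by (rule X.base_algebra)
  interpret BH': abelian_group BH by simp
  fix x y assume xy: "x \<in> carrier X" "y \<in> carrier X"
  show "raA u (x \<oplus>\<^bsub>X\<^esub> y) = raA u x \<oplus>\<^bsub>BH\<^esub> raA u y"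
  proof (rule BH.add_map_eqI[where G = BH, OF raA_add _ BH_group _ assms])
    show "add_map BH BH (\<lambda>u. raA u x \<oplus>\<^bsub>BH\<^esub> raA u y)"
      using xy raA_add[of x] raA_add[of y] by (auto simp: add_map_def BH'.a_ac)
    show "raA (b \<boxtimes>\<^bsub>BH\<^esub> h) (x \<oplus>\<^bsub>X\<^esub> y) = raA (b \<boxtimes>\<^bsub>BH\<^esub> h) x \<oplus>\<^bsub>BH\<^esub> raA (b \<boxtimes>\<^bsub>BH\<^esub> h) y"
      if "b \<in> carrier B" "h \<in> carrier H" for b h
      using that xy add_map_add[OF BH_add2[OF that(1) raX_add[OF that(2)]], of x y]
      by (simp add: raA_tens)
  qed (use xy in auto)
qed (use assms in auto)

lemma rho_counit:
  assumes "u \<in> carrier BH"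
  shows "tsum A H A (\<rho> u) (\<lambda>v c. raA v (\<epsilon>X c)) = u"
proof -
  interpret X': k_algebra K X by (rule X.base_algebra)
  have eps_la: "\<epsilon>X (laX x h) = x \<otimes>\<^bsub>X\<^esub> \<epsilon>X h" if "x \<in> carrier X" "h \<in> carrier H" for x h
    using X.counit_bilinear[of x "\<one>\<^bsub>X\<^esub>" h] that X.ra_one[of "laX x h"] by simp
  have bal: "AX.bal BH (\<lambda>v c. raA v (\<epsilon>X c))"
    by (intro AX_balI add_map_comp[OF X.counit_add_map raA_add2] raA_add) (auto simp: eps_la raA_assoc)
  have "tsum A H BH (\<rho> u) (\<lambda>v c. raA v (\<epsilon>X c)) = u"
  proof (rule BH.add_map_eqI[where G = BH, OF tsum_rho_add_map[OF BH_group bal] add_map_id BH_group _ assms])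
    fix b h assume bh: "b \<in> carrier B" "h \<in> carrier H"
    show "tsum A H BH (\<rho> (b \<boxtimes>\<^bsub>BH\<^esub> h)) (\<lambda>v c. raA v (\<epsilon>X c)) = b \<boxtimes>\<^bsub>BH\<^esub> h"
      using bh X.counit_right_tsum[OF BH_group BH_add2[OF bh(1) add_map_id] bh(2)]
      by (simp add: tsum_rho_tens bal raA_tens del: rho_tens)
  qed
  then show ?thesis by (simp add: tsum_target_cong[of A BH])
qed

lemma raA_right_module: "right_module K X A raA"
proof -
  interpret X': k_algebra K X by (rule X.base_algebra)
  \<comment> \<open>Scalars coming from X act through the factor H, those of \<open>A\<close>
    through the factor B; \<open>BH_smult_right\<close> reconciles them.\<close>
  have smult2: "raA u (c \<odot>\<^bsub>X\<^esub> x) = c \<odot>\<^bsub>BH\<^esub> raA u x"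
    if "c \<in> carrier K" "x \<in> carrier X" "u \<in> carrier BH" for c x u
  proof (rule BH.add_map_eqI[where G = BH, OF raA_add add_map_comp[OF raA_add BH.smult_add_map]])
    fix b h assume bh: "b \<in> carrier B" "h \<in> carrier H"
    have "raX h (c \<odot>\<^bsub>X\<^esub> x) = c \<odot>\<^bsub>H\<^esub> raX h x"
      using X.bimodule bh that by (auto simp: bimodule_def right_module_def k_bilinear_def k_linear_def)
    then show "raA (b \<boxtimes>\<^bsub>BH\<^esub> h) (c \<odot>\<^bsub>X\<^esub> x) = c \<odot>\<^bsub>BH\<^esub> raA (b \<boxtimes>\<^bsub>BH\<^esub> h) x"
      using bh that by (simp add: raA_tens BH_smult_right)
  qed (use that in auto)
  have one: "raA u \<one>\<^bsub>X\<^esub> = u" if "u \<in> carrier BH" for u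
    by (rule BH.add_map_eqI[where G = BH, OF raA_add add_map_id])
      (use that in \<open>auto simp: raA_tens X.ra_one\<close>)
  show ?thesis unfolding right_module_def k_bilinear_def k_linear_def
    using A_module raA_add raA_add2
    by (auto simp: raA_assoc smult2 one raA_smult add_map_def)
qed

lemma rho_base_linear:
  assumes "u \<in> carrier BH" "x \<in> carrier X"
  shows "\<rho> (raA u x) = tsum A H AXH (\<rho> u) (\<lambda>v h. v \<boxtimes>\<^bsub>AXH\<^esub> raX h x)"
proof (rule rho_transport[where \<phi> = "\<lambda>h. raX h x"])
  interpret X': k_algebra K X by (rule X.base_algebra)
  show "\<gamma>X (raX h x) = tsum H H X.CC (\<gamma>X h) (\<lambda>a b. a \<boxtimes>\<^bsub>X.CC\<^esub> raX b x)" if "h \<in> carrier H" for h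
    using that assms X.comult_bilinear[of "\<one>\<^bsub>X\<^esub>" x h] by (simp add: X.la_one X.sweedler_comult)
qed (use assms in \<open>auto simp: raA_tens laX_raX X.ra_add_map raA_add\<close>)

lemma P_tens:
  assumes "h \<in> carrier H" "k \<in> carrier H" "c \<in> carrier H"
  shows "P h k \<boxtimes>\<^bsub>AXH\<^esub> c = SL AXH k (\<lambda>k1 k2. SL AXH h (\<lambda>h1 h2. (\<sigma> h1 k1 \<boxtimes>\<^bsub>BH\<^esub> (h2 \<otimes>\<^bsub>H\<^esub> k2)) \<boxtimes>\<^bsub>AXH\<^esub> c))"
proof -
  have hom: "tsum H H BH T f \<boxtimes>\<^bsub>AXH\<^esub> c = tsum H H AXH T (\<lambda>x y. f x y \<boxtimes>\<^bsub>AXH\<^esub> c)"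
    if "\<And>x y. x \<in> carrier H \<Longrightarrow> y \<in> carrier H \<Longrightarrow> f x y \<in> carrier BH" for T f
    using that assms(3) by (intro tsum_hom[of BH AXH "\<lambda>u. u \<boxtimes>\<^bsub>AXH\<^esub> c"] AXH_add1 add_map_id BH_group AXH_group)
  show ?thesis using assms by (simp add: P_def hom tsum_closed)
qed

text \<open>Mixed coassociativity is applied first in \<open>h\<close> and then in \<open>k\<close>.\<close>

lemma rho_P:
  assumes hk: "h \<in> carrier H" "k \<in> carrier H"
  and mult: "\<And>h k f. h \<in> carrier H \<Longrightarrow> k \<in> carrier H \<Longrightarrow> X.CC.bal AXH f \<Longrightarrow>
    SX AXH (h \<otimes>\<^bsub>H\<^esub> k) f = SX AXH k (\<lambda>k1 k2. SX AXH h (\<lambda>h1 h2. f (h1 \<otimes>\<^bsub>H\<^esub> k1) (h2 \<otimes>\<^bsub>H\<^esub> k2)))"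
  and mixed: "\<And>h F. h \<in> carrier H \<Longrightarrow> tri_map H (carrier L) ractL lactL (carrier X) raX laX AXH F \<Longrightarrow>
    SX AXH h (\<lambda>a b. SL AXH a (\<lambda>a1 a2. F a1 a2 b)) = SL AXH h (\<lambda>a b. SX AXH b (\<lambda>b1 b2. F a b1 b2))"
  and link_left: "\<And>a d k x f. a \<in> carrier H \<Longrightarrow> d \<in> carrier H \<Longrightarrow> k \<in> carrier H \<Longrightarrow> x \<in> carrier X \<Longrightarrow> X.CC.bal AXH f \<Longrightarrow>
    SX AXH k (\<lambda>k1 k2. f (raX a x \<otimes>\<^bsub>H\<^esub> k1) (d \<otimes>\<^bsub>H\<^esub> k2)) = SX AXH k (\<lambda>k1 k2. f (a \<otimes>\<^bsub>H\<^esub> k1) (laX x d \<otimes>\<^bsub>H\<^esub> k2))"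
  and link_right: "\<And>h y k k' x. h \<in> carrier H \<Longrightarrow> y \<in> carrier H \<Longrightarrow> k \<in> carrier H \<Longrightarrow> k' \<in> carrier H \<Longrightarrow> x \<in> carrier X \<Longrightarrow>
    SX AXH h (\<lambda>h1 h2. SL AXH h1 (\<lambda>a b. (\<sigma> a y \<boxtimes>\<^bsub>BH\<^esub> (b \<otimes>\<^bsub>H\<^esub> raX k x)) \<boxtimes>\<^bsub>AXH\<^esub> (h2 \<otimes>\<^bsub>H\<^esub> k')))
    = SX AXH h (\<lambda>h1 h2. SL AXH h1 (\<lambda>a b. (\<sigma> a y \<boxtimes>\<^bsub>BH\<^esub> (b \<otimes>\<^bsub>H\<^esub> k)) \<boxtimes>\<^bsub>AXH\<^esub> (h2 \<otimes>\<^bsub>H\<^esub> laX x k')))"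
  shows "\<rho> (P h k) = SX AXH k (\<lambda>k1 k2. SX AXH h (\<lambda>h1 h2. P h1 k1 \<boxtimes>\<^bsub>AXH\<^esub> (h2 \<otimes>\<^bsub>H\<^esub> k2)))"
proof -
  \<comment> \<open>The legs of h and of k are kept apart in F. The interchanges below serve to
    bring the two sums over legs of one variable next to each other.\<close>
  define F where "F a b c k1 k2 k3 = (\<sigma> a k1 \<boxtimes>\<^bsub>BH\<^esub> (b \<otimes>\<^bsub>H\<^esub> k2)) \<boxtimes>\<^bsub>AXH\<^esub> (c \<otimes>\<^bsub>H\<^esub> k3)"
    for a b c k1 k2 k3
  have F_closed [simp]: "F a b c k1 k2 k3 \<in> carrier AXH"
    if "a \<in> carrier H" "b \<in> carrier H" "c \<in> carrier H" "k1 \<in> carrier H" "k2 \<in> carrier H" "k3 \<in> carrier H"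
    for a b c k1 k2 k3
    using that by (simp add: F_def)
  have "\<rho> (P h k) = SL AXH k (\<lambda>k1 k2. SL AXH h (\<lambda>h1 h2. SX AXH k2 (\<lambda>k2 k3. SX AXH h2 (\<lambda>b c. F h1 b c k1 k2 k3))))"
    using hk by (simp add: P_def rho_tsum tsum_closed mult rho_bal1 F_def)
  also have "\<dots> = SL AXH k (\<lambda>k1 k2. SL AXH h (\<lambda>h1 h2. SX AXH h2 (\<lambda>b c. SX AXH k2 (\<lambda>k2 k3. F h1 b c k1 k2 k3))))"
    by (rule tsum_cong[OF HOL.refl], rule tsum_cong[OF HOL.refl], rule tsum_swap) simp_all
  also have "\<dots> = SL AXH h (\<lambda>h1 h2. SL AXH k (\<lambda>k1 k2. SX AXH h2 (\<lambda>b c. SX AXH k2 (\<lambda>k2 k3. F h1 b c k1 k2 k3))))"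
    by (rule tsum_swap) (simp_all add: tsum_closed)
  also have "\<dots> = SL AXH h (\<lambda>h1 h2. SX AXH h2 (\<lambda>b c. SL AXH k (\<lambda>k1 k2. SX AXH k2 (\<lambda>k2 k3. F h1 b c k1 k2 k3))))"
    by (rule tsum_cong[OF HOL.refl], rule tsum_swap) (simp_all add: tsum_closed)
  also have "\<dots> = SX AXH h (\<lambda>h1 c. SL AXH h1 (\<lambda>a b. SL AXH k (\<lambda>k1 k2. SX AXH k2 (\<lambda>k2 k3. F a b c k1 k2 k3))))"
  proof (rule mixed[OF hk(1), symmetric], rule tri_mapI)
    fix a b c x assume *: "a \<in> carrier H" "b \<in> carrier H" "c \<in> carrier H" "x \<in> carrier X"
    show "SL AXH k (\<lambda>k1 k2. SX AXH k2 (\<lambda>k2 k3. F a (raX b x) c k1 k2 k3))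
      = SL AXH k (\<lambda>k1 k2. SX AXH k2 (\<lambda>k2 k3. F a b (laX x c) k1 k2 k3))"
      unfolding F_def using * by (intro tsum_cong[OF HOL.refl] link_left rho_bal1) auto
  qed (auto simp: F_def \<sigma>_tL BH_balanced H.m_assoc intro!: add_map_intros tsum_cong)
  also have "\<dots> = SX AXH h (\<lambda>h1 c. SL AXH k (\<lambda>k1 k2. SL AXH h1 (\<lambda>a b. SX AXH k2 (\<lambda>k2 k3. F a b c k1 k2 k3))))"
    by (rule tsum_cong[OF HOL.refl], rule tsum_swap) (simp_all add: tsum_closed)
  also have "\<dots> = SX AXH h (\<lambda>h1 c. SL AXH k (\<lambda>k1 k2. SX AXH k2 (\<lambda>k2 k3. SL AXH h1 (\<lambda>a b. F a b c k1 k2 k3))))"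
    by (rule tsum_cong[OF HOL.refl], rule tsum_cong[OF HOL.refl], rule tsum_swap) simp_all
  also have "\<dots> = SL AXH k (\<lambda>k1 k2. SX AXH h (\<lambda>h1 c. SX AXH k2 (\<lambda>k2 k3. SL AXH h1 (\<lambda>a b. F a b c k1 k2 k3))))"
    by (rule tsum_swap) (simp_all add: tsum_closed)
  also have "\<dots> = SL AXH k (\<lambda>k1 k2. SX AXH k2 (\<lambda>k2 k3. SX AXH h (\<lambda>h1 c. SL AXH h1 (\<lambda>a b. F a b c k1 k2 k3))))"
    by (rule tsum_cong[OF HOL.refl], rule tsum_swap) (simp_all add: tsum_closed)
  also have "\<dots> = SX AXH k (\<lambda>k1 k3. SL AXH k1 (\<lambda>k1 k2. SX AXH h (\<lambda>h1 c. SL AXH h1 (\<lambda>a b. F a b c k1 k2 k3))))"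
  proof (rule mixed[OF hk(2), symmetric], rule tri_mapI)
    fix k1 k2 k3 l assume *: "k1 \<in> carrier H" "k2 \<in> carrier H" "k3 \<in> carrier H" "l \<in> carrier L"
    show "SX AXH h (\<lambda>h1 c. SL AXH h1 (\<lambda>a b. F a b c (ractL k1 l) k2 k3))
      = SX AXH h (\<lambda>h1 c. SL AXH h1 (\<lambda>a b. F a b c k1 (lactL l k2) k3))"
    proof (rule tsum_cong[OF HOL.refl])
      fix h1 c assume h1: "h1 \<in> carrier H" "c \<in> carrier H"
      have "balL AXH (\<lambda>a b. F a b c k1 k2 k3)"
        unfolding F_def using * h1
        by (intro bal_mapI add_map_intros) (auto simp: \<sigma>_tL BH_balanced H.m_assoc)
      from SL_takeuchi[OF AXH_group this h1(1) *(4)]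
      show "SL AXH h1 (\<lambda>a b. F a b c (ractL k1 l) k2 k3) = SL AXH h1 (\<lambda>a b. F a b c k1 (lactL l k2) k3)"
        using * h1 by (simp add: F_def \<sigma>_balanced H.m_assoc)
    qed
  next
    fix k1 k2 k3 x assume *: "k1 \<in> carrier H" "k2 \<in> carrier H" "k3 \<in> carrier H" "x \<in> carrier X"
    show "SX AXH h (\<lambda>h1 c. SL AXH h1 (\<lambda>a b. F a b c k1 (raX k2 x) k3))
      = SX AXH h (\<lambda>h1 c. SL AXH h1 (\<lambda>a b. F a b c k1 k2 (laX x k3)))"
      unfolding F_def using * by (intro link_right hk)
  qed (auto simp: F_def intro!: add_map_intros)
  also have "\<dots> = SX AXH k (\<lambda>k1 k3. SX AXH h (\<lambda>h1 c. SL AXH k1 (\<lambda>k1 k2. SL AXH h1 (\<lambda>a b. F a b c k1 k2 k3))))"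
    by (rule tsum_cong[OF HOL.refl], rule tsum_swap) (simp_all add: tsum_closed)
  also have "\<dots> = SX AXH k (\<lambda>k1 k2. SX AXH h (\<lambda>h1 h2. P h1 k1 \<boxtimes>\<^bsub>AXH\<^esub> (h2 \<otimes>\<^bsub>H\<^esub> k2)))"
    by (simp add: P_tens F_def)
  finally show ?thesis .
qed

text \<open>By B-linearity and \<open>rho_P\<close> a single use of mixed coassociativity in h
  remains; it joins the leg that measures c to the leg inside P. The hypotheses
  \<open>mixed\<close>, \<open>rho_P\<close> and \<open>link_P\<close> are the points whose proofs
  differ for the coactions over L and over R.\<close>

lemma rho_cmult_tens:
  assumes hk: "h \<in> carrier H" "k \<in> carrier H" and bc: "b \<in> carrier B" "c \<in> carrier B"
  and mixed: "\<And>h F. h \<in> carrier H \<Longrightarrow> tri_map H (carrier L) ractL lactL (carrier X) raX laX AXH F \<Longrightarrow>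
    SX AXH h (\<lambda>a b. SL AXH a (\<lambda>a1 a2. F a1 a2 b)) = SL AXH h (\<lambda>a b. SX AXH b (\<lambda>b1 b2. F a b1 b2))"
  and rho_P: "\<And>h. h \<in> carrier H \<Longrightarrow>
    \<rho> (P h k) = SX AXH k (\<lambda>k1 k2. SX AXH h (\<lambda>h1 h2. P h1 k1 \<boxtimes>\<^bsub>AXH\<^esub> (h2 \<otimes>\<^bsub>H\<^esub> k2)))"
  and link_P: "\<And>a d x. a \<in> carrier H \<Longrightarrow> d \<in> carrier H \<Longrightarrow> x \<in> carrier X \<Longrightarrow>
    SX AXH k (\<lambda>k1 k2. P (raX a x) k1 \<boxtimes>\<^bsub>AXH\<^esub> (d \<otimes>\<^bsub>H\<^esub> k2)) = SX AXH k (\<lambda>k1 k2. P a k1 \<boxtimes>\<^bsub>AXH\<^esub> (laX x d \<otimes>\<^bsub>H\<^esub> k2))"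
  shows "\<rho> ((b \<boxtimes>\<^bsub>BH\<^esub> h) \<star> (c \<boxtimes>\<^bsub>BH\<^esub> k))
    = SX AXH h (\<lambda>h1 h2. SX AXH k (\<lambda>k1 k2. ((b \<boxtimes>\<^bsub>BH\<^esub> h1) \<star> (c \<boxtimes>\<^bsub>BH\<^esub> k1)) \<boxtimes>\<^bsub>AXH\<^esub> (h2 \<otimes>\<^bsub>H\<^esub> k2)))"
proof -
  have link: "SX AXH k (\<lambda>k1 k2. (y \<triangleright> P (raX a x) k1) \<boxtimes>\<^bsub>AXH\<^esub> (d \<otimes>\<^bsub>H\<^esub> k2))
    = SX AXH k (\<lambda>k1 k2. (y \<triangleright> P a k1) \<boxtimes>\<^bsub>AXH\<^esub> (laX x d \<otimes>\<^bsub>H\<^esub> k2))"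
    if "a \<in> carrier H" "d \<in> carrier H" "x \<in> carrier X" "y \<in> carrier B" for a d x y
  proof -
    have "xact y (SX AXH k (\<lambda>k1 k2. P (raX a x) k1 \<boxtimes>\<^bsub>AXH\<^esub> (d \<otimes>\<^bsub>H\<^esub> k2)))
      = xact y (SX AXH k (\<lambda>k1 k2. P a k1 \<boxtimes>\<^bsub>AXH\<^esub> (laX x d \<otimes>\<^bsub>H\<^esub> k2)))"
      using link_P that by simp
    then show ?thesis using that by (simp add: xact.act_tsum)
  qed
  have hom: "tsum H H BH T f \<boxtimes>\<^bsub>AXH\<^esub> c = tsum H H AXH T (\<lambda>x y. f x y \<boxtimes>\<^bsub>AXH\<^esub> c)"
    if "c \<in> carrier H" "\<And>x y. x \<in> carrier H \<Longrightarrow> y \<in> carrier H \<Longrightarrow> f x y \<in> carrier BH" for T f c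
    using that by (intro tsum_hom[of BH AXH "\<lambda>u. u \<boxtimes>\<^bsub>AXH\<^esub> c"] AXH_add1 add_map_id BH_group AXH_group)
  have "\<rho> ((b \<boxtimes>\<^bsub>BH\<^esub> h) \<star> (c \<boxtimes>\<^bsub>BH\<^esub> k))
    = xact b (SL AXH h (\<lambda>h1 h2. SX AXH k (\<lambda>k1 k2. SX AXH h2 (\<lambda>a d. ((h1 \<cdot> c) \<triangleright> P a k1) \<boxtimes>\<^bsub>AXH\<^esub> (d \<otimes>\<^bsub>H\<^esub> k2)))))"
    using hk bc by (simp add: rho_bact rho_tsum rho_P xact.act_tsum tsum_closed)
  also have "\<dots> = xact b (SL AXH h (\<lambda>h1 h2. SX AXH h2 (\<lambda>a d. SX AXH k (\<lambda>k1 k2. ((h1 \<cdot> c) \<triangleright> P a k1) \<boxtimes>\<^bsub>AXH\<^esub> (d \<otimes>\<^bsub>H\<^esub> k2)))))"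
    by (rule arg_cong[where f = "xact b"], rule tsum_cong[OF HOL.refl], rule tsum_swap) (use bc in simp_all)
  also have "\<dots> = xact b (SX AXH h (\<lambda>h1 d. SL AXH h1 (\<lambda>y a. SX AXH k (\<lambda>k1 k2. ((y \<cdot> c) \<triangleright> P a k1) \<boxtimes>\<^bsub>AXH\<^esub> (d \<otimes>\<^bsub>H\<^esub> k2)))))"
  proof (rule arg_cong[where f = "xact b"], rule mixed[OF hk(1), symmetric], rule tri_mapI)
    fix y a d x assume *: "y \<in> carrier H" "a \<in> carrier H" "d \<in> carrier H" "x \<in> carrier X"
    then show "SX AXH k (\<lambda>k1 k2. ((y \<cdot> c) \<triangleright> P (raX a x) k1) \<boxtimes>\<^bsub>AXH\<^esub> (d \<otimes>\<^bsub>H\<^esub> k2))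
      = SX AXH k (\<lambda>k1 k2. ((y \<cdot> c) \<triangleright> P a k1) \<boxtimes>\<^bsub>AXH\<^esub> (laX x d \<otimes>\<^bsub>H\<^esub> k2))"
      using bc by (intro link) auto
  qed (use bc in \<open>auto simp: meas_tL act.act_assoc P_sL_left intro!: add_map_intros\<close>)
  also have "\<dots> = xact b (SX AXH h (\<lambda>h1 d. SX AXH k (\<lambda>k1 k2. SL AXH h1 (\<lambda>y a. ((y \<cdot> c) \<triangleright> P a k1) \<boxtimes>\<^bsub>AXH\<^esub> (d \<otimes>\<^bsub>H\<^esub> k2)))))"
    by (rule arg_cong[where f = "xact b"], rule tsum_cong[OF HOL.refl], rule tsum_swap) (use bc in simp_all)
  also have "\<dots> = SX AXH h (\<lambda>h1 h2. SX AXH k (\<lambda>k1 k2. ((b \<boxtimes>\<^bsub>BH\<^esub> h1) \<star> (c \<boxtimes>\<^bsub>BH\<^esub> k1)) \<boxtimes>\<^bsub>AXH\<^esub> (h2 \<otimes>\<^bsub>H\<^esub> k2)))"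
    using bc by (simp add: xact.act_tsum tsum_closed hom act.act_tsum)
  finally show ?thesis .
qed

end

text \<open>
  The hypotheses below are the compatibilities of two coring structures on \<open>H\<close>, equal or not, from
  which all (mixed) coassociativity and linearity axioms of the two coactions follow.
\<close>

locale crossed_coact_pair =
  crossed_hopf K H L sL tL \<gamma>L \<pi>L B \<iota> meas \<sigma> R sR tR \<gamma>R \<pi>R S +
  X: crossed_coact K H L sL tL \<gamma>L \<pi>L B \<iota> meas \<sigma> R sR tR \<gamma>R \<pi>R S X laX raX \<gamma>X \<epsilon>X raA +
  Y: crossed_coact K H L sL tL \<gamma>L \<pi>L B \<iota> meas \<sigma> R sR tR \<gamma>R \<pi>R S Y laY raY \<gamma>Y \<epsilon>Y rbA
  for K :: "('k, 'y) ring_scheme"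
    and H :: "('k, 'h) module"
    and L :: "('k, 'l) module" and sL tL \<gamma>L \<pi>L
    and B :: "('k, 'b) module" and \<iota>
    and meas :: "'h \<Rightarrow> 'b \<Rightarrow> 'b"  (infixr \<open>\<cdot>\<close> 75)
    and \<sigma> :: "'h \<Rightarrow> 'h \<Rightarrow> 'b"
    and R :: "('k, 'r) module" and sR tR \<gamma>R \<pi>R S
    and X :: "('k, 's) module" and laX raX \<gamma>X \<epsilon>X raA
    and Y :: "('k, 't) module" and laY raY \<gamma>Y \<epsilon>Y rbA +
  assumes laX_raY: "\<lbrakk>h \<in> carrier H; x \<in> carrier X; y \<in> carrier Y\<rbrakk> \<Longrightarrow> raY (laX x h) y = laX x (raY h y)"
    and gammaX_raY: "\<lbrakk>h \<in> carrier H; y \<in> carrier Y\<rbrakk> \<Longrightarrow>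
      \<gamma>X (raY h y) = tsum H H X.X.CC (\<gamma>X h) (\<lambda>a b. a \<boxtimes>\<^bsub>X.X.CC\<^esub> raY b y)"
    and gammaY_laX: "\<lbrakk>h \<in> carrier H; x \<in> carrier X\<rbrakk> \<Longrightarrow>
      \<gamma>Y (laX x h) = tsum H H Y.X.CC (\<gamma>Y h) (\<lambda>a b. laX x a \<boxtimes>\<^bsub>Y.X.CC\<^esub> b)"
    and coassoc_pair: "h \<in> carrier H \<Longrightarrow>
        (let G = tensor_product H Y.X.CC (carrier X) raX (tensor_lact Y.X.CC laX) in
          sweedler G (\<gamma>Y h) (\<lambda>a b. sweedler G (\<gamma>X a) (\<lambda>a1 a2. a1 \<boxtimes>\<^bsub>G\<^esub> (a2 \<boxtimes>\<^bsub>Y.X.CC\<^esub> b)))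
          = sweedler G (\<gamma>X h) (\<lambda>a b. a \<boxtimes>\<^bsub>G\<^esub> \<gamma>Y b))"
begin

lemma rho_linear_pair:
  assumes "u \<in> carrier BH" "y \<in> carrier Y"
  shows "X.\<rho> (rbA u y) = tsum A H X.AXH (X.\<rho> u) (\<lambda>v h. v \<boxtimes>\<^bsub>X.AXH\<^esub> raY h y)"
  by (rule X.rho_transport[where \<phi> = "\<lambda>h. raY h y"])
    (use assms in \<open>auto simp: Y.raA_tens laX_raY gammaX_raY Y.X.ra_add_map Y.raA_add\<close>)

text \<open>With equal coring structures this is coassociativity of a coaction, with different ones
  a mixed law. Both sides are additive in m; on b # h the factor b is only carried along and the law
  for H itself applies.\<close>

lemma rho_coassoc_pair:
  assumes m: "m \<in> carrier BH"
  defines "G \<equiv> tensor_product A Y.X.CC (carrier X) raA (tensor_lact Y.X.CC laX)"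
  shows "sweedler G (X.\<rho> m) (\<lambda>x c. x \<boxtimes>\<^bsub>G\<^esub> \<gamma>Y c)
    = sweedler G (Y.\<rho> m) (\<lambda>x c. sweedler G (X.\<rho> x) (\<lambda>y d. y \<boxtimes>\<^bsub>G\<^esub> (d \<boxtimes>\<^bsub>Y.X.CC\<^esub> c)))"
proof -
  let ?HYH = "Y.X.CC"
  have lact: "tensor_lact ?HYH laX r T = tsum H H ?HYH T (\<lambda>m n. laX r m \<boxtimes>\<^bsub>?HYH\<^esub> n)"
    if "T \<in> carrier ?HYH" for r T
    using that unfolding tensor_lact_def by (rule Y.X.CC.sweedler_eq_tsum)
  have lact_bal: "Y.X.CC.bal ?HYH (\<lambda>m n. laX r m \<boxtimes>\<^bsub>?HYH\<^esub> n)" if "r \<in> carrier X" for r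
    using that bal_map_add1[OF Y.X.CC.tens_bal _ X.X.la_add_map] bal_map_add2[OF Y.X.CC.tens_bal _ add_map_id]
    by (intro bal_mapI) (auto simp: bal_map_balanced[OF Y.X.CC.tens_bal] simp flip: laX_raY)
  interpret G: tensor_pair A "?HYH" "carrier X" raA "tensor_lact ?HYH laX"
    by (intro tensor_pair.intro)
      (auto simp: lact intro!: Y.X.CC.T_group tsum_closed Y.X.CC.tens_closed)
  have G_group: "abelian_group G" unfolding G_def by (rule G.T_group)
  have G_bal: "G.bal G (tens G)" unfolding G_def by (rule G.tens_bal)
  have HYH_closed: "d \<boxtimes>\<^bsub>?HYH\<^esub> c \<in> carrier ?HYH" if "d \<in> carrier H" "c \<in> carrier H" for d c
    using that by (rule Y.X.CC.tens_closed)
  have G_add1: "add_map M G (\<lambda>y. f y \<boxtimes>\<^bsub>G\<^esub> T)" if "add_map M BH f" "T \<in> carrier ?HYH"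
    for M :: "('k, 'm) module" and f T
    using bal_map_add1[OF G_bal, of T M f] that by (simp add: add_map_def)
  have G_add2: "add_map M G (\<lambda>y. u \<boxtimes>\<^bsub>G\<^esub> f y)" if "add_map M ?HYH f" "u \<in> carrier BH"
    for M :: "('k, 'h) module" and f u
    using bal_map_add2[OF G_bal, of u M f] that by simp
  have G_add0: "add_map BH G (\<lambda>u. u \<boxtimes>\<^bsub>G\<^esub> T)" if "T \<in> carrier ?HYH" for T
    using bal_map_add1[OF G_bal that add_map_id] by (simp add: add_map_def)
  have G_balanced: "raA u r \<boxtimes>\<^bsub>G\<^esub> T = u \<boxtimes>\<^bsub>G\<^esub> tensor_lact ?HYH laX r T"
    if "u \<in> carrier BH" "r \<in> carrier X" "T \<in> carrier ?HYH" for u r T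
    using bal_map_balanced[OF G_bal] that by simp
  have lact_tens: "tensor_lact ?HYH laX r (d \<boxtimes>\<^bsub>?HYH\<^esub> c) = laX r d \<boxtimes>\<^bsub>?HYH\<^esub> c"
    if "r \<in> carrier X" "d \<in> carrier H" "c \<in> carrier H" for r d c
    using that by (simp add: lact HYH_closed Y.X.CC.tsum_tens[OF Y.X.CC.T_group lact_bal])
  have HYH_add1: "add_map H ?HYH (\<lambda>d. d \<boxtimes>\<^bsub>?HYH\<^esub> c)" if "c \<in> carrier H" for c
    using that by (rule bal_map_add1[OF Y.X.CC.tens_bal _ add_map_id])
  have HYH_add2: "add_map H ?HYH (\<lambda>c. d \<boxtimes>\<^bsub>?HYH\<^esub> c)" if "d \<in> carrier H" for d
    using that by (rule bal_map_add2[OF Y.X.CC.tens_bal _ add_map_id])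
  have HYH_balanced: "raY d y \<boxtimes>\<^bsub>?HYH\<^esub> c = d \<boxtimes>\<^bsub>?HYH\<^esub> laY y c"
    if "d \<in> carrier H" "c \<in> carrier H" "y \<in> carrier Y" for d c y
    using that by (rule bal_map_balanced[OF Y.X.CC.tens_bal])
  \<comment> \<open>The facts \<open>bal1\<close>, \<open>bal2\<close> and \<open>bal3\<close>
    ensure that the Sweedler sums on both sides are additive in the element on which the coaction is
    evaluated, and that they may be computed on elementary tensors.\<close>
  have bal1: "X.AX.bal G (\<lambda>x c. x \<boxtimes>\<^bsub>G\<^esub> \<gamma>Y c)"
  proof (rule X.AX_balI)
    show "raA a r \<boxtimes>\<^bsub>G\<^esub> \<gamma>Y b = a \<boxtimes>\<^bsub>G\<^esub> \<gamma>Y (laX r b)"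
      if "a \<in> carrier BH" "b \<in> carrier H" "r \<in> carrier X" for a b r
      using that Y.X.comult_closed by (simp add: gammaY_laX G_balanced lact)
    show "add_map H G (\<lambda>c. a \<boxtimes>\<^bsub>G\<^esub> \<gamma>Y c)" if "a \<in> carrier BH" for a
      using Y.X.comult_add_map that by (rule G_add2)
    show "add_map BH G (\<lambda>a. a \<boxtimes>\<^bsub>G\<^esub> \<gamma>Y b)" if "b \<in> carrier H" for b
      using that by (intro G_add0 Y.X.comult_closed)
  qed
  have bal2: "X.AX.bal G (\<lambda>y d. y \<boxtimes>\<^bsub>G\<^esub> (d \<boxtimes>\<^bsub>?HYH\<^esub> c))" if c: "c \<in> carrier H" for c
  proof (rule X.AX_balI)
    show "raA a r \<boxtimes>\<^bsub>G\<^esub> (b \<boxtimes>\<^bsub>?HYH\<^esub> c) = a \<boxtimes>\<^bsub>G\<^esub> (laX r b \<boxtimes>\<^bsub>?HYH\<^esub> c)"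
      if "a \<in> carrier BH" "b \<in> carrier H" "r \<in> carrier X" for a b r
      using that c by (simp add: G_balanced HYH_closed lact_tens)
    show "add_map H G (\<lambda>d. a \<boxtimes>\<^bsub>G\<^esub> (d \<boxtimes>\<^bsub>?HYH\<^esub> c))" if "a \<in> carrier BH" for a
      using HYH_add1[OF c] that by (rule G_add2)
    show "add_map BH G (\<lambda>a. a \<boxtimes>\<^bsub>G\<^esub> (b \<boxtimes>\<^bsub>?HYH\<^esub> c))" if "b \<in> carrier H" for b
      using that c by (intro G_add0 HYH_closed)
  qed
  have bal3: "Y.AX.bal G (\<lambda>x c. tsum A H G (X.\<rho> x) (\<lambda>y d. y \<boxtimes>\<^bsub>G\<^esub> (d \<boxtimes>\<^bsub>?HYH\<^esub> c)))"
  proof (rule Y.AX_balI)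
    show "add_map BH G (\<lambda>x. tsum A H G (X.\<rho> x) (\<lambda>y d. y \<boxtimes>\<^bsub>G\<^esub> (d \<boxtimes>\<^bsub>?HYH\<^esub> c)))"
      if "c \<in> carrier H" for c
      using that by (intro X.tsum_rho_add_map G_group bal2)
    show "add_map H G (\<lambda>c. tsum A H G (X.\<rho> x) (\<lambda>y d. y \<boxtimes>\<^bsub>G\<^esub> (d \<boxtimes>\<^bsub>?HYH\<^esub> c)))" for x
      by (intro add_map_tsum G_group G_add2 HYH_add2) auto
    fix a c r assume *: "a \<in> carrier BH" "c \<in> carrier H" "r \<in> carrier Y"
    have "tsum A H G (X.\<rho> (rbA a r)) (\<lambda>y d. y \<boxtimes>\<^bsub>G\<^esub> (d \<boxtimes>\<^bsub>?HYH\<^esub> c))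
      = tsum A H G (X.\<rho> a) (\<lambda>y d. y \<boxtimes>\<^bsub>G\<^esub> (raY d r \<boxtimes>\<^bsub>?HYH\<^esub> c))"
      unfolding rho_linear_pair[OF *(1,3)]
      using * by (intro X.AX.tsum_tsum_tens G_group bal2) auto
    then show "tsum A H G (X.\<rho> (rbA a r)) (\<lambda>y d. y \<boxtimes>\<^bsub>G\<^esub> (d \<boxtimes>\<^bsub>?HYH\<^esub> c))
      = tsum A H G (X.\<rho> a) (\<lambda>y d. y \<boxtimes>\<^bsub>G\<^esub> (d \<boxtimes>\<^bsub>?HYH\<^esub> laY r c))"
      using * by (simp add: HYH_balanced)
  qed
  have eq: "tsum A H G (X.\<rho> m) (\<lambda>x c. x \<boxtimes>\<^bsub>G\<^esub> \<gamma>Y c)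
    = tsum A H G (Y.\<rho> m) (\<lambda>x c. tsum A H G (X.\<rho> x) (\<lambda>y d. y \<boxtimes>\<^bsub>G\<^esub> (d \<boxtimes>\<^bsub>?HYH\<^esub> c)))"
  proof (rule BH.add_map_eqI[where G = G, OF X.tsum_rho_add_map[OF G_group bal1]
        Y.tsum_rho_add_map[OF G_group bal3] G_group _ m])
    fix b h assume bh: "b \<in> carrier B" "h \<in> carrier H"
    have "tsum A H G (Y.\<rho> (b \<boxtimes>\<^bsub>BH\<^esub> h)) (\<lambda>x c. tsum A H G (X.\<rho> x) (\<lambda>y d. y \<boxtimes>\<^bsub>G\<^esub> (d \<boxtimes>\<^bsub>?HYH\<^esub> c)))
      = tsum H H G (\<gamma>Y h) (\<lambda>a c. tsum H H G (\<gamma>X a) (\<lambda>a1 a2. (b \<boxtimes>\<^bsub>BH\<^esub> a1) \<boxtimes>\<^bsub>G\<^esub> (a2 \<boxtimes>\<^bsub>?HYH\<^esub> c)))"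
      unfolding Y.tsum_rho_tens[OF G_group bal3 bh]
      by (rule tsum_cong[OF HOL.refl]) (rule X.tsum_rho_tens[OF G_group bal2 bh(1)])
    also have "\<dots> = tsum H H G (\<gamma>X h) (\<lambda>a c. tsum H H G (\<gamma>Y c) (\<lambda>c1 c2. (b \<boxtimes>\<^bsub>BH\<^esub> a) \<boxtimes>\<^bsub>G\<^esub> (c1 \<boxtimes>\<^bsub>?HYH\<^esub> c2)))"
    proof (rule coassoc_eval[OF X.X.CC.tensor_pair_axioms Y.X.CC.tensor_pair_axioms])
      show "tri_map H (carrier X) raX laX (carrier Y) raY laY G
        (\<lambda>a c1 c2. (b \<boxtimes>\<^bsub>BH\<^esub> a) \<boxtimes>\<^bsub>G\<^esub> (c1 \<boxtimes>\<^bsub>?HYH\<^esub> c2))"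
        using bh by (intro tri_mapI G_add1 G_add2 HYH_add1 HYH_add2 BH_add2 add_map_id)
          (auto simp: HYH_closed HYH_balanced G_balanced lact_tens simp flip: X.raA_tens)
    qed (use bh coassoc_pair[OF bh(2)] G_group X.X.comult_closed Y.X.comult_closed in \<open>auto simp: Let_def\<close>)
    also have "\<dots> = tsum H H G (\<gamma>X h) (\<lambda>a c. (b \<boxtimes>\<^bsub>BH\<^esub> a) \<boxtimes>\<^bsub>G\<^esub> \<gamma>Y c)"
    proof (rule tsum_cong[OF HOL.refl])
      fix a c assume ac: "a \<in> carrier H" "c \<in> carrier H"
      have "add_map ?HYH G (\<lambda>T. (b \<boxtimes>\<^bsub>BH\<^esub> a) \<boxtimes>\<^bsub>G\<^esub> T)"
        using bal_map_add2[OF G_bal _ add_map_id, of "b \<boxtimes>\<^bsub>BH\<^esub> a"] bh ac by simp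
      from Y.X.CC.tsum_rep[OF this G_group Y.X.comult_closed[OF ac(2)]]
      show "tsum H H G (\<gamma>Y c) (\<lambda>c1 c2. (b \<boxtimes>\<^bsub>BH\<^esub> a) \<boxtimes>\<^bsub>G\<^esub> (c1 \<boxtimes>\<^bsub>?HYH\<^esub> c2)) = (b \<boxtimes>\<^bsub>BH\<^esub> a) \<boxtimes>\<^bsub>G\<^esub> \<gamma>Y c"
        by simp
    qed
    also have "\<dots> = tsum A H G (X.\<rho> (b \<boxtimes>\<^bsub>BH\<^esub> h)) (\<lambda>x c. x \<boxtimes>\<^bsub>G\<^esub> \<gamma>Y c)"
      by (rule X.tsum_rho_tens[OF G_group bal1 bh, symmetric])
    finally show "tsum A H G (X.\<rho> (b \<boxtimes>\<^bsub>BH\<^esub> h)) (\<lambda>x c. x \<boxtimes>\<^bsub>G\<^esub> \<gamma>Y c)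
      = tsum A H G (Y.\<rho> (b \<boxtimes>\<^bsub>BH\<^esub> h)) (\<lambda>x c. tsum A H G (X.\<rho> x) (\<lambda>y d. y \<boxtimes>\<^bsub>G\<^esub> (d \<boxtimes>\<^bsub>?HYH\<^esub> c)))"
      by (rule HOL.sym)
  qed
  have "sweedler G (X.\<rho> m) (\<lambda>x c. x \<boxtimes>\<^bsub>G\<^esub> \<gamma>Y c) = tsum A H G (X.\<rho> m) (\<lambda>x c. x \<boxtimes>\<^bsub>G\<^esub> \<gamma>Y c)"
    by (rule X.sweedler_rho[OF m])
  moreover have "sweedler G (Y.\<rho> m) (\<lambda>x c. sweedler G (X.\<rho> x) (\<lambda>y d. y \<boxtimes>\<^bsub>G\<^esub> (d \<boxtimes>\<^bsub>?HYH\<^esub> c)))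
    = tsum A H G (Y.\<rho> m) (\<lambda>x c. tsum A H G (X.\<rho> x) (\<lambda>y d. y \<boxtimes>\<^bsub>G\<^esub> (d \<boxtimes>\<^bsub>?HYH\<^esub> c)))"
    unfolding Y.sweedler_rho[OF m] by (rule tsum_cong[OF HOL.refl]) (simp add: X.sweedler_rho)
  ultimately show ?thesis using eq by simp
qed

end

section \<open>The two base actions on the crossed product and its two coactions\<close>

context crossed_hopf
begin

text \<open>These are the terms that the comodule algebra axioms produce when r is sent to 1 #
  s_R(r), so that \<open>raR_fun\<close> and \<open>raL_fun\<close> fold them literally. That they
  act on the factor H alone is \<open>raR_tens\<close> and \<open>raL_tens\<close>.\<close>

definition raR where "raR a r = a \<otimes>\<^bsub>A\<^esub> (\<one>\<^bsub>B\<^esub> \<boxtimes>\<^bsub>A\<^esub> sR r)"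
definition raL where "raL a l = (\<one>\<^bsub>B\<^esub> \<boxtimes>\<^bsub>A\<^esub> sR (\<pi>R (tL l))) \<otimes>\<^bsub>A\<^esub> a"

lemma raR_eq: "u \<in> carrier BH \<Longrightarrow> r \<in> carrier R \<Longrightarrow> raR u r = u \<star> j (sR r)"
  by (simp add: raR_def)

lemma raL_eq: "u \<in> carrier BH \<Longrightarrow> l \<in> carrier L \<Longrightarrow> raL u l = j (tL l) \<star> u"
  by (simp add: raL_def sR_\<pi>R_tL)

lemma P_tL_right_one: "h \<in> carrier H \<Longrightarrow> l \<in> carrier L \<Longrightarrow> P h (tL l) = j (h \<otimes>\<^bsub>H\<^esub> tL l)"
  using P_tL_right[of h "\<one>\<^bsub>H\<^esub>" l] by (simp add: P_one_right)

lemma P_tL_left_one: "h \<in> carrier H \<Longrightarrow> l \<in> carrier L \<Longrightarrow> P (tL l) h = j (tL l \<otimes>\<^bsub>H\<^esub> h)"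
  using P_tL_right[of "\<one>\<^bsub>H\<^esub>" h l] by (simp add: P_one_left)

lemma cmult_j_tL:
  "b \<in> carrier B \<Longrightarrow> h \<in> carrier H \<Longrightarrow> l \<in> carrier L \<Longrightarrow> (b \<boxtimes>\<^bsub>BH\<^esub> h) \<star> j (tL l) = b \<boxtimes>\<^bsub>BH\<^esub> (h \<otimes>\<^bsub>H\<^esub> tL l)"
  by (simp add: Theta_j P_tL_right_one del: Theta_tens)

text \<open>The coproduct of t_L(l) is 1 \<otimes> t_L(l), so the measuring sees only 1, which acts
  trivially; t_L(l) then slips past \<sigma>, which is balanced over L^op.\<close>

lemma j_tL_cmult:
  assumes "b \<in> carrier B" "h \<in> carrier H" "l \<in> carrier L"
  shows "j (tL l) \<star> (b \<boxtimes>\<^bsub>BH\<^esub> h) = b \<boxtimes>\<^bsub>BH\<^esub> (tL l \<otimes>\<^bsub>H\<^esub> h)"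
proof -
  have bal: "balL BH (\<lambda>h1 h2. (h1 \<cdot> b) \<triangleright> P h2 h)"
    using assms by (intro meas_act_bal P_add1 add_map_id P_sL_left)
  have "balL BH (\<lambda>h1 h2. (h1 \<cdot> b) \<triangleright> P (tL l \<otimes>\<^bsub>H\<^esub> h2) h)"
    using balL_tL[OF bal assms(3)] .
  then show ?thesis
    using assms SL_tL[OF BH_group bal H.one_closed assms(3)]
    by (simp add: SL_one act.act_one meas_unit P_tL_left_one)
qed

lemma j_sR_cmult:
  "b \<in> carrier B \<Longrightarrow> h \<in> carrier H \<Longrightarrow> r \<in> carrier R \<Longrightarrow> j (sR r) \<star> (b \<boxtimes>\<^bsub>BH\<^esub> h) = b \<boxtimes>\<^bsub>BH\<^esub> (sR r \<otimes>\<^bsub>H\<^esub> h)"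
  using j_tL_cmult[of b h "\<pi>L (sR r)"] by (simp add: tL_\<pi>L_sR del: cmult_tens)

lemma cmult_j_sR:
  "b \<in> carrier B \<Longrightarrow> h \<in> carrier H \<Longrightarrow> r \<in> carrier R \<Longrightarrow> (b \<boxtimes>\<^bsub>BH\<^esub> h) \<star> j (sR r) = b \<boxtimes>\<^bsub>BH\<^esub> (h \<otimes>\<^bsub>H\<^esub> sR r)"
  using cmult_j_tL[of b h "\<pi>L (sR r)"] by (simp add: tL_\<pi>L_sR del: cmult_tens)

lemma gammaR_eqs:
  assumes "h \<in> carrier H"
  shows "l \<in> carrier L \<Longrightarrow> \<gamma>R (sL l \<otimes>\<^bsub>H\<^esub> h) = right.SR right.HRH h (\<lambda>a b. (sL l \<otimes>\<^bsub>H\<^esub> a) \<boxtimes>\<^bsub>right.HRH\<^esub> b)"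
    and "l \<in> carrier L \<Longrightarrow> \<gamma>R (tL l \<otimes>\<^bsub>H\<^esub> h) = right.SR right.HRH h (\<lambda>a b. a \<boxtimes>\<^bsub>right.HRH\<^esub> (tL l \<otimes>\<^bsub>H\<^esub> b))"
    and "r \<in> carrier R \<Longrightarrow> \<gamma>R (h \<otimes>\<^bsub>H\<^esub> sR r) = right.SR right.HRH h (\<lambda>a b. a \<boxtimes>\<^bsub>right.HRH\<^esub> (b \<otimes>\<^bsub>H\<^esub> sR r))"
    and "r \<in> carrier R \<Longrightarrow> \<gamma>R (h \<otimes>\<^bsub>H\<^esub> tR r) = right.SR right.HRH h (\<lambda>a b. (a \<otimes>\<^bsub>H\<^esub> tR r) \<boxtimes>\<^bsub>right.HRH\<^esub> b)"
  using assms
    SR_sL[OF right.HRH_group right.corR.CC.tens_bal assms]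
    SR_tL[OF right.HRH_group right.corR.CC.tens_bal assms]
    right.SR_sR[OF right.HRH_group right.corR.CC.tens_bal assms]
    right.SR_tR[OF right.HRH_group right.corR.CC.tens_bal assms]
  by (simp_all add: right.corR.CC.tsum_tens_self)

lemma gammaL_eqs:
  assumes "h \<in> carrier H"
  shows "l \<in> carrier L \<Longrightarrow> \<gamma>L (sL l \<otimes>\<^bsub>H\<^esub> h) = SL HLH h (\<lambda>a b. (sL l \<otimes>\<^bsub>H\<^esub> a) \<boxtimes>\<^bsub>HLH\<^esub> b)"
    and "l \<in> carrier L \<Longrightarrow> \<gamma>L (tL l \<otimes>\<^bsub>H\<^esub> h) = SL HLH h (\<lambda>a b. a \<boxtimes>\<^bsub>HLH\<^esub> (tL l \<otimes>\<^bsub>H\<^esub> b))"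
    and "r \<in> carrier R \<Longrightarrow> \<gamma>L (h \<otimes>\<^bsub>H\<^esub> sR r) = SL HLH h (\<lambda>a b. a \<boxtimes>\<^bsub>HLH\<^esub> (b \<otimes>\<^bsub>H\<^esub> sR r))"
    and "r \<in> carrier R \<Longrightarrow> \<gamma>L (h \<otimes>\<^bsub>H\<^esub> tR r) = SL HLH h (\<lambda>a b. (a \<otimes>\<^bsub>H\<^esub> tR r) \<boxtimes>\<^bsub>HLH\<^esub> b)"
  using assms
    SL_sL[OF HLH_group corL.CC.tens_bal assms]
    SL_tL[OF HLH_group corL.CC.tens_bal assms]
    SL_mult_sR[OF HLH_group corL.CC.tens_bal assms]
    SL_mult_tR[OF HLH_group corL.CC.tens_bal assms]
  by (simp_all add: corL.CC.tsum_tens_self)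

lemma raR_add: "r \<in> carrier R \<Longrightarrow> add_map BH BH (\<lambda>u. raR u r)"
  using cmult_add1[OF _ add_map_id, of "j (sR r)"] by (simp add: add_map_def raR_eq
      abelian_monoid.a_closed abelian_group.axioms(1))

lemma raL_add: "l \<in> carrier L \<Longrightarrow> add_map BH BH (\<lambda>u. raL u l)"
  using cmult_add2[OF add_map_id, of "j (tL l)"] by (simp add: add_map_def raL_eq
      abelian_monoid.a_closed abelian_group.axioms(1))

lemma raR_tens:
  "b \<in> carrier B \<Longrightarrow> h \<in> carrier H \<Longrightarrow> r \<in> carrier R \<Longrightarrow> raR (b \<boxtimes>\<^bsub>BH\<^esub> h) r = b \<boxtimes>\<^bsub>BH\<^esub> (h \<otimes>\<^bsub>H\<^esub> sR r)"
  by (simp add: raR_eq cmult_j_sR del: cmult_tens)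

lemma raL_tens:
  "b \<in> carrier B \<Longrightarrow> h \<in> carrier H \<Longrightarrow> l \<in> carrier L \<Longrightarrow> raL (b \<boxtimes>\<^bsub>BH\<^esub> h) l = b \<boxtimes>\<^bsub>BH\<^esub> (tL l \<otimes>\<^bsub>H\<^esub> h)"
  by (simp add: raL_eq j_tL_cmult del: cmult_tens)

sublocale cR: crossed_coact K H L sL tL \<gamma>L \<pi>L B \<iota> meas \<sigma> R sR tR \<gamma>R \<pi>R S
  R "\<lambda>r h. h \<otimes>\<^bsub>H\<^esub> tR r" "\<lambda>h r. h \<otimes>\<^bsub>H\<^esub> sR r" \<gamma>R \<pi>R raR
  by (intro crossed_coact.intro crossed_hopf_axioms right.coringR crossed_coact_axioms.intro)
    (simp_all add: H.m_assoc gammaR_eqs raR_add raR_tens)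

sublocale cL: crossed_coact K H L sL tL \<gamma>L \<pi>L B \<iota> meas \<sigma> R sR tR \<gamma>R \<pi>R S
  L "\<lambda>l h. sL l \<otimes>\<^bsub>H\<^esub> h" "\<lambda>h l. tL l \<otimes>\<^bsub>H\<^esub> h" \<gamma>L \<pi>L raL
  by (intro crossed_coact.intro crossed_hopf_axioms coringL crossed_coact_axioms.intro)
    (simp_all add: sL_tL_left_commute gammaL_eqs raL_add raL_tens)

text \<open>The four instances feed \<open>A_comodule\<close>: \<open>pair_RR\<close> and
  \<open>pair_LL\<close> give coassociativity of each coaction, \<open>pair_RL\<close> and
  \<open>pair_LR\<close> the mixed laws and linearity over the other base.\<close>

lemma pair_RR: "crossed_coact_pair K H L sL tL \<gamma>L \<pi>L B \<iota> meas \<sigma> R sR tR \<gamma>R \<pi>R S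
  R (\<lambda>r h. h \<otimes>\<^bsub>H\<^esub> tR r) (\<lambda>h r. h \<otimes>\<^bsub>H\<^esub> sR r) \<gamma>R \<pi>R raR R (\<lambda>r h. h \<otimes>\<^bsub>H\<^esub> tR r) (\<lambda>h r. h \<otimes>\<^bsub>H\<^esub> sR r) \<gamma>R \<pi>R raR"
  by (intro crossed_coact_pair.intro crossed_hopf_axioms cR.crossed_coact_axioms crossed_coact_pair_axioms.intro)
    (simp_all add: right.sR_tR_right_commute gammaR_eqs Let_def right.corR.coassoc)

lemma pair_LL: "crossed_coact_pair K H L sL tL \<gamma>L \<pi>L B \<iota> meas \<sigma> R sR tR \<gamma>R \<pi>R S
  L (\<lambda>l h. sL l \<otimes>\<^bsub>H\<^esub> h) (\<lambda>h l. tL l \<otimes>\<^bsub>H\<^esub> h) \<gamma>L \<pi>L raL L (\<lambda>l h. sL l \<otimes>\<^bsub>H\<^esub> h) (\<lambda>h l. tL l \<otimes>\<^bsub>H\<^esub> h) \<gamma>L \<pi>L raL"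
  by (intro crossed_coact_pair.intro crossed_hopf_axioms cL.crossed_coact_axioms crossed_coact_pair_axioms.intro)
    (simp_all add: sL_tL_left_commute gammaL_eqs Let_def corL.coassoc)

lemma pair_RL: "crossed_coact_pair K H L sL tL \<gamma>L \<pi>L B \<iota> meas \<sigma> R sR tR \<gamma>R \<pi>R S
  R (\<lambda>r h. h \<otimes>\<^bsub>H\<^esub> tR r) (\<lambda>h r. h \<otimes>\<^bsub>H\<^esub> sR r) \<gamma>R \<pi>R raR L (\<lambda>l h. sL l \<otimes>\<^bsub>H\<^esub> h) (\<lambda>h l. tL l \<otimes>\<^bsub>H\<^esub> h) \<gamma>L \<pi>L raL"
  using \<gamma>R_\<gamma>L_coassoc
  by (intro crossed_coact_pair.intro crossed_hopf_axioms cL.crossed_coact_axioms cR.crossed_coact_axioms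
      crossed_coact_pair_axioms.intro)
    (simp_all add: H.m_assoc gammaL_eqs gammaR_eqs Let_def)

lemma pair_LR: "crossed_coact_pair K H L sL tL \<gamma>L \<pi>L B \<iota> meas \<sigma> R sR tR \<gamma>R \<pi>R S
  L (\<lambda>l h. sL l \<otimes>\<^bsub>H\<^esub> h) (\<lambda>h l. tL l \<otimes>\<^bsub>H\<^esub> h) \<gamma>L \<pi>L raL R (\<lambda>r h. h \<otimes>\<^bsub>H\<^esub> tR r) (\<lambda>h r. h \<otimes>\<^bsub>H\<^esub> sR r) \<gamma>R \<pi>R raR"
  using \<gamma>L_\<gamma>R_coassoc
  by (intro crossed_coact_pair.intro crossed_hopf_axioms cL.crossed_coact_axioms cR.crossed_coact_axioms
      crossed_coact_pair_axioms.intro)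
    (simp_all add: H.m_assoc gammaL_eqs gammaR_eqs Let_def)

section \<open>Multiplicativity of the coactions\<close>

abbreviation "SR G h f \<equiv> tsum H H G (\<gamma>R h) f"

lemma P_raR:
  assumes "h \<in> carrier H" "k \<in> carrier H" "r \<in> carrier R"
  shows "P h (k \<otimes>\<^bsub>H\<^esub> sR r) = raR (P h k) r"
proof -
  have hom: "raR (tsum H H BH T f) r = tsum H H BH T (\<lambda>x y. raR (f x y) r)"
    if "\<And>x y. x \<in> carrier H \<Longrightarrow> y \<in> carrier H \<Longrightarrow> f x y \<in> carrier BH" for T f
    using that assms by (intro tsum_hom[of BH BH "\<lambda>u. raR u r"] raR_add BH_group)
  show ?thesis using assms
    by (simp add: P_def SL_mult_sR P_bal hom tsum_closed raR_tens H.m_assoc)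
qed

lemma P_raL:
  assumes "h \<in> carrier H" "k \<in> carrier H" "l \<in> carrier L"
  shows "P (tL l \<otimes>\<^bsub>H\<^esub> h) k = raL (P h k) l"
proof -
  have hom: "raL (tsum H H BH T f) l = tsum H H BH T (\<lambda>x y. raL (f x y) l)"
    if "\<And>x y. x \<in> carrier H \<Longrightarrow> y \<in> carrier H \<Longrightarrow> f x y \<in> carrier BH" for T f
    using that assms by (intro tsum_hom[of BH BH "\<lambda>u. raL u l"] raL_add BH_group)
  show ?thesis using assms
    by (simp add: P_def SL_tL P_bal1 hom tsum_closed raL_tens H.m_assoc)
qed

lemma rhoR_P:
  assumes "h \<in> carrier H" "k \<in> carrier H"
  shows "cR.\<rho> (P h k) = SR cR.AXH k (\<lambda>k1 k2. SR cR.AXH h (\<lambda>h1 h2. P h1 k1 \<boxtimes>\<^bsub>cR.AXH\<^esub> (h2 \<otimes>\<^bsub>H\<^esub> k2)))"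
proof (rule cR.rho_P[OF assms])
  fix h k f assume *: "h \<in> carrier H" "k \<in> carrier H" "right.balR cR.AXH f"
  show "SR cR.AXH (h \<otimes>\<^bsub>H\<^esub> k) f = SR cR.AXH k (\<lambda>k1 k2. SR cR.AXH h (\<lambda>h1 h2. f (h1 \<otimes>\<^bsub>H\<^esub> k1) (h2 \<otimes>\<^bsub>H\<^esub> k2)))"
    \<comment> \<open>Multiplicativity of \<gamma>R has the sum over the left factor outside, while
      \<open>rho_P\<close> expects the order of the left bialgebroid.\<close>
    unfolding right.SR_mult[OF cR.AXH_group *(3,1,2)]
    by (rule tsum_swap) (auto intro: bal_map_closed[OF *(3)])
next
  fix a d k x f
  assume *: "a \<in> carrier H" "d \<in> carrier H" "k \<in> carrier H" "x \<in> carrier R" "right.balR cR.AXH f"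
  from right.SR_takeuchi[OF cR.AXH_group right.balR_mult[OF *(5,1,2)] *(3,4)]
  show "SR cR.AXH k (\<lambda>k1 k2. f (a \<otimes>\<^bsub>H\<^esub> sR x \<otimes>\<^bsub>H\<^esub> k1) (d \<otimes>\<^bsub>H\<^esub> k2))
    = SR cR.AXH k (\<lambda>k1 k2. f (a \<otimes>\<^bsub>H\<^esub> k1) (d \<otimes>\<^bsub>H\<^esub> tR x \<otimes>\<^bsub>H\<^esub> k2))"
    using * by (simp add: H.m_assoc)
next
  fix h y k k' x
  assume *: "h \<in> carrier H" "y \<in> carrier H" "k \<in> carrier H" "k' \<in> carrier H" "x \<in> carrier R"
  have "(\<sigma> a y \<boxtimes>\<^bsub>BH\<^esub> (b \<otimes>\<^bsub>H\<^esub> (k \<otimes>\<^bsub>H\<^esub> sR x))) \<boxtimes>\<^bsub>cR.AXH\<^esub> (h2 \<otimes>\<^bsub>H\<^esub> k')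
    = (\<sigma> a y \<boxtimes>\<^bsub>BH\<^esub> (b \<otimes>\<^bsub>H\<^esub> k)) \<boxtimes>\<^bsub>cR.AXH\<^esub> (h2 \<otimes>\<^bsub>H\<^esub> (k' \<otimes>\<^bsub>H\<^esub> tR x))"
    if "a \<in> carrier H" "b \<in> carrier H" "h2 \<in> carrier H" for a b h2
    using * that cR.AXH_balanced[of "\<sigma> a y \<boxtimes>\<^bsub>BH\<^esub> (b \<otimes>\<^bsub>H\<^esub> k)" "h2 \<otimes>\<^bsub>H\<^esub> k'" x]
    by (simp add: raR_tens H.m_assoc)
  then show "SR cR.AXH h (\<lambda>h1 h2. SL cR.AXH h1 (\<lambda>a b. (\<sigma> a y \<boxtimes>\<^bsub>BH\<^esub> (b \<otimes>\<^bsub>H\<^esub> (k \<otimes>\<^bsub>H\<^esub> sR x))) \<boxtimes>\<^bsub>cR.AXH\<^esub> (h2 \<otimes>\<^bsub>H\<^esub> k')))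
    = SR cR.AXH h (\<lambda>h1 h2. SL cR.AXH h1 (\<lambda>a b. (\<sigma> a y \<boxtimes>\<^bsub>BH\<^esub> (b \<otimes>\<^bsub>H\<^esub> k)) \<boxtimes>\<^bsub>cR.AXH\<^esub> (h2 \<otimes>\<^bsub>H\<^esub> (k' \<otimes>\<^bsub>H\<^esub> tR x))))"
    by simp
qed (rule coassoc_LR[OF cR.AXH_group])

lemma rhoL_P:
  assumes "h \<in> carrier H" "k \<in> carrier H"
  shows "cL.\<rho> (P h k) = SL cL.AXH k (\<lambda>k1 k2. SL cL.AXH h (\<lambda>h1 h2. P h1 k1 \<boxtimes>\<^bsub>cL.AXH\<^esub> (h2 \<otimes>\<^bsub>H\<^esub> k2)))"
proof (rule cL.rho_P[OF assms])
  fix a d k x f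
  assume *: "a \<in> carrier H" "d \<in> carrier H" "k \<in> carrier H" "x \<in> carrier L" "balL cL.AXH f"
  show "SL cL.AXH k (\<lambda>k1 k2. f (tL x \<otimes>\<^bsub>H\<^esub> a \<otimes>\<^bsub>H\<^esub> k1) (d \<otimes>\<^bsub>H\<^esub> k2))
    = SL cL.AXH k (\<lambda>k1 k2. f (a \<otimes>\<^bsub>H\<^esub> k1) (sL x \<otimes>\<^bsub>H\<^esub> d \<otimes>\<^bsub>H\<^esub> k2))"
    using * by (simp add: H.m_assoc bal_map_balanced[OF *(5)])
next
  fix h y k k' x
  assume *: "h \<in> carrier H" "y \<in> carrier H" "k \<in> carrier H" "k' \<in> carrier H" "x \<in> carrier L"
  define F where "F k k' a b c = (\<sigma> a y \<boxtimes>\<^bsub>BH\<^esub> (b \<otimes>\<^bsub>H\<^esub> k)) \<boxtimes>\<^bsub>cL.AXH\<^esub> (c \<otimes>\<^bsub>H\<^esub> k')" for k k' a b c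
  have bal: "balL cL.AXH (F k k' a)" if "k \<in> carrier H" "k' \<in> carrier H" "a \<in> carrier H" for k k' a
    unfolding F_def using that *(2) cL.AXH_balanced
    by (intro bal_mapI add_map_intros cL.AXH_add1 cL.AXH_add2) (auto simp: H.m_assoc simp flip: raL_tens)
  have tri: "triL cL.AXH (F k k')" if "k \<in> carrier H" "k' \<in> carrier H" for k k'
    unfolding tri_map_def
  proof (intro conjI ballI)
    show "balL cL.AXH (\<lambda>a b. F k k' a b c)" if "c \<in> carrier H" for c
      unfolding F_def using \<open>k \<in> carrier H\<close> \<open>k' \<in> carrier H\<close> that *(2)
      by (intro bal_mapI add_map_intros cL.AXH_add1 cL.AXH_add2) (auto simp: H.m_assoc \<sigma>_tL BH_balanced)
  qed (use that bal in auto)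
  \<comment> \<open>The Takeuchi condition moves t_L(x) between the two legs of one coproduct.
    Coassociativity is used before and after it, to make the second and third leg of h such a
    pair.\<close>
  have "SL cL.AXH h (\<lambda>h1 h2. SL cL.AXH h1 (\<lambda>a b. F (tL x \<otimes>\<^bsub>H\<^esub> k) k' a b h2))
    = SL cL.AXH h (\<lambda>h1 h2. SL cL.AXH h2 (\<lambda>b c. F (tL x \<otimes>\<^bsub>H\<^esub> k) k' h1 b c))"
    by (intro SL_coassoc tri *(1) cL.AXH_group) (use * in auto)
  also have "\<dots> = SL cL.AXH h (\<lambda>h1 h2. SL cL.AXH h2 (\<lambda>b c. F k k' h1 (b \<otimes>\<^bsub>H\<^esub> tL x) c))"
    using * by (simp add: F_def H.m_assoc)
  also have "\<dots> = SL cL.AXH h (\<lambda>h1 h2. SL cL.AXH h2 (\<lambda>b c. F k k' h1 b (c \<otimes>\<^bsub>H\<^esub> sL x)))"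
    by (rule tsum_cong[OF HOL.refl], rule SL_takeuchi[OF cL.AXH_group bal]) (use * in auto)
  also have "\<dots> = SL cL.AXH h (\<lambda>h1 h2. SL cL.AXH h2 (\<lambda>b c. F k (sL x \<otimes>\<^bsub>H\<^esub> k') h1 b c))"
    using * by (simp add: F_def H.m_assoc)
  also have "\<dots> = SL cL.AXH h (\<lambda>h1 h2. SL cL.AXH h1 (\<lambda>a b. F k (sL x \<otimes>\<^bsub>H\<^esub> k') a b h2))"
    by (intro SL_coassoc[symmetric] tri *(1) cL.AXH_group) (use * in auto)
  finally show "SL cL.AXH h (\<lambda>h1 h2. SL cL.AXH h1 (\<lambda>a b. (\<sigma> a y \<boxtimes>\<^bsub>BH\<^esub> (b \<otimes>\<^bsub>H\<^esub> (tL x \<otimes>\<^bsub>H\<^esub> k))) \<boxtimes>\<^bsub>cL.AXH\<^esub> (h2 \<otimes>\<^bsub>H\<^esub> k')))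
    = SL cL.AXH h (\<lambda>h1 h2. SL cL.AXH h1 (\<lambda>a b. (\<sigma> a y \<boxtimes>\<^bsub>BH\<^esub> (b \<otimes>\<^bsub>H\<^esub> k)) \<boxtimes>\<^bsub>cL.AXH\<^esub> (h2 \<otimes>\<^bsub>H\<^esub> (sL x \<otimes>\<^bsub>H\<^esub> k'))))"
    unfolding F_def .
qed (rule SL_mult[OF cL.AXH_group] SL_coassoc[OF cL.AXH_group]; assumption)+

text \<open>On elementary tensors this is \<open>rho_cmult_tens\<close>; the work lies in the
  passage to all u and v. The inner summand is balanced because the R-action is right
  multiplication, the outer one after summation over v, by the Takeuchi condition of
  \<gamma>R.\<close>

lemma rhoR_cmult:
  assumes uv: "u \<in> carrier BH" "v \<in> carrier BH"
  shows "cR.\<rho> (u \<star> v) = tsum A H cR.AXH (cR.\<rho> u) (\<lambda>x h. tsum A H cR.AXH (cR.\<rho> v)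
    (\<lambda>x' h'. (x \<star> x') \<boxtimes>\<^bsub>cR.AXH\<^esub> (h \<otimes>\<^bsub>H\<^esub> h')))"
proof -
  note [add_map_intros] = cR.AXH_add1 cR.AXH_add2 cR.rho_add
  have bal_in: "cR.AX.bal cR.AXH (\<lambda>x' h'. (x \<star> x') \<boxtimes>\<^bsub>cR.AXH\<^esub> (h \<otimes>\<^bsub>H\<^esub> h'))"
    if "x \<in> carrier BH" "h \<in> carrier H" for x h
  proof (rule cR.AX_balI)
    show "(x \<star> raR a r) \<boxtimes>\<^bsub>cR.AXH\<^esub> (h \<otimes>\<^bsub>H\<^esub> b) = (x \<star> a) \<boxtimes>\<^bsub>cR.AXH\<^esub> (h \<otimes>\<^bsub>H\<^esub> (b \<otimes>\<^bsub>H\<^esub> tR r))"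
      if "a \<in> carrier BH" "b \<in> carrier H" "r \<in> carrier R" for a b r
      using that \<open>x \<in> carrier BH\<close> \<open>h \<in> carrier H\<close> cR.AXH_balanced[of "x \<star> a" "h \<otimes>\<^bsub>H\<^esub> b" r]
      by (simp add: raR_eq cmult_assoc H.m_assoc)
  qed (use that in \<open>auto intro!: add_map_intros\<close>)
  have inner: "tsum A H cR.AXH (cR.\<rho> (c \<boxtimes>\<^bsub>BH\<^esub> k)) (\<lambda>x' h'. (x \<star> x') \<boxtimes>\<^bsub>cR.AXH\<^esub> (h \<otimes>\<^bsub>H\<^esub> h'))
      = SR cR.AXH k (\<lambda>k1 k2. (x \<star> (c \<boxtimes>\<^bsub>BH\<^esub> k1)) \<boxtimes>\<^bsub>cR.AXH\<^esub> (h \<otimes>\<^bsub>H\<^esub> k2))"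
    if "x \<in> carrier BH" "h \<in> carrier H" "c \<in> carrier B" "k \<in> carrier H" for x h c k
    using that by (intro cR.tsum_rho_tens cR.AXH_group bal_in)
  have bal_out: "cR.AX.bal cR.AXH (\<lambda>x h. tsum A H cR.AXH (cR.\<rho> v)
      (\<lambda>x' h'. (x \<star> x') \<boxtimes>\<^bsub>cR.AXH\<^esub> (h \<otimes>\<^bsub>H\<^esub> h')))" if v: "v \<in> carrier BH" for v
  proof (rule cR.AX_balI)
    fix x h r assume *: "x \<in> carrier BH" "h \<in> carrier H" "r \<in> carrier R"
    show "tsum A H cR.AXH (cR.\<rho> v) (\<lambda>x' h'. (raR x r \<star> x') \<boxtimes>\<^bsub>cR.AXH\<^esub> (h \<otimes>\<^bsub>H\<^esub> h'))
      = tsum A H cR.AXH (cR.\<rho> v) (\<lambda>x' h'. (x \<star> x') \<boxtimes>\<^bsub>cR.AXH\<^esub> (h \<otimes>\<^bsub>H\<^esub> tR r \<otimes>\<^bsub>H\<^esub> h'))"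
    proof (rule BH.add_map_eqI[where G = cR.AXH, OF cR.tsum_rho_add_map[OF _ bal_in]
          cR.tsum_rho_add_map[OF _ bal_in] cR.AXH_group _ v])
      fix c k assume ck: "c \<in> carrier B" "k \<in> carrier H"
      have "right.balR cR.AXH (\<lambda>p q. (x \<star> (c \<boxtimes>\<^bsub>BH\<^esub> p)) \<boxtimes>\<^bsub>cR.AXH\<^esub> (h \<otimes>\<^bsub>H\<^esub> q))"
      proof (rule bal_mapI)
        show "(x \<star> (c \<boxtimes>\<^bsub>BH\<^esub> (a \<otimes>\<^bsub>H\<^esub> sR r))) \<boxtimes>\<^bsub>cR.AXH\<^esub> (h \<otimes>\<^bsub>H\<^esub> b)
          = (x \<star> (c \<boxtimes>\<^bsub>BH\<^esub> a)) \<boxtimes>\<^bsub>cR.AXH\<^esub> (h \<otimes>\<^bsub>H\<^esub> (b \<otimes>\<^bsub>H\<^esub> tR r))"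
          if "a \<in> carrier H" "b \<in> carrier H" "r \<in> carrier R" for a b r
          using that ck * bal_map_balanced[OF bal_in[OF *(1,2)], of "c \<boxtimes>\<^bsub>BH\<^esub> a" b r]
          by (simp add: raR_tens)
      qed (use * ck in \<open>auto intro!: add_map_intros\<close>)
      from right.SR_takeuchi[OF cR.AXH_group this ck(2) *(3)]
      have "SR cR.AXH k (\<lambda>k1 k2. (raR x r \<star> (c \<boxtimes>\<^bsub>BH\<^esub> k1)) \<boxtimes>\<^bsub>cR.AXH\<^esub> (h \<otimes>\<^bsub>H\<^esub> k2))
        = SR cR.AXH k (\<lambda>k1 k2. (x \<star> (c \<boxtimes>\<^bsub>BH\<^esub> k1)) \<boxtimes>\<^bsub>cR.AXH\<^esub> (h \<otimes>\<^bsub>H\<^esub> tR r \<otimes>\<^bsub>H\<^esub> k2))"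
        using * ck by (simp add: raR_eq cmult_assoc j_sR_cmult H.m_assoc del: cmult_tens)
      then show "tsum A H cR.AXH (cR.\<rho> (c \<boxtimes>\<^bsub>BH\<^esub> k)) (\<lambda>x' h'. (raR x r \<star> x') \<boxtimes>\<^bsub>cR.AXH\<^esub> (h \<otimes>\<^bsub>H\<^esub> h'))
        = tsum A H cR.AXH (cR.\<rho> (c \<boxtimes>\<^bsub>BH\<^esub> k)) (\<lambda>x' h'. (x \<star> x') \<boxtimes>\<^bsub>cR.AXH\<^esub> (h \<otimes>\<^bsub>H\<^esub> tR r \<otimes>\<^bsub>H\<^esub> h'))"
        using * ck by (simp add: inner del: cR.rho_tens)
    qed (use * in auto)
  qed (auto intro!: add_map_intros)
  show ?thesis
  proof (rule BH.add_map_eqI[where G = cR.AXH and \<phi> = "\<lambda>u. cR.\<rho> (u \<star> v)", OF _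
        cR.tsum_rho_add_map[OF cR.AXH_group bal_out[OF uv(2)]] cR.AXH_group _ uv(1)])
    show "add_map BH cR.AXH (\<lambda>u. cR.\<rho> (u \<star> v))"
      using uv by (intro add_map_intros)
    fix b h assume bh: "b \<in> carrier B" "h \<in> carrier H"
    have out: "tsum A H cR.AXH (cR.\<rho> (b \<boxtimes>\<^bsub>BH\<^esub> h)) (\<lambda>x h. tsum A H cR.AXH (cR.\<rho> v)
        (\<lambda>x' h'. (x \<star> x') \<boxtimes>\<^bsub>cR.AXH\<^esub> (h \<otimes>\<^bsub>H\<^esub> h')))
      = SR cR.AXH h (\<lambda>h1 h2. tsum A H cR.AXH (cR.\<rho> v) (\<lambda>x' h'. ((b \<boxtimes>\<^bsub>BH\<^esub> h1) \<star> x') \<boxtimes>\<^bsub>cR.AXH\<^esub> (h2 \<otimes>\<^bsub>H\<^esub> h')))"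
      if "v \<in> carrier BH" for v
      using that bh by (intro cR.tsum_rho_tens cR.AXH_group bal_out)
    show "cR.\<rho> ((b \<boxtimes>\<^bsub>BH\<^esub> h) \<star> v) = tsum A H cR.AXH (cR.\<rho> (b \<boxtimes>\<^bsub>BH\<^esub> h)) (\<lambda>x h. tsum A H cR.AXH (cR.\<rho> v)
        (\<lambda>x' h'. (x \<star> x') \<boxtimes>\<^bsub>cR.AXH\<^esub> (h \<otimes>\<^bsub>H\<^esub> h')))"
      unfolding out[OF uv(2)]
    proof (rule BH.add_map_eqI[where G = cR.AXH and \<phi> = "\<lambda>v. cR.\<rho> ((b \<boxtimes>\<^bsub>BH\<^esub> h) \<star> v)", OF _ _ cR.AXH_group _ uv(2)])
      show "add_map BH cR.AXH (\<lambda>v. cR.\<rho> ((b \<boxtimes>\<^bsub>BH\<^esub> h) \<star> v))"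
        by (intro add_map_intros)
      show "add_map BH cR.AXH (\<lambda>v. SR cR.AXH h (\<lambda>h1 h2. tsum A H cR.AXH (cR.\<rho> v)
          (\<lambda>x' h'. ((b \<boxtimes>\<^bsub>BH\<^esub> h1) \<star> x') \<boxtimes>\<^bsub>cR.AXH\<^esub> (h2 \<otimes>\<^bsub>H\<^esub> h'))))"
        using bh by (intro add_map_tsum cR.tsum_rho_add_map cR.AXH_group bal_in) auto
      fix c k assume ck: "c \<in> carrier B" "k \<in> carrier H"
      have "cR.\<rho> ((b \<boxtimes>\<^bsub>BH\<^esub> h) \<star> (c \<boxtimes>\<^bsub>BH\<^esub> k)) = SR cR.AXH h (\<lambda>h1 h2. SR cR.AXH k
          (\<lambda>k1 k2. ((b \<boxtimes>\<^bsub>BH\<^esub> h1) \<star> (c \<boxtimes>\<^bsub>BH\<^esub> k1)) \<boxtimes>\<^bsub>cR.AXH\<^esub> (h2 \<otimes>\<^bsub>H\<^esub> k2)))"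
      proof (rule cR.rho_cmult_tens[OF bh(2) ck(2) bh(1) ck(1) coassoc_LR[OF cR.AXH_group] rhoR_P[OF _ ck(2)]])
        fix a d x assume *: "a \<in> carrier H" "d \<in> carrier H" "x \<in> carrier R"
        have "right.balR cR.AXH (\<lambda>p q. P a p \<boxtimes>\<^bsub>cR.AXH\<^esub> (d \<otimes>\<^bsub>H\<^esub> q))"
          using * cR.AXH_balanced[of "P a _" "d \<otimes>\<^bsub>H\<^esub> _"]
          by (intro bal_mapI add_map_intros) (auto simp: P_raR H.m_assoc)
        from right.SR_takeuchi[OF cR.AXH_group this ck(2) *(3)]
        show "SR cR.AXH k (\<lambda>k1 k2. P (a \<otimes>\<^bsub>H\<^esub> sR x) k1 \<boxtimes>\<^bsub>cR.AXH\<^esub> (d \<otimes>\<^bsub>H\<^esub> k2))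
          = SR cR.AXH k (\<lambda>k1 k2. P a k1 \<boxtimes>\<^bsub>cR.AXH\<^esub> (d \<otimes>\<^bsub>H\<^esub> tR x \<otimes>\<^bsub>H\<^esub> k2))"
          using * P_tL_right[of a _ "\<pi>L (sR x)"] by (simp add: tL_\<pi>L_sR H.m_assoc)
      qed
      then show "cR.\<rho> ((b \<boxtimes>\<^bsub>BH\<^esub> h) \<star> (c \<boxtimes>\<^bsub>BH\<^esub> k)) = SR cR.AXH h (\<lambda>h1 h2. tsum A H cR.AXH
          (cR.\<rho> (c \<boxtimes>\<^bsub>BH\<^esub> k)) (\<lambda>x' h'. ((b \<boxtimes>\<^bsub>BH\<^esub> h1) \<star> x') \<boxtimes>\<^bsub>cR.AXH\<^esub> (h2 \<otimes>\<^bsub>H\<^esub> h')))"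
        using bh ck by (simp add: inner del: cR.rho_tens cmult_tens)
    qed
  qed
qed

text \<open>The sum over u is the inner one here, as the Takeuchi condition of \<gamma>L concerns
  right multiplication. The L-action is left multiplication by 1 # t_L(l), hence commutes with right
  factors, which balances the inner summand.\<close>

lemma rhoL_cmult:
  assumes uv: "u \<in> carrier BH" "v \<in> carrier BH"
  shows "cL.\<rho> (u \<star> v) = tsum A H cL.AXH (cL.\<rho> v) (\<lambda>x' h'. tsum A H cL.AXH (cL.\<rho> u)
    (\<lambda>x h. (x \<star> x') \<boxtimes>\<^bsub>cL.AXH\<^esub> (h \<otimes>\<^bsub>H\<^esub> h')))"
proof -
  note [add_map_intros] = cL.AXH_add1 cL.AXH_add2 cL.rho_add
  have bal_in: "cL.AX.bal cL.AXH (\<lambda>x h. (x \<star> x') \<boxtimes>\<^bsub>cL.AXH\<^esub> (h \<otimes>\<^bsub>H\<^esub> h'))"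
    if "x' \<in> carrier BH" "h' \<in> carrier H" for x' h'
  proof (rule cL.AX_balI)
    show "(raL a r \<star> x') \<boxtimes>\<^bsub>cL.AXH\<^esub> (b \<otimes>\<^bsub>H\<^esub> h') = (a \<star> x') \<boxtimes>\<^bsub>cL.AXH\<^esub> (sL r \<otimes>\<^bsub>H\<^esub> b \<otimes>\<^bsub>H\<^esub> h')"
      if "a \<in> carrier BH" "b \<in> carrier H" "r \<in> carrier L" for a b r
      using that \<open>x' \<in> carrier BH\<close> \<open>h' \<in> carrier H\<close> cL.AXH_balanced[of "a \<star> x'" "b \<otimes>\<^bsub>H\<^esub> h'" r]
      by (simp add: raL_eq cmult_assoc H.m_assoc del: cmult_tens)
  qed (use that in \<open>auto intro!: add_map_intros\<close>)
  have inner: "tsum A H cL.AXH (cL.\<rho> (b \<boxtimes>\<^bsub>BH\<^esub> k)) (\<lambda>x h. (x \<star> x') \<boxtimes>\<^bsub>cL.AXH\<^esub> (h \<otimes>\<^bsub>H\<^esub> h'))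
      = SL cL.AXH k (\<lambda>k1 k2. ((b \<boxtimes>\<^bsub>BH\<^esub> k1) \<star> x') \<boxtimes>\<^bsub>cL.AXH\<^esub> (k2 \<otimes>\<^bsub>H\<^esub> h'))"
    if "x' \<in> carrier BH" "h' \<in> carrier H" "b \<in> carrier B" "k \<in> carrier H" for x' h' b k
    using that by (intro cL.tsum_rho_tens cL.AXH_group bal_in)
  have bal_out: "cL.AX.bal cL.AXH (\<lambda>x' h'. tsum A H cL.AXH (cL.\<rho> u)
      (\<lambda>x h. (x \<star> x') \<boxtimes>\<^bsub>cL.AXH\<^esub> (h \<otimes>\<^bsub>H\<^esub> h')))" if u: "u \<in> carrier BH" for u
  proof (rule cL.AX_balI)
    fix x' h' l assume *: "x' \<in> carrier BH" "h' \<in> carrier H" "l \<in> carrier L"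
    show "tsum A H cL.AXH (cL.\<rho> u) (\<lambda>x h. (x \<star> raL x' l) \<boxtimes>\<^bsub>cL.AXH\<^esub> (h \<otimes>\<^bsub>H\<^esub> h'))
      = tsum A H cL.AXH (cL.\<rho> u) (\<lambda>x h. (x \<star> x') \<boxtimes>\<^bsub>cL.AXH\<^esub> (h \<otimes>\<^bsub>H\<^esub> (sL l \<otimes>\<^bsub>H\<^esub> h')))"
    proof (rule BH.add_map_eqI[where G = cL.AXH, OF cL.tsum_rho_add_map[OF _ bal_in]
          cL.tsum_rho_add_map[OF _ bal_in] cL.AXH_group _ u])
      fix b k assume bk: "b \<in> carrier B" "k \<in> carrier H"
      have "balL cL.AXH (\<lambda>p q. ((b \<boxtimes>\<^bsub>BH\<^esub> p) \<star> x') \<boxtimes>\<^bsub>cL.AXH\<^esub> (q \<otimes>\<^bsub>H\<^esub> h'))"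
      proof (rule bal_mapI)
        show "((b \<boxtimes>\<^bsub>BH\<^esub> (tL r \<otimes>\<^bsub>H\<^esub> p)) \<star> x') \<boxtimes>\<^bsub>cL.AXH\<^esub> (q \<otimes>\<^bsub>H\<^esub> h')
          = ((b \<boxtimes>\<^bsub>BH\<^esub> p) \<star> x') \<boxtimes>\<^bsub>cL.AXH\<^esub> (sL r \<otimes>\<^bsub>H\<^esub> q \<otimes>\<^bsub>H\<^esub> h')"
          if "p \<in> carrier H" "q \<in> carrier H" "r \<in> carrier L" for p q r
          using that bk * bal_map_balanced[OF bal_in[OF *(1,2)], of "b \<boxtimes>\<^bsub>BH\<^esub> p" q r]
          by (simp add: raL_tens del: cmult_tens)
      qed (use * bk in \<open>auto intro!: add_map_intros simp del: cmult_tens\<close>)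
      from SL_takeuchi[OF cL.AXH_group this bk(2) *(3)]
      have "SL cL.AXH k (\<lambda>k1 k2. ((b \<boxtimes>\<^bsub>BH\<^esub> k1) \<star> raL x' l) \<boxtimes>\<^bsub>cL.AXH\<^esub> (k2 \<otimes>\<^bsub>H\<^esub> h'))
        = SL cL.AXH k (\<lambda>k1 k2. ((b \<boxtimes>\<^bsub>BH\<^esub> k1) \<star> x') \<boxtimes>\<^bsub>cL.AXH\<^esub> (k2 \<otimes>\<^bsub>H\<^esub> (sL l \<otimes>\<^bsub>H\<^esub> h')))"
        using * bk by (simp add: raL_eq cmult_j_tL H.m_assoc cmult_assoc[symmetric] del: cmult_tens)
      then show "tsum A H cL.AXH (cL.\<rho> (b \<boxtimes>\<^bsub>BH\<^esub> k)) (\<lambda>x h. (x \<star> raL x' l) \<boxtimes>\<^bsub>cL.AXH\<^esub> (h \<otimes>\<^bsub>H\<^esub> h'))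
        = tsum A H cL.AXH (cL.\<rho> (b \<boxtimes>\<^bsub>BH\<^esub> k)) (\<lambda>x h. (x \<star> x') \<boxtimes>\<^bsub>cL.AXH\<^esub> (h \<otimes>\<^bsub>H\<^esub> (sL l \<otimes>\<^bsub>H\<^esub> h')))"
        using * bk by (simp add: inner del: cL.rho_tens cmult_tens)
    qed (use * in auto)
  qed (auto intro!: add_map_intros)
  show ?thesis
  proof (rule BH.add_map_eqI[where G = cL.AXH and \<phi> = "\<lambda>v. cL.\<rho> (u \<star> v)", OF _
        cL.tsum_rho_add_map[OF cL.AXH_group bal_out[OF uv(1)]] cL.AXH_group _ uv(2)])
    show "add_map BH cL.AXH (\<lambda>v. cL.\<rho> (u \<star> v))"
      by (intro add_map_intros)
    fix c k assume ck: "c \<in> carrier B" "k \<in> carrier H"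
    have out: "tsum A H cL.AXH (cL.\<rho> (c \<boxtimes>\<^bsub>BH\<^esub> k)) (\<lambda>x' h'. tsum A H cL.AXH (cL.\<rho> u)
        (\<lambda>x h. (x \<star> x') \<boxtimes>\<^bsub>cL.AXH\<^esub> (h \<otimes>\<^bsub>H\<^esub> h')))
      = SL cL.AXH k (\<lambda>k1 k2. tsum A H cL.AXH (cL.\<rho> u) (\<lambda>x h. (x \<star> (c \<boxtimes>\<^bsub>BH\<^esub> k1)) \<boxtimes>\<^bsub>cL.AXH\<^esub> (h \<otimes>\<^bsub>H\<^esub> k2)))"
      if "u \<in> carrier BH" for u
      using that ck by (intro cL.tsum_rho_tens cL.AXH_group bal_out)
    show "cL.\<rho> (u \<star> (c \<boxtimes>\<^bsub>BH\<^esub> k)) = tsum A H cL.AXH (cL.\<rho> (c \<boxtimes>\<^bsub>BH\<^esub> k)) (\<lambda>x' h'. tsum A H cL.AXH (cL.\<rho> u)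
        (\<lambda>x h. (x \<star> x') \<boxtimes>\<^bsub>cL.AXH\<^esub> (h \<otimes>\<^bsub>H\<^esub> h')))"
      unfolding out[OF uv(1)]
    proof (rule BH.add_map_eqI[where G = cL.AXH and \<phi> = "\<lambda>u. cL.\<rho> (u \<star> (c \<boxtimes>\<^bsub>BH\<^esub> k))", OF _ _ cL.AXH_group _ uv(1)])
      show "add_map BH cL.AXH (\<lambda>u. cL.\<rho> (u \<star> (c \<boxtimes>\<^bsub>BH\<^esub> k)))"
        using ck by (intro add_map_intros) auto
      show "add_map BH cL.AXH (\<lambda>u. SL cL.AXH k (\<lambda>k1 k2. tsum A H cL.AXH (cL.\<rho> u)
          (\<lambda>x h. (x \<star> (c \<boxtimes>\<^bsub>BH\<^esub> k1)) \<boxtimes>\<^bsub>cL.AXH\<^esub> (h \<otimes>\<^bsub>H\<^esub> k2))))"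
        using ck by (intro add_map_tsum cL.tsum_rho_add_map cL.AXH_group bal_in) auto
      fix b h assume bh: "b \<in> carrier B" "h \<in> carrier H"
      have "cL.\<rho> ((b \<boxtimes>\<^bsub>BH\<^esub> h) \<star> (c \<boxtimes>\<^bsub>BH\<^esub> k)) = SL cL.AXH h (\<lambda>h1 h2. SL cL.AXH k
          (\<lambda>k1 k2. ((b \<boxtimes>\<^bsub>BH\<^esub> h1) \<star> (c \<boxtimes>\<^bsub>BH\<^esub> k1)) \<boxtimes>\<^bsub>cL.AXH\<^esub> (h2 \<otimes>\<^bsub>H\<^esub> k2)))"
      proof (rule cL.rho_cmult_tens[OF bh(2) ck(2) bh(1) ck(1) SL_coassoc[OF cL.AXH_group] rhoL_P[OF _ ck(2)]])
        fix a d x assume *: "a \<in> carrier H" "d \<in> carrier H" "x \<in> carrier L"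
        then show "SL cL.AXH k (\<lambda>k1 k2. P (tL x \<otimes>\<^bsub>H\<^esub> a) k1 \<boxtimes>\<^bsub>cL.AXH\<^esub> (d \<otimes>\<^bsub>H\<^esub> k2))
          = SL cL.AXH k (\<lambda>k1 k2. P a k1 \<boxtimes>\<^bsub>cL.AXH\<^esub> (sL x \<otimes>\<^bsub>H\<^esub> d \<otimes>\<^bsub>H\<^esub> k2))"
          by (simp add: P_raL cL.AXH_balanced H.m_assoc)
      qed
      also have "\<dots> = SL cL.AXH k (\<lambda>k1 k2. SL cL.AXH h
          (\<lambda>h1 h2. ((b \<boxtimes>\<^bsub>BH\<^esub> h1) \<star> (c \<boxtimes>\<^bsub>BH\<^esub> k1)) \<boxtimes>\<^bsub>cL.AXH\<^esub> (h2 \<otimes>\<^bsub>H\<^esub> k2)))"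
        using bh ck by (intro tsum_swap cL.AXH_group) (auto simp del: cmult_tens)
      finally show "cL.\<rho> ((b \<boxtimes>\<^bsub>BH\<^esub> h) \<star> (c \<boxtimes>\<^bsub>BH\<^esub> k)) = SL cL.AXH k (\<lambda>k1 k2. tsum A H cL.AXH
          (cL.\<rho> (b \<boxtimes>\<^bsub>BH\<^esub> h)) (\<lambda>x h. (x \<star> (c \<boxtimes>\<^bsub>BH\<^esub> k1)) \<boxtimes>\<^bsub>cL.AXH\<^esub> (h \<otimes>\<^bsub>H\<^esub> k2)))"
        using bh ck by (simp add: inner del: cL.rho_tens cmult_tens)
    qed
  qed
qed

section \<open>The crossed product as a comodule algebra and as an extension of B\<close>

lemma raR_fun: "(\<lambda>a r. a \<otimes>\<^bsub>A\<^esub> (\<one>\<^bsub>B\<^esub> \<boxtimes>\<^bsub>A\<^esub> sR r)) = raR"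
  by (intro ext) (simp only: raR_def)

lemma raL_fun: "(\<lambda>a l. (\<one>\<^bsub>B\<^esub> \<boxtimes>\<^bsub>A\<^esub> sR (\<pi>R (tL l))) \<otimes>\<^bsub>A\<^esub> a) = raL"
  by (intro ext) (simp only: raL_def)

lemma A_comodule: "right_hopf_comodule K H L sL tL \<gamma>L \<pi>L R sR tR \<gamma>R \<pi>R S A raR raL cR.\<rho> cL.\<rho>"
proof (intro right_hopf_comodule.intro hopf_algebroid_axioms right_hopf_comodule_axioms.intro)
  show "right_comodule K R H (\<lambda>r h. h \<otimes>\<^bsub>H\<^esub> tR r) (\<lambda>h r. h \<otimes>\<^bsub>H\<^esub> sR r) \<gamma>R \<pi>R A raR cR.\<rho>"
    by (intro right_comodule.intro right.coringR right_comodule_axioms.intro cR.raA_right_module cR.rho_linear;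
        (simp add: Let_def crossed_coact_pair.rho_coassoc_pair[OF pair_RR]; fail)?)
      (simp_all add: Let_def cR.rho_base_linear cR.sweedler_rho cR.rho_counit)
  show "right_comodule K L H (\<lambda>l h. sL l \<otimes>\<^bsub>H\<^esub> h) (\<lambda>h l. tL l \<otimes>\<^bsub>H\<^esub> h) \<gamma>L \<pi>L A raL cL.\<rho>"
    by (intro right_comodule.intro coringL right_comodule_axioms.intro cL.raA_right_module cL.rho_linear;
        (simp add: Let_def crossed_coact_pair.rho_coassoc_pair[OF pair_LL]; fail)?)
      (simp_all add: Let_def cL.rho_base_linear cL.sweedler_rho cL.rho_counit)
qed (simp_all add: Let_def crossed_coact_pair.rho_coassoc_pair[OF pair_RL] cR.sweedler_rho[symmetric]
    cL.sweedler_rho[symmetric] crossed_coact_pair.rho_linear_pair[OF pair_RL]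
    crossed_coact_pair.rho_linear_pair[OF pair_LR] crossed_coact_pair.rho_coassoc_pair[OF pair_LR])

lemma etaR_hom: "(\<lambda>r. \<one>\<^bsub>B\<^esub> \<boxtimes>\<^bsub>A\<^esub> sR r) \<in> alg_hom K R A"
  using right.sR_linear
  by (auto simp: alg_hom_def ring_hom_def k_linear_def cmult_j_sR right.sR_mult BH_smult_right
      add_map_add[OF BH_add2[OF B.one_closed add_map_id]] simp del: cmult_tens)

lemma etaL_hom: "(\<lambda>l. \<one>\<^bsub>B\<^esub> \<boxtimes>\<^bsub>A\<^esub> sL l) \<in> alg_hom K L A"
proof -
  have "j (sL l) \<star> j (sL l') = j (sL l \<otimes>\<^bsub>H\<^esub> sL l')" if "l \<in> carrier L" "l' \<in> carrier L" for l l'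
  proof -
    \<comment> \<open>Written as \<iota>(l) acting on the unit, the left factor comes out by
      B-linearity of the product.\<close>
    have "j (sL l) = \<iota> l \<triangleright> j \<one>\<^bsub>H\<^esub>" using that by (simp add: iota_tens)
    then show ?thesis using that by (simp add: bact_cmult cmult_one_left iota_tens del: bact_tens cmult_tens)
        (simp add: iota_tens)
  qed
  then show ?thesis using sL_linear
  by (auto simp: alg_hom_def ring_hom_def k_linear_def sL_mult BH_smult_right
      add_map_add[OF BH_add2[OF B.one_closed add_map_id]] simp del: cmult_tens)
qed

text \<open>Since \<gamma>R(s_R(r) h) = h^(1) \<otimes> s_R(r) h^(2), the left side at b # h is the
  counit law for s_R(r) h; left multiplication by 1 # s_R(r) gives b # s_R(r) h as well.\<close>

lemma left_action_A:
  assumes "u \<in> carrier BH" "r \<in> carrier R"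
  shows "tsum A H A (cR.\<rho> u) (\<lambda>x h. raR x (\<pi>R (sR r \<otimes>\<^bsub>H\<^esub> h))) = j (sR r) \<star> u"
proof -
  have pi: "\<pi>R (h \<otimes>\<^bsub>H\<^esub> tR x) = x \<otimes>\<^bsub>R\<^esub> \<pi>R h" if "x \<in> carrier R" "h \<in> carrier H" for x h
    using right.corR.counit_bilinear[of x "\<one>\<^bsub>R\<^esub>" h] that by simp
  have bal: "cR.AX.bal BH (\<lambda>x h. raR x (\<pi>R (sR r \<otimes>\<^bsub>H\<^esub> h)))"
  proof (rule cR.AX_balI)
    show "add_map H BH (\<lambda>h. raR x (\<pi>R (sR r \<otimes>\<^bsub>H\<^esub> h)))" if "x \<in> carrier BH" for x
      using that assms
      by (intro add_map_comp[OF add_map_comp[OF H.add_map_mult_left[OF _ add_map_id] right.corR.counit_add_map]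
            cR.raA_add2]) auto
    show "raR (raR a y) (\<pi>R (sR r \<otimes>\<^bsub>H\<^esub> b)) = raR a (\<pi>R (sR r \<otimes>\<^bsub>H\<^esub> (b \<otimes>\<^bsub>H\<^esub> tR y)))"
      if "a \<in> carrier BH" "b \<in> carrier H" "y \<in> carrier R" for a b y
      using that assms by (simp add: cR.raA_assoc pi right.R.m_closed flip: H.m_assoc)
  qed (use assms in \<open>auto intro!: raR_add\<close>)
  have "tsum A H BH (cR.\<rho> u) (\<lambda>x h. raR x (\<pi>R (sR r \<otimes>\<^bsub>H\<^esub> h))) = j (sR r) \<star> u"
  proof (rule BH.add_map_eqI[where G = BH, OF cR.tsum_rho_add_map[OF BH_group bal] cmult_add2[OF add_map_id]
        BH_group _ assms(1)])
    fix b h assume bh: "b \<in> carrier B" "h \<in> carrier H"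
    have "right.balR BH (\<lambda>a c. b \<boxtimes>\<^bsub>BH\<^esub> (a \<otimes>\<^bsub>H\<^esub> sR (\<pi>R c)))"
      using bh k_linear_add_map[OF right.sR_linear]
      by (intro bal_mapI add_map_intros add_map_comp[OF right.corR.counit_add_map, of H sR])
        (auto simp: pi right.sR_mult H.m_assoc)
    from right.SR_sR_mult[OF BH_group this bh(2) assms(2)]
    have "SR BH h (\<lambda>a c. b \<boxtimes>\<^bsub>BH\<^esub> (a \<otimes>\<^bsub>H\<^esub> sR (\<pi>R (sR r \<otimes>\<^bsub>H\<^esub> c)))) = b \<boxtimes>\<^bsub>BH\<^esub> (sR r \<otimes>\<^bsub>H\<^esub> h)"
      using right.SR_counit_right[OF BH_group BH_add2[OF bh(1) add_map_id], of "sR r \<otimes>\<^bsub>H\<^esub> h"] bh assms by simp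
    then show "tsum A H BH (cR.\<rho> (b \<boxtimes>\<^bsub>BH\<^esub> h)) (\<lambda>x h. raR x (\<pi>R (sR r \<otimes>\<^bsub>H\<^esub> h))) = j (sR r) \<star> (b \<boxtimes>\<^bsub>BH\<^esub> h)"
      using bh assms
      by (simp add: cR.tsum_rho_tens[OF BH_group bal] raR_tens j_sR_cmult del: cmult_tens cR.rho_tens)
  qed
  then show ?thesis by (simp add: tsum_target_cong[of A BH])
qed

lemma rhoR_one: "cR.\<rho> (j \<one>\<^bsub>H\<^esub>) = j \<one>\<^bsub>H\<^esub> \<boxtimes>\<^bsub>cR.AXH\<^esub> \<one>\<^bsub>H\<^esub>"
  by (simp add: right.SR_one cR.rho_bal1)

lemma rhoL_one: "cL.\<rho> (j \<one>\<^bsub>H\<^esub>) = j \<one>\<^bsub>H\<^esub> \<boxtimes>\<^bsub>cL.AXH\<^esub> \<one>\<^bsub>H\<^esub>"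
  by (simp add: SL_one cL.rho_bal1)

lemma A_comodule_algebra:
  "comodule_algebra K H L sL tL \<gamma>L \<pi>L R sR tR \<gamma>R \<pi>R S A (\<lambda>r. \<one>\<^bsub>B\<^esub> \<boxtimes>\<^bsub>A\<^esub> sR r) cR.\<rho> cL.\<rho>"
proof (intro comodule_algebra.intro comodule_algebra_data.intro hopf_algebroid_axioms comodule_algebra_axioms.intro A_algebra etaR_hom;
    (unfold raR_fun raL_fun)?)
  show "right_hopf_comodule K H L sL tL \<gamma>L \<pi>L R sR tR \<gamma>R \<pi>R S A raR raL cR.\<rho> cL.\<rho>"
    by (rule A_comodule)
  fix a r assume "a \<in> carrier A" "r \<in> carrier R"
  then show "sweedler A (cR.\<rho> a) (\<lambda>x h. x \<otimes>\<^bsub>A\<^esub> (\<one>\<^bsub>B\<^esub> \<boxtimes>\<^bsub>A\<^esub> sR (\<pi>R (sR r \<otimes>\<^bsub>H\<^esub> h)))) = (\<one>\<^bsub>B\<^esub> \<boxtimes>\<^bsub>A\<^esub> sR r) \<otimes>\<^bsub>A\<^esub> a"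
    using left_action_A[of a r] by (simp add: cR.sweedler_rho raR_def)
next
  show "cR.\<rho> \<one>\<^bsub>A\<^esub> = \<one>\<^bsub>A\<^esub> \<boxtimes>\<^bsub>cR.AXH\<^esub> \<one>\<^bsub>H\<^esub>" "cL.\<rho> \<one>\<^bsub>A\<^esub> = \<one>\<^bsub>A\<^esub> \<boxtimes>\<^bsub>cL.AXH\<^esub> \<one>\<^bsub>H\<^esub>"
    using rhoR_one rhoL_one by simp_all
next
  fix a a' assume *: "a \<in> carrier A" "a' \<in> carrier A"
  show "cR.\<rho> (a \<otimes>\<^bsub>A\<^esub> a') = sweedler cR.AXH (cR.\<rho> a) (\<lambda>x h. sweedler cR.AXH (cR.\<rho> a') (\<lambda>x' h'.
      (x \<otimes>\<^bsub>A\<^esub> x') \<boxtimes>\<^bsub>cR.AXH\<^esub> (h \<otimes>\<^bsub>H\<^esub> h')))"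
    using * by (auto simp: cR.sweedler_rho rhoR_cmult intro!: tsum_cong)
  show "cL.\<rho> (a \<otimes>\<^bsub>A\<^esub> a') = sweedler cL.AXH (cL.\<rho> a') (\<lambda>x' h'. sweedler cL.AXH (cL.\<rho> a) (\<lambda>x h.
      (x \<otimes>\<^bsub>A\<^esub> x') \<boxtimes>\<^bsub>cL.AXH\<^esub> (h \<otimes>\<^bsub>H\<^esub> h')))"
    using * by (auto simp: cL.sweedler_rho rhoL_cmult intro!: tsum_cong)
qed

text \<open>The retraction \<open>B \<otimes>_L \<pi>_L\<close> of \<open>b \<mapsto> b # 1\<close>.\<close>

definition retract where "retract u = tsum B H B u (\<lambda>b h. b \<otimes>\<^bsub>B\<^esub> \<iota> (\<pi>L h))"

lemma piL_sL_mult: "l \<in> carrier L \<Longrightarrow> h \<in> carrier H \<Longrightarrow> \<pi>L (sL l \<otimes>\<^bsub>H\<^esub> h) = l \<otimes>\<^bsub>L\<^esub> \<pi>L h"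
  using corL.counit_bilinear[of l "\<one>\<^bsub>L\<^esub>" h] by simp

lemma retract_bal: "BH.bal B (\<lambda>b h. b \<otimes>\<^bsub>B\<^esub> \<iota> (\<pi>L h))"
  by (intro bal_mapI add_map_intros) (auto simp: piL_sL_mult iota_mult B.m_assoc)

lemma retract_tens [simp]:
  "b \<in> carrier B \<Longrightarrow> h \<in> carrier H \<Longrightarrow> retract (b \<boxtimes>\<^bsub>BH\<^esub> h) = b \<otimes>\<^bsub>B\<^esub> \<iota> (\<pi>L h)"
  unfolding retract_def by (intro BH.tsum_tens retract_bal B_group)

lemma retract_add_map: "add_map BH B retract"
  using BH.tsum_add_map[OF B_group retract_bal] by (simp add: retract_def[abs_def])

text \<open>
  If \<open>u\<close> is coinvariant, then applying \<open>(b # h) \<otimes> k \<mapsto> b # h S(k)\<close> to \<open>\<rho>(u) = u \<otimes> 1\<close>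
  exhibits \<open>u\<close> as \<open>retract u # 1\<close>.
\<close>

lemma coinvariant_eq:
  assumes u: "u \<in> carrier BH" and coinv: "cR.\<rho> u = u \<boxtimes>\<^bsub>cR.AXH\<^esub> \<one>\<^bsub>H\<^esub>"
  shows "u = retract u \<boxtimes>\<^bsub>BH\<^esub> \<one>\<^bsub>H\<^esub>"
proof -
  define f where "f v k = tsum B H BH v (\<lambda>b h. b \<boxtimes>\<^bsub>BH\<^esub> (h \<otimes>\<^bsub>H\<^esub> k))" for v k
  have bal0: "BH.bal BH (\<lambda>b h. b \<boxtimes>\<^bsub>BH\<^esub> (h \<otimes>\<^bsub>H\<^esub> k))" if "k \<in> carrier H" for k
    using that by (intro bal_mapI add_map_intros) (auto simp: BH_balanced H.m_assoc)
  have f_tens: "f (b \<boxtimes>\<^bsub>BH\<^esub> h) k = b \<boxtimes>\<^bsub>BH\<^esub> (h \<otimes>\<^bsub>H\<^esub> k)"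
    if "b \<in> carrier B" "h \<in> carrier H" "k \<in> carrier H" for b h k
    unfolding f_def using that by (intro BH.tsum_tens bal0 BH_group)
  have f_add1: "add_map BH BH (\<lambda>v. f v k)" if "k \<in> carrier H" for k
    unfolding f_def using that by (intro BH.tsum_add_map bal0 BH_group)
  have f_add2: "add_map H BH (f v)" for v
    unfolding f_def by (intro add_map_intros) auto
  have bal: "cR.AX.bal BH (\<lambda>v k. f v (S k))"
  proof (rule cR.AX_balI)
    fix v k r assume *: "v \<in> carrier BH" "k \<in> carrier H" "r \<in> carrier R"
    show "f (raR v r) (S k) = f v (S (k \<otimes>\<^bsub>H\<^esub> tR r))"
      by (rule BH.add_map_eqI[where G = BH, OF add_map_comp[OF raR_add f_add1] f_add1])
        (use * in \<open>auto simp: raR_tens f_tens S_tR H.m_assoc\<close>)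
  qed (auto intro: add_map_comp[OF S_add_map f_add2] f_add1)
  have "u = f u \<one>\<^bsub>H\<^esub>"
    by (rule BH.add_map_eqI[where G = BH, OF add_map_id f_add1]) (use u in \<open>auto simp: f_tens\<close>)
  also have "\<dots> = tsum A H BH (cR.\<rho> u) (\<lambda>v k. f v (S k))"
    using u bal by (simp add: coinv cR.AX.tsum_tens S_one)
  also have "\<dots> = retract u \<boxtimes>\<^bsub>BH\<^esub> \<one>\<^bsub>H\<^esub>"
  proof (rule BH.add_map_eqI[where G = BH, OF cR.tsum_rho_add_map[OF BH_group bal]
        BH_add1[OF H.one_closed retract_add_map] BH_group _ u])
    fix b h assume bh: "b \<in> carrier B" "h \<in> carrier H"
    show "tsum A H BH (cR.\<rho> (b \<boxtimes>\<^bsub>BH\<^esub> h)) (\<lambda>v k. f v (S k)) = retract (b \<boxtimes>\<^bsub>BH\<^esub> h) \<boxtimes>\<^bsub>BH\<^esub> \<one>\<^bsub>H\<^esub>"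
      using bh S_right_hom[OF BH_add2[OF bh(1) add_map_id] BH_group bh(2)]
      by (simp add: cR.tsum_rho_tens[OF BH_group bal] f_tens BH_balanced del: cR.rho_tens)
  qed
  finally show ?thesis .
qed

lemma A_extension:
  "hopf_extension K H L sL tL \<gamma>L \<pi>L R sR tR \<gamma>R \<pi>R S A (\<lambda>r. \<one>\<^bsub>B\<^esub> \<boxtimes>\<^bsub>A\<^esub> sR r) cR.\<rho> cL.\<rho>
    B (\<lambda>b. b \<boxtimes>\<^bsub>A\<^esub> \<one>\<^bsub>H\<^esub>)"
proof (intro hopf_extension.intro A_comodule_algebra hopf_extension_axioms.intro B_algebra; (unfold raR_fun)?)
  show "(\<lambda>b. b \<boxtimes>\<^bsub>A\<^esub> \<one>\<^bsub>H\<^esub>) \<in> alg_hom K B A"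
    by (auto simp: alg_hom_def ring_hom_def k_linear_def Theta_one BH.smult_tens
        add_map_add[OF BH_add1[OF H.one_closed add_map_id]] simp del: Theta_tens)
  show "inj_on (\<lambda>b. b \<boxtimes>\<^bsub>A\<^esub> \<one>\<^bsub>H\<^esub>) (carrier B)"
  proof (rule inj_on_inverseI)
    show "retract (b \<boxtimes>\<^bsub>A\<^esub> \<one>\<^bsub>H\<^esub>) = b" if "b \<in> carrier B" for b
      using that by (simp add: \<pi>L_one)
  qed
  show "(\<lambda>b. b \<boxtimes>\<^bsub>A\<^esub> \<one>\<^bsub>H\<^esub>) ` carrier B = {b \<in> carrier A. cR.\<rho> b = b \<boxtimes>\<^bsub>cR.AXH\<^esub> \<one>\<^bsub>H\<^esub>}"
  proof (intro equalityI subsetI)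
    fix u assume "u \<in> {b \<in> carrier A. cR.\<rho> b = b \<boxtimes>\<^bsub>cR.AXH\<^esub> \<one>\<^bsub>H\<^esub>}"
    then have "u \<in> carrier BH" "u = retract u \<boxtimes>\<^bsub>BH\<^esub> \<one>\<^bsub>H\<^esub>"
      using coinvariant_eq[of u] by auto
    then show "u \<in> (\<lambda>b. b \<boxtimes>\<^bsub>A\<^esub> \<one>\<^bsub>H\<^esub>) ` carrier B"
      using add_map_closed[OF retract_add_map] by auto
  qed (auto simp: right.SR_one cR.rho_bal1)
qed

end

section \<open>The convolution inverse of the cleaving map\<close>

locale crossed_hopf_inv =
  crossed_hopf K H L sL tL \<gamma>L \<pi>L B \<iota> meas \<sigma> R sR tR \<gamma>R \<pi>R S
  for K :: "('k, 'y) ring_scheme"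
    and H :: "('k, 'h) module"
    and L :: "('k, 'l) module" and sL tL \<gamma>L \<pi>L
    and B :: "('k, 'b) module" and \<iota>
    and meas :: "'h \<Rightarrow> 'b \<Rightarrow> 'b"  (infixr \<open>\<cdot>\<close> 75)
    and \<sigma> :: "'h \<Rightarrow> 'h \<Rightarrow> 'b"
    and R :: "('k, 'r) module" and sR tR \<gamma>R \<pi>R S +
  fixes \<tau> :: "'h \<Rightarrow> 'h \<Rightarrow> 'b"
  assumes tau: "cocycle_inverse \<sigma> \<tau>"
begin

lemma tau_bilinear: "k_bilinear K H H B \<tau>"
  and tau_balanced: "h \<in> carrier H \<Longrightarrow> k \<in> carrier H \<Longrightarrow> l \<in> carrier L
    \<Longrightarrow> \<tau> (h \<otimes>\<^bsub>H\<^esub> sL l) k = \<tau> h (sL l \<otimes>\<^bsub>H\<^esub> k)"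
  and tau_sL: "h \<in> carrier H \<Longrightarrow> k \<in> carrier H \<Longrightarrow> l \<in> carrier L
    \<Longrightarrow> \<tau> (sL l \<otimes>\<^bsub>H\<^esub> h) k = \<iota> l \<otimes>\<^bsub>B\<^esub> \<tau> h k"
  and tau_tL: "h \<in> carrier H \<Longrightarrow> k \<in> carrier H \<Longrightarrow> l \<in> carrier L
    \<Longrightarrow> \<tau> (tL l \<otimes>\<^bsub>H\<^esub> h) k = \<tau> h k \<otimes>\<^bsub>B\<^esub> \<iota> l"
  using tau by (auto simp: cocycle_inverse_def)

lemma tau_iota: "h \<in> carrier H \<Longrightarrow> k \<in> carrier H \<Longrightarrow> l \<in> carrier L
    \<Longrightarrow> \<tau> h (tL l \<otimes>\<^bsub>H\<^esub> k) = SL B h (\<lambda>h1 h2. \<tau> h1 k \<otimes>\<^bsub>B\<^esub> (h2 \<cdot> \<iota> l))"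
  using tau by (auto simp: cocycle_inverse_def corL.sweedler_comult)

lemma tau_add1 [add_map_intros]: "k \<in> carrier H \<Longrightarrow> add_map M H f \<Longrightarrow> add_map M B (\<lambda>x. \<tau> (f x) k)"
  using k_bilinear_add_map(2)[OF tau_bilinear] by (rule add_map_comp[rotated])

lemma tau_add2 [add_map_intros]: "h \<in> carrier H \<Longrightarrow> add_map M H f \<Longrightarrow> add_map M B (\<lambda>x. \<tau> h (f x))"
  using k_bilinear_add_map(1)[OF tau_bilinear] by (rule add_map_comp[rotated])

lemma tau_closed [simp]: "h \<in> carrier H \<Longrightarrow> k \<in> carrier H \<Longrightarrow> \<tau> h k \<in> carrier B"
  using k_bilinear_add_map(1)[OF tau_bilinear] by (rule add_map_closed)

lemma sigma_tau:
  "h \<in> carrier H \<Longrightarrow> k \<in> carrier H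
    \<Longrightarrow> SL B k (\<lambda>k1 k2. SL B h (\<lambda>h1 h2. \<sigma> h1 k1 \<otimes>\<^bsub>B\<^esub> \<tau> h2 k2)) = h \<cdot> k \<cdot> \<one>\<^bsub>B\<^esub>"
  using tau by (auto simp: cocycle_inverse_def corL.sweedler_comult)

lemma tau_sigma:
  "h \<in> carrier H \<Longrightarrow> k \<in> carrier H
    \<Longrightarrow> SL B k (\<lambda>k1 k2. SL B h (\<lambda>h1 h2. \<tau> h1 k1 \<otimes>\<^bsub>B\<^esub> \<sigma> h2 k2)) = (h \<otimes>\<^bsub>H\<^esub> k) \<cdot> \<one>\<^bsub>B\<^esub>"
  using tau by (auto simp: cocycle_inverse_def corL.sweedler_comult)

text \<open>Condition (b) for \<tau> and condition (b) for \<sigma> produce the same middle factor h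
  \<cdot> \<iota>(l), as \<open>linked_meas\<close> requires.\<close>

lemma linked_tau_sigma: "linked (Suc (Suc 0)) B (\<otimes>\<^bsub>B\<^esub>) (fn2 \<tau>) (fn2 \<sigma>)"
  by (intro linked_meas actB)
    (auto simp: tau_tL \<sigma>_sL tau_iota sigma_iota_tsum intro!: add_map_intros)

text \<open>The part of \<open>linked_tau_sigma\<close> on the second variable, singled out because
  it has to be applied underneath a measuring by h.\<close>

lemma tau_sigma_link:
  assumes "k \<in> carrier H" "m \<in> carrier H" "m' \<in> carrier H" "l \<in> carrier L"
  shows "SL B k (\<lambda>k1 k2. \<tau> k1 (tL l \<otimes>\<^bsub>H\<^esub> m) \<otimes>\<^bsub>B\<^esub> \<sigma> k2 m')
    = SL B k (\<lambda>k1 k2. \<tau> k1 m \<otimes>\<^bsub>B\<^esub> \<sigma> k2 (sL l \<otimes>\<^bsub>H\<^esub> m'))"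
proof -
  from linked_tau_sigma assms
  have "conv B (\<otimes>\<^bsub>B\<^esub>) (\<lambda>p. fn2 \<tau> ((tL l \<otimes>\<^bsub>H\<^esub> m) # p)) (\<lambda>p. fn2 \<sigma> (m' # p)) [k]
    = conv B (\<otimes>\<^bsub>B\<^esub>) (\<lambda>p. fn2 \<tau> (m # p)) (\<lambda>p. fn2 \<sigma> ((sL l \<otimes>\<^bsub>H\<^esub> m') # p)) [k]"
    by (subst (asm) linked.simps) (auto simp del: conv.simps fn_Cons linked.simps)
  then show ?thesis by simp
qed

lemma multi_add_inverse:
  "multi_add (Suc (Suc (Suc 0))) B (fn3 (\<lambda>h k m. h \<cdot> \<tau> k m))"
  "multi_add (Suc (Suc (Suc 0))) B (fn3 (\<lambda>h k m. \<tau> (h \<otimes>\<^bsub>H\<^esub> k) m))"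
  by (intro multi_add_fn3 add_map_intros; auto)+

text \<open>In the third variable the balancing is that of \<tau> and \<sigma> in k, measured by h:
  multiplicativity of the measuring distributes h over the two factors.\<close>

lemma linked_meas_tau_sigma:
  "linked (Suc (Suc (Suc 0))) B (\<otimes>\<^bsub>B\<^esub>) (fn3 (\<lambda>h k m. h \<cdot> \<tau> k m)) (fn3 (\<lambda>h k m. h \<cdot> \<sigma> k m))"
proof (rule linked_fn3)
  fix m m' assume m: "m \<in> carrier H" "m' \<in> carrier H"
  show "linked (Suc (Suc 0)) B (\<otimes>\<^bsub>B\<^esub>) (fn2 (\<lambda>h k. h \<cdot> \<tau> k m)) (fn2 (\<lambda>h k. h \<cdot> \<sigma> k m'))"
    using m by (intro linked_meas actB)
      (auto simp: tau_tL \<sigma>_sL meas_tL meas_sL meas_mult_tsum intro!: add_map_intros)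
next
  fix h k m m' l
  assume *: "h \<in> carrier H" "k \<in> carrier H" "m \<in> carrier H" "m' \<in> carrier H" "l \<in> carrier L"
  then have "h \<cdot> SL B k (\<lambda>k1 k2. \<tau> k1 (tL l \<otimes>\<^bsub>H\<^esub> m) \<otimes>\<^bsub>B\<^esub> \<sigma> k2 m')
    = h \<cdot> SL B k (\<lambda>k1 k2. \<tau> k1 m \<otimes>\<^bsub>B\<^esub> \<sigma> k2 (sL l \<otimes>\<^bsub>H\<^esub> m'))"
    by (simp add: tau_sigma_link)
  then show "SL B k (\<lambda>k1 k2. SL B h (\<lambda>h1 h2. (h1 \<cdot> \<tau> k1 (tL l \<otimes>\<^bsub>H\<^esub> m)) \<otimes>\<^bsub>B\<^esub> (h2 \<cdot> \<sigma> k2 m')))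
    = SL B k (\<lambda>k1 k2. SL B h (\<lambda>h1 h2. (h1 \<cdot> \<tau> k1 m) \<otimes>\<^bsub>B\<^esub> (h2 \<cdot> \<sigma> k2 (sL l \<otimes>\<^bsub>H\<^esub> m'))))"
    using * by (simp add: meas_tsum meas_mult_tsum)
qed

lemma linked_sigma_tau:
  "linked (Suc (Suc (Suc 0))) B (\<otimes>\<^bsub>B\<^esub>) (fn3 (\<lambda>h k m. \<sigma> h (k \<otimes>\<^bsub>H\<^esub> m))) (fn3 (\<lambda>h k m. \<tau> (h \<otimes>\<^bsub>H\<^esub> k) m))"
proof (rule linked_fn3_diag[OF actB _ multi_add_cocycle(2) multi_add_inverse(2)])
  fix m m' assume m: "m \<in> carrier H" "m' \<in> carrier H"
  show "linked (Suc (Suc 0)) B (\<otimes>\<^bsub>B\<^esub>) (fn2 (\<lambda>h k. \<sigma> h (k \<otimes>\<^bsub>H\<^esub> m))) (fn2 (\<lambda>h k. \<tau> (h \<otimes>\<^bsub>H\<^esub> k) m'))"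
    using m by (intro linked_diag actB)
      (auto simp: \<sigma>_tL \<sigma>_balanced tau_sL H.m_assoc intro!: add_map_intros)
qed (auto simp: H.m_assoc tau_balanced simp flip: H.m_assoc)

lemma piL_tL_mult: "l \<in> carrier L \<Longrightarrow> h \<in> carrier H \<Longrightarrow> \<pi>L (tL l \<otimes>\<^bsub>H\<^esub> h) = \<pi>L h \<otimes>\<^bsub>L\<^esub> l"
  using corL.counit_bilinear[of "\<one>\<^bsub>L\<^esub>" l h] by simp

text \<open>
  With \<open>a = h \<cdot> \<tau>(k, m)\<close>, \<open>b = h \<cdot> \<sigma>(k, m)\<close>, \<open>c = \<sigma>(h, k m)\<close>, \<open>d = \<tau>(h k, m)\<close>
  evaluate the convolution product \<open>a b c d\<close> by first computing \<open>a b\<close>, respectively \<open>b c\<close>.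
\<close>

lemma inverse_cocycle:
  assumes hk: "h \<in> carrier H" "k \<in> carrier H" "m \<in> carrier H"
  shows "conv B (\<otimes>\<^bsub>B\<^esub>) (fn2 (\<lambda>h k. h \<cdot> \<tau> k m)) (fn2 \<sigma>) [k, h]
    = conv B (\<otimes>\<^bsub>B\<^esub>) (fn3 (\<lambda>h k m. \<sigma> h (k \<otimes>\<^bsub>H\<^esub> m))) (fn3 (\<lambda>h k m. \<tau> (h \<otimes>\<^bsub>H\<^esub> k) m)) [m, k, h]"
proof -
  let ?n = "Suc (Suc (Suc 0))" and ?cv = "conv B (\<otimes>\<^bsub>B\<^esub>)"
  let ?a = "fn3 (\<lambda>h k m. h \<cdot> \<tau> k m)" and ?b = "fn3 (\<lambda>h k m. h \<cdot> \<sigma> k m)"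
    and ?c = "fn3 (\<lambda>h k m. \<sigma> h (k \<otimes>\<^bsub>H\<^esub> m))" and ?d = "fn3 (\<lambda>h k m. \<tau> (h \<otimes>\<^bsub>H\<^esub> k) m)"
  note madd = multi_add_inverse multi_add_cocycle
  note links = linked_meas_tau_sigma linked_cocycle linked_sigma_tau
  have pts: "[m, k, h] \<in> pts ?n" using hk by simp
  have ab: "?cv ?a ?b [m, k, h] = h \<cdot> \<iota> (\<pi>L (k \<otimes>\<^bsub>H\<^esub> m))"
    if "h \<in> carrier H" "k \<in> carrier H" "m \<in> carrier H" for h k m
  proof -
    have "h \<cdot> SL B m (\<lambda>m1 m2. SL B k (\<lambda>k1 k2. \<tau> k1 m1 \<otimes>\<^bsub>B\<^esub> \<sigma> k2 m2)) = h \<cdot> \<iota> (\<pi>L (k \<otimes>\<^bsub>H\<^esub> m))"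
      using that by (simp add: tau_sigma meas_one)
    then show ?thesis using that by (simp add: meas_tsum meas_mult_tsum tsum_closed)
  qed
  \<comment> \<open>In front of \<sigma> the factor h \<cdot> \<iota>(\<pi>L(k m)) is absorbed by
    condition (b) of a cocycle, and the counit law for k m restores \<sigma>(h, k m).\<close>
  have abc: "?cv (?cv ?a ?b) ?c [m, k, h] = \<sigma> h (k \<otimes>\<^bsub>H\<^esub> m)"
    if "h \<in> carrier H" "k \<in> carrier H" "m \<in> carrier H" for h k m
  proof -
    have bal: "balL B (\<lambda>y1 y2. \<sigma> h (sL (\<pi>L y1) \<otimes>\<^bsub>H\<^esub> y2))"
      using that k_linear_add_map[OF sL_linear]
      by (intro bal_mapI add_map_intros add_map_comp[OF corL.counit_add_map, of H sL])
        (auto simp: piL_tL_mult sL_mult H.m_assoc)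
    have "?cv (?cv ?a ?b) ?c [m, k, h] = ?cv (fn3 (\<lambda>h k m. h \<cdot> \<iota> (\<pi>L (k \<otimes>\<^bsub>H\<^esub> m)))) ?c [m, k, h]"
      by (rule conv_cong[of ?n]) (use that in \<open>auto simp: ab simp del: conv.simps elim!: pts_SucE\<close>)
    also have "\<dots> = SL B (k \<otimes>\<^bsub>H\<^esub> m) (\<lambda>y1 y2. \<sigma> h (sL (\<pi>L y1) \<otimes>\<^bsub>H\<^esub> y2))"
      using that SL_mult[OF B_group bal that(2,3)] by (simp add: sigma_iota_tsum)
    also have "\<dots> = \<sigma> h (k \<otimes>\<^bsub>H\<^esub> m)"
      using that by (intro SL_counit_left B_group add_map_intros) auto
    finally show ?thesis .
  qed
  \<comment> \<open>The cocycle condition rewrites the product of b and c as that of \<sigma>(h, k)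
    and \<sigma>(h k, m). The second factor cancels against d by \<sigma> \<tau> = 1 and leaves (h
    k) \<cdot> \<iota>(\<pi>L(m)), which the twisting condition brings to the left of
    \<sigma>.\<close>
  have bcd: "?cv (?cv ?b ?c) ?d [m, k, h] = ?cv (fn2 (\<lambda>h k. h \<cdot> k \<cdot> \<iota> (\<pi>L m))) (fn2 \<sigma>) [k, h]"
    if hk: "h \<in> carrier H" "k \<in> carrier H" "m \<in> carrier H" for h k m
  proof -
    have "?cv (?cv ?b ?c) ?d [m, k, h] = SL B m (\<lambda>m1 m2. ?cv (?cv (fn2 \<sigma>) (fn2 (\<lambda>h k. \<sigma> (h \<otimes>\<^bsub>H\<^esub> k) m1)))
        (fn2 (\<lambda>h k. \<tau> (h \<otimes>\<^bsub>H\<^esub> k) m2)) [k, h])"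
      by (subst conv.simps(2), intro tsum_cong HOL.refl, rule conv_cong[of "Suc (Suc 0)"])
        (use hk in \<open>auto simp: cocycle_conv simp del: conv.simps elim!: pts_SucE\<close>)
    also have "\<dots> = SL B m (\<lambda>m1 m2. ?cv (fn2 \<sigma>) (?cv (fn2 (\<lambda>h k. \<sigma> (h \<otimes>\<^bsub>H\<^esub> k) m1))
        (fn2 (\<lambda>h k. \<tau> (h \<otimes>\<^bsub>H\<^esub> k) m2))) [k, h])"
    proof (intro tsum_cong HOL.refl conv_assoc[OF actB, where n = "Suc (Suc 0)", symmetric] multi_add_sigma)
      fix m1 m2 assume m: "m1 \<in> carrier H" "m2 \<in> carrier H"
      show "linked (Suc (Suc 0)) B (\<otimes>\<^bsub>B\<^esub>) (fn2 \<sigma>) (fn2 (\<lambda>h k. \<sigma> (h \<otimes>\<^bsub>H\<^esub> k) m1))"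
        using m by (intro linked_sigma_mult[where \<phi> = "\<lambda>x. \<sigma> x m1"] actB add_map_intros) (auto simp: \<sigma>_sL)
      show "linked (Suc (Suc 0)) B (\<otimes>\<^bsub>B\<^esub>) (fn2 (\<lambda>h k. \<sigma> (h \<otimes>\<^bsub>H\<^esub> k) m1)) (fn2 (\<lambda>h k. \<tau> (h \<otimes>\<^bsub>H\<^esub> k) m2))"
        using m by (intro linked_mult_mult[where \<phi> = "\<lambda>x. \<sigma> x m1" and \<psi> = "\<lambda>x. \<tau> x m2"] actB add_map_intros)
          (auto simp: \<sigma>_tL tau_sL)
      show "multi_add (Suc (Suc 0)) B (fn2 (\<lambda>h k. \<sigma> (h \<otimes>\<^bsub>H\<^esub> k) m1))"
        "multi_add (Suc (Suc 0)) B (fn2 (\<lambda>h k. \<tau> (h \<otimes>\<^bsub>H\<^esub> k) m2))"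
        using m by (intro multi_add_fn2 add_map_intros; simp)+
    qed (use hk in auto)
    also have "\<dots> = ?cv (fn2 \<sigma>) (\<lambda>p. SL B m (\<lambda>m1 m2. ?cv (fn2 (\<lambda>h k. \<sigma> (h \<otimes>\<^bsub>H\<^esub> k) m1))
        (fn2 (\<lambda>h k. \<tau> (h \<otimes>\<^bsub>H\<^esub> k) m2)) p)) [k, h]"
      by (intro conv_tsum2[OF actB, where n = "Suc (Suc 0)", symmetric] conv_closed[OF actB, where n = "Suc (Suc 0)"])
        (use hk in \<open>auto elim!: pts_SucE\<close>)
    also have "\<dots> = ?cv (fn2 \<sigma>) (fn2 (\<lambda>h k. (h \<otimes>\<^bsub>H\<^esub> k) \<cdot> \<iota> (\<pi>L m))) [k, h]"
    proof (rule conv_cong[of "Suc (Suc 0)"])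
      fix p assume "p \<in> pts (Suc (Suc 0))"
      then obtain h k where p: "p = [k, h]" "h \<in> carrier H" "k \<in> carrier H"
        by (auto elim!: pts_SucE)
      have "SL B (h \<otimes>\<^bsub>H\<^esub> k) (\<lambda>x1 x2. \<sigma> x1 m1 \<otimes>\<^bsub>B\<^esub> \<tau> x2 m2)
        = SL B k (\<lambda>k1 k2. SL B h (\<lambda>h1 h2. \<sigma> (h1 \<otimes>\<^bsub>H\<^esub> k1) m1 \<otimes>\<^bsub>B\<^esub> \<tau> (h2 \<otimes>\<^bsub>H\<^esub> k2) m2))"
        if "m1 \<in> carrier H" "m2 \<in> carrier H" for m1 m2
        using p that by (intro SL_mult B_group bal_mapI add_map_intros) (auto simp: \<sigma>_tL tau_sL B.m_assoc)
      then show "SL B m (\<lambda>m1 m2. ?cv (fn2 (\<lambda>h k. \<sigma> (h \<otimes>\<^bsub>H\<^esub> k) m1)) (fn2 (\<lambda>h k. \<tau> (h \<otimes>\<^bsub>H\<^esub> k) m2)) p)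
        = fn2 (\<lambda>h k. (h \<otimes>\<^bsub>H\<^esub> k) \<cdot> \<iota> (\<pi>L m)) p"
        using sigma_tau[of "h \<otimes>\<^bsub>H\<^esub> k" m] p hk by (simp add: meas_one)
    qed (use hk in auto)
    also have "\<dots> = ?cv (fn2 (\<lambda>h k. h \<cdot> k \<cdot> \<iota> (\<pi>L m))) (fn2 \<sigma>) [k, h]"
      using hk by (intro meas_twisted_conv[symmetric]) auto
    finally show ?thesis .
  qed
  have madd_bc: "multi_add ?n B (?cv ?b ?c)"
    by (intro multi_add_conv[OF actB] madd links)
  have "?cv ?a (?cv (?cv ?b ?c) ?d) [m, k, h] = ?cv (?cv ?a (?cv ?b ?c)) ?d [m, k, h]"
    by (intro conv_assoc[OF actB, where n = ?n] linked_conv1[OF actB] linked_conv2[OF actB] madd madd_bc links pts)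
  also have "\<dots> = ?cv ?c ?d [m, k, h]"
  proof (rule conv_cong[of ?n])
    fix p assume p: "p \<in> pts ?n"
    have "?cv ?a (?cv ?b ?c) p = ?cv (?cv ?a ?b) ?c p"
      by (intro conv_assoc[OF actB, where n = ?n] madd links p)
    then show "?cv ?a (?cv ?b ?c) p = ?c p"
      using p by (auto simp: abc simp del: conv.simps elim!: pts_SucE)
  qed (use hk in auto)
  finally have 1: "?cv ?a (?cv (?cv ?b ?c) ?d) [m, k, h] = ?cv ?c ?d [m, k, h]" .
  have "?cv ?a (?cv (?cv ?b ?c) ?d) [m, k, h]
    = SL B m (\<lambda>m1 m2. ?cv (fn2 (\<lambda>h k. h \<cdot> \<tau> k m1)) (?cv (fn2 (\<lambda>h k. h \<cdot> k \<cdot> \<iota> (\<pi>L m2))) (fn2 \<sigma>)) [k, h])"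
    by (subst conv.simps(2), intro tsum_cong HOL.refl, rule conv_cong[of "Suc (Suc 0)"])
      (use hk in \<open>auto simp: bcd simp del: conv.simps elim!: pts_SucE\<close>)
  also have "\<dots> = SL B m (\<lambda>m1 m2. ?cv (?cv (fn2 (\<lambda>h k. h \<cdot> \<tau> k m1)) (fn2 (\<lambda>h k. h \<cdot> k \<cdot> \<iota> (\<pi>L m2)))) (fn2 \<sigma>) [k, h])"
  proof (intro tsum_cong HOL.refl conv_assoc[OF actB, where n = "Suc (Suc 0)"] multi_add_sigma linked_meas_sigma)
    fix m1 m2 assume m: "m1 \<in> carrier H" "m2 \<in> carrier H"
    show "linked (Suc (Suc 0)) B (\<otimes>\<^bsub>B\<^esub>) (fn2 (\<lambda>h k. h \<cdot> \<tau> k m1)) (fn2 (\<lambda>h k. h \<cdot> k \<cdot> \<iota> (\<pi>L m2)))"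
      using m by (intro linked_meas actB)
        (auto simp: tau_tL meas_tL meas_sL meas_mult_tsum intro!: add_map_intros)
    show "multi_add (Suc (Suc 0)) B (fn2 (\<lambda>h k. h \<cdot> \<tau> k m1))"
      "multi_add (Suc (Suc 0)) B (fn2 (\<lambda>h k. h \<cdot> k \<cdot> \<iota> (\<pi>L m2)))"
      using m by (intro multi_add_fn2 add_map_intros; simp)+
  qed (use hk in \<open>auto simp: meas_tL intro!: add_map_intros\<close>)
  also have "\<dots> = ?cv (\<lambda>p. SL B m (\<lambda>m1 m2. ?cv (fn2 (\<lambda>h k. h \<cdot> \<tau> k m1)) (fn2 (\<lambda>h k. h \<cdot> k \<cdot> \<iota> (\<pi>L m2))) p)) (fn2 \<sigma>) [k, h]"
    by (intro conv_tsum1[OF actB, where n = "Suc (Suc 0)", symmetric] conv_closed[OF actB, where n = "Suc (Suc 0)"])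
      (use hk in \<open>auto elim!: pts_SucE\<close>)
  also have "\<dots> = ?cv (fn2 (\<lambda>h k. h \<cdot> \<tau> k m)) (fn2 \<sigma>) [k, h]"
  proof (rule conv_cong[of "Suc (Suc 0)"])
    fix p assume "p \<in> pts (Suc (Suc 0))"
    then obtain h k where p: "p = [k, h]" "h \<in> carrier H" "k \<in> carrier H"
      by (auto elim!: pts_SucE)
    \<comment> \<open>\<open>tau_iota\<close> absorbs the measured \<iota>(\<pi>L(m2)) into \<tau>,
      so that the counit law in m applies.\<close>
    have "SL B m (\<lambda>m1 m2. h \<cdot> \<tau> k (tL (\<pi>L m2) \<otimes>\<^bsub>H\<^esub> m1)) = h \<cdot> \<tau> k m"
      using p hk by (intro SL_counit_right B_group add_map_intros) auto
    then show "SL B m (\<lambda>m1 m2. ?cv (fn2 (\<lambda>h k. h \<cdot> \<tau> k m1)) (fn2 (\<lambda>h k. h \<cdot> k \<cdot> \<iota> (\<pi>L m2))) p) = fn2 (\<lambda>h k. h \<cdot> \<tau> k m) p"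
      using p by (simp add: tau_iota meas_tsum meas_mult_tsum)
  qed (use hk in auto)
  finally show ?thesis using 1 by (simp del: conv.simps)
qed

text \<open>Informally Q(y, w) is 1 # y w with 1 # w divided off on the right, as
  \<open>Q_cmult_j\<close> makes precise. The first argument is left free so that later it can be a
  product u S(v).\<close>

definition Q where "Q y w = SL BH y (\<lambda>y1 y2. \<tau> y1 w \<boxtimes>\<^bsub>BH\<^esub> y2)"

lemma Q_bal: "w \<in> carrier H \<Longrightarrow> balL BH (\<lambda>y1 y2. \<tau> y1 w \<boxtimes>\<^bsub>BH\<^esub> y2)"
  by (intro bal_mapI add_map_intros) (auto simp: tau_tL BH_balanced)

lemma Q_closed [simp]: "w \<in> carrier H \<Longrightarrow> Q y w \<in> carrier BH"
  unfolding Q_def by (intro tsum_closed BH_group) auto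

lemma Q_add1 [add_map_intros]: "w \<in> carrier H \<Longrightarrow> add_map M H f \<Longrightarrow> add_map M BH (\<lambda>x. Q (f x) w)"
  unfolding Q_def by (intro SL_add_map Q_bal BH_group)

lemma Q_add2 [add_map_intros]: "add_map M H f \<Longrightarrow> add_map M BH (\<lambda>x. Q y (f x))"
  unfolding Q_def by (intro add_map_intros BH_group)

lemma Q_sL: "y \<in> carrier H \<Longrightarrow> w \<in> carrier H \<Longrightarrow> l \<in> carrier L \<Longrightarrow> Q (sL l \<otimes>\<^bsub>H\<^esub> y) w = \<iota> l \<triangleright> Q y w"
  by (simp add: Q_def SL_sL Q_bal tau_sL act.act_tsum)

lemma Q_balanced:
  "y \<in> carrier H \<Longrightarrow> w \<in> carrier H \<Longrightarrow> l \<in> carrier L \<Longrightarrow> Q (y \<otimes>\<^bsub>H\<^esub> sL l) w = Q y (sL l \<otimes>\<^bsub>H\<^esub> w)"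
  by (simp add: Q_def SL_mult_sL Q_bal tau_balanced)

lemma Q_sR:
  assumes "y \<in> carrier H" "w \<in> carrier H" "r \<in> carrier R"
  shows "Q (sR r \<otimes>\<^bsub>H\<^esub> y) w = j (sR r) \<star> Q y w"
  using assms by (simp add: Q_def SL_sR Q_bal cmult_tsum j_sR_cmult del: cmult_tens)

lemma cmult_j_sL:
  assumes "b \<in> carrier B" "h \<in> carrier H" "l \<in> carrier L"
  shows "(b \<boxtimes>\<^bsub>BH\<^esub> h) \<star> j (sL l) = b \<triangleright> SL BH h (\<lambda>h1 h2. (h1 \<cdot> \<iota> l) \<triangleright> j h2)"
proof -
  have "j (sL l) = \<iota> l \<boxtimes>\<^bsub>BH\<^esub> \<one>\<^bsub>H\<^esub>" using assms by (simp add: iota_tens)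
  then show ?thesis using assms by (simp add: P_one_right)
qed

text \<open>Condition (b) of \<tau> and associativity of convolution in y. Through
  \<open>jc_tL\<close> this becomes the right L-linearity of the convolution inverse.\<close>

lemma Q_tL:
  assumes "y \<in> carrier H" "w \<in> carrier H" "l \<in> carrier L"
  shows "Q y (tL l \<otimes>\<^bsub>H\<^esub> w) = Q y w \<star> j (sL l)"
proof -
  have "Q y w \<star> j (sL l)
    = conv BH bact (fn1 (\<lambda>y. \<tau> y w)) (conv BH bact (fn1 (\<lambda>y. y \<cdot> \<iota> l)) (fn1 j)) [y]"
    using assms by (simp add: Q_def tsum_cmult cmult_j_sL del: cmult_tens)
  also have "\<dots> = conv BH bact (conv B (\<otimes>\<^bsub>B\<^esub>) (fn1 (\<lambda>y. \<tau> y w)) (fn1 (\<lambda>y. y \<cdot> \<iota> l))) (fn1 j) [y]"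
    using assms
    by (intro conv_assoc[OF actT, where n = "Suc 0"] multi_add_fn1 linked_fn1)
      (auto simp: tau_tL meas_sL meas_tL B.m_assoc BH_balanced intro!: add_map_intros)
  also have "\<dots> = Q y (tL l \<otimes>\<^bsub>H\<^esub> w)"
    using assms by (simp add: Q_def tau_iota tsum_closed)
  finally show ?thesis by simp
qed

lemma j_sL_cmult: "h \<in> carrier H \<Longrightarrow> l \<in> carrier L \<Longrightarrow> j (sL l) \<star> j h = j (sL l \<otimes>\<^bsub>H\<^esub> h)"
proof -
  assume *: "h \<in> carrier H" "l \<in> carrier L"
  have "j (sL l) = \<iota> l \<triangleright> j \<one>\<^bsub>H\<^esub>" using * by (simp add: iota_tens)
  then have "j (sL l) \<star> j h = \<iota> l \<triangleright> j h"
    using * by (simp add: bact_cmult cmult_one_left del: bact_tens cmult_tens)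
  then show ?thesis using * by (simp add: iota_tens)
qed

text \<open>The convolution of \<tau> and \<sigma> is \<iota>(\<pi>L(k m)), and the counit law for k
  m removes it.\<close>

lemma Q_cmult_j:
  assumes "k \<in> carrier H" "m \<in> carrier H"
  shows "SL BH m (\<lambda>m1 m2. Q k m1 \<star> j m2) = j (k \<otimes>\<^bsub>H\<^esub> m)"
proof -
  have bal: "balL BH (\<lambda>y1 y2. j (sL (\<pi>L y1) \<otimes>\<^bsub>H\<^esub> y2))"
    using k_linear_add_map[OF sL_linear]
    by (intro bal_mapI add_map_intros add_map_comp[OF corL.counit_add_map, of H sL])
      (auto simp: piL_tL_mult sL_mult H.m_assoc)
  have "SL BH m (\<lambda>m1 m2. Q k m1 \<star> j m2) = conv BH bact (fn2 \<tau>) (fn2 P) [m, k]"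
    using assms by (simp add: Q_def tsum_cmult Theta_j del: Theta_tens)
  also have "\<dots> = conv BH bact (fn2 \<tau>) (conv BH bact (fn2 \<sigma>) (fn2 (\<lambda>h k. j (h \<otimes>\<^bsub>H\<^esub> k)))) [m, k]"
    by (rule conv_cong[of "Suc (Suc 0)"]) (use assms in \<open>auto simp: P_eq_conv simp del: conv.simps elim!: pts_SucE\<close>)
  also have "\<dots> = conv BH bact (conv B (\<otimes>\<^bsub>B\<^esub>) (fn2 \<tau>) (fn2 \<sigma>)) (fn2 (\<lambda>h k. j (h \<otimes>\<^bsub>H\<^esub> k))) [m, k]"
    using assms by (intro conv_assoc[OF actT, where n = "Suc (Suc 0)"] multi_add_sigma multi_add_mult j_add
        linked_tau_sigma linked_P multi_add_fn2 add_map_intros) auto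
  also have "\<dots> = conv BH bact (fn2 (\<lambda>h k. \<iota> (\<pi>L (h \<otimes>\<^bsub>H\<^esub> k)))) (fn2 (\<lambda>h k. j (h \<otimes>\<^bsub>H\<^esub> k))) [m, k]"
    by (rule conv_cong[of "Suc (Suc 0)"]) (use assms in \<open>auto simp: tau_sigma meas_one elim!: pts_SucE\<close>)
  also have "\<dots> = SL BH (k \<otimes>\<^bsub>H\<^esub> m) (\<lambda>y1 y2. j (sL (\<pi>L y1) \<otimes>\<^bsub>H\<^esub> y2))"
    unfolding SL_mult[OF BH_group bal assms] using assms by (simp add: iota_tens)
  also have "\<dots> = j (k \<otimes>\<^bsub>H\<^esub> m)"
    using assms by (intro SL_counit_left j_add BH_group) auto
  finally show ?thesis .
qed

text \<open>Moving u past \<tau>(x1, w) measures it, and P(u2, x2) contributes \<sigma>. The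
  resulting (u1 \<cdot> \<tau>(x1, w)) \<sigma>(u2, x2) is the left side of
  \<open>inverse_cocycle\<close>, whose right side is then regrouped so that \<tau> and the tensor
  form Q.\<close>

lemma Theta_Q:
  assumes ux: "u \<in> carrier H" "x \<in> carrier H" "w \<in> carrier H"
  shows "\<Theta> u (Q x w) = SL BH w (\<lambda>w1 w2. SL BH x (\<lambda>x1 x2. SL BH u (\<lambda>u1 u2.
    \<sigma> u1 (x1 \<otimes>\<^bsub>H\<^esub> w1) \<triangleright> Q (u2 \<otimes>\<^bsub>H\<^esub> x2) w2)))"
proof -
  let ?n = "Suc (Suc 0)" and ?cvB = "conv B (\<otimes>\<^bsub>B\<^esub>)" and ?cv = "conv BH bact"
  let ?a = "fn2 (\<lambda>h k. h \<cdot> \<tau> k w)" and ?j = "fn2 (\<lambda>h k. j (h \<otimes>\<^bsub>H\<^esub> k))"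
  let ?s = "\<lambda>w. fn2 (\<lambda>h k. \<sigma> h (k \<otimes>\<^bsub>H\<^esub> w))" and ?t = "\<lambda>w. fn2 (\<lambda>h k. \<tau> (h \<otimes>\<^bsub>H\<^esub> k) w)"
  have pts: "[x, u] \<in> pts ?n" using ux by simp
  have "\<Theta> u (Q x w) = ?cv ?a (fn2 P) [x, u]"
  proof -
    have "\<tau> x1 w \<boxtimes>\<^bsub>BH\<^esub> x2 = \<tau> x1 w \<triangleright> j x2" if "x1 \<in> carrier H" "x2 \<in> carrier H" for x1 x2
      using that ux by simp
    then show ?thesis using ux
      by (simp add: Q_def Theta_tsum Theta_bact Theta_j del: Theta_tens bact_tens)
  qed
  also have "\<dots> = ?cv ?a (?cv (fn2 \<sigma>) ?j) [x, u]"
    by (rule conv_cong[of ?n]) (use ux in \<open>auto simp: P_eq_conv simp del: conv.simps elim!: pts_SucE\<close>)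
  also have "\<dots> = ?cv (?cvB ?a (fn2 \<sigma>)) ?j [x, u]"
  proof (intro conv_assoc[OF actT, where n = ?n] multi_add_sigma multi_add_mult j_add linked_P linked_meas_sigma pts)
    show "multi_add ?n B ?a"
      using ux by (intro multi_add_fn2 add_map_intros) auto
  qed (use ux in \<open>auto simp: tau_tL intro!: add_map_intros\<close>)
  also have "\<dots> = ?cv (\<lambda>p. SL B w (\<lambda>w1 w2. ?cvB (?s w1) (?t w2) p)) ?j [x, u]"
  proof (rule conv_cong[of ?n])
    fix p assume "p \<in> pts ?n"
    then obtain h k where p: "p = [k, h]" "h \<in> carrier H" "k \<in> carrier H"
      by (auto elim!: pts_SucE)
    show "?cvB ?a (fn2 \<sigma>) p = SL B w (\<lambda>w1 w2. ?cvB (?s w1) (?t w2) p)"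
      unfolding p(1) inverse_cocycle[OF p(2,3) ux(3)] by simp
  qed (use ux in auto)
  also have "\<dots> = SL BH w (\<lambda>w1 w2. ?cv (?cvB (?s w1) (?t w2)) ?j [x, u])"
    by (intro conv_tsum1[OF actT, where n = ?n] conv_closed[OF actB, where n = ?n] pts)
      (use ux in \<open>auto elim!: pts_SucE\<close>)
  also have "\<dots> = SL BH w (\<lambda>w1 w2. ?cv (?s w1) (?cv (?t w2) ?j) [x, u])"
  proof (intro tsum_cong HOL.refl conv_assoc[OF actT, where n = ?n, symmetric] multi_add_mult[OF j_add] pts)
    fix w1 w2 assume w: "w1 \<in> carrier H" "w2 \<in> carrier H"
    show "multi_add ?n B (?s w1)" "multi_add ?n B (?t w2)"
      using w by (intro multi_add_fn2 add_map_intros; simp)+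
    show "linked ?n B (\<otimes>\<^bsub>B\<^esub>) (?s w1) (?t w2)"
      using w by (intro linked_diag actB)
        (auto simp: \<sigma>_tL \<sigma>_balanced tau_sL H.m_assoc intro!: add_map_intros)
    show "linked ?n BH bact (?t w2) ?j"
      using w by (intro linked_mult_mult[where \<phi> = "\<lambda>x. \<tau> x w2" and \<psi> = j] actT add_map_intros)
        (auto simp: tau_tL iota_tens)
  qed
  also have "\<dots> = SL BH w (\<lambda>w1 w2. ?cv (?s w1) (fn2 (\<lambda>h k. Q (h \<otimes>\<^bsub>H\<^esub> k) w2)) [x, u])"
    by (intro tsum_cong HOL.refl, rule conv_cong[of ?n])
      (use ux in \<open>auto simp: Q_def SL_mult Q_bal elim!: pts_SucE\<close>)
  finally show ?thesis by simp
qed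

section \<open>The convolution inverse and its two identities\<close>

definition jc where "jc v = SL BH v (\<lambda>v1 v2. Q (S v1) v2)"

lemma jc_bal: "balL BH (\<lambda>v1 v2. Q (S v1) v2)"
  by (intro bal_mapI add_map_intros S_add) (auto simp: S_tL Q_balanced)

lemma jc_closed [simp]: "jc v \<in> carrier BH"
  unfolding jc_def by (intro tsum_closed BH_group) auto

lemma jc_add_map: "add_map H BH jc"
  using corL.comult_tsum_add_map[OF BH_group jc_bal] by (simp add: jc_def[abs_def])

lemma jc_tL:
  assumes "h \<in> carrier H" "l \<in> carrier L"
  shows "jc (tL l \<otimes>\<^bsub>H\<^esub> h) = jc h \<star> j (sL l)"
  using assms by (simp add: jc_def SL_tL jc_bal Q_tL tsum_cmult)

lemma jc_tR:
  assumes "h \<in> carrier H" "r \<in> carrier R"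
  shows "jc (h \<otimes>\<^bsub>H\<^esub> tR r) = j (sR r) \<star> jc h"
  using assms by (simp add: jc_def SL_mult_tR jc_bal S_tR Q_sR cmult_tsum del: cmult_tens)

text \<open>Scalars are a case of the base algebra: c h = t_L(c 1) h, so \<open>jc_tL\<close> yields
  homogeneity.\<close>

lemma jc_linear: "k_linear K H A jc"
proof -
  have "jc (c \<odot>\<^bsub>H\<^esub> h) = c \<odot>\<^bsub>BH\<^esub> jc h" if "c \<in> carrier K" "h \<in> carrier H" for c h
  proof -
    have "c \<odot>\<^bsub>H\<^esub> h = tL (c \<odot>\<^bsub>L\<^esub> \<one>\<^bsub>L\<^esub>) \<otimes>\<^bsub>H\<^esub> h"
      using tL_hom that by (simp add: alg_hom_def k_linear_def opposite_def H.smult_mult_left)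
    moreover have "j (sL (c \<odot>\<^bsub>L\<^esub> \<one>\<^bsub>L\<^esub>)) = c \<odot>\<^bsub>BH\<^esub> j \<one>\<^bsub>H\<^esub>"
      using sL_linear that by (simp add: k_linear_def BH_smult_right)
    ultimately show ?thesis
      using that by (simp add: jc_tL smult_cmult cmult_one_right)
  qed
  then show ?thesis using jc_add_map by (auto simp: k_linear_def add_map_def)
qed

text \<open>Coassociativity makes the second argument of Q and the right factor the two legs of one
  element, on which \<open>Q_cmult_j\<close> collapses the product to 1 # S(h1) h2; the antipode
  axiom finishes.\<close>

lemma jc_j:
  assumes "h \<in> carrier H"
  shows "SL BH h (\<lambda>h1 h2. jc h1 \<star> j h2) = j (sR (\<pi>R h))"
proof -
  have "SL BH h (\<lambda>h1 h2. jc h1 \<star> j h2) = SL BH h (\<lambda>h1 h3. SL BH h1 (\<lambda>h1 h2. Q (S h1) h2 \<star> j h3))"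
    using assms by (simp add: jc_def tsum_cmult)
  also have "\<dots> = SL BH h (\<lambda>h1 h2. SL BH h2 (\<lambda>h2 h3. Q (S h1) h2 \<star> j h3))"
    using assms
    by (intro SL_coassoc tri_mapI BH_group)
      (auto simp: S_tL Q_balanced Q_tL cmult_assoc j_sL_cmult simp del: cmult_tens intro!: add_map_intros S_add)
  also have "\<dots> = SL BH h (\<lambda>h1 h2. j (S h1 \<otimes>\<^bsub>H\<^esub> h2))"
    by (simp add: Q_cmult_j)
  also have "\<dots> = j (sR (\<pi>R h))"
    using assms by (intro S_left_hom j_add BH_group)
  finally show ?thesis .
qed

text \<open>The identity \<sigma> \<tau> = 1 at h = 1, where \<sigma>(1, k) = \<iota>(\<pi>L(k)) and
  the counit law leaves \<tau>(1, k).\<close>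

lemma tau_one_left:
  assumes "k \<in> carrier H"
  shows "\<tau> \<one>\<^bsub>H\<^esub> k = \<iota> (\<pi>L k)"
proof -
  have bal: "balL B (\<lambda>h1 h2. \<sigma> h1 k1 \<otimes>\<^bsub>B\<^esub> \<tau> h2 k2)" if "k1 \<in> carrier H" "k2 \<in> carrier H" for k1 k2
    using that by (intro bal_mapI add_map_intros) (auto simp: \<sigma>_tL tau_sL B.m_assoc)
  have "\<iota> (\<pi>L k) = SL B k (\<lambda>k1 k2. SL B \<one>\<^bsub>H\<^esub> (\<lambda>h1 h2. \<sigma> h1 k1 \<otimes>\<^bsub>B\<^esub> \<tau> h2 k2))"
    using assms sigma_tau[of "\<one>\<^bsub>H\<^esub>" k] by (simp add: meas_unit meas_one)
  also have "\<dots> = SL B k (\<lambda>k1 k2. \<tau> \<one>\<^bsub>H\<^esub> (sL (\<pi>L k1) \<otimes>\<^bsub>H\<^esub> k2))"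
    using assms tau_balanced[of "\<one>\<^bsub>H\<^esub>"] tau_sL[of "\<one>\<^bsub>H\<^esub>"] by (simp add: SL_one bal \<sigma>_one_left)
  also have "\<dots> = \<tau> \<one>\<^bsub>H\<^esub> k"
    using assms by (intro SL_counit_left B_group add_map_intros) auto
  finally show ?thesis by simp
qed

text \<open>\<open>Theta_Q\<close> at x = S(v1) pairs u1 with S(v1)_(1) v2 inside \<sigma>. By
  \<open>antipode_coproduct\<close> that element becomes 1, so \<sigma> contributes only
  \<iota>(\<pi>L(u1)), and u slides into the first argument of Q.\<close>

lemma Theta_jc:
  assumes uv: "u \<in> carrier H" "v \<in> carrier H"
  shows "\<Theta> u (jc v) = SL BH v (\<lambda>v1 v2. Q (u \<otimes>\<^bsub>H\<^esub> S v1) v2)"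
proof -
  define G where "G c y z = SL BH u (\<lambda>u1 u2. \<sigma> u1 y \<triangleright> Q (u2 \<otimes>\<^bsub>H\<^esub> z) c)" for c y z
  have bal: "balL BH (\<lambda>u1 u2. \<sigma> u1 y \<triangleright> Q (u2 \<otimes>\<^bsub>H\<^esub> z) c)"
    if "c \<in> carrier H" "y \<in> carrier H" "z \<in> carrier H" for c y z
    using that by (intro bal_mapI add_map_intros) (auto simp: \<sigma>_tL act.act_assoc Q_sL H.m_assoc)
  have G_closed [simp]: "G c y z \<in> carrier BH"
    if "c \<in> carrier H" "y \<in> carrier H" "z \<in> carrier H" for c y z
    unfolding G_def using that by (intro tsum_closed BH_group) auto
  have G_add1 [add_map_intros]: "add_map H BH (\<lambda>x. G (f x) y z)"
    if "add_map H H f" "y \<in> carrier H" "z \<in> carrier H" for f y z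
    unfolding G_def using that by (intro add_map_intros BH_group) auto
  have G_add2 [add_map_intros]: "add_map H BH (\<lambda>x. G c (f x) z)"
    if "add_map H H f" "c \<in> carrier H" "z \<in> carrier H" for f c z
    unfolding G_def using that by (intro add_map_intros BH_group) auto
  have G_add3 [add_map_intros]: "add_map H BH (\<lambda>x. G c y (f x))"
    if "add_map H H f" "c \<in> carrier H" "y \<in> carrier H" for f c y
    unfolding G_def using that by (intro add_map_intros BH_group) auto
  have G_bal: "G c (tL l \<otimes>\<^bsub>H\<^esub> y) z = G c y (sL l \<otimes>\<^bsub>H\<^esub> z)"
    if "c \<in> carrier H" "y \<in> carrier H" "z \<in> carrier H" "l \<in> carrier L" for c y z l
    using SL_takeuchi[OF BH_group bal[OF that(1,2,3)] uv(1) that(4)] that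
    by (simp add: G_def \<sigma>_balanced H.m_assoc)
  have G_sL: "G (sL l \<otimes>\<^bsub>H\<^esub> c) y z = G c y (z \<otimes>\<^bsub>H\<^esub> sL l)"
    if "c \<in> carrier H" "y \<in> carrier H" "z \<in> carrier H" "l \<in> carrier L" for c y z l
    using that by (simp add: G_def Q_balanced flip: H.m_assoc)
  have G_one: "G c \<one>\<^bsub>H\<^esub> z = Q (u \<otimes>\<^bsub>H\<^esub> z) c" if "c \<in> carrier H" "z \<in> carrier H" for c z
  proof -
    have "SL BH u (\<lambda>u1 u2. Q (sL (\<pi>L u1) \<otimes>\<^bsub>H\<^esub> u2 \<otimes>\<^bsub>H\<^esub> z) c) = Q (u \<otimes>\<^bsub>H\<^esub> z) c"
      using that uv by (intro SL_counit_left[where \<phi> = "\<lambda>y. Q (y \<otimes>\<^bsub>H\<^esub> z) c"] BH_group add_map_intros)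
    then show ?thesis using that by (simp add: G_def \<sigma>_one_right Q_sL H.m_assoc)
  qed
  have G_balL: "balL BH (G c)" if "c \<in> carrier H" for c
    using that by (intro bal_mapI add_map_intros) (auto simp: G_bal)
  have G_balL_mult: "balL BH (\<lambda>x1 x2. G c (x1 \<otimes>\<^bsub>H\<^esub> b) x2)" if "c \<in> carrier H" "b \<in> carrier H" for b c
    using that by (intro bal_mapI add_map_intros) (auto simp: G_bal H.m_assoc)
  have "\<Theta> u (jc v) = SL BH v (\<lambda>v1 v2. SL BH v2 (\<lambda>v2 v3. SL BH (S v1) (\<lambda>x1 x2. G v3 (x1 \<otimes>\<^bsub>H\<^esub> v2) x2)))"
    using uv by (simp add: jc_def Theta_tsum Theta_Q G_def)
  also have "\<dots> = SL BH v (\<lambda>v1 v3. SL BH v1 (\<lambda>v1 v2. SL BH (S v1) (\<lambda>x1 x2. G v3 (x1 \<otimes>\<^bsub>H\<^esub> v2) x2)))"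
  proof (rule SL_coassoc[OF BH_group _ uv(2), symmetric], rule tri_mapI)
    fix a b c l assume *: "a \<in> carrier H" "b \<in> carrier H" "c \<in> carrier H" "l \<in> carrier L"
    show "SL BH (S (tL l \<otimes>\<^bsub>H\<^esub> a)) (\<lambda>x1 x2. G c (x1 \<otimes>\<^bsub>H\<^esub> b) x2)
      = SL BH (S a) (\<lambda>x1 x2. G c (x1 \<otimes>\<^bsub>H\<^esub> (sL l \<otimes>\<^bsub>H\<^esub> b)) x2)"
      using * SL_mult_sL[OF BH_group G_balL_mult[OF *(3,2)], of "S a" l] by (simp add: S_tL H.m_assoc)
    show "SL BH (S a) (\<lambda>x1 x2. G c (x1 \<otimes>\<^bsub>H\<^esub> (tL l \<otimes>\<^bsub>H\<^esub> b)) x2)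
      = SL BH (S a) (\<lambda>x1 x2. G (sL l \<otimes>\<^bsub>H\<^esub> c) (x1 \<otimes>\<^bsub>H\<^esub> b) x2)"
      using * SL_takeuchi[OF BH_group G_balL_mult[OF *(3,2)], of "S a" l] by (simp add: G_sL H.m_assoc)
  qed (auto intro!: add_map_intros S_add G_balL_mult)
  also have "\<dots> = SL BH v (\<lambda>v1 v2. G v2 \<one>\<^bsub>H\<^esub> (S v1))"
    by (intro tsum_cong HOL.refl antipode_coproduct G_balL BH_group)
  also have "\<dots> = SL BH v (\<lambda>v1 v2. Q (u \<otimes>\<^bsub>H\<^esub> S v1) v2)"
    by (simp add: G_one)
  finally show ?thesis .
qed

text \<open>Mixed coassociativity makes u and the argument of S the two legs of \<gamma>R(a), where
  a is the first leg of \<gamma>L(h). They collapse to s_L(\<pi>L(a)), balancing of Q moves this to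
  the second argument, and the counit law leaves Q(1, h).\<close>

lemma j_jc:
  assumes h: "h \<in> carrier H"
  shows "SR BH h (\<lambda>h1 h2. j h1 \<star> jc h2) = j (sL (\<pi>L h))"
proof -
  have Q_one: "Q (sL (\<pi>L a)) b = Q \<one>\<^bsub>H\<^esub> (sL (\<pi>L a) \<otimes>\<^bsub>H\<^esub> b)" if "a \<in> carrier H" "b \<in> carrier H" for a b
    using that Q_balanced[of "\<one>\<^bsub>H\<^esub>" b "\<pi>L a"] by simp
  have "SR BH h (\<lambda>h1 h2. j h1 \<star> jc h2) = SR BH h (\<lambda>u v. SL BH v (\<lambda>v1 v2. Q (u \<otimes>\<^bsub>H\<^esub> S v1) v2))"
    by (simp add: Theta_jc act.act_one tsum_closed)
  also have "\<dots> = SL BH h (\<lambda>a b. SR BH a (\<lambda>a1 a2. Q (a1 \<otimes>\<^bsub>H\<^esub> S a2) b))"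
    by (intro coassoc_RL[symmetric] h BH_group tri_mapI)
      (auto simp: S_tR S_tL H.m_assoc Q_balanced simp flip: Q_balanced intro!: add_map_intros S_add)
  also have "\<dots> = SL BH h (\<lambda>a b. Q \<one>\<^bsub>H\<^esub> (sL (\<pi>L a) \<otimes>\<^bsub>H\<^esub> b))"
    by (intro tsum_cong HOL.refl)
      (simp add: S_right_hom[where \<phi> = "\<lambda>y. Q y _"] Q_add1 add_map_id Q_one)
  also have "\<dots> = Q \<one>\<^bsub>H\<^esub> h"
    using h by (intro SL_counit_left BH_group add_map_intros)
  also have "\<dots> = j (sL (\<pi>L h))"
    using h by (simp add: Q_def SL_one Q_bal tau_one_left iota_tens)
  finally show ?thesis .
qed

lemma cleft: "cleft_extension K H L sL tL \<gamma>L \<pi>L R sR tR \<gamma>R \<pi>R S A (\<lambda>r. \<one>\<^bsub>B\<^esub> \<boxtimes>\<^bsub>A\<^esub> sR r) cR.\<rho> cL.\<rho>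
    B (\<lambda>b. b \<boxtimes>\<^bsub>A\<^esub> \<one>\<^bsub>H\<^esub>) (\<lambda>l. \<one>\<^bsub>B\<^esub> \<boxtimes>\<^bsub>A\<^esub> sL l)"
proof (intro cleft_extension.intro A_extension cleft_extension_axioms.intro etaL_hom)
  show "(\<lambda>l. \<one>\<^bsub>B\<^esub> \<boxtimes>\<^bsub>A\<^esub> sL l) ` carrier L \<subseteq> (\<lambda>b. b \<boxtimes>\<^bsub>A\<^esub> \<one>\<^bsub>H\<^esub>) ` carrier B"
  proof
    fix u assume "u \<in> (\<lambda>l. \<one>\<^bsub>B\<^esub> \<boxtimes>\<^bsub>A\<^esub> sL l) ` carrier L"
    then obtain l where "l \<in> carrier L" "u = j (sL l)" by auto
    \<comment> \<open>The witness is \<iota>(l): balancing over L gives 1 # s_L(l) = \<iota>(l) #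
      1.\<close>
    then show "u \<in> (\<lambda>b. b \<boxtimes>\<^bsub>A\<^esub> \<one>\<^bsub>H\<^esub>) ` carrier B"
      by (intro image_eqI[of _ _ "\<iota> l"]) (simp_all add: iota_tens)
  qed
  have lin: "k_linear K H A j"
    using j_add by (auto simp: k_linear_def add_map_def BH_smult_right)
  have "hopf_extension.convolution_inverse K H L tL \<gamma>L \<pi>L R tR \<gamma>R \<pi>R A (\<lambda>r. \<one>\<^bsub>B\<^esub> \<boxtimes>\<^bsub>A\<^esub> sR r)
    (\<lambda>l. \<one>\<^bsub>B\<^esub> \<boxtimes>\<^bsub>A\<^esub> sL l) j jc"
    unfolding hopf_extension.convolution_inverse_def[OF A_extension]
    using jc_linear
    by (auto simp: jc_tL jc_tR cmult_assoc corL.sweedler_comult right.corR.sweedler_comult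
        tsum_target_cong[of A BH] jc_j j_jc simp del: cmult_tens)
  then show "\<exists>j. hopf_extension.cleaving_map K H L sL tL \<gamma>L \<pi>L R sR tR \<gamma>R \<pi>R A (\<lambda>r. \<one>\<^bsub>B\<^esub> \<boxtimes>\<^bsub>A\<^esub> sR r)
      cR.\<rho> cL.\<rho> (\<lambda>l. \<one>\<^bsub>B\<^esub> \<boxtimes>\<^bsub>A\<^esub> sL l) j"
    unfolding hopf_extension.cleaving_map_def[OF A_extension] hopf_extension.comodule_map_def[OF A_extension]
      raR_fun raL_fun
    using lin
    by (intro exI[of _ j])
      (auto simp: cmult_j_sR j_tL_cmult sR_\<pi>R_tL j_sL_cmult corL.sweedler_comult right.corR.sweedler_comult
        simp del: cmult_tens)
qed

end

theorem theorem4p11: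
  fixes K :: "'k ring"
    and H :: "('k, 'h) module"
    and L :: "('k, 'l) module"
    and R :: "('k, 'r) module"
    and B :: "('k, 'b) module"
    and sL tL :: "'l \<Rightarrow> 'h" and \<gamma>L :: "'h \<Rightarrow> ('h \<times> 'h) list set" and \<pi>L :: "'h \<Rightarrow> 'l"
    and sR tR :: "'r \<Rightarrow> 'h" and \<gamma>R :: "'h \<Rightarrow> ('h \<times> 'h) list set" and \<pi>R :: "'h \<Rightarrow> 'r"
    and S :: "'h \<Rightarrow> 'h"
    and \<iota> :: "'l \<Rightarrow> 'b" and meas :: "'h \<Rightarrow> 'b \<Rightarrow> 'b" and \<sigma> :: "'h \<Rightarrow> 'h \<Rightarrow> 'b"
  assumes "hopf_algebroid K H L sL tL \<gamma>L \<pi>L R sR tR \<gamma>R \<pi>R S"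
    and "twisted_ring K H L sL tL \<gamma>L \<pi>L B \<iota> meas \<sigma>"
    and "invertible_cocycle K H L sL tL \<gamma>L \<pi>L B \<iota> meas \<sigma>"
  shows
    "let A = crossed_product H L sL \<gamma>L B \<iota> meas \<sigma>;
         \<eta>R = (\<lambda>r. \<one>\<^bsub>B\<^esub> \<boxtimes>\<^bsub>A\<^esub> sR r);
         \<eta>L = (\<lambda>l. \<one>\<^bsub>B\<^esub> \<boxtimes>\<^bsub>A\<^esub> sL l);
         ARH = tensor_product A H (carrier R)
                 (\<lambda>a r. a \<otimes>\<^bsub>A\<^esub> \<eta>R r) (\<lambda>r h. h \<otimes>\<^bsub>H\<^esub> tR r);
         ALH = tensor_product A H (carrier L)
                 (\<lambda>a l. \<eta>R (\<pi>R (tL l)) \<otimes>\<^bsub>A\<^esub> a) (\<lambda>l h. sL l \<otimes>\<^bsub>H\<^esub> h)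
     in cleft_extension K H L sL tL \<gamma>L \<pi>L R sR tR \<gamma>R \<pi>R S
          A \<eta>R (crossed_coaction A ARH \<gamma>R) (crossed_coaction A ALH \<gamma>L)
          B (\<lambda>b. b \<boxtimes>\<^bsub>A\<^esub> \<one>\<^bsub>H\<^esub>) \<eta>L"
proof -
  have hopf: "crossed_hopf K H L sL tL \<gamma>L \<pi>L B \<iota> meas \<sigma> R sR tR \<gamma>R \<pi>R S"
    using assms by (intro crossed_hopf.intro)
  obtain \<tau> where "measured_ring.cocycle_inverse K H L sL tL \<gamma>L B \<iota> meas \<sigma> \<tau>"
    using invertible_cocycle.invertible[OF assms(3)] by blast
  then interpret crossed_hopf_inv K H L sL tL \<gamma>L \<pi>L B \<iota> meas \<sigma> R sR tR \<gamma>R \<pi>R S \<tau>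
    using hopf by (intro crossed_hopf_inv.intro crossed_hopf_inv_axioms.intro)
  show ?thesis
    using cleft unfolding cR.\<rho>_def cL.\<rho>_def Let_def A_def[symmetric] raR_fun raL_fun .
qed

end
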